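(* (Quasi-orthogonality of the pressure) Let $\mathcal T_k$ be a refinement of $\mathcal T_{k-1}$, let $(u,p)$ be the solution of the Stokes problem, and let $(u_k,p_k)$ and $(u_{k-1},p_{k-1})$ be the discrete solutions on $\mathcal T_k$ and $\mathcal T_{k-1}$, respectively. Then there is a constant $C>0$, independent of the mesh sizes and of the level $k$, such that $$|(p-p_k,p_k-p_{k-1})_{L^2(\Omega)}|\le C\bigg(\Big(\sum_{K\in\mathcal T_{k-1}\setminus\mathcal T_k}h_K^2\|g\|_{L^2(K)}^2\Big)^{1/2}+\|\nabla_k(u_k-u_{k-1})\|_{L^2(\Omega)}\bigg)\|p-p_k\|_{L^2(\Omega)}.$$
   Context: Stokes problem: $\Omega\subset\mathbb R^2$ is a polygonal domain, $\mu>0$, $g\in L^2(\Omega)^2$, $V:=(H_0^1(\Omega))^2$, $Q:=L^2_0(\Omega)=\{q\in L^2(\Omega):\int_\Omega q\,dx=0\}$, $a(u,v):=\mu(\nabla u,\nabla v)_{L^2(\Omega)}$, $b(v,q):=(\operatorname{div}v,q)_{L^2(\Omega)}$; $(u,p)\in V\times Q$ satisfies $a(u,v)+b(v,p)+b(u,q)=(g,v)_{L^2(\Omega)}$ for all $(v,q)\in V\times Q$. Meshes: $\mathcal T_0$ is an initial shape-regular (conforming) triangulation of $\overline\Omega$ into triangles; every $\mathcal T_k$ is a nested conforming refinement of $\mathcal T_{k-1}$ by newest vertex bisection. $\mathcal E_k$ is the set of edges of $\mathcal T_k$, $\mathcal E_k(\Omega)$ the interior edges, $h_K:=|K|^{1/2}$,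 and $[v]$ is the jump of $v$ across an edge. Discrete problem (nonconforming $P_1$): $V_k:=\{v_k\in L^2(\Omega)^2: v_k|_K\in P_1(K)^2\ \forall K\in\mathcal T_k,\ \int_E[v_k]\,ds=0\ \forall E\in\mathcal E_k(\Omega),\ \int_Ev_k\,ds=0\ \forall E\in\mathcal E_k,\ E\subset\partial\Omega\}$, $Q_k:=\{q_k\in Q: q_k|_K\in P_0(K)\ \forall K\in\mathcal T_k\}$. $\nabla_k,\operatorname{div}_k$ are the element-by-element operators with respect to $\mathcal T_k$, $a_k(u,v):=\mu(\nabla_ku,\nabla_kv)_{L^2(\Omega)}$, $b_k(v,q):=(\operatorname{div}_kv,q)_{L^2(\Omega)}$; $(u_k,p_k)\in V_k\times Q_k$ satisfies $a_k(u_k,v)+b_k(v,p_k)+b_k(u_k,q)=(g,v)_{L^2(\Omega)}$ for all $(v,q)\in V_k\times Q_k$; likewise on $\mathcal T_{k-1}$. *)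

theory Defs
  imports "HOL-Analysis.Analysis"
begin

text \<open>
  Elements of \<open>L\<^sup>2\<close> are represented by functions on the whole plane. Only their values almost
  everywhere on the set in question matter. All notions below are invariant under changes on null sets.
\<close>

section \<open>Lebesgue spaces\<close>

definition square_integrable :: "(real^2) set \<Rightarrow> (real^2 \<Rightarrow> 'b::euclidean_space) \<Rightarrow> bool" where
  "square_integrable S f \<longleftrightarrow>
     f \<in> borel_measurable (lebesgue_on S) \<and> integrable (lebesgue_on S) (\<lambda>x. (norm (f x))\<^sup>2)"

text \<open>For matrix-valued functions \<open>\<bullet>\<close> is the Frobenius inner product.\<close>

definition L2_inner :: "(real^2) set \<Rightarrow> (real^2 \<Rightarrow> 'b::euclidean_space) \<Rightarrow> (real^2 \<Rightarrow> 'b) \<Rightarrow> real" where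
  "L2_inner S f g = integral\<^sup>L (lebesgue_on S) (\<lambda>x. f x \<bullet> g x)"

definition L2_norm :: "(real^2) set \<Rightarrow> (real^2 \<Rightarrow> 'b::euclidean_space) \<Rightarrow> real" where
  "L2_norm S f = sqrt (L2_inner S f f)"

definition L2_zero_mean :: "(real^2) set \<Rightarrow> (real^2 \<Rightarrow> real) set" where
  "L2_zero_mean \<Omega> = {q. square_integrable \<Omega> q \<and> integral\<^sup>L (lebesgue_on \<Omega>) q = 0}"

section \<open>Sobolev spaces\<close>

definition grad :: "(real^2 \<Rightarrow> real) \<Rightarrow> real^2 \<Rightarrow> real^2" where
  "grad f x = (\<chi> j. frechet_derivative f (at x) (axis j 1))"

primrec C_times :: "nat \<Rightarrow> (real^2 \<Rightarrow> real) \<Rightarrow> bool" where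
  "C_times 0 f \<longleftrightarrow> continuous_on UNIV f"
| "C_times (Suc n) f \<longleftrightarrow> (\<forall>x. f differentiable (at x)) \<and> (\<forall>j. C_times n (\<lambda>x. grad f x $ j))"

definition test_functions :: "(real^2) set \<Rightarrow> (real^2 \<Rightarrow> real) set" where
  "test_functions \<Omega> =
     {\<phi>. (\<forall>n. C_times n \<phi>) \<and> (\<exists>K. compact K \<and> K \<subseteq> \<Omega> \<and> (\<forall>x. x \<notin> K \<longrightarrow> \<phi> x = 0))}"

definition has_weak_gradient :: "(real^2) set \<Rightarrow> (real^2 \<Rightarrow> real) \<Rightarrow> (real^2 \<Rightarrow> real^2) \<Rightarrow> bool" where
  "has_weak_gradient \<Omega> f G \<longleftrightarrow> square_integrable \<Omega> f \<and> square_integrable \<Omega> G \<and>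
     (\<forall>\<phi>\<in>test_functions \<Omega>.
        integral\<^sup>L (lebesgue_on \<Omega>) (\<lambda>x. f x *\<^sub>R grad \<phi> x)
          = - integral\<^sup>L (lebesgue_on \<Omega>) (\<lambda>x. \<phi> x *\<^sub>R G x))"

text \<open>The weak gradient is unique almost everywhere in the open set \<open>\<Omega>\<close>; any representative is
  chosen.\<close>

definition weak_gradient :: "(real^2) set \<Rightarrow> (real^2 \<Rightarrow> real) \<Rightarrow> real^2 \<Rightarrow> real^2" where
  "weak_gradient \<Omega> f = (SOME G. has_weak_gradient \<Omega> f G)"

definition H10 :: "(real^2) set \<Rightarrow> (real^2 \<Rightarrow> real) set" where
  "H10 \<Omega> = {f. \<exists>G. has_weak_gradient \<Omega> f G \<and>
     (\<exists>\<phi>. (\<forall>n::nat. \<phi> n \<in> test_functions \<Omega>) \<and>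
        (\<lambda>n. L2_norm \<Omega> (\<lambda>x. \<phi> n x - f x)) \<longlonglongrightarrow> 0 \<and>
        (\<lambda>n. L2_norm \<Omega> (\<lambda>x. grad (\<phi> n) x - G x)) \<longlonglongrightarrow> 0)}"

definition H10_vec :: "(real^2) set \<Rightarrow> (real^2 \<Rightarrow> real^2) set" where
  "H10_vec \<Omega> = {v. \<forall>i. (\<lambda>x. v x $ i) \<in> H10 \<Omega>}"

text \<open>Row \<open>i\<close> is the gradient of the \<open>i\<close>-th component, as in \<^const>\<open>jacobian\<close>; hence the
  divergence is the trace.\<close>

definition weak_jacobian :: "(real^2) set \<Rightarrow> (real^2 \<Rightarrow> real^2) \<Rightarrow> real^2 \<Rightarrow> real^2^2" where
  "weak_jacobian \<Omega> v x = (\<chi> i. weak_gradient \<Omega> (\<lambda>y. v y $ i) x)"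

definition weak_div :: "(real^2) set \<Rightarrow> (real^2 \<Rightarrow> real^2) \<Rightarrow> real^2 \<Rightarrow> real" where
  "weak_div \<Omega> v x = trace (weak_jacobian \<Omega> v x)"

section \<open>The Stokes problem\<close>

text \<open>The condition \<open>interior (closure \<Omega>) = \<Omega>\<close> says that the domain lies on one side of its boundary
  (no slits or removed points).\<close>

definition polygonal_domain :: "(real^2) set \<Rightarrow> bool" where
  "polygonal_domain \<Omega> \<longleftrightarrow>
     open \<Omega> \<and> connected \<Omega> \<and> bounded \<Omega> \<and> \<Omega> \<noteq> {} \<and> interior (closure \<Omega>) = \<Omega> \<and>
     (\<exists>S. finite S \<and> frontier \<Omega> = (\<Union>(a, b)\<in>S. closed_segment a b))"

definition stokes_a :: "(real^2) set \<Rightarrow> real \<Rightarrow> (real^2 \<Rightarrow> real^2) \<Rightarrow> (real^2 \<Rightarrow> real^2) \<Rightarrow> real" where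
  "stokes_a \<Omega> \<mu> u v = \<mu> * L2_inner \<Omega> (weak_jacobian \<Omega> u) (weak_jacobian \<Omega> v)"

definition stokes_b :: "(real^2) set \<Rightarrow> (real^2 \<Rightarrow> real^2) \<Rightarrow> (real^2 \<Rightarrow> real) \<Rightarrow> real" where
  "stokes_b \<Omega> v q = L2_inner \<Omega> (weak_div \<Omega> v) q"

definition stokes_solution ::
  "(real^2) set \<Rightarrow> real \<Rightarrow> (real^2 \<Rightarrow> real^2) \<Rightarrow> (real^2 \<Rightarrow> real^2) \<Rightarrow> (real^2 \<Rightarrow> real) \<Rightarrow> bool" where
  "stokes_solution \<Omega> \<mu> g u p \<longleftrightarrow> u \<in> H10_vec \<Omega> \<and> p \<in> L2_zero_mean \<Omega> \<and>
     (\<forall>v\<in>H10_vec \<Omega>. \<forall>q\<in>L2_zero_mean \<Omega>.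
        stokes_a \<Omega> \<mu> u v + stokes_b \<Omega> v p + stokes_b \<Omega> u q = L2_inner \<Omega> g v)"

section \<open>Meshes and newest vertex bisection\<close>

text \<open>A labelled triangle \<open>(z, x, y)\<close> has newest vertex \<open>z\<close>, so its refinement edge is the one
  joining \<open>x\<close> and \<open>y\<close>. The unlabelled element is the closed triangle.\<close>

type_synonym labelled_triangle = "(real^2) \<times> (real^2) \<times> (real^2)"

fun element :: "labelled_triangle \<Rightarrow> (real^2) set" where
  "element (z, x, y) = convex hull {z, x, y}"

definition elements :: "labelled_triangle set \<Rightarrow> (real^2) set set" where
  "elements M = element ` M"

text \<open>The library's \<^const>\<open>triangulation\<close> requires that any two members meet in a common face, which
  is conformity.\<close>

definition conforming_mesh :: "(real^2) set \<Rightarrow> labelled_triangle set \<Rightarrow> bool" where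
  "conforming_mesh \<Omega> M \<longleftrightarrow> inj_on element M \<and> triangulation (elements M) \<and>
     (\<forall>K\<in>elements M. 2 simplex K) \<and> \<Union>(elements M) = closure \<Omega>"

fun children :: "labelled_triangle \<Rightarrow> labelled_triangle set" where
  "children (z, x, y) = {(midpoint x y, z, x), (midpoint x y, z, y)}"

definition bisect_one :: "labelled_triangle set \<Rightarrow> labelled_triangle set \<Rightarrow> bool" where
  "bisect_one M M' \<longleftrightarrow> (\<exists>t\<in>M. M' = (M - {t}) \<union> children t)"

text \<open>The meshes between two consecutive levels may have hanging nodes; only the levels themselves
  are conforming.\<close>

definition nvb_sequence :: "(real^2) set \<Rightarrow> (nat \<Rightarrow> labelled_triangle set) \<Rightarrow> bool" where
  "nvb_sequence \<Omega> M \<longleftrightarrow>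
     (\<forall>k. conforming_mesh \<Omega> (M k)) \<and> (\<forall>k. bisect_one\<^sup>*\<^sup>* (M k) (M (Suc k)))"

definition elem_size :: "(real^2) set \<Rightarrow> real" where
  "elem_size K = sqrt (measure lebesgue K)"

definition shape_regular :: "real \<Rightarrow> (real^2) set set \<Rightarrow> bool" where
  "shape_regular \<sigma> \<T> \<longleftrightarrow> (\<forall>K\<in>\<T>. diameter K \<le> \<sigma> * elem_size K)"

definition mesh_edges :: "(real^2) set set \<Rightarrow> (real^2) set set" where
  "mesh_edges \<T> = {E. \<exists>K\<in>\<T>. E edge_of K}"

definition boundary_edges :: "(real^2) set \<Rightarrow> (real^2) set set \<Rightarrow> (real^2) set set" where
  "boundary_edges \<Omega> \<T> = {E \<in> mesh_edges \<T>. E \<subseteq> frontier \<Omega>}"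

definition interior_edges :: "(real^2) set \<Rightarrow> (real^2) set set \<Rightarrow> (real^2) set set" where
  "interior_edges \<Omega> \<T> = mesh_edges \<T> - boundary_edges \<Omega> \<T>"

section \<open>The nonconforming finite element method\<close>

definition is_affine_on :: "(real^2) set \<Rightarrow> (real^2 \<Rightarrow> real^2) \<Rightarrow> (real^2 \<Rightarrow> real^2) \<Rightarrow> bool" where
  "is_affine_on K v A \<longleftrightarrow>
     (\<exists>L c. linear L \<and> A = (\<lambda>x. L x + c)) \<and> (AE x in lebesgue_on K. v x = A x)"

text \<open>The affine map agreeing with \<open>v\<close> almost everywhere on the triangle \<open>K\<close> (it is unique). Its
  values on an edge of \<open>K\<close> are the trace of \<open>v\<close> taken from \<open>K\<close>.\<close>

definition affine_part :: "(real^2) set \<Rightarrow> (real^2 \<Rightarrow> real^2) \<Rightarrow> real^2 \<Rightarrow> real^2" where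
  "affine_part K v = (SOME A. is_affine_on K v A)"

text \<open>Integral with respect to arc length; the choice of the orientation is irrelevant.\<close>

definition edge_integral :: "(real^2) set \<Rightarrow> (real^2 \<Rightarrow> real^2) \<Rightarrow> real^2" where
  "edge_integral E f =
     (let (a, b) = (SOME (a, b). E = closed_segment a b)
      in dist a b *\<^sub>R integral {0..1} (\<lambda>t. f (linepath a b t)))"

definition CR_velocity :: "(real^2) set \<Rightarrow> (real^2) set set \<Rightarrow> (real^2 \<Rightarrow> real^2) set" where
  "CR_velocity \<Omega> \<T> = {v. square_integrable \<Omega> v \<and>
     (\<forall>K\<in>\<T>. \<exists>A. is_affine_on K v A) \<and>
     (\<forall>E\<in>interior_edges \<Omega> \<T>. \<forall>K\<in>\<T>. \<forall>K'\<in>\<T>. K \<noteq> K' \<and> E edge_of K \<and> E edge_of K' \<longrightarrow>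
        edge_integral E (\<lambda>x. affine_part K v x - affine_part K' v x) = 0) \<and>
     (\<forall>E\<in>boundary_edges \<Omega> \<T>. \<forall>K\<in>\<T>. E edge_of K \<longrightarrow> edge_integral E (affine_part K v) = 0)}"

definition P0_pressure :: "(real^2) set \<Rightarrow> (real^2) set set \<Rightarrow> (real^2 \<Rightarrow> real) set" where
  "P0_pressure \<Omega> \<T> =
     {q \<in> L2_zero_mean \<Omega>. \<forall>K\<in>\<T>. \<exists>c. AE x in lebesgue_on K. q x = c}"

text \<open>Element-by-element derivatives of piecewise affine functions; the value on the null set of
  element boundaries is immaterial.\<close>

definition broken_jacobian :: "(real^2) set set \<Rightarrow> (real^2 \<Rightarrow> real^2) \<Rightarrow> real^2 \<Rightarrow> real^2^2" where
  "broken_jacobian \<T> v x =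
     (\<Sum>K\<in>\<T>. indicat_real (interior K) x *\<^sub>R jacobian (affine_part K v) (at x))"

definition broken_div :: "(real^2) set set \<Rightarrow> (real^2 \<Rightarrow> real^2) \<Rightarrow> real^2 \<Rightarrow> real" where
  "broken_div \<T> v x = trace (broken_jacobian \<T> v x)"

definition discrete_a ::
  "(real^2) set \<Rightarrow> (real^2) set set \<Rightarrow> real \<Rightarrow> (real^2 \<Rightarrow> real^2) \<Rightarrow> (real^2 \<Rightarrow> real^2) \<Rightarrow> real" where
  "discrete_a \<Omega> \<T> \<mu> u v = \<mu> * L2_inner \<Omega> (broken_jacobian \<T> u) (broken_jacobian \<T> v)"

definition discrete_b ::
  "(real^2) set \<Rightarrow> (real^2) set set \<Rightarrow> (real^2 \<Rightarrow> real^2) \<Rightarrow> (real^2 \<Rightarrow> real) \<Rightarrow> real" where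
  "discrete_b \<Omega> \<T> v q = L2_inner \<Omega> (broken_div \<T> v) q"

definition discrete_solution ::
  "(real^2) set \<Rightarrow> (real^2) set set \<Rightarrow> real \<Rightarrow> (real^2 \<Rightarrow> real^2) \<Rightarrow>
   (real^2 \<Rightarrow> real^2) \<Rightarrow> (real^2 \<Rightarrow> real) \<Rightarrow> bool" where
  "discrete_solution \<Omega> \<T> \<mu> g uh ph \<longleftrightarrow> uh \<in> CR_velocity \<Omega> \<T> \<and> ph \<in> P0_pressure \<Omega> \<T> \<and>
     (\<forall>v\<in>CR_velocity \<Omega> \<T>. \<forall>q\<in>P0_pressure \<Omega> \<T>.
        discrete_a \<Omega> \<T> \<mu> uh v + discrete_b \<Omega> \<T> v ph + discrete_b \<Omega> \<T> uh q = L2_inner \<Omega> g v)"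

end

theory Submission
  imports Defs
begin

text \<open>
  The function \<open>r = p - pk\<close> has mean zero. On a polygonal domain the divergence has a bounded right inverse in the
  following sense: there are fields \<open>v\<close> vanishing outside \<open>\<Omega>\<close> with \<open>div v\<close> arbitrarily close to \<open>r\<close> and
  \<open>\<parallel>\<nabla>v\<parallel> \<le> K * \<parallel>r\<parallel>\<close> up to an arbitrarily small error, where \<open>K\<close> depends on \<open>\<Omega>\<close> only
  (\<open>mesh_domain_solvable\<close>). Hence it suffices to estimate \<open>(div v, pk - pk')\<close> by \<open>\<parallel>\<nabla>v\<parallel>\<close>
  (\<open>pairing_bound\<close>).

  The Crouzeix-Raviart interpolant \<open>\<Pi>v\<close> has the same mean as \<open>v\<close> on every edge. Therefore its gradient on a triangle
  is the mean of \<open>\<nabla>v\<close>, and so \<open>a(uk, \<Pi>v) = \<mu> * (\<nabla>uk, \<nabla>v)\<close> and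
  \<open>b(\<Pi>v, q) = (div v, q)\<close> for discrete \<open>uk\<close> and \<open>q\<close> (\<open>discrete_a_interpolant\<close>,
  \<open>discrete_b_interpolant\<close>). Subtraction of the momentum equations on the two meshes, tested with the two interpolants
  of \<open>v\<close>, gives
  \<open>(div v, pk - pk') = (g, \<Pi>v - \<Pi>'v) - \<mu> * (\<nabla>(uk - uk'), \<nabla>v)\<close>.
  The second term is estimated by the Cauchy-Schwarz inequality. In the first, the two interpolants agree on the triangles that
  belong to both meshes; on a triangle \<open>K\<close> that is refined, each of them differs from \<open>v\<close> by at most
  \<open>4 * diameter K * \<parallel>\<nabla>v\<parallel>\<close>, by a Poincare inequality for functions with mean zero over one side
  (\<open>triangle_poincare\<close>, \<open>interpolant_change\<close>). Diameters are comparable to element sizes on all levels because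
  bisection halves both the area and the sum of the squares of the two sides at the newest vertex
  (\<open>nvb_shape_regular\<close>).

  The right inverse of the divergence is constructed by elementary means, with approximation in place of regularity theory. On
  a large square, cosine polynomials are dense, the Neumann problem for them is solved mode by mode, and
  \<open>\<parallel>D\<^sup>2\<phi>\<parallel> = \<parallel>\<Delta>\<phi>\<parallel>\<close> bounds the gradient of the field \<open>\<nabla>\<phi>\<close>
  (\<open>approx_neumann_solver\<close>, \<open>neumann_gradient_energy\<close>). A reflection that commutes with the divergence makes
  the field vanish on two sides of a smaller square (\<open>corner_divergence_solver\<close>), and a cutoff makes it vanish on the other
  two. The cutoff produces an error in the divergence that is differentiable, and for such data the equation is solved by
  integration along the axes (\<open>regular_divergence_solver\<close>, \<open>square_divergence_solver\<close>). The result is carried to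
  parallelograms by the Piola transform, and every triangle of a mesh is a finite union of parallelograms with room around them
  (\<open>triangle_cover\<close>). Finally, solvability for data on two sets implies solvability for data on their union, since in a
  connected domain mass can be moved from one to the other through a chain of small squares (\<open>solvable_on_Un\<close>).
\<close>

text \<open>
  Functions of two real variables are curried, so that partial derivatives and iterated integrals are one-variable notions.
\<close>

section \<open>Double integrals and differentiable functions of two variables\<close>

definition cont2 :: "(real \<Rightarrow> real \<Rightarrow> real) \<Rightarrow> bool" where
  "cont2 f \<longleftrightarrow> continuous_on UNIV (\<lambda>p::real\<times>real. f (fst p) (snd p))"

lemma cont2_compose:
  assumes "cont2 f" "continuous_on S a" "continuous_on S b"
  shows "continuous_on S (\<lambda>z. f (a z) (b z))"
  using continuous_on_compose2[OF assms(1)[unfolded cont2_def] continuous_on_Pair[OF assms(2,3)]]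
  by simp

lemma cont2_fst: "cont2 f \<Longrightarrow> continuous_on S (\<lambda>x. f x y)"
  and cont2_snd: "cont2 f \<Longrightarrow> continuous_on S (\<lambda>y. f x y)"
  using cont2_compose[of f S "\<lambda>x. x" "\<lambda>_. y"] cont2_compose[of f S "\<lambda>_. x" "\<lambda>x. x"]
  by (auto intro: continuous_intros)

lemma cont2_add: "cont2 f \<Longrightarrow> cont2 g \<Longrightarrow> cont2 (\<lambda>x y. f x y + g x y)"
  and cont2_diff: "cont2 f \<Longrightarrow> cont2 g \<Longrightarrow> cont2 (\<lambda>x y. f x y - g x y)"
  and cont2_mult: "cont2 f \<Longrightarrow> cont2 g \<Longrightarrow> cont2 (\<lambda>x y. f x y * g x y)"
  and cont2_minus: "cont2 f \<Longrightarrow> cont2 (\<lambda>x y. - f x y)"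
  and cont2_power: "cont2 f \<Longrightarrow> cont2 (\<lambda>x y. f x y ^ n)"
  and cont2_const: "cont2 (\<lambda>x y. c)"
  unfolding cont2_def by (auto intro!: continuous_intros)

lemma cont2_of_fst: "continuous_on UNIV a \<Longrightarrow> cont2 (\<lambda>x y. a x)"
  and cont2_of_snd: "continuous_on UNIV a \<Longrightarrow> cont2 (\<lambda>x y. a y)"
  unfolding cont2_def
  by (rule continuous_on_compose2[of UNIV a], auto intro: continuous_intros)+

lemmas cont2_intros = cont2_const cont2_add cont2_diff cont2_mult cont2_minus cont2_power

lemma cont2_comp:
  assumes "cont2 f" "continuous_on UNIV a" "continuous_on UNIV b"
  shows "cont2 (\<lambda>x y. f (a x) (b y))"
  unfolding cont2_def
  by (rule cont2_compose[OF assms(1)])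
     (rule continuous_on_compose2[OF assms(2)] continuous_on_compose2[OF assms(3)],
      auto intro: continuous_intros)+

definition dbl_int :: "real \<Rightarrow> real \<Rightarrow> (real \<Rightarrow> real \<Rightarrow> real) \<Rightarrow> real" where
  "dbl_int a b f = integral {a..b} (\<lambda>x. integral {a..b} (\<lambda>y. f x y))"

lemma dbl_int_pair:
  assumes "cont2 f"
  shows "dbl_int a b f = integral (cbox (a, a) (b, b)) (\<lambda>p. f (fst p) (snd p))"
  using integral_prod_continuous[of a a b b "\<lambda>p. f (fst p) (snd p)"]
    continuous_on_subset[OF assms[unfolded cont2_def]]
  by (simp add: dbl_int_def)

lemma cont2_integrable:
  assumes "cont2 f"
  shows "(\<lambda>p. f (fst p) (snd p)) integrable_on cbox (a, b) (c, d)"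
  by (rule integrable_continuous) (rule continuous_on_subset[OF assms[unfolded cont2_def]], simp)

lemma dbl_int_add:
  assumes "cont2 f" "cont2 g"
  shows "dbl_int a b (\<lambda>x y. f x y + g x y) = dbl_int a b f + dbl_int a b g"
  using assms cont2_add[OF assms]
  by (simp add: dbl_int_pair integral_add[OF cont2_integrable cont2_integrable])

lemma dbl_int_cmult: "dbl_int a b (\<lambda>x y. c * f x y) = c * dbl_int a b f"
  by (simp add: dbl_int_def)

lemma dbl_int_minus: "dbl_int a b (\<lambda>x y. - f x y) = - dbl_int a b f"
  by (simp add: dbl_int_def)

lemma dbl_int_diff:
  assumes "cont2 f" "cont2 g"
  shows "dbl_int a b (\<lambda>x y. f x y - g x y) = dbl_int a b f - dbl_int a b g"
  using dbl_int_add[OF assms(1) cont2_minus[OF assms(2)]] by (simp add: dbl_int_minus)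

lemma dbl_int_mono:
  assumes "cont2 f" "cont2 g" "\<And>x y. x \<in> {a..b} \<Longrightarrow> y \<in> {a..b} \<Longrightarrow> f x y \<le> g x y"
  shows "dbl_int a b f \<le> dbl_int a b g"
  unfolding dbl_int_pair[OF assms(1)] dbl_int_pair[OF assms(2)]
  by (rule integral_le) (use assms in \<open>auto intro: cont2_integrable\<close>)

lemma dbl_int_swap:
  assumes "cont2 f"
  shows "dbl_int a b (\<lambda>x y. f y x) = dbl_int a b f"
  using integral_swap_continuous[of a a b b f] continuous_on_subset[OF assms[unfolded cont2_def]]
  by (simp add: dbl_int_def case_prod_beta)

lemma dbl_int_const: "a \<le> b \<Longrightarrow> dbl_int a b (\<lambda>x y. c) = (b - a)\<^sup>2 * c"
  by (simp add: dbl_int_def power2_eq_square)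

lemma dbl_int_nonneg:
  assumes "cont2 f" "\<And>x y. f x y \<ge> 0" "a \<le> b"
  shows "0 \<le> dbl_int a b f"
  using dbl_int_mono[OF cont2_const assms(1), of a b 0] assms by (simp add: dbl_int_const)

lemma dbl_int_cong:
  assumes "\<And>x y. x \<in> {a..b} \<Longrightarrow> y \<in> {a..b} \<Longrightarrow> f x y = g x y"
  shows "dbl_int a b f = dbl_int a b g"
  unfolding dbl_int_def by (intro integral_cong) (use assms in auto)

lemma integral_derivative_zero_ends:
  assumes "a \<le> b" "\<And>x. (f has_real_derivative f' x) (at x)" "f a = 0" "f b = 0"
  shows "integral {a..b} f' = 0"
proof -
  have "(f' has_integral (f b - f a)) {a..b}"
    by (rule fundamental_theorem_of_calculus)
      (use assms in \<open>auto simp: has_real_derivative_iff_has_vector_derivative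
        intro: has_vector_derivative_at_within\<close>)
  then show ?thesis using assms by (simp add: integral_unique)
qed

lemma dbl_int_dy_zero:
  assumes "a \<le> b" "\<And>x y. ((\<lambda>y. A x y) has_real_derivative A' x y) (at y)"
    "\<And>x. A x a = 0" "\<And>x. A x b = 0"
  shows "dbl_int a b A' = 0"
proof -
  have "integral {a..b} (\<lambda>y. A' x y) = 0" for x
    by (rule integral_derivative_zero_ends[OF assms(1), of "\<lambda>y. A x y"]) (use assms in auto)
  then show ?thesis by (simp add: dbl_int_def)
qed

lemma dbl_int_dx_zero:
  assumes "a \<le> b" "\<And>x y. ((\<lambda>x. A x y) has_real_derivative A' x y) (at x)" "cont2 A'"
    "\<And>y. A a y = 0" "\<And>y. A b y = 0"
  shows "dbl_int a b A' = 0"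
  using dbl_int_dy_zero[of a b "\<lambda>x y. A y x" "\<lambda>x y. A' y x"] assms dbl_int_swap[OF assms(3)] by simp

text \<open>
  The partial derivatives are parameters, not operators: every construction below carries explicit formulas for them.
\<close>

definition C1_2 :: "(real \<Rightarrow> real \<Rightarrow> real) \<Rightarrow> (real \<Rightarrow> real \<Rightarrow> real) \<Rightarrow> (real \<Rightarrow> real \<Rightarrow> real) \<Rightarrow> bool"
  where "C1_2 f fx fy \<longleftrightarrow>
    (\<forall>x y. ((\<lambda>x. f x y) has_real_derivative fx x y) (at x)) \<and>
    (\<forall>x y. ((\<lambda>y. f x y) has_real_derivative fy x y) (at y)) \<and> cont2 fx \<and> cont2 fy"

lemma C1_2_has_derivative:
  assumes "C1_2 f fx fy"
  shows "((\<lambda>p. f (fst p) (snd p)) has_derivative (\<lambda>h. fx x y * fst h + fy x y * snd h)) (at (x, y))"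
proof -
  have "((\<lambda>(x, y). f x y) has_derivative
      (\<lambda>(tx, ty). fx x y * tx + blinfun_apply (blinfun_mult_right (fy x y)) ty))
      (at (x, y) within UNIV \<times> UNIV)"
  proof (rule has_derivative_partialsI[where fy = "\<lambda>x y. blinfun_mult_right (fy x y)"])
    show "((\<lambda>x. f x y) has_derivative (*) (fx x y)) (at x within UNIV)"
      using assms by (auto simp: C1_2_def has_field_derivative_def)
    show "((\<lambda>y. f x y) has_derivative blinfun_apply (blinfun_mult_right (fy x y))) (at y within UNIV)"
      for x y using assms by (auto simp: C1_2_def has_field_derivative_def)
    have "continuous_on UNIV (\<lambda>(x, y). blinfun_mult_right (fy x y))"
      using assms unfolding C1_2_def cont2_def case_prod_beta
      by (intro continuous_intros) auto
    then show "continuous (at (x, y) within UNIV \<times> UNIV) (\<lambda>(x, y). blinfun_mult_right (fy x y))"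
      by (simp add: continuous_on_eq_continuous_at)
  qed auto
  then show ?thesis by (simp only: case_prod_beta' UNIV_Times_UNIV blinfun_mult_right.rep_eq)
qed

lemma C1_2_cont2:
  assumes "C1_2 f fx fy" shows "cont2 f"
  unfolding cont2_def continuous_on_eq_continuous_within
  using has_derivative_continuous[OF C1_2_has_derivative[OF assms]] by auto

lemma C1_2_cont: "C1_2 f fx fy \<Longrightarrow> cont2 fx" "C1_2 f fx fy \<Longrightarrow> cont2 fy"
  by (auto simp: C1_2_def)

lemma C1_2_dx: "C1_2 f fx fy \<Longrightarrow> ((\<lambda>x. f x y) has_real_derivative fx x y) (at x)"
  and C1_2_dy: "C1_2 f fx fy \<Longrightarrow> ((\<lambda>y. f x y) has_real_derivative fy x y) (at y)"
  by (auto simp: C1_2_def)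

lemma C1_2_add:
  "C1_2 f fx fy \<Longrightarrow> C1_2 g gx gy \<Longrightarrow>
    C1_2 (\<lambda>x y. f x y + g x y) (\<lambda>x y. fx x y + gx x y) (\<lambda>x y. fy x y + gy x y)"
  unfolding C1_2_def by (auto intro!: derivative_eq_intros cont2_intros)

lemma C1_2_diff:
  "C1_2 f fx fy \<Longrightarrow> C1_2 g gx gy \<Longrightarrow>
    C1_2 (\<lambda>x y. f x y - g x y) (\<lambda>x y. fx x y - gx x y) (\<lambda>x y. fy x y - gy x y)"
  unfolding C1_2_def by (auto intro!: derivative_eq_intros cont2_intros)

lemma C1_2_cmult:
  "C1_2 f fx fy \<Longrightarrow> C1_2 (\<lambda>x y. c * f x y) (\<lambda>x y. c * fx x y) (\<lambda>x y. c * fy x y)"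
  unfolding C1_2_def by (auto intro!: DERIV_cmult cont2_intros)

lemma C1_2_mult:
  assumes "C1_2 f fx fy" "C1_2 g gx gy"
  shows "C1_2 (\<lambda>x y. f x y * g x y) (\<lambda>x y. fx x y * g x y + f x y * gx x y)
    (\<lambda>x y. fy x y * g x y + f x y * gy x y)"
  using assms C1_2_cont2[OF assms(1)] C1_2_cont2[OF assms(2)] unfolding C1_2_def
  by (auto intro!: derivative_eq_intros cont2_intros)

lemma C1_2_scale:
  assumes "C1_2 f fx fy"
  shows "C1_2 (\<lambda>x y. f (a * x) (b * y)) (\<lambda>x y. a * fx (a * x) (b * y)) (\<lambda>x y. b * fy (a * x) (b * y))"
proof -
  have "((\<lambda>x. f (a * x) (b * y)) has_real_derivative a * fx (a * x) (b * y)) (at x)" for x y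
    using DERIV_chain2[where f = "\<lambda>x. f x (b * y)" and g = "(*) a", OF C1_2_dx[OF assms] DERIV_cmult_Id]
    by (simp add: mult.commute[of _ a])
  moreover have "((\<lambda>y. f (a * x) (b * y)) has_real_derivative b * fy (a * x) (b * y)) (at y)" for x y
    using DERIV_chain2[where f = "\<lambda>y. f (a * x) y" and g = "(*) b", OF C1_2_dy[OF assms] DERIV_cmult_Id]
    by (simp add: mult.commute[of _ b])
  moreover have "cont2 (\<lambda>x y. a * fx (a * x) (b * y))" "cont2 (\<lambda>x y. b * fy (a * x) (b * y))"
    using cont2_comp[of fx "\<lambda>x. a * x" "\<lambda>y. b * y"] cont2_comp[of fy "\<lambda>x. a * x" "\<lambda>y. b * y"] C1_2_cont[OF assms]
    by (intro cont2_mult cont2_const; simp add: continuous_on_mult_const)+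
  ultimately show ?thesis by (auto simp: C1_2_def)
qed

section \<open>The Neumann problem on a square\<close>

text \<open>
  \<open>(V1, V2)\<close> stands for a gradient \<open>\<nabla>\<phi>\<close> with vanishing normal derivative on the boundary of the square
  \<open>(-4, 4)\<^sup>2\<close>. The mixed derivative \<open>V1y\<close> occurs twice because the field is curl-free. The function \<open>T\<close> is the
  third derivative that the integration by parts in the energy identity needs.
\<close>

definition neumann_gradient where
  "neumann_gradient V1 V2 V1x V1y V2y \<longleftrightarrow> C1_2 V1 V1x V1y \<and> C1_2 V2 V1y V2y \<and>
     (\<exists>T. cont2 T \<and> (\<forall>x y. ((\<lambda>x. V2y x y) has_real_derivative T x y) (at x) \<and>
        ((\<lambda>y. V1y x y) has_real_derivative T x y) (at y))) \<and>
     (\<forall>y. V1 (-4) y = 0 \<and> V1 4 y = 0) \<and>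
     (\<forall>x. V1y x (-4) = 0 \<and> V1y x 4 = 0 \<and> V2 x (-4) = 0 \<and> V2 x 4 = 0)"

lemma neumann_gradientE:
  assumes "neumann_gradient V1 V2 V1x V1y V2y"
  obtains T where "cont2 T" "\<And>x y. ((\<lambda>x. V2y x y) has_real_derivative T x y) (at x)"
     "\<And>x y. ((\<lambda>y. V1y x y) has_real_derivative T x y) (at y)"
proof -
  have "\<exists>T. cont2 T \<and> (\<forall>x y. ((\<lambda>x. V2y x y) has_real_derivative T x y) (at x) \<and>
        ((\<lambda>y. V1y x y) has_real_derivative T x y) (at y))"
    using assms unfolding neumann_gradient_def by (elim conjE)
  then show thesis by (metis that)
qed

lemma neumann_gradient_add:
  assumes "neumann_gradient V1 V2 V1x V1y V2y" "neumann_gradient W1 W2 W1x W1y W2y"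
  shows "neumann_gradient (\<lambda>x y. V1 x y + W1 x y) (\<lambda>x y. V2 x y + W2 x y)
    (\<lambda>x y. V1x x y + W1x x y) (\<lambda>x y. V1y x y + W1y x y) (\<lambda>x y. V2y x y + W2y x y)"
proof -
  obtain T where T: "cont2 T" "\<And>x y. ((\<lambda>x. V2y x y) has_real_derivative T x y) (at x)"
     "\<And>x y. ((\<lambda>y. V1y x y) has_real_derivative T x y) (at y)"
    by (rule neumann_gradientE[OF assms(1)]) (rule that)
  obtain U where U: "cont2 U" "\<And>x y. ((\<lambda>x. W2y x y) has_real_derivative U x y) (at x)"
     "\<And>x y. ((\<lambda>y. W1y x y) has_real_derivative U x y) (at y)"
    by (rule neumann_gradientE[OF assms(2)]) (rule that)
  have "\<exists>T. cont2 T \<and> (\<forall>x y. ((\<lambda>x. V2y x y + W2y x y) has_real_derivative T x y) (at x) \<and>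
        ((\<lambda>y. V1y x y + W1y x y) has_real_derivative T x y) (at y))"
    by (rule exI[of _ "\<lambda>x y. T x y + U x y"]) (use T U in \<open>auto intro!: DERIV_add cont2_add\<close>)
  moreover have "C1_2 V1 V1x V1y" "C1_2 V2 V1y V2y" "C1_2 W1 W1x W1y" "C1_2 W2 W1y W2y"
    using assms unfolding neumann_gradient_def by simp_all
  from C1_2_add[OF this(1,3)] C1_2_add[OF this(2,4)]
  have "C1_2 (\<lambda>x y. V1 x y + W1 x y) (\<lambda>x y. V1x x y + W1x x y) (\<lambda>x y. V1y x y + W1y x y)"
    "C1_2 (\<lambda>x y. V2 x y + W2 x y) (\<lambda>x y. V1y x y + W1y x y) (\<lambda>x y. V2y x y + W2y x y)" .
  ultimately show ?thesis using assms unfolding neumann_gradient_def by simp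
qed

lemma neumann_gradient_cmult:
  assumes "neumann_gradient V1 V2 V1x V1y V2y"
  shows "neumann_gradient (\<lambda>x y. c * V1 x y) (\<lambda>x y. c * V2 x y)
    (\<lambda>x y. c * V1x x y) (\<lambda>x y. c * V1y x y) (\<lambda>x y. c * V2y x y)"
proof -
  obtain T where T: "cont2 T" "\<And>x y. ((\<lambda>x. V2y x y) has_real_derivative T x y) (at x)"
     "\<And>x y. ((\<lambda>y. V1y x y) has_real_derivative T x y) (at y)"
    by (rule neumann_gradientE[OF assms]) (rule that)
  have "\<exists>T. cont2 T \<and> (\<forall>x y. ((\<lambda>x. c * V2y x y) has_real_derivative T x y) (at x) \<and>
        ((\<lambda>y. c * V1y x y) has_real_derivative T x y) (at y))"
    by (rule exI[of _ "\<lambda>x y. c * T x y"]) (use T in \<open>auto intro!: DERIV_cmult cont2_intros\<close>)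
  moreover have "C1_2 V1 V1x V1y" "C1_2 V2 V1y V2y"
    using assms unfolding neumann_gradient_def by simp_all
  note C1_2_cmult[OF this(1), of c] C1_2_cmult[OF this(2), of c]
  ultimately show ?thesis using assms unfolding neumann_gradient_def by simp
qed

text \<open>
  This is \<open>\<parallel>D\<^sup>2\<phi>\<parallel> = \<parallel>\<Delta>\<phi>\<parallel>\<close>: the difference of the integrands is twice the divergence of
  \<open>(V1 * V2y, - V1 * V1y)\<close>, whose normal component vanishes on the boundary.
\<close>

lemma neumann_gradient_energy:
  assumes "neumann_gradient V1 V2 V1x V1y V2y"
  shows "dbl_int (-4) 4 (\<lambda>x y. (V1x x y)\<^sup>2 + 2 * (V1y x y)\<^sup>2 + (V2y x y)\<^sup>2) =
      dbl_int (-4) 4 (\<lambda>x y. (V1x x y + V2y x y)\<^sup>2)"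
proof -
  obtain T where T: "cont2 T" "\<And>x y. ((\<lambda>x. V2y x y) has_real_derivative T x y) (at x)"
     "\<And>x y. ((\<lambda>y. V1y x y) has_real_derivative T x y) (at y)"
    by (rule neumann_gradientE[OF assms]) (rule that)
  have C: "C1_2 V1 V1x V1y" "C1_2 V2 V1y V2y" using assms by (auto simp: neumann_gradient_def)
  note c = C1_2_cont2[OF C(1)] C1_2_cont[OF C(1)] C1_2_cont[OF C(2)] T(1)
  have 1: "dbl_int (-4) 4 (\<lambda>x y. V1x x y * V2y x y + V1 x y * T x y) = 0"
    by (rule dbl_int_dx_zero[where A = "\<lambda>x y. V1 x y * V2y x y"])
      (use assms in \<open>auto intro!: derivative_eq_intros C1_2_dx[OF C(1)] T(2) cont2_intros c simp: neumann_gradient_def\<close>)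
  have 2: "dbl_int (-4) 4 (\<lambda>x y. V1y x y * V1y x y + V1 x y * T x y) = 0"
    by (rule dbl_int_dy_zero[where A = "\<lambda>x y. V1 x y * V1y x y"])
      (use assms in \<open>auto intro!: derivative_eq_intros C1_2_dy[OF C(1)] T(3) simp: neumann_gradient_def\<close>)
  have "dbl_int (-4) 4 (\<lambda>x y. (V1x x y + V2y x y)\<^sup>2) =
    dbl_int (-4) 4 (\<lambda>x y. ((V1x x y)\<^sup>2 + 2 * (V1y x y)\<^sup>2 + (V2y x y)\<^sup>2) +
      (2 * (V1x x y * V2y x y + V1 x y * T x y) - 2 * (V1y x y * V1y x y + V1 x y * T x y)))"
    by (rule dbl_int_cong) (simp add: power2_eq_square algebra_simps)
  also have "\<dots> = dbl_int (-4) 4 (\<lambda>x y. (V1x x y)\<^sup>2 + 2 * (V1y x y)\<^sup>2 + (V2y x y)\<^sup>2)"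
    apply (subst dbl_int_add)
    subgoal by (intro cont2_intros c)
    subgoal by (intro cont2_intros c)
    apply (subst dbl_int_diff)
    subgoal by (intro cont2_intros c)
    subgoal by (intro cont2_intros c)
    apply (simp only: dbl_int_cmult 1 2 mult_zero_right diff_self add_0_right)
    done
  finally show ?thesis ..
qed

lemma neumann_gradient_mean:
  assumes "neumann_gradient V1 V2 V1x V1y V2y"
  shows "dbl_int (-4) 4 (\<lambda>x y. V1x x y + V2y x y) = 0"
proof -
  have C: "C1_2 V1 V1x V1y" "C1_2 V2 V1y V2y" using assms by (auto simp: neumann_gradient_def)
  have "dbl_int (-4) 4 V1x = 0"
    by (rule dbl_int_dx_zero[where A = V1])
      (use assms C1_2_cont[OF C(1)] C1_2_dx[OF C(1)] in \<open>auto simp: neumann_gradient_def\<close>)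
  moreover have "dbl_int (-4) 4 V2y = 0"
    by (rule dbl_int_dy_zero[where A = V2])
      (use assms C1_2_dy[OF C(2)] in \<open>auto simp: neumann_gradient_def\<close>)
  ultimately show ?thesis using C1_2_cont[OF C(1)] C1_2_cont[OF C(2)] by (simp add: dbl_int_add)
qed

text \<open>
  The Neumann eigenfunctions of \<open>[-4, 4]\<close>, of frequency \<open>k * pi / 8\<close>, and the corresponding sines.
\<close>

definition cos_mode :: "nat \<Rightarrow> real \<Rightarrow> real" where "cos_mode k x = cos (k * pi / 8 * (x + 4))"
definition sin_mode :: "nat \<Rightarrow> real \<Rightarrow> real" where "sin_mode k x = sin (k * pi / 8 * (x + 4))"

inductive cospoly :: "(real \<times> real \<Rightarrow> real) \<Rightarrow> bool" where
  base: "cospoly (\<lambda>p. cos_mode k (fst p) * cos_mode l (snd p))"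
| add: "cospoly f \<Longrightarrow> cospoly g \<Longrightarrow> cospoly (\<lambda>p. f p + g p)"
| cmult: "cospoly f \<Longrightarrow> cospoly (\<lambda>p. c * f p)"

lemma deriv_cos_mode: "(cos_mode k has_real_derivative - (k * pi / 8 * sin_mode k x)) (at x)"
  unfolding cos_mode_def sin_mode_def by (auto intro!: derivative_eq_intros)

lemma deriv_sin_mode: "(sin_mode k has_real_derivative (k * pi / 8 * cos_mode k x)) (at x)"
  unfolding cos_mode_def[abs_def] sin_mode_def[abs_def] by (auto intro!: derivative_eq_intros)

lemma continuous_cos_mode: "continuous_on S (cos_mode k)" and continuous_sin_mode: "continuous_on S (sin_mode k)"
  unfolding cos_mode_def[abs_def] sin_mode_def[abs_def] by (auto intro!: continuous_intros)

lemma sin_mode_ends: "sin_mode k (-4) = 0" "sin_mode k 4 = 0"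
  by (auto simp: sin_mode_def)

lemma cos_mode_mult: "cos_mode k x * cos_mode m x = (cos_mode (k + m) x + cos_mode (if k \<le> m then m - k else k - m) x) / 2"
proof -
  have "cos_mode (if k \<le> m then m - k else k - m) x = cos ((k * pi / 8 * (x + 4)) - (m * pi / 8 * (x + 4)))"
  proof (cases "k \<le> m")
    case True
    then have "real (m - k) * pi / 8 * (x + 4) = - (k * pi / 8 * (x + 4) - m * pi / 8 * (x + 4))"
      by (simp add: of_nat_diff field_simps)
    with True have "cos_mode (if k \<le> m then m - k else k - m) x =
        cos (- ((k * pi / 8 * (x + 4)) - (m * pi / 8 * (x + 4))))"
      by (simp only: cos_mode_def if_True)
    then show ?thesis by (simp only: cos_minus)
  next
    case False
    then have "real (k - m) * pi / 8 * (x + 4) = k * pi / 8 * (x + 4) - m * pi / 8 * (x + 4)"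
      by (simp add: of_nat_diff field_simps)
    with False show ?thesis by (simp only: cos_mode_def if_False)
  qed
  moreover have "cos_mode (k + m) x = cos ((k * pi / 8 * (x + 4)) + (m * pi / 8 * (x + 4)))"
    by (simp add: cos_mode_def algebra_simps add_divide_distrib)
  ultimately show ?thesis by (simp add: cos_mode_def cos_times_cos)
qed

text \<open>
  By the product formula for cosines the cosine polynomials form an algebra, as the Stone-Weierstrass theorem requires.
\<close>

lemma cospoly_times:
  assumes "cospoly f" "cospoly g" shows "cospoly (\<lambda>p. f p * g p)"
  using assms
proof (induction arbitrary: g)
  case (base k l)
  then show ?case
  proof (induction)
    case (base k' l')
    define d where "d = (\<lambda>k m::nat. if k \<le> m then m - k else k - m)"
    have eq: "(\<lambda>p. cos_mode k (fst p) * cos_mode l (snd p) * (cos_mode k' (fst p) * cos_mode l' (snd p))) =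
      (\<lambda>p. (1/4) * ((cos_mode (k + k') (fst p) * cos_mode (l + l') (snd p) +
         cos_mode (k + k') (fst p) * cos_mode (d l l') (snd p)) +
         (cos_mode (d k k') (fst p) * cos_mode (l + l') (snd p) +
         cos_mode (d k k') (fst p) * cos_mode (d l l') (snd p))))"
    proof
      fix p :: "real \<times> real"
      have "cos_mode k (fst p) * cos_mode l (snd p) * (cos_mode k' (fst p) * cos_mode l' (snd p)) =
        (cos_mode k (fst p) * cos_mode k' (fst p)) * (cos_mode l (snd p) * cos_mode l' (snd p))" by simp
      then show "cos_mode k (fst p) * cos_mode l (snd p) * (cos_mode k' (fst p) * cos_mode l' (snd p)) =
      (1/4) * ((cos_mode (k + k') (fst p) * cos_mode (l + l') (snd p) +
         cos_mode (k + k') (fst p) * cos_mode (d l l') (snd p)) +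
         (cos_mode (d k k') (fst p) * cos_mode (l + l') (snd p) +
         cos_mode (d k k') (fst p) * cos_mode (d l l') (snd p)))"
        unfolding cos_mode_mult d_def by (simp only: distrib_left distrib_right times_divide_times_eq times_divide_eq_left times_divide_eq_right mult_1 add_divide_distrib mult.assoc mult.left_commute mult.commute add.assoc add.left_commute add.commute)
    qed
    show ?case unfolding eq by (intro cospoly.intros)
  next
    case (add f g) from cospoly.add[OF add.IH] show ?case by (simp add: algebra_simps)
  next
    case (cmult f c) from cospoly.cmult[OF cmult.IH, of c] show ?case by (simp add: algebra_simps)
  qed
next
  case (add f g) from cospoly.add[OF add.IH(1)[OF add.prems] add.IH(2)[OF add.prems]] show ?case by (simp add: algebra_simps)
next
  case (cmult f c) from cospoly.cmult[OF cmult.IH, of _ c] cmult.prems show ?case by (simp add: mult.assoc)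
qed

lemma cospoly_const: "cospoly (\<lambda>p. c)"
  using cospoly.cmult[OF cospoly.base[of 0 0], of c] by (simp add: cos_mode_def)

lemma cospoly_continuous: "cospoly f \<Longrightarrow> continuous_on UNIV f"
proof (induction rule: cospoly.induct)
  case (base k l)
  have "continuous_on UNIV (\<lambda>p. cos_mode k (fst p))" "continuous_on UNIV (\<lambda>p. cos_mode l (snd p))"
    by (rule continuous_on_compose2[OF continuous_cos_mode[of UNIV]]; auto intro: continuous_intros)+
  then show ?case by (rule continuous_on_mult)
qed (auto intro: continuous_intros)

lemma cos_mode_1_inj:
  assumes "x \<in> {-4..4}" "y \<in> {-4..4}" "cos_mode 1 x = cos_mode 1 y" shows "x = y"
proof -
  have "inj_on cos {0..pi}" by (rule cos_inj_pi[THEN inj_onI]) auto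
  moreover have "pi / 8 * (z + 4) \<in> {0..pi}" if "z \<in> {-4..4}" for z
    using that mult_left_mono[of "z + 4" 8 "pi / 8"] pi_gt_zero by auto
  ultimately have "pi / 8 * (x + 4) = pi / 8 * (y + 4)"
    using assms by (auto simp: cos_mode_def dest!: inj_onD)
  then show ?thesis by simp
qed

text \<open>
  Already the cosine of lowest frequency is injective on \<open>[-4, 4]\<close>, so cosine polynomials separate points.
\<close>

lemma cospoly_dense:
  assumes "continuous_on (cbox (-4, -4) (4, 4)) f" "\<epsilon> > 0"
  shows "\<exists>g. cospoly g \<and> (\<forall>p\<in>cbox (-4, -4) (4, 4). \<bar>f p - g p\<bar> < \<epsilon>)"
proof (rule Stone_Weierstrass_HOL[where P = cospoly])
  fix p q :: "real \<times> real"
  assume pq: "p \<in> cbox (-4, -4) (4, 4) \<and> q \<in> cbox (-4, -4) (4, 4) \<and> p \<noteq> q"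
  then have "cos_mode 1 (fst p) \<noteq> cos_mode 1 (fst q) \<or> cos_mode 1 (snd p) \<noteq> cos_mode 1 (snd q)"
    using cos_mode_1_inj by (metis cbox_Pair_eq mem_Times_iff prod_eq_iff box_real(2))
  moreover have "cospoly (\<lambda>p. cos_mode 1 (fst p))" "cospoly (\<lambda>p. cos_mode 1 (snd p))"
    using cospoly.base[of 1 0] cospoly.base[of 0 1] by (auto simp: cos_mode_def)
  ultimately show "\<exists>f. cospoly f \<and> f p \<noteq> f q" by blast
qed (use assms in \<open>auto intro: cospoly_const cospoly.add cospoly_times
    continuous_on_subset[OF cospoly_continuous]\<close>)

text \<open>
  The Laplacian is diagonal in the cosine basis: a mode with frequencies \<open>(a, b) \<noteq> (0, 0)\<close> is the divergence of
  the gradient of \<open>- 1 / (a\<^sup>2 + b\<^sup>2)\<close> times itself. Only the constant mode is left over.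
\<close>

lemma cospoly_potential:
  assumes "cospoly Q"
  shows "\<exists>c V1 V2 V1x V1y V2y. neumann_gradient V1 V2 V1x V1y V2y \<and>
     (\<forall>x y. Q (x, y) = c + (V1x x y + V2y x y))"
  using assms
proof induction
  case (base k l)
  define a b where "a = real k * pi / 8" and "b = real l * pi / 8"
  show ?case
  proof (cases "k = 0 \<and> l = 0")
    case True
    have "neumann_gradient (\<lambda>x y. 0) (\<lambda>x y. 0) (\<lambda>x y. 0) (\<lambda>x y. 0) (\<lambda>x y. 0)"
      unfolding neumann_gradient_def C1_2_def by (auto intro!: exI[of _ "\<lambda>x y. 0"] cont2_const)
    then show ?thesis
      by (intro exI[of _ 1] exI[of _ "\<lambda>x y. 0"]) (use True in \<open>auto simp: cos_mode_def\<close>)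
  next
    case False
    then have pos: "a\<^sup>2 + b\<^sup>2 > 0" by (auto simp: a_def b_def sum_power2_gt_zero_iff)
    define r where "r = 1 / (a\<^sup>2 + b\<^sup>2)"
    have dc: "(cos_mode k has_real_derivative - (a * sin_mode k x)) (at x)"
       "(cos_mode l has_real_derivative - (b * sin_mode l x)) (at x)"
       "(sin_mode k has_real_derivative (a * cos_mode k x)) (at x)"
       "(sin_mode l has_real_derivative (b * cos_mode l x)) (at x)" for x
      using deriv_cos_mode deriv_sin_mode unfolding a_def b_def by auto
    have c: "cont2 (\<lambda>x y. sin_mode k x)" "cont2 (\<lambda>x y. cos_mode k x)" "cont2 (\<lambda>x y. sin_mode l y)" "cont2 (\<lambda>x y. cos_mode l y)"
      by (auto intro!: cont2_of_fst cont2_of_snd continuous_cos_mode continuous_sin_mode)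
    have "neumann_gradient (\<lambda>x y. r * a * (sin_mode k x * cos_mode l y)) (\<lambda>x y. r * b * (cos_mode k x * sin_mode l y))
       (\<lambda>x y. r * a * (a * (cos_mode k x * cos_mode l y))) (\<lambda>x y. - (r * a * b * (sin_mode k x * sin_mode l y)))
       (\<lambda>x y. r * b * (b * (cos_mode k x * cos_mode l y)))"
      unfolding neumann_gradient_def C1_2_def
      apply (intro conjI allI exI[of _ "\<lambda>x y. - (r * a * b * b * (sin_mode k x * cos_mode l y))"])
      by (auto intro!: derivative_eq_intros dc cont2_intros c simp: sin_mode_ends)
    moreover have "cos_mode k x * cos_mode l y = 0 + (r * a * (a * (cos_mode k x * cos_mode l y)) + r * b * (b * (cos_mode k x * cos_mode l y)))" for x y
    proof -
      have "r * a * (a * (cos_mode k x * cos_mode l y)) + r * b * (b * (cos_mode k x * cos_mode l y)) = r * (a\<^sup>2 + b\<^sup>2) * (cos_mode k x * cos_mode l y)"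
        by (simp add: algebra_simps power2_eq_square)
      moreover have "r * (a\<^sup>2 + b\<^sup>2) = 1" using pos by (auto simp: r_def)
      ultimately show ?thesis by simp
    qed
    ultimately show ?thesis unfolding fst_conv snd_conv by blast
  qed
next
  case (add f g)
  then obtain c V1 V2 V1x V1y V2y c' W1 W2 W1x W1y W2y where
    "neumann_gradient V1 V2 V1x V1y V2y" "neumann_gradient W1 W2 W1x W1y W2y"
    "\<forall>x y. f (x, y) = c + (V1x x y + V2y x y)" "\<forall>x y. g (x, y) = c' + (W1x x y + W2y x y)" by blast
  with neumann_gradient_add[of V1 V2 V1x V1y V2y W1 W2 W1x W1y W2y] show ?case
    by (intro exI[of _ "c + c'"] exI[of _ "\<lambda>x y. V1 x y + W1 x y"] exI[of _ "\<lambda>x y. V2 x y + W2 x y"]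
     exI[of _ "\<lambda>x y. V1x x y + W1x x y"] exI[of _ "\<lambda>x y. V1y x y + W1y x y"] exI[of _ "\<lambda>x y. V2y x y + W2y x y"]) auto
next
  case (cmult f d)
  then obtain c V1 V2 V1x V1y V2y where
    "neumann_gradient V1 V2 V1x V1y V2y" "\<forall>x y. f (x, y) = c + (V1x x y + V2y x y)" by blast
  with neumann_gradient_cmult[of V1 V2 V1x V1y V2y d] show ?case
    by (intro exI[of _ "d * c"] exI[of _ "\<lambda>x y. d * V1 x y"] exI[of _ "\<lambda>x y. d * V2 x y"]
     exI[of _ "\<lambda>x y. d * V1x x y"] exI[of _ "\<lambda>x y. d * V1y x y"] exI[of _ "\<lambda>x y. d * V2y x y"])
      (auto simp: algebra_simps)
qed

text \<open>
  The datum is replaced by a cosine polynomial, for which the Neumann problem is solved explicitly. The constant mode of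
  that polynomial is its mean, which is small because the datum has mean zero.
\<close>

lemma approx_neumann_solver:
  assumes q: "cont2 q" "dbl_int (-4) 4 q = 0" and "\<epsilon> > 0"
  shows "\<exists>V1 V2 V1x V1y V2y. neumann_gradient V1 V2 V1x V1y V2y \<and>
     (\<forall>x\<in>{-4..4}. \<forall>y\<in>{-4..4}. \<bar>V1x x y + V2y x y - q x y\<bar> \<le> \<epsilon>)"
proof -
  obtain Q where Q: "cospoly Q" "\<forall>p\<in>cbox (-4, -4) (4, 4). \<bar>q (fst p) (snd p) - Q p\<bar> < \<epsilon> / 2"
    using cospoly_dense[OF continuous_on_subset[OF q(1)[unfolded cont2_def]], of "\<epsilon> / 2"] \<open>\<epsilon> > 0\<close> by auto
  obtain c V1 V2 V1x V1y V2y where V: "neumann_gradient V1 V2 V1x V1y V2y"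
     "\<And>x y. Q (x, y) = c + (V1x x y + V2y x y)"
    using cospoly_potential[OF Q(1)] by blast
  have cQ: "cont2 (\<lambda>x y. Q (x, y))"
    using cospoly_continuous[OF Q(1)] by (simp add: cont2_def)
  have b: "\<bar>q x y - Q (x, y)\<bar> \<le> \<epsilon> / 2" if "x \<in> {-4..4}" "y \<in> {-4..4}" for x y
    using Q(2) that by force
  have cV: "cont2 V1x" "cont2 V2y" using V(1) unfolding neumann_gradient_def C1_2_def by auto
  have "64 * c = dbl_int (-4) 4 (\<lambda>x y. Q (x, y))"
    unfolding V(2) using cV neumann_gradient_mean[OF V(1)]
    by (subst dbl_int_add) (auto simp: dbl_int_const intro: cont2_intros)
  also have "\<dots> = dbl_int (-4) 4 (\<lambda>x y. Q (x, y) - q x y)"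
    using cQ q by (simp add: dbl_int_diff)
  finally have e: "64 * c = dbl_int (-4) 4 (\<lambda>x y. Q (x, y) - q x y)" .
  have b': "Q (x, y) - q x y \<le> \<epsilon> / 2" "- (\<epsilon> / 2) \<le> Q (x, y) - q x y"
    if "x \<in> {-4..4}" "y \<in> {-4..4}" for x y
    using b[OF that] by linarith+
  have cd: "cont2 (\<lambda>x y. Q (x, y) - q x y)" using cQ q(1) by (rule cont2_diff)
  have "64 * c \<le> dbl_int (-4) 4 (\<lambda>x y. \<epsilon> / 2)"
    unfolding e by (rule dbl_int_mono[OF cd cont2_const]) (use b'(1) in simp)
  moreover have "dbl_int (-4) 4 (\<lambda>x y. - (\<epsilon> / 2)) \<le> 64 * c"
    unfolding e by (rule dbl_int_mono[OF cont2_const cd]) (use b'(2) in simp)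
  ultimately have "\<bar>c\<bar> \<le> \<epsilon> / 2" by (simp add: dbl_int_const)
  then have "\<bar>V1x x y + V2y x y - q x y\<bar> \<le> \<epsilon>" if "x \<in> {-4..4}" "y \<in> {-4..4}" for x y
    using b[OF that] V(2)[of x y] by linarith
  with V(1) show ?thesis by blast
qed

section \<open>Reflection across the axes\<close>

text \<open>
  The combinations of the values at \<open>x\<close>, \<open>- x\<close> and \<open>- 2 * x\<close> used below have coefficients \<open>(1, -3, 2)\<close>
  and \<open>(1, 3, -4)\<close>. Both have sum zero, so the combination vanishes at \<open>x = 0\<close>; and differentiation in \<open>x\<close> turns
  the first into the second, which makes the operation compatible with the divergence.
\<close>

definition refl_x :: "real \<Rightarrow> real \<Rightarrow> (real \<Rightarrow> real \<Rightarrow> real) \<Rightarrow> real \<Rightarrow> real \<Rightarrow> real" where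
  "refl_x \<alpha> \<beta> f x y = f x y + \<alpha> * f (- x) y + \<beta> * f (-2 * x) y"

definition refl_y :: "real \<Rightarrow> real \<Rightarrow> (real \<Rightarrow> real \<Rightarrow> real) \<Rightarrow> real \<Rightarrow> real \<Rightarrow> real" where
  "refl_y \<alpha> \<beta> f x y = f x y + \<alpha> * f x (- y) + \<beta> * f x (-2 * y)"

lemma C1_2_refl_x:
  assumes "C1_2 f fx fy"
  shows "C1_2 (refl_x \<alpha> \<beta> f) (refl_x (-\<alpha>) (-2 * \<beta>) fx) (refl_x \<alpha> \<beta> fy)"
proof -
  have "C1_2 (\<lambda>x y. f x y + \<alpha> * f (- 1 * x) (1 * y) + \<beta> * f (-2 * x) (1 * y))
   (\<lambda>x y. fx x y + \<alpha> * (-1 * fx (- 1 * x) (1 * y)) + \<beta> * (-2 * fx (-2 * x) (1 * y)))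
   (\<lambda>x y. fy x y + \<alpha> * (1 * fy (- 1 * x) (1 * y)) + \<beta> * (1 * fy (-2 * x) (1 * y)))"
    by (intro C1_2_add C1_2_cmult C1_2_scale assms)
  then show ?thesis unfolding refl_x_def[abs_def] by (simp add: algebra_simps)
qed

lemma C1_2_refl_y:
  assumes "C1_2 f fx fy"
  shows "C1_2 (refl_y \<alpha> \<beta> f) (refl_y \<alpha> \<beta> fx) (refl_y (-\<alpha>) (-2 * \<beta>) fy)"
proof -
  have "C1_2 (\<lambda>x y. f x y + \<alpha> * f (1 * x) (-1 * y) + \<beta> * f (1 * x) (-2 * y))
   (\<lambda>x y. fx x y + \<alpha> * (1 * fx (1 * x) (-1 * y)) + \<beta> * (1 * fx (1 * x) (-2 * y)))
   (\<lambda>x y. fy x y + \<alpha> * (-1 * fy (1 * x) (-1 * y)) + \<beta> * (-2 * fy (1 * x) (-2 * y)))"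
    by (intro C1_2_add C1_2_cmult C1_2_scale assms)
  then show ?thesis unfolding refl_y_def[abs_def] by (simp add: algebra_simps)
qed

lemma integral_reflected_le:
  fixes g :: "real \<Rightarrow> real"
  assumes g: "continuous_on UNIV g" "\<And>x. 0 \<le> g x"
  shows "integral {0..2} g \<le> integral {-4..4} g"
    "integral {0..2} (\<lambda>x. g (- x)) \<le> integral {-4..4} g"
    "integral {0..2} (\<lambda>x. g (-2 * x)) \<le> integral {-4..4} g"
proof -
  have i: "g integrable_on {a..b}" for a b
    by (rule integrable_continuous_real) (rule continuous_on_subset[OF g(1)], simp)
  have sub: "integral {a..b} g \<le> integral {-4..4} g" if "-4 \<le> a" "b \<le> 4" for a b
    by (rule integral_subset_le) (use i g that in auto)
  show "integral {0..2} g \<le> integral {-4..4} g" by (rule sub) auto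
  have "integral {0..2} (\<lambda>x. g (- x)) = integral {-2..0} g"
    using Henstock_Kurzweil_Integration.integral_reflect_real[where a = "-2" and b = 0 and f = g] by simp
  then show "integral {0..2} (\<lambda>x. g (- x)) \<le> integral {-4..4} g" using sub[of "-2" 0] by simp
  have "((\<lambda>x. g ((-2) *\<^sub>R x + 0)) has_integral (1 / \<bar>-2\<bar> ^ DIM(real)) *\<^sub>R integral {-4..0} g)
     ((\<lambda>x. (1 / (-2)) *\<^sub>R x + - ((1 / (-2)) *\<^sub>R 0)) ` cbox (-4) 0)"
    by (rule has_integral_affinity) (use i[of "-4" 0] in \<open>auto intro: integrable_integral\<close>)
  moreover have "(\<lambda>x::real. (1 / (-2)) *\<^sub>R x + - ((1 / (-2)) *\<^sub>R 0)) ` cbox (-4) 0 = {0..2}"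
    by (auto simp: image_iff intro!: bexI[where x = "-2 * _"])
  ultimately have "integral {0..2} (\<lambda>x. g (-2 * x)) = integral {-4..0} g / 2"
    by (simp add: integral_unique)
  moreover have "0 \<le> integral {-4..0} g" by (rule integral_nonneg) (use i g in auto)
  ultimately show "integral {0..2} (\<lambda>x. g (-2 * x)) \<le> integral {-4..4} g" using sub[of "-4" 0] by simp
qed

lemma three_term_square:
  "(a + \<alpha> * b + \<beta> * c)\<^sup>2 \<le> (1 + \<alpha>\<^sup>2 + \<beta>\<^sup>2) * (a\<^sup>2 + b\<^sup>2 + c\<^sup>2)" for a :: real
proof -
  have "(1 + \<alpha>\<^sup>2 + \<beta>\<^sup>2) * (a\<^sup>2 + b\<^sup>2 + c\<^sup>2) - (a + \<alpha> * b + \<beta> * c)\<^sup>2 =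
    (b - \<alpha> * a)\<^sup>2 + (c - \<beta> * a)\<^sup>2 + (\<alpha> * c - \<beta> * b)\<^sup>2"
    by (simp add: power2_eq_square algebra_simps)
  then show ?thesis by (smt (verit) zero_le_power2)
qed

lemma integral_cont2_snd:
  assumes "cont2 f"
  shows "continuous_on UNIV (\<lambda>x. integral {c..d} (\<lambda>y. f x y))"
proof -
  have "continuous_on UNIV (\<lambda>x. integral (cbox c d) (f x))"
    by (rule integral_continuous_on_param)
      (use continuous_on_subset[OF assms[unfolded cont2_def]] in \<open>auto simp: case_prod_beta'\<close>)
  then show ?thesis by simp
qed

lemma reflection_bound_1d:
  fixes g :: "real \<Rightarrow> real"
  assumes g: "continuous_on UNIV g" and K: "1 + \<alpha>\<^sup>2 + \<beta>\<^sup>2 \<le> 74"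
  shows "integral {0..2} (\<lambda>x. (g x + \<alpha> * g (-x) + \<beta> * g (-2 * x))\<^sup>2) \<le> 222 * integral {-4..4} (\<lambda>x. (g x)\<^sup>2)"
proof -
  have c: "continuous_on S (\<lambda>x. g x)" "continuous_on S (\<lambda>x. g (-x))" "continuous_on S (\<lambda>x. g (-2 * x))" for S
    by (rule continuous_on_compose2[OF g]; auto intro!: continuous_intros)+
  have i: "(\<lambda>x. (g x)\<^sup>2) integrable_on {0..2}" "(\<lambda>x. (g (-x))\<^sup>2) integrable_on {0..2}"
     "(\<lambda>x. (g (-2 * x))\<^sup>2) integrable_on {0..2}"
    by (intro integrable_continuous_real continuous_intros c)+
  have "integral {0..2} (\<lambda>x. (g x + \<alpha> * g (-x) + \<beta> * g (-2 * x))\<^sup>2) \<le>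
    integral {0..2} (\<lambda>x. 74 * ((g x)\<^sup>2 + (g (-x))\<^sup>2 + (g (-2 * x))\<^sup>2))"
  proof (rule integral_le)
    show "(\<lambda>x. (g x + \<alpha> * g (-x) + \<beta> * g (-2 * x))\<^sup>2) integrable_on {0..2}"
      by (intro integrable_continuous_real continuous_intros c)
    show "(\<lambda>x. 74 * ((g x)\<^sup>2 + (g (-x))\<^sup>2 + (g (-2 * x))\<^sup>2)) integrable_on {0..2}"
      by (intro integrable_continuous_real continuous_intros c)
    show "(g x + \<alpha> * g (-x) + \<beta> * g (-2 * x))\<^sup>2 \<le> 74 * ((g x)\<^sup>2 + (g (-x))\<^sup>2 + (g (-2 * x))\<^sup>2)" for x
      by (rule order_trans[OF three_term_square mult_right_mono[OF K]]) simp
  qed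
  also have "\<dots> = 74 * (integral {0..2} (\<lambda>x. (g x)\<^sup>2) + integral {0..2} (\<lambda>x. (g (-x))\<^sup>2) +
     integral {0..2} (\<lambda>x. (g (-2 * x))\<^sup>2))"
    using i by (simp add: integral_add integrable_add)
  also have "\<dots> \<le> 222 * integral {-4..4} (\<lambda>x. (g x)\<^sup>2)"
    using integral_reflected_le[OF continuous_on_power[OF g, of 2] zero_le_power2] by simp
  finally show ?thesis .
qed

lemma cont2_refl_x: "cont2 f \<Longrightarrow> cont2 (refl_x \<alpha> \<beta> f)"
  and cont2_refl_y: "cont2 f \<Longrightarrow> cont2 (refl_y \<alpha> \<beta> f)"
  unfolding refl_x_def[abs_def] refl_y_def[abs_def]
  using cont2_comp[of f "\<lambda>x. - x" "\<lambda>y. y"] cont2_comp[of f "\<lambda>x. -2 * x" "\<lambda>y. y"]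
    cont2_comp[of f "\<lambda>x. x" "\<lambda>y. - y"] cont2_comp[of f "\<lambda>x. x" "\<lambda>y. -2 * y"]
  by (intro cont2_intros; simp add: continuous_on_mult_const continuous_on_minus continuous_on_id)+

lemma cont2_swap: "cont2 f \<Longrightarrow> cont2 (\<lambda>x y. f y x)"
  unfolding cont2_def[of "\<lambda>x y. f y x"] by (erule cont2_compose[where f = f and a = snd and b = fst]) (intro continuous_intros)+

text \<open>
  The constant 74 is the largest value of \<open>1 + \<alpha>\<^sup>2 + \<beta>\<^sup>2\<close> that occurs, for the coefficients
  \<open>(1, -3, 8)\<close>; each variable contributes the factor \<open>222 = 3 * 74\<close>. The arguments \<open>- 2 * x\<close> with
  \<open>x\<close> in \<open>[0, 2]\<close> are the reason for working on \<open>[-4, 4]\<close>.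
\<close>

lemma reflection_bound:
  assumes f: "cont2 f" and K: "1 + \<alpha>\<^sup>2 + \<beta>\<^sup>2 \<le> 74" "1 + \<alpha>'\<^sup>2 + \<beta>'\<^sup>2 \<le> 74"
  shows "dbl_int 0 2 (\<lambda>x y. (refl_x \<alpha> \<beta> (refl_y \<alpha>' \<beta>' f) x y)\<^sup>2) \<le> 49284 * dbl_int (-4) 4 (\<lambda>x y. (f x y)\<^sup>2)"
proof -
  define h where "h = refl_y \<alpha>' \<beta>' f"
  have h: "cont2 h" unfolding h_def by (rule cont2_refl_y[OF f])
  have ch: "cont2 (\<lambda>x y. (h x y)\<^sup>2)" "cont2 (\<lambda>x y. (refl_x \<alpha> \<beta> h x y)\<^sup>2)" "cont2 (\<lambda>x y. (f x y)\<^sup>2)"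
    by (intro cont2_power h cont2_refl_x f)+
  have ic: "(\<lambda>y. integral {a..b} (\<lambda>x. F x y)) integrable_on {c..d}" if "cont2 F" for F a b c d
    by (intro integrable_continuous_real continuous_on_subset[OF integral_cont2_snd[OF cont2_swap[OF that]]]) simp
  have ic2: "(\<lambda>x. integral {a..b} (\<lambda>y. F x y)) integrable_on {c..d}" if "cont2 F" for F a b c d
    by (intro integrable_continuous_real continuous_on_subset[OF integral_cont2_snd[OF that]]) simp
  have swap: "integral {a..b} (\<lambda>x. integral {c..d} (F x)) = integral {c..d} (\<lambda>y. integral {a..b} (\<lambda>x. F x y))"
    if "cont2 F" for F a b c d
    using integral_swap_continuous[of a c b d F] continuous_on_subset[OF that[unfolded cont2_def]]
    by (simp add: case_prod_beta')
  have "dbl_int 0 2 (\<lambda>x y. (refl_x \<alpha> \<beta> h x y)\<^sup>2) = integral {0..2} (\<lambda>y. integral {0..2} (\<lambda>x. (refl_x \<alpha> \<beta> h x y)\<^sup>2))"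
    unfolding dbl_int_def by (rule swap[OF ch(2)])
  also have "\<dots> \<le> integral {0..2} (\<lambda>y. 222 * integral {-4..4} (\<lambda>x. (h x y)\<^sup>2))"
  proof (rule integral_le)
    show "(\<lambda>y. integral {0..2} (\<lambda>x. (refl_x \<alpha> \<beta> h x y)\<^sup>2)) integrable_on {0..2}" by (rule ic[OF ch(2)])
    show "(\<lambda>y. 222 * integral {-4..4} (\<lambda>x. (h x y)\<^sup>2)) integrable_on {0..2}"
      using ic[OF ch(1)] by (rule integrable_on_mult_right)
    show "integral {0..2} (\<lambda>x. (refl_x \<alpha> \<beta> h x y)\<^sup>2) \<le> 222 * integral {-4..4} (\<lambda>x. (h x y)\<^sup>2)" for y
      unfolding refl_x_def using reflection_bound_1d[OF cont2_fst[OF h] K(1)] .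
  qed
  also have "\<dots> = 222 * integral {0..2} (\<lambda>y. integral {-4..4} (\<lambda>x. (h x y)\<^sup>2))" by simp
  also have "integral {0..2} (\<lambda>y. integral {-4..4} (\<lambda>x. (h x y)\<^sup>2)) = integral {-4..4} (\<lambda>x. integral {0..2} (\<lambda>y. (h x y)\<^sup>2))"
    by (rule swap[OF ch(1), symmetric])
  also have "\<dots> \<le> integral {-4..4} (\<lambda>x. 222 * integral {-4..4} (\<lambda>y. (f x y)\<^sup>2))"
  proof (rule integral_le)
    show "(\<lambda>x. integral {0..2} (\<lambda>y. (h x y)\<^sup>2)) integrable_on {-4..4}" by (rule ic2[OF ch(1)])
    show "(\<lambda>x. 222 * integral {-4..4} (\<lambda>y. (f x y)\<^sup>2)) integrable_on {-4..4}"
      using ic2[OF ch(3)] by (rule integrable_on_mult_right)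
    show "integral {0..2} (\<lambda>y. (h x y)\<^sup>2) \<le> 222 * integral {-4..4} (\<lambda>y. (f x y)\<^sup>2)" for x
      unfolding h_def refl_y_def using reflection_bound_1d[OF cont2_snd[OF f] K(2)] .
  qed
  also have "\<dots> = 222 * dbl_int (-4) 4 (\<lambda>x y. (f x y)\<^sup>2)" by (simp add: dbl_int_def)
  finally show ?thesis unfolding h_def by simp
qed

section \<open>Norms on the small square\<close>

text \<open>
  The square of the \<open>L\<^sup>2\<close> norm on \<open>(0, 2)\<^sup>2\<close>; it needs no square root as long as constants are generous.
\<close>

definition sqn :: "(real \<Rightarrow> real \<Rightarrow> real) \<Rightarrow> real" where
  "sqn f = dbl_int 0 2 (\<lambda>x y. (f x y)\<^sup>2)"

lemma sqn_nonneg: "cont2 f \<Longrightarrow> 0 \<le> sqn f"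
  unfolding sqn_def by (rule dbl_int_nonneg) (auto intro: cont2_power)

lemma sqn_add:
  assumes "cont2 f" "cont2 g" shows "sqn (\<lambda>x y. f x y + g x y) \<le> 2 * sqn f + 2 * sqn g"
proof -
  have "sqn (\<lambda>x y. f x y + g x y) \<le> dbl_int 0 2 (\<lambda>x y. 2 * (f x y)\<^sup>2 + 2 * (g x y)\<^sup>2)"
    unfolding sqn_def
  proof (rule dbl_int_mono)
    show "(f x y + g x y)\<^sup>2 \<le> 2 * (f x y)\<^sup>2 + 2 * (g x y)\<^sup>2" for x y
      using zero_le_power2[of "f x y - g x y"] by (simp add: power2_eq_square algebra_simps)
  qed (intro cont2_intros assms)+
  also have "\<dots> = 2 * sqn f + 2 * sqn g"
    unfolding sqn_def
    by (subst dbl_int_add, intro cont2_intros assms, intro cont2_intros assms) (simp only: dbl_int_cmult)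
  finally show ?thesis .
qed

lemma sqn_minus: "sqn (\<lambda>x y. - f x y) = sqn f" by (simp add: sqn_def)

lemma sqn_diff:
  assumes "cont2 f" "cont2 g" shows "sqn (\<lambda>x y. f x y - g x y) \<le> 2 * sqn f + 2 * sqn g"
  using sqn_add[OF assms(1) cont2_minus[OF assms(2)]] by (simp add: sqn_minus)

lemma sqn_mult_le:
  assumes "cont2 a" "cont2 f" "\<And>x y. x \<in> {0..2} \<Longrightarrow> y \<in> {0..2} \<Longrightarrow> \<bar>a x y\<bar> \<le> M"
  shows "sqn (\<lambda>x y. a x y * f x y) \<le> M\<^sup>2 * sqn f"
proof -
  have "sqn (\<lambda>x y. a x y * f x y) \<le> dbl_int 0 2 (\<lambda>x y. M\<^sup>2 * (f x y)\<^sup>2)"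
    unfolding sqn_def
  proof (rule dbl_int_mono)
    show "(a x y * f x y)\<^sup>2 \<le> M\<^sup>2 * (f x y)\<^sup>2" if "x \<in> {0..2}" "y \<in> {0..2}" for x y
      using power_mono[OF assms(3)[OF that], of 2] by (simp add: power_mult_distrib mult_right_mono)
  qed (intro cont2_intros assms)+
  then show ?thesis by (simp add: sqn_def dbl_int_cmult)
qed

lemma sqn_bounded:
  assumes "cont2 f" "\<And>x y. x \<in> {0..2} \<Longrightarrow> y \<in> {0..2} \<Longrightarrow> \<bar>f x y\<bar> \<le> M"
  shows "sqn f \<le> 4 * M\<^sup>2"
  using sqn_mult_le[OF assms(1) cont2_const[of 1] assms(2)] by (simp add: sqn_def dbl_int_const)

lemma integral_square_le:
  fixes g :: "real \<Rightarrow> real"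
  assumes "continuous_on {a..b} g" "a \<le> b"
  shows "(integral {a..b} g)\<^sup>2 \<le> (b - a) * integral {a..b} (\<lambda>x. (g x)\<^sup>2)"
proof (cases "a = b")
  case False
  define m where "m = integral {a..b} g / (b - a)"
  have "0 \<le> integral {a..b} (\<lambda>x. (g x - m)\<^sup>2)"
    by (rule integral_nonneg) (auto intro!: integrable_continuous_real continuous_intros assms)
  also have "integral {a..b} (\<lambda>x. (g x - m)\<^sup>2) = integral {a..b} (\<lambda>x. (g x)\<^sup>2 - 2 * m * g x + m\<^sup>2)"
    by (simp add: power2_eq_square algebra_simps)
  also have "\<dots> = integral {a..b} (\<lambda>x. (g x)\<^sup>2) - 2 * m * integral {a..b} g + m\<^sup>2 * (b - a)"
    using assms
    by (subst integral_add integral_diff; auto intro!: integrable_continuous_real continuous_intros)+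
  also have "2 * m * integral {a..b} g = 2 * m\<^sup>2 * (b - a)"
    using False by (simp add: m_def power2_eq_square)
  finally have "m\<^sup>2 * (b - a) \<le> integral {a..b} (\<lambda>x. (g x)\<^sup>2)" by (simp add: algebra_simps)
  moreover have "(integral {a..b} g)\<^sup>2 = (b - a) * (m\<^sup>2 * (b - a))"
    using False by (simp add: m_def power2_eq_square)
  ultimately show ?thesis using assms by (simp add: mult_left_mono mult.commute)
qed auto

lemma integral_0x_square_le:
  fixes g :: "real \<Rightarrow> real"
  assumes g: "continuous_on UNIV g" and x: "x \<in> {0..2}"
  shows "(integral {0..x} g)\<^sup>2 \<le> 2 * integral {0..2} (\<lambda>x. (g x)\<^sup>2)"
proof -
  have i: "(\<lambda>x. (g x)\<^sup>2) integrable_on {a..b}" for a b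
    by (auto intro!: integrable_continuous_real continuous_intros continuous_on_subset[OF g])
  have "(integral {0..x} g)\<^sup>2 \<le> (x - 0) * integral {0..x} (\<lambda>x. (g x)\<^sup>2)"
    by (rule integral_square_le) (use x in \<open>auto intro: continuous_on_subset[OF g]\<close>)
  also have "\<dots> \<le> 2 * integral {0..2} (\<lambda>x. (g x)\<^sup>2)"
    by (rule mult_mono) (use x i in \<open>auto intro!: integral_subset_le integral_nonneg\<close>)
  finally show ?thesis .
qed

lemma sqn_swap: "cont2 f \<Longrightarrow> sqn (\<lambda>x y. f y x) = sqn f"
  unfolding sqn_def using dbl_int_swap[OF cont2_power, of f 0 2 2] by simp

text \<open>
  Integrating a bound by the norm of a whole slice costs only the side length of the square.
\<close>

lemma sqn_le_slice:
  assumes "cont2 f" "cont2 g"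
    and "\<And>x y. x \<in> {0..2} \<Longrightarrow> y \<in> {0..2} \<Longrightarrow> (f x y)\<^sup>2 \<le> c * integral {0..2} (\<lambda>t. (g x t)\<^sup>2)"
  shows "sqn f \<le> 2 * c * sqn g"
proof -
  have i: "continuous_on UNIV (\<lambda>x. integral {0..2} (\<lambda>t. (g x t)\<^sup>2))"
    by (rule integral_cont2_snd[OF cont2_power[OF assms(2)]])
  have "sqn f \<le> dbl_int 0 2 (\<lambda>x y. c * integral {0..2} (\<lambda>t. (g x t)\<^sup>2))"
    unfolding sqn_def
  proof (rule dbl_int_mono)
    show "cont2 (\<lambda>x y. (f x y)\<^sup>2)" by (rule cont2_power[OF assms(1)])
    show "cont2 (\<lambda>x y. c * integral {0..2} (\<lambda>t. (g x t)\<^sup>2))"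
      by (rule cont2_mult[OF cont2_const cont2_of_fst[OF i]])
  qed (rule assms(3))
  also have "\<dots> = 2 * c * sqn g" by (simp add: sqn_def dbl_int_def)
  finally show ?thesis .
qed

lemma sqn_le_slice':
  assumes "cont2 f" "cont2 g"
    and "\<And>x y. x \<in> {0..2} \<Longrightarrow> y \<in> {0..2} \<Longrightarrow> (f x y)\<^sup>2 \<le> c * integral {0..2} (\<lambda>t. (g t y)\<^sup>2)"
  shows "sqn f \<le> 2 * c * sqn g"
  using sqn_le_slice[OF cont2_swap[OF assms(1)] cont2_swap[OF assms(2)], of c] assms
  by (simp add: sqn_swap)

lemma poincare_x:
  assumes "C1_2 w wx wy" "\<And>y. w 0 y = 0"
  shows "sqn w \<le> 4 * sqn wx"
proof -
  have "(w x y)\<^sup>2 \<le> 2 * integral {0..2} (\<lambda>t. (wx t y)\<^sup>2)" if x: "x \<in> {0..2}" for x y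
  proof -
    have "((\<lambda>t. wx t y) has_integral (w x y - w 0 y)) {0..x}"
      by (rule fundamental_theorem_of_calculus)
       (use x C1_2_dx[OF assms(1)] in \<open>auto simp: has_real_derivative_iff_has_vector_derivative
        intro: has_vector_derivative_at_within\<close>)
    then have "w x y = integral {0..x} (\<lambda>t. wx t y)" using assms(2) by (simp add: integral_unique)
    then show ?thesis
      using integral_0x_square_le[OF cont2_fst[OF C1_2_cont(1)[OF assms(1)]] x, of y] by simp
  qed
  from sqn_le_slice'[OF C1_2_cont2[OF assms(1)] C1_2_cont(1)[OF assms(1)] this]
  show ?thesis by simp
qed

section \<open>Regular data for the divergence equation\<close>

text \<open>
  The primitive that vanishes at 0. The substituted form is meaningful for arguments of either sign and makes joint
  continuity in a parameter evident.
\<close>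

definition primitive :: "(real \<Rightarrow> real) \<Rightarrow> real \<Rightarrow> real" where
  "primitive g x = x * integral {0..1} (\<lambda>t. g (x * t))"

lemma primitive_antiderivative:
  assumes "\<And>x. (G has_real_derivative g x) (at x)"
  shows "primitive g x = G x - G 0"
proof -
  have "((\<lambda>t. x * g (x * t)) has_integral (G (x * 1) - G (x * 0))) {0..1}"
  proof (rule fundamental_theorem_of_calculus)
    fix t :: real
    have "((\<lambda>t. G (x * t)) has_real_derivative g (x * t) * x) (at t)"
      by (rule DERIV_chain2[where f = G and g = "(*) x", OF assms DERIV_cmult_Id])
    then show "((\<lambda>t. G (x * t)) has_vector_derivative x * g (x * t)) (at t within {0..1})"
      unfolding has_real_derivative_iff_has_vector_derivative
      by (subst mult.commute[of x "g _"]) (rule has_vector_derivative_at_within)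
  qed simp
  from integral_unique[OF this] show ?thesis by (simp add: primitive_def)
qed

lemma has_antiderivative:
  fixes g :: "real \<Rightarrow> real"
  assumes "continuous_on UNIV g"
  obtains G where "\<And>x. (G has_real_derivative g x) (at x)"
proof -
  have "\<exists>F. \<forall>x. (-\<infinity>::ereal) < ereal x \<longrightarrow> ereal x < (\<infinity>::ereal) \<longrightarrow> (F has_vector_derivative g x) (at x)"
    by (rule einterval_antiderivative) (use assms in \<open>auto simp: continuous_on_eq_continuous_at\<close>)
  then show ?thesis using that by (auto simp: has_real_derivative_iff_has_vector_derivative)
qed

lemma primitive_eq_integral:
  assumes "continuous_on UNIV g" "0 \<le> x"
  shows "primitive g x = integral {0..x} g"
proof -
  obtain G where G: "\<And>x. (G has_real_derivative g x) (at x)" by (rule has_antiderivative[OF assms(1)]) (rule that)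
  have "(g has_integral (G x - G 0)) {0..x}"
    by (rule fundamental_theorem_of_calculus) (use G assms in
      \<open>auto simp: has_real_derivative_iff_has_vector_derivative intro: has_vector_derivative_at_within\<close>)
  then show ?thesis by (simp add: primitive_antiderivative[OF G] integral_unique)
qed

lemma deriv_primitive:
  assumes "continuous_on UNIV g"
  shows "(primitive g has_real_derivative g x) (at x)"
proof -
  obtain G where G: "\<And>x. (G has_real_derivative g x) (at x)" by (rule has_antiderivative[OF assms]) (rule that)
  then have "primitive g = (\<lambda>x. G x - G 0)" by (auto simp: primitive_antiderivative)
  then show ?thesis using G by (auto intro!: derivative_eq_intros)
qed

lemma cont2_primitive:
  assumes "cont2 g"
  shows "cont2 (\<lambda>x y. primitive (\<lambda>s. g s y) x)"
proof -
  have "continuous_on UNIV (\<lambda>p. integral (cbox 0 1) (\<lambda>t. g (fst p * t) (snd p)))"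
  proof (rule integral_continuous_on_param)
    have "continuous_on (UNIV \<times> cbox 0 1) (\<lambda>z. g (fst (fst z) * snd z) (snd (fst z)))"
      by (rule cont2_compose[OF assms]) (intro continuous_intros)+
    then show "continuous_on (UNIV \<times> cbox 0 1) (\<lambda>(p, t). g (fst p * t) (snd p))"
      by (simp add: case_prod_beta')
  qed
  then show ?thesis unfolding cont2_def primitive_def by (auto intro!: continuous_intros)
qed

lemma C1_2_primitive:
  assumes f: "C1_2 f fx fy"
  shows "C1_2 (\<lambda>x y. primitive (\<lambda>s. f s y) x) f (\<lambda>x y. primitive (\<lambda>s. fy s y) x)"
proof -
  note c = C1_2_cont2[OF f] C1_2_cont[OF f]
  have "((\<lambda>y. primitive (\<lambda>s. f s y) x) has_real_derivative primitive (\<lambda>s. fy s y) x) (at y)" for x y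
  proof -
    have "((\<lambda>y. integral (cbox 0 1) (\<lambda>t. f (x * t) y)) has_real_derivative
       integral (cbox 0 1) (\<lambda>t. fy (x * t) y)) (at y within UNIV)"
    proof (rule leibniz_rule_field_derivative)
      show "((\<lambda>y. f (x * t) y) has_real_derivative fy (x * t) y) (at y within UNIV)" for y t
        using C1_2_dy[OF f] .
      show "(\<lambda>t. f (x * t) y) integrable_on cbox 0 1" for y
        by (rule integrable_continuous, rule cont2_compose[OF c(1)]) (intro continuous_intros)+
      have "continuous_on (UNIV \<times> cbox 0 1) (\<lambda>z. fy (x * snd z) (fst z))"
        by (rule cont2_compose[OF c(3)]) (intro continuous_intros)+
      then show "continuous_on (UNIV \<times> cbox 0 1) (\<lambda>(y, t). fy (x * t) y)"
        by (simp add: case_prod_beta')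
    qed auto
    then show ?thesis unfolding primitive_def by (auto intro!: DERIV_cmult)
  qed
  then show ?thesis unfolding C1_2_def
    using deriv_primitive[OF cont2_fst[OF c(1)]] c cont2_primitive[OF c(3)] by auto
qed

text \<open>
  A bump on \<open>[0, 2]\<close> that vanishes at both ends and has integral 1; \<open>bubble_primitive\<close> grows from 0 to 1.
\<close>

definition bubble :: "real \<Rightarrow> real" where "bubble x = 3/4 * (x * (2 - x))"
definition bubble' :: "real \<Rightarrow> real" where "bubble' x = 3/2 * (1 - x)"
definition bubble_primitive :: "real \<Rightarrow> real" where "bubble_primitive x = 3/4 * (x\<^sup>2 - x^3 / 3)"

lemma deriv_bubble: "(bubble has_real_derivative bubble' x) (at x)"
  unfolding bubble_def[abs_def] bubble'_def by (auto intro!: derivative_eq_intros simp: field_simps)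

lemma deriv_bubble_primitive: "(bubble_primitive has_real_derivative bubble x) (at x)"
  unfolding bubble_def bubble_primitive_def[abs_def]
  by (auto intro!: derivative_eq_intros simp: field_simps power2_eq_square)

lemma bubble_bounds:
  assumes "x \<in> {0..2}"
  shows "\<bar>bubble x\<bar> \<le> 3/4" "\<bar>bubble' x\<bar> \<le> 3/2" "\<bar>bubble_primitive x\<bar> \<le> 1"
proof -
  have "0 \<le> (x - 1)\<^sup>2" by simp
  then have "x * (2 - x) \<le> 1" by (simp add: power2_eq_square algebra_simps)
  moreover have "0 \<le> x * (2 - x)" using assms by simp
  ultimately show "\<bar>bubble x\<bar> \<le> 3/4" by (simp add: bubble_def)
  show "\<bar>bubble' x\<bar> \<le> 3/2" using assms by (auto simp: bubble'_def abs_le_iff)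
  have e: "bubble_primitive x = x\<^sup>2 * (3 - x) / 4" by (simp add: bubble_primitive_def power2_eq_square power3_eq_cube field_simps)
  have "0 \<le> (2 - x)\<^sup>2 * (x + 1)" using assms by simp
  then have "x\<^sup>2 * (3 - x) \<le> 4" by (simp add: power2_eq_square algebra_simps)
  moreover have "0 \<le> x\<^sup>2 * (3 - x)" using assms by simp
  ultimately show "\<bar>bubble_primitive x\<bar> \<le> 1" unfolding e by simp
qed

lemma bubble_ends: "bubble 0 = 0" "bubble 2 = 0" "bubble_primitive 0 = 0" "bubble_primitive 2 = 1"
  by (auto simp: bubble_def bubble_primitive_def power2_eq_square power3_eq_cube)

lemma integral_bubble: "integral {0..2} bubble = 1"
proof -
  have "(bubble has_integral (bubble_primitive 2 - bubble_primitive 0)) {0..2}"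
    by (rule fundamental_theorem_of_calculus) (use deriv_bubble_primitive in
      \<open>auto simp: has_real_derivative_iff_has_vector_derivative intro: has_vector_derivative_at_within\<close>)
  then show ?thesis by (simp add: bubble_ends integral_unique)
qed

lemma cont_bubble: "continuous_on S bubble" "continuous_on S bubble'" "continuous_on S bubble_primitive"
  unfolding bubble_def[abs_def] bubble'_def[abs_def] bubble_primitive_def[abs_def] by (intro continuous_intros; simp)+

lemma C1_2_of_fst:
  assumes "\<And>x. (a has_real_derivative a' x) (at x)" "continuous_on UNIV a'"
  shows "C1_2 (\<lambda>x y. a x) (\<lambda>x y. a' x) (\<lambda>x y. 0)"
  unfolding C1_2_def using assms by (auto intro: cont2_of_fst cont2_const)

lemma C1_2_of_snd:
  assumes "\<And>x. (a has_real_derivative a' x) (at x)" "continuous_on UNIV a'"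
  shows "C1_2 (\<lambda>x y. a y) (\<lambda>x y. 0) (\<lambda>x y. a' y)"
  unfolding C1_2_def using assms by (auto intro: cont2_of_snd cont2_const)

definition zero_on_boundary :: "(real \<Rightarrow> real \<Rightarrow> real) \<Rightarrow> bool" where
  "zero_on_boundary z \<longleftrightarrow> (\<forall>t\<in>{0..2}. z 0 t = 0 \<and> z 2 t = 0 \<and> z t 0 = 0 \<and> z t 2 = 0)"

text \<open>
  The divergence equation is solved by successive integration. Let \<open>F y\<close> be the integral of \<open>f\<close> over the row at
  height \<open>y\<close>. The difference of \<open>f\<close> and \<open>bubble x * F y\<close> has mean zero on every row, so its primitive in
  \<open>x\<close> vanishes at both ends; and \<open>F\<close> has mean zero, so the primitive of \<open>bubble x * F y\<close> in \<open>y\<close> vanishes at both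
  ends. The price is the derivative \<open>fy\<close> on the right-hand side, so this alone does not treat \<open>L\<^sup>2\<close> data.
\<close>

lemma regular_divergence_solver:
  assumes f: "C1_2 f fx fy" and bd: "\<And>x. x \<in> {0..2} \<Longrightarrow> f x 0 = 0 \<and> f x 2 = 0" and mean: "dbl_int 0 2 f = 0"
  shows "\<exists>z1 z2 z1x z1y z2x z2y. C1_2 z1 z1x z1y \<and> C1_2 z2 z2x z2y \<and> zero_on_boundary z1 \<and> zero_on_boundary z2 \<and>
    (\<forall>x y. z1x x y + z2y x y = f x y) \<and>
    sqn z1x + sqn z1y + sqn z2x + sqn z2y \<le> 50 * (sqn f + sqn fy)"
proof -
  note c = C1_2_cont2[OF f] C1_2_cont[OF f]
  define F where "F = (\<lambda>y. primitive (\<lambda>s. f s y) 2)"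
  define F' where "F' = (\<lambda>y. primitive (\<lambda>s. fy s y) 2)"
  have F: "(F has_real_derivative F' y) (at y)" for y
    unfolding F_def F'_def by (rule C1_2_dy[OF C1_2_primitive[OF f]])
  have F'c: "continuous_on UNIV F'" unfolding F'_def by (rule cont2_snd[OF cont2_primitive[OF c(3)]])
  have Fc: "continuous_on UNIV F" unfolding F_def by (rule cont2_snd[OF cont2_primitive[OF c(1)]])
  have Feq: "F y = integral {0..2} (\<lambda>s. f s y)" for y
    unfolding F_def by (rule primitive_eq_integral[OF cont2_fst[OF c(1)]]) simp
  have F'eq: "F' y = integral {0..2} (\<lambda>s. fy s y)" for y
    unfolding F'_def by (rule primitive_eq_integral[OF cont2_fst[OF c(3)]]) simp
  have Bx: "C1_2 (\<lambda>x y. bubble_primitive x) (\<lambda>x y. bubble x) (\<lambda>x y. 0)" by (rule C1_2_of_fst[OF deriv_bubble_primitive cont_bubble(1)])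
  have bx: "C1_2 (\<lambda>x y. bubble x) (\<lambda>x y. bubble' x) (\<lambda>x y. 0)" by (rule C1_2_of_fst[OF deriv_bubble cont_bubble(2)])
  have FY: "C1_2 (\<lambda>x y. F y) (\<lambda>x y. 0) (\<lambda>x y. F' y)" by (rule C1_2_of_snd[OF F F'c])
  have HY: "C1_2 (\<lambda>x y. primitive F y) (\<lambda>x y. 0) (\<lambda>x y. F y)" by (rule C1_2_of_snd[OF deriv_primitive[OF Fc] Fc])
  define I where "I = (\<lambda>x y. primitive (\<lambda>s. f s y) x)"
  define Iy where "Iy = (\<lambda>x y. primitive (\<lambda>s. fy s y) x)"
  have I: "C1_2 I f Iy" unfolding I_def Iy_def by (rule C1_2_primitive[OF f])
  have z1: "C1_2 (\<lambda>x y. I x y - bubble_primitive x * F y) (\<lambda>x y. f x y - bubble x * F y) (\<lambda>x y. Iy x y - bubble_primitive x * F' y)"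
    using C1_2_diff[OF I C1_2_mult[OF Bx FY]] by simp
  have z2: "C1_2 (\<lambda>x y. bubble x * primitive F y) (\<lambda>x y. bubble' x * primitive F y) (\<lambda>x y. bubble x * F y)"
    using C1_2_mult[OF bx HY] by simp
  have Iin: "I x y = integral {0..x} (\<lambda>s. f s y)" "Iy x y = integral {0..x} (\<lambda>s. fy s y)" if "0 \<le> x" for x y
    unfolding I_def Iy_def by (rule primitive_eq_integral[OF cont2_fst that] c)+
  have H: "primitive F y = integral {0..y} F" if "0 \<le> y" for y by (rule primitive_eq_integral[OF Fc that])
  have H2: "integral {0..2} F = 0"
    using mean dbl_int_swap[OF c(1), of 0 2] by (simp add: Feq[abs_def] dbl_int_def)
  have I0: "integral {0..x} (\<lambda>s. f s y) = 0" if "y = 0 \<or> y = 2" "x \<in> {0..2}" for x y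
  proof -
    have "integral {0..x} (\<lambda>s. f s y) = integral {0..x} (\<lambda>s. 0)"
      by (rule integral_cong) (use that bd in auto)
    then show ?thesis by simp
  qed
  have "zero_on_boundary (\<lambda>x y. I x y - bubble_primitive x * F y)"
    unfolding zero_on_boundary_def by (auto simp: bubble_ends Iin I0 Feq)
  moreover have "zero_on_boundary (\<lambda>x y. bubble x * primitive F y)"
    unfolding zero_on_boundary_def by (auto simp: bubble_ends H H2)
  moreover
  have cF: "cont2 (\<lambda>x y. F y)" and cF': "cont2 (\<lambda>x y. F' y)" and cH: "cont2 (\<lambda>x y. primitive F y)"
    using C1_2_cont2[OF FY] C1_2_cont[OF FY] C1_2_cont2[OF HY] by auto
  have cb: "cont2 (\<lambda>x y. bubble x)" "cont2 (\<lambda>x y. bubble' x)" "cont2 (\<lambda>x y. bubble_primitive x)"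
    using C1_2_cont2[OF Bx] C1_2_cont[OF Bx] C1_2_cont[OF bx] by auto
  have sF: "sqn (\<lambda>x y. F y) \<le> 4 * sqn f"
    using sqn_le_slice'[OF cF c(1), of 2] integral_0x_square_le[OF cont2_fst[OF c(1)], of 2] by (simp add: Feq)
  have sF': "sqn (\<lambda>x y. F' y) \<le> 4 * sqn fy"
    using sqn_le_slice'[OF cF' c(3), of 2] integral_0x_square_le[OF cont2_fst[OF c(3)], of 2] by (simp add: F'eq)
  have sI: "sqn Iy \<le> 4 * sqn fy"
    using sqn_le_slice'[OF C1_2_cont(2)[OF I] c(3), of 2] integral_0x_square_le[OF cont2_fst[OF c(3)]] by (simp add: Iin)
  have sH: "sqn (\<lambda>x y. primitive F y) \<le> 4 * sqn (\<lambda>x y. F y)"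
    using sqn_le_slice[OF cH cF, of 2] integral_0x_square_le[OF Fc] by (simp add: H)
  have "sqn (\<lambda>x y. bubble x * F y) \<le> (3/4)\<^sup>2 * sqn (\<lambda>x y. F y)"
    by (rule sqn_mult_le[OF cb(1) cF]) (use bubble_bounds in auto)
  moreover have "sqn (\<lambda>x y. bubble' x * primitive F y) \<le> (3/2)\<^sup>2 * sqn (\<lambda>x y. primitive F y)"
    by (rule sqn_mult_le[OF cb(2) cH]) (use bubble_bounds in auto)
  moreover have "sqn (\<lambda>x y. bubble_primitive x * F' y) \<le> 1\<^sup>2 * sqn (\<lambda>x y. F' y)"
    by (rule sqn_mult_le[OF cb(3) cF']) (use bubble_bounds in auto)
  moreover have "sqn (\<lambda>x y. f x y - bubble x * F y) \<le> 2 * sqn f + 2 * sqn (\<lambda>x y. bubble x * F y)"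
    by (rule sqn_diff[OF c(1) cont2_mult[OF cb(1) cF]])
  moreover have "sqn (\<lambda>x y. Iy x y - bubble_primitive x * F' y) \<le> 2 * sqn Iy + 2 * sqn (\<lambda>x y. bubble_primitive x * F' y)"
    by (rule sqn_diff[OF C1_2_cont(2)[OF I] cont2_mult[OF cb(3) cF']])
  ultimately have "sqn (\<lambda>x y. f x y - bubble x * F y) + sqn (\<lambda>x y. Iy x y - bubble_primitive x * F' y) +
      sqn (\<lambda>x y. bubble' x * primitive F y) + sqn (\<lambda>x y. bubble x * F y) \<le> 50 * (sqn f + sqn fy)"
    using sF sF' sI sH sqn_nonneg[OF c(1)] sqn_nonneg[OF c(3)] by (simp add: power2_eq_square)
  moreover have "\<forall>x y. (f x y - bubble x * F y) + bubble x * F y = f x y" by simp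
  ultimately show ?thesis using z1 z2 \<open>zero_on_boundary (\<lambda>x y. I x y - bubble_primitive x * F y)\<close> \<open>zero_on_boundary (\<lambda>x y. bubble x * primitive F y)\<close>
    by blast
qed

section \<open>Approximate solutions of the divergence equation on a square\<close>

lemma dbl_int_square_le:
  assumes "cont2 f" "a \<le> b"
  shows "(dbl_int a b f)\<^sup>2 \<le> (b - a)\<^sup>2 * dbl_int a b (\<lambda>x y. (f x y)\<^sup>2)"
proof -
  have c: "continuous_on {a..b} (\<lambda>x. integral {a..b} (f x))"
    by (rule continuous_on_subset[OF integral_cont2_snd[OF assms(1)]]) simp
  have c2: "continuous_on {a..b} (\<lambda>x. integral {a..b} (\<lambda>y. (f x y)\<^sup>2))"
    by (rule continuous_on_subset[OF integral_cont2_snd[OF cont2_power[OF assms(1)]]]) simp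
  have "(dbl_int a b f)\<^sup>2 \<le> (b - a) * integral {a..b} (\<lambda>x. (integral {a..b} (f x))\<^sup>2)"
    unfolding dbl_int_def by (rule integral_square_le[OF c assms(2)])
  also have "\<dots> \<le> (b - a) * integral {a..b} (\<lambda>x. (b - a) * integral {a..b} (\<lambda>y. (f x y)\<^sup>2))"
  proof (intro mult_left_mono integral_le)
    show "(\<lambda>x. (integral {a..b} (f x))\<^sup>2) integrable_on {a..b}"
      by (intro integrable_continuous_real continuous_on_power c)
    show "(\<lambda>x. (b - a) * integral {a..b} (\<lambda>y. (f x y)\<^sup>2)) integrable_on {a..b}"
      by (intro integrable_continuous_real continuous_on_mult continuous_on_const c2)
    show "(integral {a..b} (f x))\<^sup>2 \<le> (b - a) * integral {a..b} (\<lambda>y. (f x y)\<^sup>2)" for x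
      by (rule integral_square_le[OF cont2_snd[OF assms(1)] assms(2)])
  qed (use assms in simp)
  finally show ?thesis by (simp add: dbl_int_def power2_eq_square mult.assoc)
qed

lemma integral_zero_outside:
  fixes g :: "real \<Rightarrow> real"
  assumes "\<And>x. x \<notin> {0..2} \<Longrightarrow> g x = 0" "a \<le> 0" "2 \<le> b"
  shows "integral {a..b} g = integral {0..2} g"
proof -
  have "integral {a..b} g = integral {a..b} (\<lambda>x. if x \<in> {0..2} then g x else 0)"
    by (rule integral_cong) (use assms in auto)
  also have "\<dots> = integral ({0..2} \<inter> {a..b}) g" by (rule integral_restrict_Int)
  also have "{0..2} \<inter> {a..b} = {0..2}" using assms by auto
  finally show ?thesis .
qed

lemma dbl_int_zero_outside:
  assumes "\<And>x y. \<not> (x \<in> {0..2} \<and> y \<in> {0..2}) \<Longrightarrow> f x y = 0"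
  shows "dbl_int (-4) 4 f = dbl_int 0 2 f"
proof -
  have 1: "integral {-4..4} (f x) = integral {0..2} (f x)" for x
    by (rule integral_zero_outside) (use assms in auto)
  have "integral {-4..4} (\<lambda>x. integral {0..2} (f x)) = integral {0..2} (\<lambda>x. integral {0..2} (f x))"
  proof (rule integral_zero_outside)
    fix x :: real assume "x \<notin> {0..2}"
    then have "f x = (\<lambda>y. 0)" using assms by auto
    then show "integral {0..2} (f x) = 0" by simp
  qed auto
  then show ?thesis by (simp add: dbl_int_def 1)
qed

text \<open>
  A function supported in \<open>[2, 4]\<close>, away from the square of interest, used to correct a mean value.
\<close>

definition ramp :: "real \<Rightarrow> real" where "ramp x = max 0 (x - 2)"

lemma ramp_props: "continuous_on S ramp" "x \<le> 2 \<Longrightarrow> ramp x = 0" "x \<in> {-4..4} \<Longrightarrow> \<bar>ramp x\<bar> \<le> 2"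
  unfolding ramp_def[abs_def] by (auto intro!: continuous_intros)

lemma integral_ramp: "integral {-4..4} ramp = 2"
proof -
  have i: "ramp integrable_on {a..b}" for a b by (intro integrable_continuous_real ramp_props)
  have "integral {-4..2} ramp = integral {-4..2} (\<lambda>x::real. 0)" by (rule integral_cong) (auto simp: ramp_props)
  moreover have "((\<lambda>x. x - 2) has_integral ((4 - 2)\<^sup>2 / 2 - (2 - 2)\<^sup>2 / 2)) {2..4::real}"
    by (rule fundamental_theorem_of_calculus)
      (auto simp: has_real_derivative_iff_has_vector_derivative[symmetric] intro!: derivative_eq_intros)
  then have "integral {2..4} (\<lambda>x::real. x - 2) = 2" by (simp add: integral_unique)
  moreover have "integral {2..4} ramp = integral {2..4} (\<lambda>x. x - 2)"
    by (rule integral_cong) (auto simp: ramp_def)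
  moreover have "integral {-4..2} ramp + integral {2..4} ramp = integral {-4..4} ramp"
    by (rule Henstock_Kurzweil_Integration.integral_combine) (auto intro: i)
  ultimately show ?thesis by simp
qed

text \<open>
  A field with vanishing values on the two axes is obtained from a Neumann solution on \<open>(-4, 4)\<^sup>2\<close> by reflection.
  Its divergence is a combination of the data at the reflected points. All of these except \<open>(x, y)\<close> itself lie where
  the data vanish, so the divergence remains \<open>q\<close> up to the approximation error. The mean value is corrected beyond
  \<open>x = 2\<close>.
\<close>

lemma corner_divergence_solver:
  assumes q: "cont2 q" "\<And>x y. \<not> (0 < x \<and> 0 < y \<and> x \<le> 2 \<and> y \<le> 2) \<Longrightarrow> q x y = 0" and "\<delta> > 0"
  shows "\<exists>w1 w2 w1x w1y w2x w2y. C1_2 w1 w1x w1y \<and> C1_2 w2 w2x w2y \<and>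
    (\<forall>t. w1 0 t = 0 \<and> w2 0 t = 0 \<and> w1 t 0 = 0 \<and> w2 t 0 = 0) \<and>
    (\<forall>x\<in>{0..2}. \<forall>y\<in>{0..2}. \<bar>w1x x y + w2y x y - q x y\<bar> \<le> 64 * \<delta>) \<and>
    (\<forall>g\<in>{w1x, w1y, w2x, w2y}. sqn g \<le> 49284 * (260 * sqn q + 128 * \<delta>\<^sup>2))"
proof -
  (* the integral of ramp over the large square is 2 * 8 = 16 *)
  define m0 where "m0 = - dbl_int (-4) 4 q / 16"
  define qt where "qt = (\<lambda>x y. q x y + m0 * ramp x)"
  have cr: "cont2 (\<lambda>x y. ramp x)" by (rule cont2_of_fst[OF ramp_props(1)])
  have cqt: "cont2 qt" unfolding qt_def by (intro cont2_intros q cr)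
  have "dbl_int (-4) 4 (\<lambda>x y. ramp x) = 16" by (simp add: dbl_int_def integral_ramp)
  then have mean: "dbl_int (-4) 4 qt = 0"
    unfolding qt_def by (subst dbl_int_add[OF q(1) cont2_mult[OF cont2_const cr]])
      (simp only: dbl_int_cmult, simp add: m0_def)
  have Q4: "dbl_int (-4) 4 (\<lambda>x y. (q x y)\<^sup>2) = sqn q"
    unfolding sqn_def by (rule dbl_int_zero_outside) (use q(2) in auto)
  have m0: "m0\<^sup>2 \<le> sqn q / 4"
    using dbl_int_square_le[OF q(1), of "-4" 4] unfolding Q4 m0_def by (simp add: power_divide)
  have "dbl_int (-4) 4 (\<lambda>x y. (ramp x)\<^sup>2) \<le> dbl_int (-4) 4 (\<lambda>x y. 4)"
    by (rule dbl_int_mono[OF cont2_power[OF cr] cont2_const])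
      (use power_mono[OF ramp_props(3), of _ 2] in auto)
  then have r2: "dbl_int (-4) 4 (\<lambda>x y. (ramp x)\<^sup>2) \<le> 256" by (simp add: dbl_int_const)
  have "dbl_int (-4) 4 (\<lambda>x y. (qt x y)\<^sup>2) \<le> dbl_int (-4) 4 (\<lambda>x y. 2 * (q x y)\<^sup>2 + 2 * m0\<^sup>2 * (ramp x)\<^sup>2)"
  proof (rule dbl_int_mono)
    show "(qt x y)\<^sup>2 \<le> 2 * (q x y)\<^sup>2 + 2 * m0\<^sup>2 * (ramp x)\<^sup>2" for x y
      using zero_le_power2[of "q x y - m0 * ramp x"]
      by (simp add: qt_def power2_eq_square algebra_simps)
  qed (intro cont2_intros cqt q cr)+
  also have "\<dots> = 2 * sqn q + 2 * m0\<^sup>2 * dbl_int (-4) 4 (\<lambda>x y. (ramp x)\<^sup>2)"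
    by (subst dbl_int_add, intro cont2_intros q, intro cont2_intros cr) (simp only: dbl_int_cmult Q4)
  also have "\<dots> \<le> 2 * sqn q + 2 * (sqn q / 4) * 256"
    by (intro add_left_mono mult_mono mult_left_mono m0 r2) (auto intro!: dbl_int_nonneg cont2_power cr sqn_nonneg q)
  finally have qt2: "dbl_int (-4) 4 (\<lambda>x y. (qt x y)\<^sup>2) \<le> 130 * sqn q" by simp
  obtain V1 V2 V1x V1y V2y where V: "neumann_gradient V1 V2 V1x V1y V2y"
    and Vq: "\<And>x y. x \<in> {-4..4} \<Longrightarrow> y \<in> {-4..4} \<Longrightarrow> \<bar>V1x x y + V2y x y - qt x y\<bar> \<le> \<delta>"
    using approx_neumann_solver[OF cqt mean \<open>\<delta> > 0\<close>] by blast
  have V1: "C1_2 V1 V1x V1y" and V2: "C1_2 V2 V1y V2y" using V unfolding neumann_gradient_def by blast+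
  note cV = C1_2_cont[OF V1] C1_2_cont[OF V2]
  define Q where "Q = (\<lambda>x y. V1x x y + V2y x y)"
  have cQ: "cont2 Q" unfolding Q_def by (intro cont2_intros cV)
  have "dbl_int (-4) 4 (\<lambda>x y. (Q x y)\<^sup>2) \<le> dbl_int (-4) 4 (\<lambda>x y. 2 * (qt x y)\<^sup>2 + 2 * \<delta>\<^sup>2)"
  proof (rule dbl_int_mono)
    show "(Q x y)\<^sup>2 \<le> 2 * (qt x y)\<^sup>2 + 2 * \<delta>\<^sup>2" if "x \<in> {-4..4}" "y \<in> {-4..4}" for x y
    proof -
      have "(Q x y - qt x y)\<^sup>2 \<le> \<delta>\<^sup>2" using power_mono[OF Vq[OF that], of 2] by (simp add: Q_def)
      then show ?thesis using zero_le_power2[of "Q x y - 2 * qt x y"]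
        by (simp add: power2_eq_square algebra_simps)
    qed
  qed (intro cont2_intros cqt cQ)+
  also have "\<dots> = 2 * dbl_int (-4) 4 (\<lambda>x y. (qt x y)\<^sup>2) + 128 * \<delta>\<^sup>2"
    by (subst dbl_int_add, intro cont2_intros cqt, intro cont2_intros) (simp add: dbl_int_cmult dbl_int_const)
  finally have Q2: "dbl_int (-4) 4 (\<lambda>x y. (Q x y)\<^sup>2) \<le> 260 * sqn q + 128 * \<delta>\<^sup>2" using qt2 by simp
  have VQ: "dbl_int (-4) 4 (\<lambda>x y. (g x y)\<^sup>2) \<le> 260 * sqn q + 128 * \<delta>\<^sup>2" if "g \<in> {V1x, V1y, V2y}" for g
  proof -
    have "dbl_int (-4) 4 (\<lambda>x y. (g x y)\<^sup>2) \<le> dbl_int (-4) 4 (\<lambda>x y. (V1x x y)\<^sup>2 + 2 * (V1y x y)\<^sup>2 + (V2y x y)\<^sup>2)"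
    proof (rule dbl_int_mono)
      show "cont2 (\<lambda>x y. (g x y)\<^sup>2)" using that cV by (auto intro: cont2_power)
    qed (intro cont2_intros cV | use that in auto)+
    then show ?thesis unfolding neumann_gradient_energy[OF V] using Q2 by (simp add: Q_def)
  qed
  (* V1 vanishes on x = 0 after (1, -3, 2) in x, V2 after (1, 3, -4);
     the combinations in y are exchanged, so both derivatives in the divergence get (1, 3, -4) twice *)
  define w1 where "w1 = refl_x (-3) 2 (refl_y 3 (-4) V1)"
  define w2 where "w2 = refl_x 3 (-4) (refl_y (-3) 2 V2)"
  define w1x where "w1x = refl_x 3 (-4) (refl_y 3 (-4) V1x)"
  define w1y where "w1y = refl_x (-3) 2 (refl_y (-3) 8 V1y)"
  define w2x where "w2x = refl_x (-3) 8 (refl_y (-3) 2 V1y)"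
  define w2y where "w2y = refl_x 3 (-4) (refl_y 3 (-4) V2y)"
  have w1: "C1_2 w1 w1x w1y" and w2: "C1_2 w2 w2x w2y"
    using C1_2_refl_x[OF C1_2_refl_y[OF V1, of 3 "-4"], of "-3" 2] C1_2_refl_x[OF C1_2_refl_y[OF V2, of "-3" 2], of 3 "-4"]
    unfolding w1_def w1x_def w1y_def w2_def w2x_def w2y_def by simp_all
  have zero: "\<forall>t. w1 0 t = 0 \<and> w2 0 t = 0 \<and> w1 t 0 = 0 \<and> w2 t 0 = 0"
    unfolding w1_def w2_def refl_x_def refl_y_def by simp
  have div: "\<bar>w1x x y + w2y x y - q x y\<bar> \<le> 64 * \<delta>" if xy: "x \<in> {0..2}" "y \<in> {0..2}" for x y
  proof -
    define D where "D = (\<lambda>x y. Q x y - qt x y)"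
    have e: "w1x x y + w2y x y = refl_x 3 (-4) (refl_y 3 (-4) Q) x y"
      unfolding w1x_def w2y_def refl_x_def refl_y_def Q_def by (simp add: algebra_simps)
    have q0: "qt a b = 0" if "a \<le> 0 \<or> b \<le> 0" "a \<le> 2" for a b
      unfolding qt_def using that q(2) ramp_props(2) by auto
    have "qt x y = q x y" unfolding qt_def using xy ramp_props(2) by simp
    moreover have "qt (-x) y = 0" "qt (-2*x) y = 0" "qt x (-y) = 0" "qt x (-2*y) = 0"
       "qt (-x) (-y) = 0" "qt (-x) (-2*y) = 0" "qt (-2*x) (-y) = 0" "qt (-2*x) (-2*y) = 0"
      by (rule q0; use xy in auto)+
    ultimately have e2: "q x y = refl_x 3 (-4) (refl_y 3 (-4) qt) x y"
      unfolding refl_x_def refl_y_def by simp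
    have D: "\<bar>D a b\<bar> \<le> \<delta>" if "a \<in> {x, -x, -2*x}" "b \<in> {y, -y, -2*y}" for a b
      unfolding D_def Q_def by (rule Vq) (use that xy in auto)
    have row: "\<bar>a + 3 * b - 4 * c\<bar> \<le> 8 * d" if "\<bar>a\<bar> \<le> d" "\<bar>b\<bar> \<le> d" "\<bar>c\<bar> \<le> d" for a b c d :: real
      using that by linarith
    define R where "R = (\<lambda>a. D a y + 3 * D a (-y) - 4 * D a (-2*y))"
    have R: "\<bar>R a\<bar> \<le> 8 * \<delta>" if "a \<in> {x, -x, -2*x}" for a
      unfolding R_def by (rule row; rule D[OF that]; simp)
    have "w1x x y + w2y x y - q x y = R x + 3 * R (-x) - 4 * R (-2*x)"
      unfolding e e2 refl_x_def refl_y_def D_def R_def by (simp add: algebra_simps)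
    then show ?thesis using row[OF R R R, of x "-x" "-2*x"] by simp
  qed
  have bnd: "sqn g \<le> 49284 * (260 * sqn q + 128 * \<delta>\<^sup>2)" if "g \<in> {w1x, w1y, w2x, w2y}" for g
  proof -
    have r: "sqn (refl_x \<alpha> \<beta> (refl_y \<alpha>' \<beta>' h)) \<le> 49284 * (260 * sqn q + 128 * \<delta>\<^sup>2)"
      if "h \<in> {V1x, V1y, V2y}" "1 + \<alpha>\<^sup>2 + \<beta>\<^sup>2 \<le> 74" "1 + \<alpha>'\<^sup>2 + \<beta>'\<^sup>2 \<le> 74" for h \<alpha> \<beta> \<alpha>' \<beta>'
      using reflection_bound[of h \<alpha> \<beta> \<alpha>' \<beta>'] that(2,3) VQ[OF that(1)] that(1) cV unfolding sqn_def by fastforce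
    show ?thesis
      using that unfolding w1x_def w1y_def w2x_def w2y_def by (elim insertE emptyE; simp only:) (rule r; simp)+
  qed
  from w1 w2 zero div bnd show ?thesis by blast
qed

text \<open>
  It vanishes together with its first derivatives on the two sides of \<open>(0, 2)\<^sup>2\<close> that do not lie on the axes.
\<close>

definition cutoff :: "real \<Rightarrow> real \<Rightarrow> real" where "cutoff x y = (2 - x)\<^sup>2 * (2 - y)\<^sup>2"
definition cutoff_x :: "real \<Rightarrow> real \<Rightarrow> real" where "cutoff_x x y = - 2 * (2 - x) * (2 - y)\<^sup>2"
definition cutoff_y :: "real \<Rightarrow> real \<Rightarrow> real" where "cutoff_y x y = - 2 * (2 - x)\<^sup>2 * (2 - y)"

lemma C1_2_cutoff: "C1_2 cutoff cutoff_x cutoff_y"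
  "C1_2 cutoff_x (\<lambda>x y. 2 * (2 - y)\<^sup>2) (\<lambda>x y. 4 * (2 - x) * (2 - y))"
  "C1_2 cutoff_y (\<lambda>x y. 4 * (2 - x) * (2 - y)) (\<lambda>x y. 2 * (2 - x)\<^sup>2)"
  unfolding C1_2_def cutoff_def[abs_def] cutoff_x_def[abs_def] cutoff_y_def[abs_def] cont2_def
  by (auto intro!: derivative_eq_intros continuous_intros simp: algebra_simps)

lemma cutoff_bounds:
  assumes "x \<in> {0..2}" "y \<in> {0..2}"
  shows "\<bar>cutoff x y\<bar> \<le> 16" "\<bar>cutoff_x x y\<bar> \<le> 16" "\<bar>cutoff_y x y\<bar> \<le> 16" "\<bar>2 * (2 - y)\<^sup>2\<bar> \<le> 16"
    "\<bar>2 * (2 - x)\<^sup>2\<bar> \<le> 16" "\<bar>4 * (2 - x) * (2 - y)\<bar> \<le> 16"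
proof -
  define a b where "a = 2 - x" and "b = 2 - y"
  have a: "0 \<le> a" "a \<le> 2" "0 \<le> b" "b \<le> 2" using assms by (auto simp: a_def b_def)
  have sq: "a\<^sup>2 \<le> 4" "b\<^sup>2 \<le> 4" using power_mono[OF a(2,1), of 2] power_mono[OF a(4,3), of 2] by auto
  have "a\<^sup>2 * b\<^sup>2 \<le> 4 * 4" "a * b\<^sup>2 \<le> 2 * 4" "a\<^sup>2 * b \<le> 4 * 2" "a * b \<le> 2 * 2"
    by (intro mult_mono; use a sq in auto)+
  moreover have "0 \<le> a\<^sup>2 * b\<^sup>2" "0 \<le> a * b\<^sup>2" "0 \<le> a\<^sup>2 * b" "0 \<le> a * b" using a by auto
  ultimately show "\<bar>cutoff x y\<bar> \<le> 16" "\<bar>cutoff_x x y\<bar> \<le> 16" "\<bar>cutoff_y x y\<bar> \<le> 16" "\<bar>2 * (2 - y)\<^sup>2\<bar> \<le> 16"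
    "\<bar>2 * (2 - x)\<^sup>2\<bar> \<le> 16" "\<bar>4 * (2 - x) * (2 - y)\<bar> \<le> 16"
    using sq unfolding cutoff_def cutoff_x_def cutoff_y_def a_def[symmetric] b_def[symmetric]
    by (auto simp: abs_le_iff mult.assoc mult.commute[of b])
qed

text \<open>
  The field \<open>w\<close> from the corner construction vanishes on the axes only. After multiplication by a cutoff it vanishes
  on all four sides, and its divergence is the cutoff times \<open>div w\<close> plus the scalar product of \<open>w\<close> with the gradient of the
  cutoff. The first part is right if the data are divided by the cutoff beforehand, which is possible because they live on
  \<open>(0, 1)\<^sup>2\<close>. The second part \<open>f\<close> is differentiable with derivatives bounded by those of \<open>w\<close>, so
  \<open>regular_divergence_solver\<close> removes it.
\<close>

lemma square_divergence_solver:
  assumes q: "cont2 q" "\<And>x y. \<not> (0 < x \<and> x < 1 \<and> 0 < y \<and> y < 1) \<Longrightarrow> q x y = 0"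
    and mean: "dbl_int 0 2 q = 0" and "\<epsilon> > 0"
  shows "\<exists>v1 v2 v1x v1y v2x v2y. C1_2 v1 v1x v1y \<and> C1_2 v2 v2x v2y \<and> zero_on_boundary v1 \<and> zero_on_boundary v2 \<and>
    (\<forall>x\<in>{0..2}. \<forall>y\<in>{0..2}. \<bar>v1x x y + v2y x y - q x y\<bar> \<le> \<epsilon>) \<and>
    sqn v1x + sqn v1y + sqn v2x + sqn v2y \<le> 10^14 * (sqn q + \<epsilon>\<^sup>2)"
proof -
  define \<delta> where "\<delta> = \<epsilon> / 8000"
  have \<delta>: "\<delta> > 0" using \<open>\<epsilon> > 0\<close> by (simp add: \<delta>_def)
  (* equal to the cutoff on the unit square and at least 1 everywhere *)
  define d where "d = (\<lambda>x y::real. (max 1 (2 - x))\<^sup>2 * (max 1 (2 - y))\<^sup>2)"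
  have d1: "1 \<le> d x y" for x y
    unfolding d_def using mult_mono[of 1 "(max 1 (2 - x))\<^sup>2" 1 "(max 1 (2 - y))\<^sup>2"] by (simp add: one_le_power)
  have dn: "d x y \<noteq> 0" for x y using d1[of x y] by auto
  define qh where "qh = (\<lambda>x y. q x y / d x y)"
  have "cont2 d" unfolding d_def cont2_def by (intro continuous_intros)
  then have cqh: "cont2 qh" unfolding qh_def cont2_def
    using q(1)[unfolded cont2_def] dn by (intro continuous_intros) auto
  have qh0: "qh x y = 0" if "\<not> (0 < x \<and> x < 1 \<and> 0 < y \<and> y < 1)" for x y
    using q(2)[OF that] by (simp add: qh_def)
  have cutoff_qh: "cutoff x y * qh x y = q x y" for x y
  proof (cases "0 < x \<and> x < 1 \<and> 0 < y \<and> y < 1")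
    case True
    then have "cutoff x y = d x y" by (simp add: cutoff_def d_def)
    then show ?thesis using d1[of x y] by (simp add: qh_def)
  qed (simp add: q(2) qh0)
  have sqh: "sqn qh \<le> sqn q"
    unfolding sqn_def
  proof (rule dbl_int_mono)
    show "(qh x y)\<^sup>2 \<le> (q x y)\<^sup>2" for x y
    proof -
      have "\<bar>qh x y\<bar> \<le> \<bar>q x y\<bar> / 1" unfolding qh_def abs_divide
        by (rule divide_left_mono) (use d1[of x y] in auto)
      then show ?thesis by (simp add: abs_le_square_iff)
    qed
  qed (intro cont2_power cqh q)+
  obtain w1 w2 w1x w1y w2x w2y where w: "C1_2 w1 w1x w1y" "C1_2 w2 w2x w2y"
    and w0: "\<And>t. w1 0 t = 0" "\<And>t. w2 0 t = 0" "\<And>t. w1 t 0 = 0" "\<And>t. w2 t 0 = 0"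
    and wd: "\<And>x y. x \<in> {0..2} \<Longrightarrow> y \<in> {0..2} \<Longrightarrow> \<bar>w1x x y + w2y x y - qh x y\<bar> \<le> 64 * \<delta>"
    and wb: "\<And>g. g \<in> {w1x, w1y, w2x, w2y} \<Longrightarrow> sqn g \<le> 49284 * (260 * sqn qh + 128 * \<delta>\<^sup>2)"
    using corner_divergence_solver[OF cqh _ \<delta>] qh0 by (smt (verit))
  define G where "G = 49284 * (260 * sqn q + 128 * \<delta>\<^sup>2)"
  have bG: "sqn w1x \<le> G" "sqn w1y \<le> G" "sqn w2x \<le> G" "sqn w2y \<le> G"
    using wb[of w1x] wb[of w1y] wb[of w2x] wb[of w2y] sqh unfolding G_def by simp_all
  have bw: "sqn w1 \<le> 4 * G" "sqn w2 \<le> 4 * G"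
    using poincare_x[OF w(1) w0(1)] poincare_x[OF w(2) w0(2)] bG by simp_all
  note cw = C1_2_cont2[OF w(1)] C1_2_cont2[OF w(2)] C1_2_cont[OF w(1)] C1_2_cont[OF w(2)]
  note cc = C1_2_cont2[OF C1_2_cutoff(1)] C1_2_cont[OF C1_2_cutoff(1)] C1_2_cont[OF C1_2_cutoff(2)] C1_2_cont[OF C1_2_cutoff(3)]
  have two_term: "sqn (\<lambda>x y. a x y * h x y + b x y * k x y) \<le> 512 * sqn h + 512 * sqn k"
    if "cont2 a" "cont2 h" "cont2 b" "cont2 k"
      "\<And>x y. x \<in> {0..2} \<Longrightarrow> y \<in> {0..2} \<Longrightarrow> \<bar>a x y\<bar> \<le> 16" "\<And>x y. x \<in> {0..2} \<Longrightarrow> y \<in> {0..2} \<Longrightarrow> \<bar>b x y\<bar> \<le> 16"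
    for a h b k
    using sqn_add[OF cont2_mult[OF that(1,2)] cont2_mult[OF that(3,4)]]
      sqn_mult_le[OF that(1,2,5)] sqn_mult_le[OF that(3,4,6)] by simp
  define f where "f = (\<lambda>x y. cutoff_x x y * w1 x y + cutoff_y x y * w2 x y)"
  define fx where "fx = (\<lambda>x y. (2 * (2 - y)\<^sup>2 * w1 x y + cutoff_x x y * w1x x y) + (4 * (2 - x) * (2 - y) * w2 x y + cutoff_y x y * w2x x y))"
  define fy where "fy = (\<lambda>x y. (4 * (2 - x) * (2 - y) * w1 x y + cutoff_x x y * w1y x y) + (2 * (2 - x)\<^sup>2 * w2 x y + cutoff_y x y * w2y x y))"
  have f: "C1_2 f fx fy" unfolding f_def fx_def fy_def
    by (rule C1_2_add[OF C1_2_mult[OF C1_2_cutoff(2) w(1)] C1_2_mult[OF C1_2_cutoff(3) w(2)]])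
  have sf: "sqn f \<le> 4096 * G"
    unfolding f_def using two_term[OF cc(2) cw(1) cc(3) cw(2) cutoff_bounds(2) cutoff_bounds(3)] bw by simp
  have sfy: "sqn fy \<le> 10240 * G"
  proof -
    have "sqn (\<lambda>x y. 4 * (2 - x) * (2 - y) * w1 x y + cutoff_x x y * w1y x y) \<le> 512 * sqn w1 + 512 * sqn w1y"
      by (rule two_term) (use cc cw cutoff_bounds in auto)
    moreover have "sqn (\<lambda>x y. 2 * (2 - x)\<^sup>2 * w2 x y + cutoff_y x y * w2y x y) \<le> 512 * sqn w2 + 512 * sqn w2y"
      by (rule two_term) (use cc cw cutoff_bounds in auto)
    moreover have "sqn fy \<le> 2 * sqn (\<lambda>x y. 4 * (2 - x) * (2 - y) * w1 x y + cutoff_x x y * w1y x y) +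
        2 * sqn (\<lambda>x y. 2 * (2 - x)\<^sup>2 * w2 x y + cutoff_y x y * w2y x y)"
      unfolding fy_def by (rule sqn_add) (intro cont2_add cont2_mult cw cc)+
    ultimately show ?thesis using bw bG by simp
  qed
  define g1x where "g1x = (\<lambda>x y. cutoff_x x y * w1 x y + cutoff x y * w1x x y)"
  define g1y where "g1y = (\<lambda>x y. cutoff_y x y * w1 x y + cutoff x y * w1y x y)"
  define g2x where "g2x = (\<lambda>x y. cutoff_x x y * w2 x y + cutoff x y * w2x x y)"
  define g2y where "g2y = (\<lambda>x y. cutoff_y x y * w2 x y + cutoff x y * w2y x y)"
  have g1: "C1_2 (\<lambda>x y. cutoff x y * w1 x y) g1x g1y" unfolding g1x_def g1y_def by (rule C1_2_mult[OF C1_2_cutoff(1) w(1)])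
  have g2: "C1_2 (\<lambda>x y. cutoff x y * w2 x y) g2x g2y" unfolding g2x_def g2y_def by (rule C1_2_mult[OF C1_2_cutoff(1) w(2)])
  have "sqn g1x \<le> 512 * sqn w1 + 512 * sqn w1x" "sqn g1y \<le> 512 * sqn w1 + 512 * sqn w1y"
     "sqn g2x \<le> 512 * sqn w2 + 512 * sqn w2x" "sqn g2y \<le> 512 * sqn w2 + 512 * sqn w2y"
    unfolding g1x_def g1y_def g2x_def g2y_def by (rule two_term; use cc cw cutoff_bounds in auto)+
  then have sg: "sqn g1x \<le> 2560 * G" "sqn g1y \<le> 2560 * G" "sqn g2x \<le> 2560 * G" "sqn g2y \<le> 2560 * G"
    using bw bG by simp_all
  note cg = C1_2_cont[OF g1] C1_2_cont[OF g2]
  have cutoff0: "cutoff 2 y = 0" "cutoff x 2 = 0" "cutoff_x x 2 = 0" "cutoff_y x 2 = 0" for x y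
    by (simp_all add: cutoff_def cutoff_x_def cutoff_y_def)
  define E where "E = (\<lambda>x y. cutoff x y * (w1x x y + w2y x y))"
  have cE: "cont2 E" unfolding E_def by (intro cont2_intros cc cw)
  have Eq: "\<bar>E x y - q x y\<bar> \<le> 1024 * \<delta>" if "x \<in> {0..2}" "y \<in> {0..2}" for x y
  proof -
    have "E x y - q x y = cutoff x y * (w1x x y + w2y x y - qh x y)"
      by (simp add: E_def cutoff_qh right_diff_distrib)
    then have "\<bar>E x y - q x y\<bar> = \<bar>cutoff x y\<bar> * \<bar>w1x x y + w2y x y - qh x y\<bar>" by (simp add: abs_mult)
    also have "\<dots> \<le> 16 * (64 * \<delta>)" by (rule mult_mono) (use cutoff_bounds(1)[OF that] wd[OF that] in auto)
    finally show ?thesis by simp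
  qed
  (* f has almost mean zero, by the divergence theorem and the mean of q; a bubble corrects the rest *)
  define m where "m = dbl_int 0 2 f"
  have "dbl_int 0 2 g1x = 0"
    by (rule dbl_int_dx_zero[where A = "\<lambda>x y. cutoff x y * w1 x y"]) (use C1_2_dx[OF g1] cg w0 cutoff0 in auto)
  moreover have "dbl_int 0 2 g2y = 0"
    by (rule dbl_int_dy_zero[where A = "\<lambda>x y. cutoff x y * w2 x y"]) (use C1_2_dy[OF g2] cg w0 cutoff0 in auto)
  moreover have fe: "f x y = (g1x x y + g2y x y) - E x y" for x y
    by (simp add: f_def g1x_def g2y_def E_def algebra_simps)
  ultimately have "m = - dbl_int 0 2 E"
    unfolding m_def fe[abs_def] by (simp add: dbl_int_diff[OF cont2_add cE] dbl_int_add cg)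
  also have "\<dots> = - dbl_int 0 2 (\<lambda>x y. E x y - q x y)"
    using mean by (simp add: dbl_int_diff[OF cE q(1)])
  finally have m: "m = - dbl_int 0 2 (\<lambda>x y. E x y - q x y)" .
  have m2: "m\<^sup>2 \<le> (4096 * \<delta>)\<^sup>2"
  proof -
    have "m\<^sup>2 \<le> 4 * sqn (\<lambda>x y. E x y - q x y)"
      using dbl_int_square_le[OF cont2_diff[OF cE q(1)], of 0 2] unfolding m sqn_def by simp
    also have "\<dots> \<le> 4 * (4 * (1024 * \<delta>)\<^sup>2)"
      using sqn_bounded[OF cont2_diff[OF cE q(1)] Eq] by simp
    finally show ?thesis by (simp add: power2_eq_square)
  qed
  then have "\<bar>m\<bar>\<^sup>2 \<le> (4096 * \<delta>)\<^sup>2" by (simp only: power2_abs)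
  then have ma: "\<bar>m\<bar> \<le> 4096 * \<delta>" by (rule power2_le_imp_le) (use \<delta> in simp)
  have bb: "C1_2 (\<lambda>x y. bubble x * bubble y) (\<lambda>x y. bubble' x * bubble y) (\<lambda>x y. bubble x * bubble' y)"
    using C1_2_mult[OF C1_2_of_fst[OF deriv_bubble cont_bubble(2)] C1_2_of_snd[OF deriv_bubble cont_bubble(2)]] by simp
  have bbb: "\<bar>bubble x * bubble y\<bar> \<le> 1" "\<bar>bubble x * bubble' y\<bar> \<le> 2" if "x \<in> {0..2}" "y \<in> {0..2}" for x y
    using mult_mono[OF bubble_bounds(1)[OF that(1)] bubble_bounds(1)[OF that(2)]]
      mult_mono[OF bubble_bounds(1)[OF that(1)] bubble_bounds(2)[OF that(2)]] by (auto simp: abs_mult)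
  define f' where "f' = (\<lambda>x y. f x y - m * (bubble x * bubble y))"
  define fy' where "fy' = (\<lambda>x y. fy x y - m * (bubble x * bubble' y))"
  have f': "C1_2 f' (\<lambda>x y. fx x y - m * (bubble' x * bubble y)) fy'"
    unfolding f'_def fy'_def by (rule C1_2_diff[OF f C1_2_cmult[OF bb]])
  have b1: "dbl_int 0 2 (\<lambda>x y. bubble x * bubble y) = 1" by (simp add: dbl_int_def integral_bubble)
  have "dbl_int 0 2 (\<lambda>x y. m * (bubble x * bubble y)) = m"
    unfolding dbl_int_cmult[of 0 2 m "\<lambda>x y. bubble x * bubble y"] b1 by simp
  then have "dbl_int 0 2 f' = 0"
    unfolding f'_def dbl_int_diff[OF C1_2_cont2[OF f] cont2_mult[OF cont2_const C1_2_cont2[OF bb]]]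
    by (simp add: m_def)
  from regular_divergence_solver[OF f' _ this] obtain z1 z2 z1x z1y z2x z2y where
    z: "C1_2 z1 z1x z1y" "C1_2 z2 z2x z2y" "zero_on_boundary z1" "zero_on_boundary z2"
    and zd: "\<And>x y. z1x x y + z2y x y = f' x y"
    and zb: "sqn z1x + sqn z1y + sqn z2x + sqn z2y \<le> 50 * (sqn f' + sqn fy')"
    by (auto simp: f'_def f_def w0 cutoff0 bubble_ends)
  have sm: "sqn (\<lambda>x y. m * (bubble x * bubble y)) \<le> m\<^sup>2 * 4" "sqn (\<lambda>x y. m * (bubble x * bubble' y)) \<le> m\<^sup>2 * 16"
  proof -
    have "sqn (\<lambda>x y. bubble x * bubble y) \<le> 4 * 1\<^sup>2" by (rule sqn_bounded[OF C1_2_cont2[OF bb] bbb(1)])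
    moreover have "sqn (\<lambda>x y. bubble x * bubble' y) \<le> 4 * 2\<^sup>2" by (rule sqn_bounded[OF C1_2_cont(2)[OF bb] bbb(2)])
    ultimately show "sqn (\<lambda>x y. m * (bubble x * bubble y)) \<le> m\<^sup>2 * 4" "sqn (\<lambda>x y. m * (bubble x * bubble' y)) \<le> m\<^sup>2 * 16"
      unfolding sqn_def power_mult_distrib[of m] dbl_int_cmult by (auto intro!: mult_left_mono)
  qed
  have a1: "sqn f' \<le> 2 * sqn f + 2 * sqn (\<lambda>x y. m * (bubble x * bubble y))"
    unfolding f'_def by (rule sqn_diff[OF C1_2_cont2[OF f] cont2_mult[OF cont2_const C1_2_cont2[OF bb]]])
  have a2: "sqn fy' \<le> 2 * sqn fy + 2 * sqn (\<lambda>x y. m * (bubble x * bubble' y))"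
    unfolding fy'_def by (rule sqn_diff[OF C1_2_cont(2)[OF f] cont2_mult[OF cont2_const C1_2_cont(2)[OF bb]]])
  define M where "M = (4096 * \<delta>)\<^sup>2"
  have m2': "m\<^sup>2 \<le> M" using m2 by (simp only: M_def)
  have "sqn f' \<le> 8192 * G + 8 * M" using a1 sm(1) sf m2' by linarith
  moreover have "sqn fy' \<le> 20480 * G + 32 * M" using a2 sm(2) sfy m2' by linarith
  ultimately have zb': "sqn z1x + sqn z1y + sqn z2x + sqn z2y \<le> 50 * (28672 * G + 40 * M)"
  proof -
    assume "sqn f' \<le> 8192 * G + 8 * M" "sqn fy' \<le> 20480 * G + 32 * M"
    then have "sqn f' + sqn fy' \<le> 28672 * G + 40 * M" by simp
    then have "50 * (sqn f' + sqn fy') \<le> 50 * (28672 * G + 40 * M)" by (rule mult_left_mono) simp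
    with zb show ?thesis by (rule order_trans)
  qed
  define v1 v2 where "v1 = (\<lambda>x y. cutoff x y * w1 x y - z1 x y)" and "v2 = (\<lambda>x y. cutoff x y * w2 x y - z2 x y)"
  define v1x v1y v2x v2y where "v1x = (\<lambda>x y. g1x x y - z1x x y)" and "v1y = (\<lambda>x y. g1y x y - z1y x y)"
    and "v2x = (\<lambda>x y. g2x x y - z2x x y)" and "v2y = (\<lambda>x y. g2y x y - z2y x y)"
  have v1: "C1_2 v1 v1x v1y" unfolding v1_def v1x_def v1y_def by (rule C1_2_diff[OF g1 z(1)])
  have v2: "C1_2 v2 v2x v2y" unfolding v2_def v2x_def v2y_def by (rule C1_2_diff[OF g2 z(2)])
  have v0: "zero_on_boundary v1" "zero_on_boundary v2"
    using z(3,4) unfolding zero_on_boundary_def v1_def v2_def by (auto simp: w0 cutoff0)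
  note cz = C1_2_cont[OF z(1)] C1_2_cont[OF z(2)]
  have "sqn v1x \<le> 2 * sqn g1x + 2 * sqn z1x" "sqn v1y \<le> 2 * sqn g1y + 2 * sqn z1y"
    "sqn v2x \<le> 2 * sqn g2x + 2 * sqn z2x" "sqn v2y \<le> 2 * sqn g2y + 2 * sqn z2y"
    unfolding v1x_def v1y_def v2x_def v2y_def by (rule sqn_diff; rule cg cz)+
  then have "sqn v1x + sqn v1y + sqn v2x + sqn v2y \<le> 20480 * G + 100 * (28672 * G + 40 * M)"
    using zb' sg by linarith
  also have "\<dots> \<le> 10^14 * (sqn q + \<epsilon>\<^sup>2)"
    using sqn_nonneg[OF q(1)] unfolding G_def M_def \<delta>_def by (simp add: power_mult_distrib power_divide)
  finally have vb: "sqn v1x + sqn v1y + sqn v2x + sqn v2y \<le> 10^14 * (sqn q + \<epsilon>\<^sup>2)" .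
  have "\<bar>v1x x y + v2y x y - q x y\<bar> \<le> \<epsilon>" if "x \<in> {0..2}" "y \<in> {0..2}" for x y
  proof -
    have "v1x x y + v2y x y - q x y = (E x y - q x y) + m * (bubble x * bubble y)"
      using zd[of x y] fe[of x y] unfolding v1x_def v2y_def f'_def by (simp add: algebra_simps)
    moreover have "\<bar>m * (bubble x * bubble y)\<bar> \<le> (4096 * \<delta>) * 1"
      unfolding abs_mult[of m] by (rule mult_mono) (use ma bbb(1)[OF that] \<delta> in auto)
    ultimately have "\<bar>v1x x y + v2y x y - q x y\<bar> \<le> 1024 * \<delta> + 4096 * \<delta>"
      using abs_triangle_ineq[of "E x y - q x y" "m * (bubble x * bubble y)"] Eq[OF that] by simp
    also have "\<dots> \<le> \<epsilon>" using \<open>\<epsilon> > 0\<close> by (simp add: \<delta>_def)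
    finally show ?thesis .
  qed
  with v1 v2 v0 vb show ?thesis by blast
qed

section \<open>Square-integrable functions\<close>

lemma square_integrable_measurable: "square_integrable S f \<Longrightarrow> f \<in> borel_measurable (lebesgue_on S)"
  and square_integrable_integrable: "square_integrable S f \<Longrightarrow> integrable (lebesgue_on S) (\<lambda>x. (norm (f x))\<^sup>2)"
  by (auto simp: square_integrable_def)

lemma square_integrable_inner_integrable:
  assumes f: "square_integrable S f" and g: "square_integrable S g"
  shows "integrable (lebesgue_on S) (\<lambda>x. f x \<bullet> g x)"
proof (rule Bochner_Integration.integrable_bound)
  show "integrable (lebesgue_on S) (\<lambda>x. (norm (f x))\<^sup>2 + (norm (g x))\<^sup>2)"
    using f g by (intro Bochner_Integration.integrable_add square_integrable_integrable)
  show "(\<lambda>x. f x \<bullet> g x) \<in> borel_measurable (lebesgue_on S)"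
    using f g by (intro borel_measurable_inner square_integrable_measurable)
  have "\<bar>f x \<bullet> g x\<bar> \<le> (norm (f x))\<^sup>2 + (norm (g x))\<^sup>2" for x
  proof -
    have "\<bar>f x \<bullet> g x\<bar> \<le> norm (f x) * norm (g x)" by (rule Cauchy_Schwarz_ineq2)
    moreover have "0 \<le> (norm (f x) - norm (g x))\<^sup>2" by simp
    moreover have "0 \<le> norm (f x) * norm (g x)" by simp
    ultimately show ?thesis by (simp only: power2_diff)
  qed
  then show "AE x in lebesgue_on S. norm (f x \<bullet> g x) \<le> norm ((norm (f x))\<^sup>2 + (norm (g x))\<^sup>2)"
    by simp
qed

lemma square_integrable_bound:
  assumes "square_integrable S f" "g \<in> borel_measurable (lebesgue_on S)"
    "AE x in lebesgue_on S. norm (g x) \<le> norm (f x)"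
  shows "square_integrable S g"
  unfolding square_integrable_def
proof (intro conjI assms(2))
  show "integrable (lebesgue_on S) (\<lambda>x. (norm (g x))\<^sup>2)"
  proof (rule Bochner_Integration.integrable_bound[OF square_integrable_integrable[OF assms(1)]])
    show "(\<lambda>x. (norm (g x))\<^sup>2) \<in> borel_measurable (lebesgue_on S)"
      using assms(2) by measurable
    show "AE x in lebesgue_on S. norm ((norm (g x))\<^sup>2) \<le> norm ((norm (f x))\<^sup>2)"
      using assms(3) by eventually_elim (auto intro: power_mono)
  qed
qed

lemma square_integrable_scaleR:
  assumes "square_integrable S f" shows "square_integrable S (\<lambda>x. c *\<^sub>R f x)"
  using assms unfolding square_integrable_def
  by (auto simp: power_mult_distrib intro!: borel_measurable_scaleR)

lemma square_integrable_add:
  fixes f g :: "real^2 \<Rightarrow> 'b::euclidean_space"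
  assumes f: "square_integrable S f" and g: "square_integrable S g"
  shows "square_integrable S (\<lambda>x. f x + g x)"
  unfolding square_integrable_def
proof
  show "(\<lambda>x. f x + g x) \<in> borel_measurable (lebesgue_on S)"
    using f g by (intro borel_measurable_add square_integrable_measurable)
  have "(\<lambda>x. (norm (f x + g x))\<^sup>2) = (\<lambda>x. (norm (f x))\<^sup>2 + (2 * (f x \<bullet> g x) + (norm (g x))\<^sup>2))"
    by (auto simp: power2_norm_eq_inner inner_add inner_commute)
  then show "integrable (lebesgue_on S) (\<lambda>x. (norm (f x + g x))\<^sup>2)"
    using square_integrable_integrable[OF f] square_integrable_integrable[OF g] square_integrable_inner_integrable[OF f g]
    by (simp add: Bochner_Integration.integrable_add integrable_mult_right)
qed

lemma square_integrable_mult: "square_integrable S f \<Longrightarrow> square_integrable S (\<lambda>x. c * f x)" for f :: "_ \<Rightarrow> real"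
  using square_integrable_scaleR[of S f c] by simp

lemma square_integrable_minus: "square_integrable S f \<Longrightarrow> square_integrable S (\<lambda>x. - f x)"
  using square_integrable_scaleR[of S f "-1"] by simp

lemma square_integrable_diff:
  fixes f g :: "real^2 \<Rightarrow> 'b::euclidean_space"
  assumes f: "square_integrable S f" and g: "square_integrable S g"
  shows "square_integrable S (\<lambda>x. f x - g x)"
  using square_integrable_add[OF f square_integrable_minus[OF g]] by simp

lemma square_integrable_zero: "square_integrable S (\<lambda>x. 0)"
  by (simp add: square_integrable_def)

lemma square_integrable_sum:
  fixes f :: "'i \<Rightarrow> real^2 \<Rightarrow> 'b::euclidean_space"
  assumes "\<And>i. i \<in> I \<Longrightarrow> square_integrable S (f i)"
  shows "square_integrable S (\<lambda>x. \<Sum>i\<in>I. f i x)"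
  using assms by (induction I rule: infinite_finite_induct) (auto intro: square_integrable_zero square_integrable_add)

lemma square_integrable_cong_AE:
  assumes f: "square_integrable S f" and "g \<in> borel_measurable (lebesgue_on S)"
    "AE x in lebesgue_on S. g x = f x"
  shows "square_integrable S g"
  by (rule square_integrable_bound[OF f assms(2)]) (use assms(3) in \<open>eventually_elim, simp\<close>)

lemma L2_norm_square:
  "(L2_norm S f)\<^sup>2 = integral\<^sup>L (lebesgue_on S) (\<lambda>x. (norm (f x))\<^sup>2)"
  unfolding L2_norm_def L2_inner_def by (simp add: power2_norm_eq_inner)

lemma L2_norm_nonneg: "0 \<le> L2_norm S f"
  unfolding L2_norm_def L2_inner_def by (auto intro!: Bochner_Integration.integral_nonneg)

lemma L2_inner_add:
  assumes "square_integrable S f" "square_integrable S g" "square_integrable S h"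
  shows "L2_inner S (\<lambda>x. f x + g x) h = L2_inner S f h + L2_inner S g h"
  unfolding L2_inner_def using assms
  by (simp add: inner_add_left Bochner_Integration.integral_add square_integrable_inner_integrable)

lemma L2_inner_diff:
  assumes "square_integrable S f" "square_integrable S g" "square_integrable S h"
  shows "L2_inner S (\<lambda>x. f x - g x) h = L2_inner S f h - L2_inner S g h"
  unfolding L2_inner_def using assms
  by (simp add: inner_diff_left Bochner_Integration.integral_diff square_integrable_inner_integrable)

lemma L2_inner_commute: "L2_inner S f g = L2_inner S g f"
  by (simp add: L2_inner_def inner_commute)

lemma L2_inner_add_right:
  assumes "square_integrable S f" "square_integrable S g" "square_integrable S h"
  shows "L2_inner S h (\<lambda>x. f x + g x) = L2_inner S h f + L2_inner S h g"
  unfolding L2_inner_commute[of S h] by (rule L2_inner_add[OF assms])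

lemma L2_inner_diff_right:
  assumes "square_integrable S f" "square_integrable S g" "square_integrable S h"
  shows "L2_inner S h (\<lambda>x. f x - g x) = L2_inner S h f - L2_inner S h g"
  unfolding L2_inner_commute[of S h] by (rule L2_inner_diff[OF assms])

lemma L2_inner_scaleR: "L2_inner S (\<lambda>x. c *\<^sub>R f x) g = c * L2_inner S f g"
  and L2_inner_scaleR_right: "L2_inner S g (\<lambda>x. c *\<^sub>R f x) = c * L2_inner S g f"
  by (simp_all add: L2_inner_def)

lemma L2_Cauchy_Schwarz:
  assumes f: "square_integrable S f" and g: "square_integrable S g"
  shows "\<bar>L2_inner S f g\<bar> \<le> L2_norm S f * L2_norm S g"
proof -
  define A B C where "A = L2_inner S f f" and "B = L2_inner S f g" and "C = L2_inner S g g"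
  have nn: "0 \<le> A" "0 \<le> C" unfolding A_def C_def L2_inner_def
    by (auto intro!: Bochner_Integration.integral_nonneg)
  have q: "0 \<le> A * t\<^sup>2 + 2 * B * t + C" for t
  proof -
    have "0 \<le> L2_inner S (\<lambda>x. t *\<^sub>R f x + g x) (\<lambda>x. t *\<^sub>R f x + g x)"
      unfolding L2_inner_def by (auto intro!: Bochner_Integration.integral_nonneg)
    also have "\<dots> = A * t\<^sup>2 + 2 * B * t + C"
      using f g by (simp add: L2_inner_add L2_inner_add_right square_integrable_scaleR square_integrable_add L2_inner_scaleR
          L2_inner_scaleR_right L2_inner_commute[of S g f] A_def B_def C_def
          power2_eq_square algebra_simps)
    finally show ?thesis .
  qed
  have "B\<^sup>2 \<le> A * C"
  proof (cases "A = 0")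
    case True
    have "B = 0"
    proof (rule ccontr)
      assume "B \<noteq> 0"
      have "0 \<le> 2 * B * (- (C + 1) / (2 * B)) + C" using q[of "- (C + 1) / (2 * B)"] True by simp
      then show False using \<open>B \<noteq> 0\<close> by simp
    qed
    then show ?thesis using True by simp
  next
    case False
    then have "A > 0" using nn by simp
    have "0 \<le> A * (- B / A)\<^sup>2 + 2 * B * (- B / A) + C" by (rule q)
    also have "\<dots> = C - B\<^sup>2 / A" using \<open>A > 0\<close> by (simp add: power2_eq_square field_simps)
    finally show ?thesis using \<open>A > 0\<close> by (simp add: field_simps)
  qed
  then have "sqrt (B\<^sup>2) \<le> sqrt (A * C)" by (rule real_sqrt_le_mono)
  then show ?thesis unfolding L2_norm_def A_def B_def C_def by (simp add: real_sqrt_mult)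
qed

lemma L2_norm_triangle:
  fixes f g :: "real^2 \<Rightarrow> 'b::euclidean_space"
  assumes f: "square_integrable S f" and g: "square_integrable S g"
  shows "L2_norm S (\<lambda>x. f x + g x) \<le> L2_norm S f + L2_norm S g"
proof (rule power2_le_imp_le)
  have "(L2_norm S (\<lambda>x. f x + g x))\<^sup>2 = L2_inner S (\<lambda>x. f x + g x) (\<lambda>x. f x + g x)"
    unfolding L2_norm_square L2_inner_def power2_norm_eq_inner ..
  also have "\<dots> = L2_inner S f f + 2 * L2_inner S f g + L2_inner S g g"
    using f g by (simp add: L2_inner_add L2_inner_add_right square_integrable_add L2_inner_commute[of S g f])
  also have "\<dots> \<le> L2_inner S f f + 2 * (L2_norm S f * L2_norm S g) + L2_inner S g g"
    using L2_Cauchy_Schwarz[OF f g] by simp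
  also have "\<dots> = (L2_norm S f + L2_norm S g)\<^sup>2"
    unfolding power2_sum L2_norm_square L2_inner_def power2_norm_eq_inner by simp
  finally show "(L2_norm S (\<lambda>x. f x + g x))\<^sup>2 \<le> (L2_norm S f + L2_norm S g)\<^sup>2" .
qed (intro add_nonneg_nonneg L2_norm_nonneg)

lemma L2_norm_scaleR: "L2_norm S (\<lambda>x. c *\<^sub>R f x) = \<bar>c\<bar> * L2_norm S f"
  by (simp add: L2_norm_def L2_inner_def real_sqrt_mult mult.assoc[symmetric])

lemma L2_norm_mult: "L2_norm S (\<lambda>x. c * f x) = \<bar>c\<bar> * L2_norm S f" for f :: "_ \<Rightarrow> real"
  using L2_norm_scaleR[of S c f] by simp

lemma L2_norm_minus: "L2_norm S (\<lambda>x. - f x) = L2_norm S f"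
  using L2_norm_scaleR[of S "-1" f] by simp

lemma L2_norm_diff:
  fixes f g :: "real^2 \<Rightarrow> 'b::euclidean_space"
  assumes f: "square_integrable S f" and g: "square_integrable S g"
  shows "L2_norm S (\<lambda>x. f x - g x) \<le> L2_norm S f + L2_norm S g"
  using L2_norm_triangle[OF f square_integrable_minus[OF g]] by (simp add: L2_norm_minus)

lemma L2_norm_mono:
  assumes "square_integrable S f" "AE x in lebesgue_on S. norm (g x) \<le> norm (f x)"
  shows "L2_norm S g \<le> L2_norm S f"
  unfolding L2_norm_def L2_inner_def power2_norm_eq_inner[symmetric]
proof (rule real_sqrt_le_mono, rule integral_mono_AE')
  show "integrable (lebesgue_on S) (\<lambda>x. (norm (f x))\<^sup>2)" by (rule square_integrable_integrable[OF assms(1)])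
  show "AE x in lebesgue_on S. (norm (g x))\<^sup>2 \<le> (norm (f x))\<^sup>2"
    using assms(2) by eventually_elim (auto intro: power_mono)
qed auto

lemma L2_norm_cong_AE:
  assumes "square_integrable S f" "square_integrable S g" "AE x in lebesgue_on S. g x = f x"
  shows "L2_norm S g = L2_norm S f"
  by (intro antisym L2_norm_mono assms; use assms(3) in \<open>eventually_elim, simp\<close>)

lemma square_integrable_bounded:
  fixes f :: "real^2 \<Rightarrow> 'b::euclidean_space"
  assumes "S \<in> lmeasurable" "f \<in> borel_measurable (lebesgue_on S)" "AE x in lebesgue_on S. norm (f x) \<le> B"
  shows "square_integrable S f"
proof -
  have "square_integrable S (\<lambda>x. B)"
    unfolding square_integrable_def using integrable_on_lebesgue_on finite_measure_lebesgue_on[OF assms(1)]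
    by (auto intro: finite_measure.integrable_const)
  then show ?thesis by (rule square_integrable_bound[OF _ assms(2)]) (use assms(3) in \<open>eventually_elim, simp\<close>)
qed

lemma L2_norm_bounded:
  fixes f :: "real^2 \<Rightarrow> 'b::euclidean_space"
  assumes "S \<in> lmeasurable" "AE x in lebesgue_on S. norm (f x) \<le> B"
  shows "L2_norm S f \<le> \<bar>B\<bar> * sqrt (measure lebesgue S)"
proof -
  have c: "square_integrable S (\<lambda>x. B)"
    by (rule square_integrable_bounded[OF assms(1)]) auto
  have S: "S \<in> sets lebesgue" using assms(1) by auto
  have "L2_norm S f \<le> L2_norm S (\<lambda>x. B)"
    by (rule L2_norm_mono[OF c]) (use assms(2) in \<open>eventually_elim, simp\<close>)
  also have "\<dots> = \<bar>B\<bar> * sqrt (measure lebesgue S)"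
    unfolding L2_norm_def L2_inner_def using S
    by (simp add: real_sqrt_mult measure_restrict_space space_restrict_space)
  finally show ?thesis .
qed

lemma square_integrable_imp_integrable:
  fixes f :: "real^2 \<Rightarrow> 'b::euclidean_space"
  assumes "S \<in> lmeasurable" "square_integrable S f"
  shows "integrable (lebesgue_on S) f"
proof (rule Bochner_Integration.integrable_bound)
  have c: "square_integrable S (\<lambda>x. 1::real)" by (rule square_integrable_bounded[OF assms(1), of _ 1]) auto
  show "integrable (lebesgue_on S) (\<lambda>x. 1 + (norm (f x))\<^sup>2)"
    using square_integrable_integrable[OF c] square_integrable_integrable[OF assms(2)] by (intro Bochner_Integration.integrable_add) auto
  show "f \<in> borel_measurable (lebesgue_on S)" by (rule square_integrable_measurable[OF assms(2)])
  have "norm (f x) \<le> 1 + (norm (f x))\<^sup>2" for x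
    using zero_le_power2[of "norm (f x) - 1/2"] by (simp add: power2_eq_square algebra_simps)
  then show "AE x in lebesgue_on S. norm (f x) \<le> norm (1 + (norm (f x))\<^sup>2)" by (simp add: order_trans[OF _ abs_ge_self])
qed

lemma integral_le_L2_norm:
  fixes f :: "real^2 \<Rightarrow> real"
  assumes "S \<in> lmeasurable" "square_integrable S f"
  shows "\<bar>integral\<^sup>L (lebesgue_on S) f\<bar> \<le> sqrt (measure lebesgue S) * L2_norm S f"
proof -
  have c: "square_integrable S (\<lambda>x. 1::real)" by (rule square_integrable_bounded[OF assms(1), of _ 1]) auto
  have "\<bar>integral\<^sup>L (lebesgue_on S) f\<bar> = \<bar>L2_inner S (\<lambda>x. 1) f\<bar>" by (simp add: L2_inner_def)
  also have "\<dots> \<le> L2_norm S (\<lambda>x. 1::real) * L2_norm S f" by (rule L2_Cauchy_Schwarz[OF c assms(2)])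
  also have "\<dots> \<le> sqrt (measure lebesgue S) * L2_norm S f"
    using L2_norm_bounded[OF assms(1), of "\<lambda>x. 1::real" 1] by (intro mult_right_mono L2_norm_nonneg) auto
  finally show ?thesis .
qed

lemma square_integrable_restrict_UNIV:
  assumes "S \<in> sets lebesgue"
  shows "square_integrable UNIV (\<lambda>x. if x \<in> S then f x else 0) \<longleftrightarrow> square_integrable S f"
proof -
  have "(\<lambda>x. (norm (if x \<in> S then f x else 0))\<^sup>2) = (\<lambda>x. if x \<in> S then (norm (f x))\<^sup>2 else 0)" by auto
  then show ?thesis unfolding square_integrable_def lebesgue_on_UNIV_eq
    by (simp add: Lebesgue_Measure.integrable_restrict_UNIV[OF assms] borel_measurable_if[OF assms])
qed

lemma L2_norm_restrict_UNIV:
  assumes "S \<in> sets lebesgue"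
  shows "L2_norm UNIV (\<lambda>x. if x \<in> S then f x else 0) = L2_norm S f"
proof -
  have "(\<lambda>x. (if x \<in> S then f x else 0) \<bullet> (if x \<in> S then f x else 0)) = (\<lambda>x. if x \<in> S then f x \<bullet> f x else 0)" by auto
  then show ?thesis unfolding L2_norm_def L2_inner_def lebesgue_on_UNIV_eq
    by (simp add: Lebesgue_Measure.integral_restrict_UNIV[OF assms])
qed

lemma square_integrable_subset:
  assumes "square_integrable S f" "T \<subseteq> S" "S \<in> sets lebesgue" "T \<in> sets lebesgue"
  shows "square_integrable T f"
proof -
  have "square_integrable UNIV (\<lambda>x. if x \<in> T then (if x \<in> S then f x else 0) else 0)"
  proof (rule square_integrable_bound)
    show 1: "square_integrable UNIV (\<lambda>x. if x \<in> S then f x else 0)"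
      using assms square_integrable_restrict_UNIV by blast
    define h where "h = (\<lambda>x. if x \<in> S then f x else 0)"
    have "(\<lambda>x. if x \<in> T then h x else 0) \<in> borel_measurable lebesgue"
      using square_integrable_measurable[OF 1] assms(4) unfolding lebesgue_on_UNIV_eq h_def[symmetric]
      by (intro measurable_If_set) auto
    then show "(\<lambda>x. if x \<in> T then (if x \<in> S then f x else 0) else 0) \<in> borel_measurable (lebesgue_on UNIV)"
      unfolding lebesgue_on_UNIV_eq h_def .
  qed auto
  then have "square_integrable T (\<lambda>x. if x \<in> S then f x else 0)" using square_integrable_restrict_UNIV[OF assms(4)] by blast
  moreover have "square_integrable T (\<lambda>x. if x \<in> S then f x else 0) = square_integrable T f"
    unfolding square_integrable_def using assms(2)
    by (intro arg_cong2[of _ _ _ _ "(\<and>)"] measurable_cong Bochner_Integration.integrable_cong refl)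
       (auto simp: space_restrict_space)
  ultimately show ?thesis by blast
qed

section \<open>Fields with a gradient along segments\<close>

text \<open>
  A field that is smooth in a square and zero outside is in general not differentiable across the boundary, but it
  is the integral of its gradient along every segment once \<open>G\<close> is given some value on the boundary. That property holds
  on edges of triangles too, is preserved by affine maps and sums, and suffices for interpolation.
\<close>

definition has_line_gradient :: "(real^2 \<Rightarrow> real^2) \<Rightarrow> (real^2 \<Rightarrow> real^2^2) \<Rightarrow> bool" where
  "has_line_gradient v G \<longleftrightarrow> continuous_on UNIV v \<and> G \<in> borel_measurable borel \<and> bounded (range G) \<and>
    (\<forall>a b. ((\<lambda>t. G (a + t *\<^sub>R (b - a)) *v (b - a)) has_integral (v b - v a)) {0..1})"

text \<open>
  These fields play the role of the members of \<open>(H\<^sup>1\<^sub>0(\<Omega>))\<^sup>2\<close>.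
\<close>

definition field_on :: "(real^2) set \<Rightarrow> (real^2 \<Rightarrow> real^2) \<Rightarrow> (real^2 \<Rightarrow> real^2^2) \<Rightarrow> bool" where
  "field_on \<Omega> v G \<longleftrightarrow> has_line_gradient v G \<and> (\<forall>x. x \<notin> \<Omega> \<longrightarrow> v x = 0 \<and> G x = 0)"

definition vec2 :: "'a \<Rightarrow> 'a \<Rightarrow> 'a^2" where "vec2 a b = (\<chi> i. if i = 1 then a else b)"

lemma vec2_nth [simp]: "vec2 a b $ 1 = a" "vec2 a b $ 2 = b"
  by (simp_all add: vec2_def)

lemma vec2_eta: "vec2 (x $ 1) (x $ 2) = x"
  by (simp add: vec_eq_iff forall_2)

lemma continuous_on_vec2 [continuous_intros]:
  "continuous_on S f \<Longrightarrow> continuous_on S g \<Longrightarrow> continuous_on S (\<lambda>x. vec2 (f x) (g x))"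
  unfolding vec2_def by (intro continuous_on_vec_lambda) (case_tac "i = 1"; simp)

lemma norm_vec2: "(norm (x :: real^2))\<^sup>2 = (x $ 1)\<^sup>2 + (x $ 2)\<^sup>2"
  unfolding power2_norm_eq_inner by (simp add: inner_vec_def sum_2 power2_eq_square)

lemma norm_mat2: "(norm (A :: real^2^2))\<^sup>2 = (A $ 1 $ 1)\<^sup>2 + (A $ 1 $ 2)\<^sup>2 + (A $ 2 $ 1)\<^sup>2 + (A $ 2 $ 2)\<^sup>2"
  unfolding power2_norm_eq_inner by (simp add: inner_vec_def sum_2 power2_eq_square)

lemma mat2_vector: "(A :: real^2^2) *v d = vec2 (A $ 1 $ 1 * d $ 1 + A $ 1 $ 2 * d $ 2) (A $ 2 $ 1 * d $ 1 + A $ 2 $ 2 * d $ 2)"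
  by (simp add: matrix_vector_mult_def vec_eq_iff forall_2 sum_2)

text \<open>
  The projection of the line onto \<open>[0, 2]\<close>.
\<close>

definition clamp2 :: "real \<Rightarrow> real" where "clamp2 x = max 0 (min 2 x)"

text \<open>
  A function vanishing on the boundary of the square is extended by zero by composing it with the projection onto the
  square. A line that does not run along a side meets the boundary in finitely many points only, so the fundamental theorem
  of calculus applies; along a side everything vanishes.
\<close>

lemma box_line_integral:
  assumes u: "C1_2 u ux uy" and z: "zero_on_boundary u"
  shows "((\<lambda>t. if 0 < a + t * d \<and> a + t * d < 2 \<and> 0 < b + t * e \<and> b + t * e < 2
      then ux (a + t * d) (b + t * e) * d + uy (a + t * d) (b + t * e) * e else 0)
    has_integral (u (clamp2 (a + d)) (clamp2 (b + e)) - u (clamp2 a) (clamp2 b))) {0..1}"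
    (is "(?f has_integral _) _")
proof -
  define U where "U = (\<lambda>t. u (clamp2 (a + t * d)) (clamp2 (b + t * e)))"
  have U0: "U t = 0" if "a + t * d \<le> 0 \<or> 2 \<le> a + t * d \<or> b + t * e \<le> 0 \<or> 2 \<le> b + t * e" for t
    using z that unfolding U_def zero_on_boundary_def clamp2_def by (auto simp: max_def min_def)
  have cU: "continuous_on UNIV U"
    unfolding U_def clamp2_def by (rule cont2_compose[OF C1_2_cont2[OF u]]) (intro continuous_intros)+
  have "(?f has_integral (U 1 - U 0)) {0..1}"
  proof (cases "(d = 0 \<and> (a = 0 \<or> a = 2)) \<or> (e = 0 \<and> (b = 0 \<or> b = 2))")
    case True
    then have "U t = 0" for t by (intro U0) auto
    moreover have "?f = (\<lambda>t. 0)" using True by auto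
    ultimately show ?thesis by simp
  next
    case False
    define S where "S = {t. a + t * d = 0} \<union> {t. a + t * d = 2} \<union> {t. b + t * e = 0} \<union> {t. b + t * e = 2}"
    have fin: "finite {t. p + t * q = r}" if "\<not> (q = 0 \<and> p = r)" for p q r :: real
    proof (cases "q = 0")
      case False
      then have "{t. p + t * q = r} \<subseteq> {(r - p) / q}" by (auto simp: field_simps)
      then show ?thesis using finite_subset by blast
    qed (use that in auto)
    have "finite S" unfolding S_def using False by (auto intro!: fin)
    show ?thesis
    proof (rule fundamental_theorem_of_calculus_interior_strong[OF \<open>finite S\<close>])
      fix t assume t: "t \<in> {0<..<1} - S"
      consider (i) "0 < a + t * d \<and> a + t * d < 2 \<and> 0 < b + t * e \<and> b + t * e < 2"
        | (o) "a + t * d < 0 \<or> 2 < a + t * d \<or> b + t * e < 0 \<or> 2 < b + t * e"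
        using t unfolding S_def by force
      then show "(U has_vector_derivative ?f t) (at t)"
      proof cases
        case i
        define O' where "O' = {t. 0 < a + t * d} \<inter> {t. a + t * d < 2} \<inter> {t. 0 < b + t * e} \<inter> {t. b + t * e < 2}"
        have o: "open O'" unfolding O'_def by (intro open_Int open_Collect_less continuous_intros)
        have "((\<lambda>s. u (a + s * d) (b + s * e)) has_derivative
           (\<lambda>h. ux (a + t * d) (b + t * e) * (h * d) + uy (a + t * d) (b + t * e) * (h * e))) (at t)"
        proof -
          have "((\<lambda>s. a + s * d) has_derivative (\<lambda>h. h * d)) (at t)"
            "((\<lambda>s. b + s * e) has_derivative (\<lambda>h. h * e)) (at t)"
            by (auto intro!: derivative_eq_intros)
          from has_derivative_compose[OF has_derivative_Pair[OF this] C1_2_has_derivative[OF u, of "a + t * d" "b + t * e"]]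
          show ?thesis by simp
        qed
        then have "((\<lambda>s. u (a + s * d) (b + s * e)) has_vector_derivative ?f t) (at t)"
          unfolding has_vector_derivative_def using i by (simp add: algebra_simps)
        then show ?thesis
        proof (rule has_vector_derivative_transform_within_open)
          show "t \<in> O'" using i by (simp add: O'_def)
          show "u (a + s * d) (b + s * e) = U s" if "s \<in> O'" for s
            using that by (simp add: U_def clamp2_def O'_def)
        qed (rule o)
      next
        case o
        define O' where "O' = {t. a + t * d < 0} \<union> {t. 2 < a + t * d} \<union> {t. b + t * e < 0} \<union> {t. 2 < b + t * e}"
        have op: "open O'" unfolding O'_def by (intro open_Un open_Collect_less continuous_intros)
        have "((\<lambda>s. 0) has_vector_derivative ?f t) (at t)" using o by auto
        then show ?thesis
        proof (rule has_vector_derivative_transform_within_open)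
          show "t \<in> O'" using o by (simp add: O'_def)
          show "0 = U s" if "s \<in> O'" for s
            using that U0[of s] by (auto simp: O'_def)
        qed (rule op)
      qed
    qed (use continuous_on_subset[OF cU] in auto)
  qed
  then show ?thesis by (simp add: U_def)
qed

definition open_square :: "(real^2) set" where
  "open_square = {x. 0 < x $ 1 \<and> x $ 1 < 2 \<and> 0 < x $ 2 \<and> x $ 2 < 2}"

lemma open_open_square: "open open_square"
proof -
  have "open_square = {x. 0 < x $ 1} \<inter> {x. x $ 1 < 2} \<inter> {x. 0 < x $ 2} \<inter> {x. x $ 2 < 2}"
    by (auto simp: open_square_def)
  moreover have "open \<dots>" by (intro open_Int open_Collect_less continuous_intros)
  ultimately show ?thesis by simp
qed

lemma open_square_box: "open_square = box 0 (vec2 2 2)"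
  by (auto simp: open_square_def mem_box_cart forall_2)

lemma cont2_comp_vec:
  assumes "cont2 f" shows "continuous_on S (\<lambda>x::real^2. f (x $ 1) (x $ 2))"
  by (rule cont2_compose[OF assms]) (intro continuous_intros)+

text \<open>
  The values of \<open>G\<close> on the boundary are 0, in accordance with the tangential derivatives.
\<close>

lemma square_field_on:
  assumes v1: "C1_2 v1 v1x v1y" and v2: "C1_2 v2 v2x v2y" and z: "zero_on_boundary v1" "zero_on_boundary v2"
  shows "field_on open_square (\<lambda>x. vec2 (v1 (clamp2 (x $ 1)) (clamp2 (x $ 2))) (v2 (clamp2 (x $ 1)) (clamp2 (x $ 2))))
    (\<lambda>x. if x \<in> open_square then vec2 (vec2 (v1x (x $ 1) (x $ 2)) (v1y (x $ 1) (x $ 2)))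
        (vec2 (v2x (x $ 1) (x $ 2)) (v2y (x $ 1) (x $ 2))) else 0)"
    (is "field_on _ ?v ?G")
  unfolding field_on_def has_line_gradient_def
proof (intro conjI allI impI)
  define F where "F = (\<lambda>x::real^2. vec2 (vec2 (v1x (x $ 1) (x $ 2)) (v1y (x $ 1) (x $ 2)))
        (vec2 (v2x (x $ 1) (x $ 2)) (v2y (x $ 1) (x $ 2))))"
  have cF: "continuous_on UNIV F"
    unfolding F_def by (intro continuous_on_vec2 cont2_comp_vec C1_2_cont[OF v1] C1_2_cont[OF v2])
  show "continuous_on UNIV ?v"
    unfolding clamp2_def
    by (intro continuous_on_vec2 cont2_compose[OF C1_2_cont2[OF v1]] cont2_compose[OF C1_2_cont2[OF v2]]
      continuous_intros)
  have "(\<lambda>x. if x \<in> open_square then F x else 0) \<in> borel_measurable borel"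
    by (rule measurable_If_set[OF borel_measurable_continuous_onI[OF cF] measurable_const])
      (use open_open_square in auto)
  then show "?G \<in> borel_measurable borel" unfolding F_def .
  have "bounded (F ` cbox 0 (vec2 2 2))"
    by (intro compact_imp_bounded compact_continuous_image continuous_on_subset[OF cF]) auto
  then have "bounded (insert 0 (F ` cbox 0 (vec2 2 2)))" by simp
  then show "bounded (range ?G)"
    by (rule bounded_subset) (auto simp: F_def open_square_box intro!: imageI box_subset_cbox[THEN subsetD])
  show "((\<lambda>t. ?G (a + t *\<^sub>R (b - a)) *v (b - a)) has_integral ?v b - ?v a) {0..1}" for a b
    unfolding has_integral_componentwise_iff[where 'b = "real^2"]
  proof
    fix i :: "real^2" assume "i \<in> Basis"
    then obtain j where i: "i = axis j 1" by (auto simp: Basis_vec_def)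
    have 1: "(b - a) $ k = b $ k - a $ k" for k by simp
    note L1 = box_line_integral[OF v1 z(1), of "a $ 1" "b $ 1 - a $ 1" "a $ 2" "b $ 2 - a $ 2"]
    note L2 = box_line_integral[OF v2 z(2), of "a $ 1" "b $ 1 - a $ 1" "a $ 2" "b $ 2 - a $ 2"]
    have "j = 1 \<or> j = 2" using exhaust_2 by blast
    then show "((\<lambda>t. (?G (a + t *\<^sub>R (b - a)) *v (b - a)) \<bullet> i) has_integral (?v b - ?v a) \<bullet> i) {0..1}"
    proof
      assume "j = 1"
      show ?thesis unfolding i \<open>j = 1\<close> inner_axis
        by (rule has_integral_eq_rhs[OF has_integral_eq[OF _ L1]]) (auto simp: open_square_def mat2_vector matrix_vector_mult_0)
    next
      assume "j = 2"
      show ?thesis unfolding i \<open>j = 2\<close> inner_axis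
        by (rule has_integral_eq_rhs[OF has_integral_eq[OF _ L2]]) (auto simp: open_square_def mat2_vector matrix_vector_mult_0)
    qed
  qed
  fix x :: "real^2" assume x: "x \<notin> open_square"
  then have "v1 (clamp2 (x $ 1)) (clamp2 (x $ 2)) = 0" "v2 (clamp2 (x $ 1)) (clamp2 (x $ 2)) = 0"
    using z unfolding open_square_def zero_on_boundary_def clamp2_def by (auto simp: max_def min_def)
  then show "?v x = 0" by (simp add: vec_eq_iff forall_2)
  show "?G x = 0" using x by simp
qed

text \<open>
  It transfers iterated integrals to the plane of vectors.
\<close>

lemma lborel_vec2: "(lborel :: (real^2) measure) = distr (lborel :: (real \<times> real) measure) borel (\<lambda>p. vec2 (fst p) (snd p))"
proof (rule lborel_eqI)
  have "(\<lambda>p::real \<times> real. vec2 (fst p) (snd p)) \<in> borel_measurable borel"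
    by (intro borel_measurable_continuous_onI continuous_intros)
  then have m: "(\<lambda>p. vec2 (fst p) (snd p)) \<in> measurable (lborel :: (real \<times> real) measure) borel"
    by simp
  fix l u :: "real^2" assume lu: "\<And>b. b \<in> Basis \<Longrightarrow> l \<bullet> b \<le> u \<bullet> b"
  have le: "l $ 1 \<le> u $ 1" "l $ 2 \<le> u $ 2" using lu[of "axis 1 1"] lu[of "axis 2 1"]
    by (auto simp: Basis_vec_def inner_axis)
  have "emeasure (distr (lborel :: (real \<times> real) measure) borel (\<lambda>p. vec2 (fst p) (snd p))) (box l u) =
     emeasure lborel ((\<lambda>p. vec2 (fst p) (snd p)) -` box l u \<inter> space (lborel :: (real \<times> real) measure))"
    by (rule emeasure_distr[OF m]) auto
  also have "(\<lambda>p. vec2 (fst p) (snd p)) -` box l u \<inter> space (lborel :: (real \<times> real) measure) = box (l $ 1, l $ 2) (u $ 1, u $ 2)"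
    by (auto simp: mem_box_cart forall_2 mem_box Basis_prod_def)
  also have "emeasure lborel (box (l $ 1, l $ 2) (u $ 1, u $ 2)) = ennreal ((u $ 1 - l $ 1) * (u $ 2 - l $ 2))"
    using le by (subst emeasure_lborel_box) (auto simp: Basis_prod_def prod.union_disjoint)
  also have "\<dots> = (\<Prod>b\<in>Basis. (u - l) \<bullet> b)"
  proof -
    have B: "(Basis :: (real^2) set) = {axis 1 1, axis 2 1}"
      by (auto simp: Basis_vec_def) (metis exhaust_2)
    have ne: "axis 1 1 \<noteq> (axis 2 1 :: real^2)" by (simp add: axis_eq_axis)
    show ?thesis unfolding B using ne by (simp add: inner_axis)
  qed
  finally show "emeasure (distr (lborel :: (real \<times> real) measure) borel (\<lambda>p. vec2 (fst p) (snd p))) (box l u) =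
     (\<Prod>b\<in>Basis. (u - l) \<bullet> b)" .
qed simp

lemma integral_square_eq_dbl_int:
  assumes "cont2 f"
  shows "integrable lebesgue (\<lambda>x. if x \<in> open_square then f (x $ 1) (x $ 2) else 0)"
    "integral\<^sup>L lebesgue (\<lambda>x. if x \<in> open_square then f (x $ 1) (x $ 2) else 0) = dbl_int 0 2 f"
proof -
  define h where "h = (\<lambda>x::real^2. if x \<in> open_square then f (x $ 1) (x $ 2) else 0)"
  have hb: "h \<in> borel_measurable borel"
    unfolding h_def
    by (rule measurable_If_set[OF borel_measurable_continuous_onI[OF cont2_comp_vec[OF assms]] measurable_const])
      (use open_open_square in auto)
  have "(\<lambda>p::real \<times> real. vec2 (fst p) (snd p)) \<in> borel_measurable borel"
    by (intro borel_measurable_continuous_onI continuous_intros)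
  then have m: "(\<lambda>p. vec2 (fst p) (snd p)) \<in> measurable (lborel :: (real \<times> real) measure) borel"
    by simp
  define g where "g = (\<lambda>p::real\<times>real. f (fst p) (snd p))"
  have hg: "h (vec2 (fst p) (snd p)) = indicat_real (box (0, 0) (2, 2)) p *\<^sub>R g p" for p :: "real \<times> real"
    by (cases p) (auto simp: h_def g_def open_square_def indicator_def mem_box Basis_prod_def)
  have cg: "continuous_on UNIV g" using assms unfolding g_def cont2_def .
  have ig: "set_integrable lborel (box (0, 0) (2, 2)) g"
    by (rule set_integrable_subset[OF borel_integrable_compact[of "cbox (0, 0) (2, 2)" g, folded set_integrable_def]])
      (use continuous_on_subset[OF cg] in \<open>auto simp: mem_box Basis_prod_def\<close>)
  have "integrable lborel h"
    unfolding lborel_vec2 by (subst integrable_distr_eq[OF m hb]) (use ig in \<open>simp add: hg set_integrable_def\<close>)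
  then show "integrable lebesgue (\<lambda>x. if x \<in> open_square then f (x $ 1) (x $ 2) else 0)"
    unfolding h_def[symmetric] using hb by (simp add: integrable_completion)
  have "integral\<^sup>L lebesgue h = integral\<^sup>L lborel h" by (rule integral_completion) (use hb in simp)
  also have "\<dots> = (LINT p|lborel. h (vec2 (fst p) (snd p)))"
    unfolding lborel_vec2 by (rule integral_distr[OF m hb])
  also have "\<dots> = (LINT p : box (0, 0) (2, 2)|lborel. g p)"
    unfolding hg set_lebesgue_integral_def ..
  also have "\<dots> = integral (box (0, 0) (2, 2)) g" by (rule set_borel_integral_eq_integral(2)[OF ig])
  also have "\<dots> = integral (cbox (0, 0) (2, 2)) g" by (rule integral_open_interval)
  also have "\<dots> = dbl_int 0 2 f" unfolding g_def by (rule dbl_int_pair[OF assms, symmetric])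
  finally show "integral\<^sup>L lebesgue (\<lambda>x. if x \<in> open_square then f (x $ 1) (x $ 2) else 0) = dbl_int 0 2 f"
    by (simp add: h_def)
qed

section \<open>From continuous to square-integrable data\<close>

lemma L2_norm_tendsto_0:
  fixes f :: "nat \<Rightarrow> real^2 \<Rightarrow> real"
  assumes "\<And>n. f n \<in> borel_measurable lebesgue" "AE x in lebesgue. (\<lambda>n. f n x) \<longlonglongrightarrow> 0"
    "integrable lebesgue w" "\<And>n x. (f n x)\<^sup>2 \<le> w x"
  shows "(\<lambda>n. L2_norm UNIV (f n)) \<longlonglongrightarrow> 0"
proof -
  have "(\<lambda>n. integral\<^sup>L lebesgue (\<lambda>x. (f n x)\<^sup>2)) \<longlonglongrightarrow> integral\<^sup>L lebesgue (\<lambda>x::real^2. 0)"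
  proof (rule integral_dominated_convergence[where w = w])
    show "integrable lebesgue w" by (rule assms(3))
    show "(\<lambda>x. (f n x)\<^sup>2) \<in> borel_measurable lebesgue" for n using assms(1) by measurable
    show "AE x in lebesgue. (\<lambda>n. (f n x)\<^sup>2) \<longlonglongrightarrow> 0"
      using assms(2) by eventually_elim (auto intro: tendsto_eq_intros)
  qed (use assms(4) in auto)
  then have "(\<lambda>n. sqrt (integral\<^sup>L lebesgue (\<lambda>x. (f n x)\<^sup>2))) \<longlonglongrightarrow> sqrt 0"
    by (intro tendsto_real_sqrt) simp
  then show ?thesis by (simp add: L2_norm_def L2_inner_def lebesgue_on_UNIV_eq power2_eq_square)
qed

definition unit_square :: "(real^2) set" where
  "unit_square = {x. 0 \<le> x $ 1 \<and> x $ 1 \<le> 1 \<and> 0 \<le> x $ 2 \<and> x $ 2 \<le> 1}"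

lemma unit_square_cbox: "unit_square = cbox 0 (vec2 1 1)"
  by (auto simp: unit_square_def mem_box_cart forall_2)

lemma measure_unit_square: "unit_square \<in> lmeasurable" "measure lebesgue unit_square = 1"
proof -
  show "unit_square \<in> lmeasurable" unfolding unit_square_cbox by (rule lmeasurable_cbox)
  have "(vec2 1 1 :: real^2) = (\<chi> i. 1)" by (simp add: vec_eq_iff forall_2)
  then show "measure lebesgue unit_square = 1" unfolding unit_square_cbox
    using content_cbox_cart[of 0 "\<chi> i. 1 :: real^2"] by (subst measure_completion) (auto simp: interval_eq_empty_cart)
qed

text \<open>
  A continuous bump with support \<open>[0, 1]\<close> and integral 1.
\<close>

definition hat :: "real \<Rightarrow> real" where "hat t = max 0 (6 * (t * (1 - t)))"

lemma hat_props: "continuous_on S hat" "\<not> (0 < t \<and> t < 1) \<Longrightarrow> hat t = 0" "0 \<le> hat t" "hat t \<le> 3/2"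
proof -
  show "continuous_on S hat" unfolding hat_def[abs_def] by (intro continuous_intros)
  show "hat t = 0" if "\<not> (0 < t \<and> t < 1)"
  proof -
    have "t * (1 - t) \<le> 0" using that by (auto simp: mult_le_0_iff not_less)
    then show ?thesis by (simp add: hat_def)
  qed
  have "0 \<le> (t - 1/2)\<^sup>2" by simp
  then have "6 * (t * (1 - t)) \<le> 3/2" by (simp add: power2_eq_square algebra_simps)
  then show "0 \<le> hat t" "hat t \<le> 3/2" unfolding hat_def by simp_all
qed

lemma integral_hat: "integral {0..2} hat = 1"
proof -
  have i: "hat integrable_on {a..b}" for a b by (intro integrable_continuous_real hat_props)
  have "((\<lambda>t. 6 * (t * (1 - t))) has_integral ((3 * 1\<^sup>2 - 2 * 1^3) - (3 * 0\<^sup>2 - 2 * 0^3))) {0..1::real}"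
    by (rule fundamental_theorem_of_calculus)
      (auto simp: has_real_derivative_iff_has_vector_derivative[symmetric] power2_eq_square algebra_simps intro!: derivative_eq_intros)
  from integral_unique[OF this] have "integral {0..1} (\<lambda>t::real. 6 * (t * (1 - t))) = 1"
    by simp
  moreover have "integral {0..1} hat = integral {0..1} (\<lambda>t. 6 * (t * (1 - t)))"
    by (rule integral_cong) (auto simp: hat_def)
  moreover have "integral {1..2} hat = integral {1..2} (\<lambda>t::real. 0)"
    by (rule integral_cong) (use hat_props(2) in auto)
  moreover have "integral {0..1} hat + integral {1..2} hat = integral {0..2} hat"
    by (rule Henstock_Kurzweil_Integration.integral_combine) (auto intro: i)
  ultimately show ?thesis by simp
qed

text \<open>
  Truncation to a bounded function, approximation of it by continuous functions almost everywhere and multiplication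
  by functions vanishing near the sides give convergence in \<open>L\<^sup>2\<close> by dominated convergence. A small multiple of a bump
  restores the mean value.
\<close>

lemma dense_continuous_mean_zero:
  fixes q :: "real^2 \<Rightarrow> real"
  assumes q: "square_integrable UNIV q" "\<And>x. x \<notin> unit_square \<Longrightarrow> q x = 0" "integral\<^sup>L lebesgue q = 0"
    and "\<eta> > 0"
  shows "\<exists>f. cont2 f \<and> (\<forall>x y. \<not> (0 < x \<and> x < 1 \<and> 0 < y \<and> y < 1) \<longrightarrow> f x y = 0) \<and> dbl_int 0 2 f = 0 \<and>
     L2_norm UNIV (\<lambda>x. q x - f (x $ 1) (x $ 2)) \<le> \<eta>"
proof -
  have qm: "q \<in> borel_measurable lebesgue" using square_integrable_measurable[OF q(1)] by (simp add: lebesgue_on_UNIV_eq)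
  have qi: "integrable lebesgue (\<lambda>x. (q x)\<^sup>2)" using square_integrable_integrable[OF q(1)] by (simp add: lebesgue_on_UNIV_eq)
  have lmu: "unit_square \<in> lmeasurable" by (rule measure_unit_square)
  have su: "unit_square \<in> sets lebesgue" using lmu by auto
  (* truncation at height m *)
  define tr where "tr = (\<lambda>(m::nat) (s::real). max (- real m) (min (real m) s))"
  have trm: "(\<lambda>x. tr m (g x)) \<in> borel_measurable M" if "g \<in> borel_measurable M" for m and M :: "(real^2) measure" and g
    unfolding tr_def using that by measurable
  have trb: "\<bar>tr m s\<bar> \<le> real m" for m s unfolding tr_def by auto
  have "(\<lambda>m. L2_norm UNIV (\<lambda>x. q x - tr m (q x))) \<longlonglongrightarrow> 0"
  proof (rule L2_norm_tendsto_0[OF _ _ qi])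
    show "(\<lambda>x. q x - tr m (q x)) \<in> borel_measurable lebesgue" for m
      using qm trm[OF qm] by measurable
    show "AE x in lebesgue. (\<lambda>m. q x - tr m (q x)) \<longlonglongrightarrow> 0"
    proof (rule AE_I2)
      fix x
      obtain N :: nat where N: "\<bar>q x\<bar> \<le> real N" using real_arch_simple by blast
      have "eventually (\<lambda>m. 0 = q x - tr m (q x)) sequentially"
        using eventually_ge_at_top[of N]
      proof eventually_elim
        case (elim m)
        then have "\<bar>q x\<bar> \<le> real m" using N by linarith
        then show ?case unfolding tr_def by auto
      qed
      then show "(\<lambda>m. q x - tr m (q x)) \<longlonglongrightarrow> 0" by (rule Lim_transform_eventually[OF tendsto_const])
    qed
    show "(q x - tr m (q x))\<^sup>2 \<le> (q x)\<^sup>2" for m x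
      unfolding abs_le_square_iff[symmetric] tr_def by auto
  qed
  then have "eventually (\<lambda>m. L2_norm UNIV (\<lambda>x. q x - tr m (q x)) < \<eta> / 8) sequentially"
    using \<open>\<eta> > 0\<close> by (intro order_tendstoD(2)[where a = "\<eta>/8"]) auto
  then obtain m where m: "L2_norm UNIV (\<lambda>x. q x - tr m (q x)) < \<eta> / 8"
    by (auto simp: eventually_sequentially)
  define p where "p = (\<lambda>x. tr m (q x))"
  have pm: "p \<in> borel_measurable lebesgue" unfolding p_def by (rule trm[OF qm])
  have p0: "p x = 0" if "x \<notin> unit_square" for x using q(2)[OF that] unfolding p_def tr_def by auto
  have "q measurable_on UNIV" by (rule lebesgue_measurable_imp_measurable_on[OF qm]) auto
  then obtain N g where N: "negligible N" and g: "\<And>n::nat. continuous_on UNIV (g n)"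
    and gq: "\<And>x. x \<notin> N \<Longrightarrow> (\<lambda>n. g n x) \<longlonglongrightarrow> q x"
    unfolding measurable_on_def by auto
  (* cutoffs in one variable, increasing to the indicator of the open unit interval *)
  define ka where "ka = (\<lambda>(n::nat) t::real. min 1 (real n * max 0 (min t (1 - t))))"
  have kac: "continuous_on UNIV (ka n)" for n unfolding ka_def by (intro continuous_intros)
  have ka01: "0 \<le> ka n t" "ka n t \<le> 1" for n t unfolding ka_def by auto
  have ka0: "ka n t = 0" if "\<not> (0 < t \<and> t < 1)" for n t using that unfolding ka_def by auto
  have ka1: "(\<lambda>n. ka n t) \<longlonglongrightarrow> 1" if t: "0 < t" "t < 1" for t
  proof -
    define r where "r = min t (1 - t)"
    have r: "r > 0" using t by (simp add: r_def)
    obtain N' :: nat where N': "1 / r \<le> real N'" using real_arch_simple by blast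
    have "eventually (\<lambda>n. 1 = ka n t) sequentially"
      using eventually_ge_at_top[of N']
    proof eventually_elim
      case (elim n)
      then have "1 / r \<le> real n" using N' by linarith
      then have "1 \<le> real n * r" using r by (simp add: field_simps)
      then show ?case unfolding ka_def r_def[symmetric] using r by simp
    qed
    then show ?thesis by (rule Lim_transform_eventually[OF tendsto_const])
  qed
  define H where "H = (\<lambda>n x. tr m (g n x) * (ka n (x $ 1) * ka n (x $ 2)))"
  have trc: "continuous_on UNIV (tr m)" unfolding tr_def by (intro continuous_intros)
  have Hc: "continuous_on UNIV (H n)" for n
    unfolding H_def
    by (intro continuous_on_mult continuous_on_compose2[OF trc g] continuous_on_compose2[OF kac] continuous_intros) auto
  have H0: "H n x = 0" if "\<not> (0 < x $ 1 \<and> x $ 1 < 1 \<and> 0 < x $ 2 \<and> x $ 2 < 1)" for n x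
    using that ka0 unfolding H_def by auto
  have Hb: "\<bar>H n x\<bar> \<le> real m" for n x
  proof -
    have "\<bar>H n x\<bar> = \<bar>tr m (g n x)\<bar> * (ka n (x $ 1) * ka n (x $ 2))"
      unfolding H_def abs_mult using ka01 by simp
    also have "\<dots> \<le> real m * (1 * 1)" by (intro mult_mono trb ka01) (auto simp: ka01)
    finally show ?thesis by simp
  qed
  have Hm: "H n \<in> borel_measurable lebesgue" for n
    using borel_measurable_continuous_onI[OF Hc] by (intro measurable_completion) simp
  have bm: "negligible (cbox 0 (vec2 1 1) - box 0 (vec2 1 1) :: (real^2) set)"
    by (rule negligible_frontier_interval)
  have "(\<lambda>n. L2_norm UNIV (\<lambda>x. p x - H n x)) \<longlonglongrightarrow> 0"
  proof (rule L2_norm_tendsto_0)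
    show "(\<lambda>x. p x - H n x) \<in> borel_measurable lebesgue" for n using pm Hm by measurable
    show "integrable lebesgue (\<lambda>x. if x \<in> unit_square then (2 * real m)\<^sup>2 else 0)"
      unfolding Lebesgue_Measure.integrable_restrict_UNIV[OF su]
      using finite_measure_lebesgue_on[OF lmu] by (rule finite_measure.integrable_const)
    show "(p x - H n x)\<^sup>2 \<le> (if x \<in> unit_square then (2 * real m)\<^sup>2 else 0)" for n x
    proof (cases "x \<in> unit_square")
      case True
      have "\<bar>p x - H n x\<bar> \<le> \<bar>2 * real m\<bar>" using Hb[of n x] trb[of m "q x"] unfolding p_def by linarith
      then show ?thesis using True by (simp only: abs_le_square_iff if_True)
    next
      case False
      then have "H n x = 0" by (intro H0) (auto simp: unit_square_def)
      then show ?thesis using False p0 by simp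
    qed
    have "AE x in lebesgue. x \<notin> N \<and> x \<notin> cbox 0 (vec2 1 1) - box 0 (vec2 1 1)"
      using N bm by (intro AE_conjI AE_not_in) (auto simp: negligible_iff_null_sets)
    then show "AE x in lebesgue. (\<lambda>n. p x - H n x) \<longlonglongrightarrow> 0"
    proof eventually_elim
      case (elim x)
      show ?case
      proof (cases "x \<in> box 0 (vec2 1 1)")
        case True
        then have x: "0 < x $ 1" "x $ 1 < 1" "0 < x $ 2" "x $ 2 < 1" by (auto simp: mem_box_cart forall_2)
        have "isCont (tr m) (q x)" using trc by (simp add: continuous_on_eq_continuous_at)
        then have "(\<lambda>n. tr m (g n x)) \<longlonglongrightarrow> tr m (q x)"
          by (rule isCont_tendsto_compose) (use elim gq in auto)
        then have "(\<lambda>n. H n x) \<longlonglongrightarrow> tr m (q x) * (1 * 1)"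
          unfolding H_def by (intro tendsto_mult ka1 x)
        then have "(\<lambda>n. p x - H n x) \<longlonglongrightarrow> p x - p x" unfolding p_def by (intro tendsto_diff tendsto_const) simp
        then show ?thesis by simp
      next
        case False
        then have "x \<notin> unit_square" using elim unit_square_cbox by auto
        moreover then have "H n x = 0" for n by (intro H0) (auto simp: unit_square_def)
        ultimately show ?thesis using p0 by simp
      qed
    qed
  qed
  then have "eventually (\<lambda>n. L2_norm UNIV (\<lambda>x. p x - H n x) < \<eta> / 8) sequentially"
    using \<open>\<eta> > 0\<close> by (intro order_tendstoD(2)[where a = "\<eta>/8"]) auto
  then obtain n where n: "L2_norm UNIV (\<lambda>x. p x - H n x) < \<eta> / 8"
    by (auto simp: eventually_sequentially)
  have siu: "square_integrable UNIV h" if "h \<in> borel_measurable lebesgue" "\<And>x. \<bar>h x\<bar> \<le> B" "\<And>x. x \<notin> unit_square \<Longrightarrow> h x = 0" for h :: "real^2 \<Rightarrow> real" and B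
  proof -
    have "square_integrable unit_square h"
      by (rule square_integrable_bounded[OF lmu, of _ B]) (use that in \<open>auto intro!: measurable_restrict_space1\<close>)
    moreover have "(\<lambda>x. if x \<in> unit_square then h x else 0) = h" using that(3) by auto
    ultimately show ?thesis using square_integrable_restrict_UNIV[OF su, of h] by simp
  qed
  have Hu: "H n x = 0" if "x \<notin> unit_square" for x
    using that by (intro H0) (auto simp: unit_square_def)
  have siH: "square_integrable UNIV (H n)" by (rule siu[OF Hm Hb Hu])
  have sip: "square_integrable UNIV p" by (rule siu[OF pm _ p0, of "real m"]) (simp add: p_def trb)
  have qH: "L2_norm UNIV (\<lambda>x. q x - H n x) \<le> \<eta> / 4"
  proof -
    have "L2_norm UNIV (\<lambda>x. (q x - p x) + (p x - H n x)) \<le> L2_norm UNIV (\<lambda>x. q x - p x) + L2_norm UNIV (\<lambda>x. p x - H n x)"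
      by (intro L2_norm_triangle square_integrable_diff q sip siH)
    then show ?thesis using m n by (simp add: p_def)
  qed
  define c where "c = integral\<^sup>L lebesgue (H n)"
  have integ: "integrable lebesgue h" "L2_norm UNIV h = L2_norm unit_square h" "integral\<^sup>L lebesgue h = integral\<^sup>L (lebesgue_on unit_square) h"
    "square_integrable unit_square h"
    if "square_integrable UNIV h" "\<And>x. x \<notin> unit_square \<Longrightarrow> h x = 0" for h :: "real^2 \<Rightarrow> real"
  proof -
    have e: "(\<lambda>x. if x \<in> unit_square then h x else 0) = h" using that(2) by auto
    show s: "square_integrable unit_square h" using square_integrable_restrict_UNIV[OF su, of h] that(1) e by simp
    show "integrable lebesgue h"
      using Lebesgue_Measure.integrable_restrict_UNIV[OF su, of h] square_integrable_imp_integrable[OF lmu s] e by simp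
    show "L2_norm UNIV h = L2_norm unit_square h" using L2_norm_restrict_UNIV[OF su, of h] e by simp
    show "integral\<^sup>L lebesgue h = integral\<^sup>L (lebesgue_on unit_square) h"
      using Lebesgue_Measure.integral_restrict_UNIV[OF su, of h] e by simp
  qed
  have cb: "\<bar>c\<bar> \<le> \<eta> / 4"
  proof -
    have sd: "square_integrable UNIV (\<lambda>x. q x - H n x)" by (intro square_integrable_diff q siH)
    have z: "\<And>x. x \<notin> unit_square \<Longrightarrow> q x - H n x = 0" using q(2) Hu by simp
    have "c = - integral\<^sup>L lebesgue (\<lambda>x. q x - H n x)"
      unfolding c_def using q(3) integ(1)[OF q(1,2)] integ(1)[OF siH Hu] by simp
    then have "\<bar>c\<bar> = \<bar>integral\<^sup>L (lebesgue_on unit_square) (\<lambda>x. q x - H n x)\<bar>" using integ(3)[OF sd z] by simp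
    also have "\<dots> \<le> 1 * L2_norm unit_square (\<lambda>x. q x - H n x)"
      using integral_le_L2_norm[OF lmu integ(4)[OF sd z]] measure_unit_square(2) by simp
    finally show ?thesis using qH integ(2)[OF sd z] by simp
  qed
  define \<beta> where "\<beta> = (\<lambda>x y. hat x * hat y)"
  have c\<beta>: "cont2 \<beta>" unfolding \<beta>_def by (intro cont2_mult cont2_of_fst cont2_of_snd hat_props)
  define f where "f = (\<lambda>x y. H n (vec2 x y) - c * \<beta> x y)"
  have cH: "cont2 (\<lambda>x y. H n (vec2 x y))" unfolding cont2_def
    by (rule continuous_on_compose2[OF Hc]) (auto intro!: continuous_intros)
  have cf: "cont2 f" unfolding f_def by (intro cont2_intros cH c\<beta>)
  have f0: "f x y = 0" if "\<not> (0 < x \<and> x < 1 \<and> 0 < y \<and> y < 1)" for x y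
    using that H0[of "vec2 x y"] hat_props(2) unfolding f_def \<beta>_def by auto
  have "dbl_int 0 2 (\<lambda>x y. H n (vec2 x y)) = integral\<^sup>L lebesgue (\<lambda>x. if x \<in> open_square then H n (vec2 (x $ 1) (x $ 2)) else 0)"
    by (rule integral_square_eq_dbl_int(2)[OF cH, symmetric])
  also have "(\<lambda>x. if x \<in> open_square then H n (vec2 (x $ 1) (x $ 2)) else 0) = H n"
  proof
    fix x show "(if x \<in> open_square then H n (vec2 (x $ 1) (x $ 2)) else 0) = H n x"
      using H0[of x n] by (cases "x \<in> open_square") (auto simp: vec2_eta open_square_def)
  qed
  finally have "dbl_int 0 2 (\<lambda>x y. H n (vec2 x y)) = c" by (simp add: c_def)
  moreover have "dbl_int 0 2 \<beta> = 1" by (simp add: dbl_int_def \<beta>_def integral_hat)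
  ultimately have "dbl_int 0 2 f = 0"
    unfolding f_def by (simp add: dbl_int_diff[OF cH cont2_mult[OF cont2_const c\<beta>]] dbl_int_cmult)
  moreover have "L2_norm UNIV (\<lambda>x. q x - f (x $ 1) (x $ 2)) \<le> \<eta>"
  proof -
    define b where "b = (\<lambda>x::real^2. \<beta> (x $ 1) (x $ 2))"
    have bb: "\<bar>b x\<bar> \<le> 3" for x
    proof -
      have "hat (x $ 1) * hat (x $ 2) \<le> 3/2 * (3/2)" by (intro mult_mono hat_props) simp
      then show ?thesis using hat_props(3)[of "x $ 1"] hat_props(3)[of "x $ 2"] unfolding b_def \<beta>_def by simp
    qed
    have b0: "b x = 0" if "x \<notin> unit_square" for x
      using that hat_props(2) by (auto simp: b_def \<beta>_def unit_square_def)
    have "b \<in> borel_measurable lebesgue"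
      using borel_measurable_continuous_onI[OF cont2_comp_vec[OF c\<beta>]] unfolding b_def by (intro measurable_completion) simp
    then have sib: "square_integrable UNIV b" by (rule siu[OF _ bb b0])
    have "L2_norm UNIV b \<le> 3"
      using L2_norm_bounded[OF lmu, of b 3] bb integ(2)[OF sib b0] measure_unit_square(2) by simp
    then have "\<bar>c\<bar> * L2_norm UNIV b \<le> \<eta> / 4 * 3"
      using cb \<open>\<eta> > 0\<close> by (intro mult_mono) (auto simp: L2_norm_nonneg)
    moreover have "L2_norm UNIV (\<lambda>x. (q x - H n x) + c * b x) \<le> L2_norm UNIV (\<lambda>x. q x - H n x) + L2_norm UNIV (\<lambda>x. c * b x)"
      by (intro L2_norm_triangle square_integrable_diff square_integrable_mult q siH sib)
    moreover have "(\<lambda>x. (q x - H n x) + c * b x) = (\<lambda>x. q x - f (x $ 1) (x $ 2))"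
      by (auto simp: f_def b_def vec2_eta)
    ultimately show ?thesis using qH by (simp add: L2_norm_mult)
  qed
  ultimately show ?thesis using cf f0 by blast
qed

text \<open>
  The datum \<open>q\<close> is the limit of divergences of fields in \<open>\<Omega>\<close> whose gradients are asymptotically bounded by
  \<open>C\<close>. Passing to a limit field would require completeness of a Sobolev space and is avoided.
\<close>

definition div_approx :: "(real^2) set \<Rightarrow> real \<Rightarrow> (real^2 \<Rightarrow> real) \<Rightarrow> bool" where
  "div_approx \<Omega> C q \<longleftrightarrow> (\<forall>\<epsilon>>0. \<exists>v G. field_on \<Omega> v G \<and>
     L2_norm UNIV (\<lambda>x. trace (G x) - q x) \<le> \<epsilon> \<and> L2_norm UNIV G \<le> C + \<epsilon>)"

lemma trace_2: "trace (A :: real^2^2) = A $ 1 $ 1 + A $ 2 $ 2"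
  by (simp add: trace_def sum_2)

lemma unit_square_solver:
  fixes q :: "real^2 \<Rightarrow> real"
  assumes q: "square_integrable UNIV q" "\<And>x. x \<notin> unit_square \<Longrightarrow> q x = 0" "integral\<^sup>L lebesgue q = 0"
  shows "div_approx open_square (10^7 * L2_norm UNIV q) q"
  unfolding div_approx_def
proof (intro allI impI)
  fix \<epsilon> :: real assume \<epsilon>: "\<epsilon> > 0"
  (* small enough to absorb the constant of the square, 10^7, which is the root of 10^14 *)
  define \<eta> where "\<eta> = \<epsilon> / (4 * 10^7)"
  have \<eta>: "\<eta> > 0" using \<epsilon> by (simp add: \<eta>_def)
  obtain f where f: "cont2 f" "\<And>x y. \<not> (0 < x \<and> x < 1 \<and> 0 < y \<and> y < 1) \<Longrightarrow> f x y = 0" "dbl_int 0 2 f = 0"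
    and qf: "L2_norm UNIV (\<lambda>x. q x - f (x $ 1) (x $ 2)) \<le> \<eta>"
    using dense_continuous_mean_zero[OF q \<eta>] by blast
  obtain v1 v2 v1x v1y v2x v2y where v: "C1_2 v1 v1x v1y" "C1_2 v2 v2x v2y" "zero_on_boundary v1" "zero_on_boundary v2"
    and vd: "\<And>x y. x \<in> {0..2} \<Longrightarrow> y \<in> {0..2} \<Longrightarrow> \<bar>v1x x y + v2y x y - f x y\<bar> \<le> \<eta>"
    and vb: "sqn v1x + sqn v1y + sqn v2x + sqn v2y \<le> 10^14 * (sqn f + \<eta>\<^sup>2)"
    using square_divergence_solver[OF f \<eta>] by blast
  define w where "w = (\<lambda>x::real^2. vec2 (v1 (clamp2 (x $ 1)) (clamp2 (x $ 2))) (v2 (clamp2 (x $ 1)) (clamp2 (x $ 2))))"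
  define G where "G = (\<lambda>x. if x \<in> open_square then vec2 (vec2 (v1x (x $ 1) (x $ 2)) (v1y (x $ 1) (x $ 2)))
        (vec2 (v2x (x $ 1) (x $ 2)) (v2y (x $ 1) (x $ 2))) else 0)"
  have fo: "field_on open_square w G" unfolding w_def G_def by (rule square_field_on[OF v])
  note cv = C1_2_cont[OF v(1)] C1_2_cont[OF v(2)]
  define g where "g = (\<lambda>x::real^2. f (x $ 1) (x $ 2))"
  have sqL: "(L2_norm UNIV (\<lambda>x::real^2. if x \<in> open_square then h (x $ 1) (x $ 2) else 0))\<^sup>2 = sqn h"
    "square_integrable UNIV (\<lambda>x::real^2. if x \<in> open_square then h (x $ 1) (x $ 2) else 0)" if "cont2 h" for h
  proof -
    have e: "(\<lambda>x. (norm (if x \<in> open_square then h (x $ 1) (x $ 2) else 0))\<^sup>2) = (\<lambda>x. if x \<in> open_square then (h (x $ 1) (x $ 2))\<^sup>2 else 0)" by auto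
    show "(L2_norm UNIV (\<lambda>x::real^2. if x \<in> open_square then h (x $ 1) (x $ 2) else 0))\<^sup>2 = sqn h"
      unfolding L2_norm_square e lebesgue_on_UNIV_eq sqn_def by (rule integral_square_eq_dbl_int(2)[OF cont2_power[OF that]])
    show "square_integrable UNIV (\<lambda>x::real^2. if x \<in> open_square then h (x $ 1) (x $ 2) else 0)"
      unfolding square_integrable_def e lebesgue_on_UNIV_eq
      using integral_square_eq_dbl_int(1)[OF that] integral_square_eq_dbl_int(1)[OF cont2_power[OF that, of 2]] by auto
  qed
  have ge: "g = (\<lambda>x. if x \<in> open_square then f (x $ 1) (x $ 2) else 0)"
  proof
    fix x show "g x = (if x \<in> open_square then f (x $ 1) (x $ 2) else 0)"
      using f(2)[of "x $ 1" "x $ 2"] by (cases "x \<in> open_square") (auto simp: g_def open_square_def)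
  qed
  have sig: "square_integrable UNIV g" and ng: "(L2_norm UNIV g)\<^sup>2 = sqn f"
    unfolding ge using sqL[OF f(1)] by auto
  have ngq: "L2_norm UNIV g \<le> L2_norm UNIV q + \<eta>"
  proof -
    have "L2_norm UNIV (\<lambda>x. q x - (q x - g x)) \<le> L2_norm UNIV q + L2_norm UNIV (\<lambda>x. q x - g x)"
      by (intro L2_norm_diff square_integrable_diff q sig)
    then show ?thesis using qf by (simp add: g_def)
  qed
  have "L2_norm UNIV (\<lambda>x. trace (G x) - q x) \<le> \<epsilon>"
  proof -
    define D where "D = (\<lambda>x y. v1x x y + v2y x y - f x y)"
    have cD: "cont2 D" unfolding D_def by (intro cont2_intros cv f)
    have "sqn D \<le> 4 * \<eta>\<^sup>2" by (rule sqn_bounded[OF cD]) (use vd in \<open>auto simp: D_def\<close>)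
    then have "(L2_norm UNIV (\<lambda>x::real^2. if x \<in> open_square then D (x $ 1) (x $ 2) else 0))\<^sup>2 \<le> (2 * \<eta>)\<^sup>2"
      unfolding sqL(1)[OF cD] by (simp add: power2_eq_square)
    then have "L2_norm UNIV (\<lambda>x::real^2. if x \<in> open_square then D (x $ 1) (x $ 2) else 0) \<le> 2 * \<eta>"
      by (rule power2_le_imp_le) (use \<eta> in auto)
    moreover have "L2_norm UNIV (\<lambda>x. (if x \<in> open_square then D (x $ 1) (x $ 2) else 0) - (q x - g x)) \<le>
       L2_norm UNIV (\<lambda>x::real^2. if x \<in> open_square then D (x $ 1) (x $ 2) else 0) + L2_norm UNIV (\<lambda>x. q x - g x)"
      by (intro L2_norm_diff square_integrable_diff q sig sqL(2)[OF cD])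
    moreover have "(\<lambda>x. (if x \<in> open_square then D (x $ 1) (x $ 2) else 0) - (q x - g x)) = (\<lambda>x. trace (G x) - q x)"
      by (auto simp: G_def trace_2 D_def ge)
    ultimately show ?thesis using qf \<epsilon> by (simp add: g_def \<eta>_def)
  qed
  moreover have "L2_norm UNIV G \<le> 10^7 * L2_norm UNIV q + \<epsilon>"
  proof -
    define E where "E = (\<lambda>x y. (v1x x y)\<^sup>2 + (v1y x y)\<^sup>2 + (v2x x y)\<^sup>2 + (v2y x y)\<^sup>2)"
    have cE: "cont2 E" unfolding E_def by (intro cont2_intros cv)
    have e: "(\<lambda>x. (norm (G x))\<^sup>2) = (\<lambda>x. if x \<in> open_square then E (x $ 1) (x $ 2) else 0)"
      by (auto simp: G_def E_def norm_mat2)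
    have "(L2_norm UNIV G)\<^sup>2 = dbl_int 0 2 E"
      unfolding L2_norm_square lebesgue_on_UNIV_eq e by (rule integral_square_eq_dbl_int(2)[OF cE])
    also have "\<dots> = sqn v1x + sqn v1y + sqn v2x + sqn v2y"
      unfolding E_def sqn_def by (subst dbl_int_add; (intro cont2_intros cv)?)+ simp
    also have "\<dots> \<le> 10^14 * ((L2_norm UNIV g)\<^sup>2 + \<eta>\<^sup>2)" using vb by (simp add: ng)
    also have "\<dots> \<le> 10^14 * (L2_norm UNIV g + \<eta>)\<^sup>2"
      using \<eta> L2_norm_nonneg[of UNIV g] by (simp add: power2_sum)
    also have "\<dots> = (10^7 * (L2_norm UNIV g + \<eta>))\<^sup>2" unfolding power_mult_distrib[of "10^7"] by simp
    finally have "L2_norm UNIV G \<le> 10^7 * (L2_norm UNIV g + \<eta>)"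
      by (rule power2_le_imp_le) (use \<eta> L2_norm_nonneg[of UNIV g] in auto)
    also have "\<dots> \<le> 10^7 * (L2_norm UNIV q + 2 * \<eta>)" using ngq by simp
    also have "\<dots> \<le> 10^7 * L2_norm UNIV q + \<epsilon>" using \<epsilon> by (simp add: \<eta>_def)
    finally show ?thesis .
  qed
  ultimately show "\<exists>v G. field_on open_square v G \<and>
     L2_norm UNIV (\<lambda>x. trace (G x) - q x) \<le> \<epsilon> \<and> L2_norm UNIV G \<le> 10^7 * L2_norm UNIV q + \<epsilon>"
    using fo by blast
qed

section \<open>Stability of approximate solvability\<close>

lemma continuous_on_trace: "continuous_on S (\<lambda>A::real^2^2. trace A)"
  unfolding trace_2[abs_def] by (intro continuous_intros)

lemma continuous_on_matrix_vector_mult [continuous_intros]: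
  "continuous_on S f \<Longrightarrow> continuous_on S (\<lambda>x. A *v f x)" for A :: "real^2^2"
  by (rule bounded_linear.continuous_on[OF matrix_vector_mul_bounded_linear])

lemma linear_conjugation: "linear (\<lambda>G. A ** (G :: real^2^2) ** B)"
  by (intro linearI) (simp_all add: matrix_matrix_mult_def vec_eq_iff sum_2 algebra_simps)

lemma abs_trace_le: "\<bar>trace (A :: real^2^2)\<bar> \<le> 2 * norm A"
proof -
  have "\<bar>A $ i $ i\<bar> \<le> norm A" for i
    using component_le_norm_cart[of "A $ i" i] Finite_Cartesian_Product.norm_nth_le[of A i] by linarith
  from this[of 1] this[of 2] show ?thesis unfolding trace_2 by linarith
qed

lemma field_on_si:
  assumes "bounded \<Omega>" "field_on \<Omega> v G"
  shows "square_integrable UNIV G" "square_integrable UNIV (\<lambda>x. trace (G x))"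
proof -
  obtain r where r: "\<Omega> \<subseteq> cball 0 r"
    using bounded_subset_ballD[OF assms(1), of 0] ball_subset_cball by blast
  have Gm: "G \<in> borel_measurable borel" and "bounded (range G)" and G0: "\<And>x. x \<notin> \<Omega> \<Longrightarrow> G x = 0"
    using assms(2) by (auto simp: field_on_def has_line_gradient_def)
  then obtain M where M: "\<And>x. norm (G x) \<le> M" unfolding bounded_iff by auto
  have Gl: "G \<in> borel_measurable lebesgue" using Gm by (intro measurable_completion) simp
  have "square_integrable (cball 0 r) G"
    by (rule square_integrable_bounded[of _ _ M]) (use Gl M in \<open>auto intro: measurable_restrict_space1\<close>)
  then have "square_integrable UNIV (\<lambda>x. if x \<in> cball 0 r then G x else 0)"
    by (subst square_integrable_restrict_UNIV) auto
  moreover have "(\<lambda>x. if x \<in> cball 0 r then G x else 0) = G" using G0 r by (auto simp: fun_eq_iff subset_iff)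
  ultimately show s: "square_integrable UNIV G" by simp
  have "(\<lambda>x. trace (G x)) \<in> borel_measurable (lebesgue_on UNIV)"
    using measurable_compose[OF square_integrable_measurable[OF s] borel_measurable_continuous_onI[OF continuous_on_trace]] .
  then show "square_integrable UNIV (\<lambda>x. trace (G x))"
    by (rule square_integrable_bound[OF square_integrable_scaleR[OF s, of 2]]) (use abs_trace_le in auto)
qed

lemma field_on_add:
  assumes "field_on \<Omega> v G" "field_on \<Omega> w H"
  shows "field_on \<Omega> (\<lambda>x. v x + w x) (\<lambda>x. G x + H x)"
proof -
  have "((\<lambda>t. (G (a + t *\<^sub>R (b - a)) + H (a + t *\<^sub>R (b - a))) *v (b - a)) has_integral (v b + w b - (v a + w a))) {0..1}" for a b
  proof -
    have "((\<lambda>t. G (a + t *\<^sub>R (b - a)) *v (b - a) + H (a + t *\<^sub>R (b - a)) *v (b - a)) has_integral ((v b - v a) + (w b - w a))) {0..1}"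
      by (rule has_integral_add) (use assms in \<open>auto simp: field_on_def has_line_gradient_def\<close>)
    then show ?thesis by (simp add: matrix_vector_mult_add_rdistrib algebra_simps)
  qed
  moreover have "bounded (range (\<lambda>x. G x + H x))"
    using assms unfolding field_on_def has_line_gradient_def by (intro bounded_plus_comp) auto
  ultimately show ?thesis
    using assms unfolding field_on_def has_line_gradient_def by (auto intro: continuous_on_add)
qed

lemma field_on_scaleR:
  assumes "field_on \<Omega> v G"
  shows "field_on \<Omega> (\<lambda>x. c *\<^sub>R v x) (\<lambda>x. c *\<^sub>R G x)"
proof -
  have "((\<lambda>t. (c *\<^sub>R G (a + t *\<^sub>R (b - a))) *v (b - a)) has_integral (c *\<^sub>R v b - c *\<^sub>R v a)) {0..1}" for a b
  proof -
    have "((\<lambda>t. c *\<^sub>R (G (a + t *\<^sub>R (b - a)) *v (b - a))) has_integral (c *\<^sub>R (v b - v a))) {0..1}"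
      by (rule has_integral_cmul) (use assms in \<open>auto simp: field_on_def has_line_gradient_def\<close>)
    then show ?thesis by (simp add: scaleR_matrix_vector_assoc algebra_simps)
  qed
  moreover have "bounded (range (\<lambda>x. c *\<^sub>R G x))"
    using assms bounded_scaleR_comp[of G UNIV c] unfolding field_on_def has_line_gradient_def by auto
  ultimately show ?thesis
    using assms unfolding field_on_def has_line_gradient_def by (auto intro: continuous_intros)
qed

lemma field_on_mono: "field_on \<Omega> v G \<Longrightarrow> \<Omega> \<subseteq> \<Omega>' \<Longrightarrow> field_on \<Omega>' v G"
  unfolding field_on_def by auto

lemma div_approx_mono:
  assumes "div_approx \<Omega> C q" "\<Omega> \<subseteq> \<Omega>'" "C \<le> C'" shows "div_approx \<Omega>' C' q"
  using assms unfolding div_approx_def by (meson field_on_mono add_right_mono order_trans)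

lemma trace_scaleR: "trace (c *\<^sub>R A) = c * trace (A :: real^2^2)"
  by (simp add: trace_2 algebra_simps)

lemma div_approx_add:
  assumes \<Omega>: "bounded \<Omega>" and q: "square_integrable UNIV q1" "square_integrable UNIV q2"
    and "div_approx \<Omega> C1 q1" "div_approx \<Omega> C2 q2"
  shows "div_approx \<Omega> (C1 + C2) (\<lambda>x. q1 x + q2 x)"
  unfolding div_approx_def
proof (intro allI impI)
  fix \<epsilon> :: real assume "\<epsilon> > 0"
  then have "\<epsilon> / 2 > 0" by simp
  then obtain v G w H where 1: "field_on \<Omega> v G" "L2_norm UNIV (\<lambda>x. trace (G x) - q1 x) \<le> \<epsilon> / 2" "L2_norm UNIV G \<le> C1 + \<epsilon> / 2"
    and 2: "field_on \<Omega> w H" "L2_norm UNIV (\<lambda>x. trace (H x) - q2 x) \<le> \<epsilon> / 2" "L2_norm UNIV H \<le> C2 + \<epsilon> / 2"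
    using assms(4,5) unfolding div_approx_def by meson
  note s = field_on_si[OF \<Omega> 1(1)] field_on_si[OF \<Omega> 2(1)]
  have "L2_norm UNIV (\<lambda>x. (trace (G x) - q1 x) + (trace (H x) - q2 x)) \<le> \<epsilon>"
    using L2_norm_triangle[OF square_integrable_diff[OF s(2) q(1)] square_integrable_diff[OF s(4) q(2)]] 1 2 by simp
  moreover have "(\<lambda>x. (trace (G x) - q1 x) + (trace (H x) - q2 x)) = (\<lambda>x. trace (G x + H x) - (q1 x + q2 x))"
    by (auto simp: trace_add)
  moreover have "L2_norm UNIV (\<lambda>x. G x + H x) \<le> C1 + C2 + \<epsilon>"
    using L2_norm_triangle[OF s(1) s(3)] 1 2 by simp
  ultimately show "\<exists>v G. field_on \<Omega> v G \<and> L2_norm UNIV (\<lambda>x. trace (G x) - (q1 x + q2 x)) \<le> \<epsilon> \<and> L2_norm UNIV G \<le> C1 + C2 + \<epsilon>"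
    using field_on_add[OF 1(1) 2(1)] by auto
qed

lemma div_approx_cmult:
  assumes "div_approx \<Omega> C q"
  shows "div_approx \<Omega> (\<bar>c\<bar> * C) (\<lambda>x. c * q x)"
  unfolding div_approx_def
proof (intro allI impI)
  fix \<epsilon> :: real assume \<epsilon>: "\<epsilon> > 0"
  define \<delta> where "\<delta> = \<epsilon> / (\<bar>c\<bar> + 1)"
  have \<delta>: "\<delta> > 0" "\<bar>c\<bar> * \<delta> \<le> \<epsilon>" using \<epsilon> by (auto simp: \<delta>_def field_simps)
  then obtain v G where 1: "field_on \<Omega> v G" "L2_norm UNIV (\<lambda>x. trace (G x) - q x) \<le> \<delta>" "L2_norm UNIV G \<le> C + \<delta>"
    using assms unfolding div_approx_def by meson
  have "(\<lambda>x. trace (c *\<^sub>R G x) - c * q x) = (\<lambda>x. c * (trace (G x) - q x))"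
    by (auto simp: trace_scaleR algebra_simps)
  then have "L2_norm UNIV (\<lambda>x. trace (c *\<^sub>R G x) - c * q x) \<le> \<epsilon>"
    using mult_left_mono[OF 1(2), of "\<bar>c\<bar>"] \<delta> by (simp add: L2_norm_mult)
  moreover have "L2_norm UNIV (\<lambda>x. c *\<^sub>R G x) \<le> \<bar>c\<bar> * C + \<epsilon>"
    using mult_left_mono[OF 1(3), of "\<bar>c\<bar>"] \<delta> by (simp add: L2_norm_scaleR algebra_simps)
  ultimately show "\<exists>v G. field_on \<Omega> v G \<and> L2_norm UNIV (\<lambda>x. trace (G x) - c * q x) \<le> \<epsilon> \<and> L2_norm UNIV G \<le> \<bar>c\<bar> * C + \<epsilon>"
    using field_on_scaleR[OF 1(1), of c] by blast
qed

section \<open>Affine images of the square\<close>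

lemma lebesgue_affine:
  fixes f :: "real^2 \<Rightarrow> real" and A B :: "real^2^2"
  assumes AB: "A ** B = mat 1" "B ** A = mat 1" and f: "integrable lebesgue f"
  shows "integrable lebesgue (\<lambda>x. f (c + A *v x))"
    "\<bar>det A\<bar> * integral\<^sup>L lebesgue (\<lambda>x. f (c + A *v x)) = integral\<^sup>L lebesgue f"
proof -
  have d: "det A \<noteq> 0" using det_mul[of A B] AB by (metis det_I mult_zero_left zero_neq_one)
  define F where "F = (\<lambda>x. vec (f x) :: real^1)"
  have F: "F absolutely_integrable_on UNIV"
    unfolding absolutely_integrable_on_1_iff using f
    by (simp add: F_def o_def set_integrable_def)
  have surj: "range (\<lambda>x. c + A *v x) = UNIV"
  proof -
    have "y = c + A *v (B *v (y - c))" for y by (simp add: matrix_vector_mul_assoc AB)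
    then show ?thesis by blast
  qed
  have "((\<lambda>x. \<bar>det (matrix ((*v) A))\<bar> *\<^sub>R F (c + A *v x)) absolutely_integrable_on UNIV \<and>
     integral UNIV (\<lambda>x. \<bar>det (matrix ((*v) A))\<bar> *\<^sub>R F (c + A *v x)) = integral UNIV F) \<longleftrightarrow>
     F absolutely_integrable_on range (\<lambda>x. c + A *v x) \<and> integral (range (\<lambda>x. c + A *v x)) F = integral UNIV F"
  proof (rule has_absolute_integral_change_of_variables_invertible)
    show "((\<lambda>x. c + A *v x) has_derivative (*v) A) (at x within UNIV)" for x
      by (auto intro!: derivative_eq_intros bounded_linear_imp_has_derivative)
    show "B *v (c + A *v x - c) = x" for x by (simp add: matrix_vector_mul_assoc AB)
    show "continuous_on (range (\<lambda>x. c + A *v x)) (\<lambda>y. B *v (y - c))"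
      by (intro continuous_intros)
  qed
  then have 1: "(\<lambda>x. \<bar>det A\<bar> *\<^sub>R F (c + A *v x)) absolutely_integrable_on UNIV"
    and 2: "integral UNIV (\<lambda>x. \<bar>det A\<bar> *\<^sub>R F (c + A *v x)) = integral UNIV F"
    using F surj by (auto simp: matrix_of_matrix_vector_mul)
  have "(\<lambda>x. \<bar>det A\<bar> * f (c + A *v x)) absolutely_integrable_on UNIV"
    using 1 unfolding absolutely_integrable_on_1_iff by (simp add: F_def o_def)
  then have i: "integrable lebesgue (\<lambda>x. \<bar>det A\<bar> * f (c + A *v x))"
    by (simp add: set_integrable_def)
  then show i': "integrable lebesgue (\<lambda>x. f (c + A *v x))" using d by simp
  have "integral UNIV (\<lambda>x. \<bar>det A\<bar> * f (c + A *v x)) = integral UNIV f"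
    using 2 1 F unfolding integral_on_1_eq F_def by (simp add: vec_eq_iff o_def)
  then show "\<bar>det A\<bar> * integral\<^sup>L lebesgue (\<lambda>x. f (c + A *v x)) = integral\<^sup>L lebesgue f"
    using integral_lebesgue[OF i] integral_lebesgue[OF f] by simp
qed

text \<open>
  It is an equality between norms, hence has no loss when approximation errors are transported.
\<close>

lemma L2_norm_affine:
  fixes f :: "real^2 \<Rightarrow> 'b::euclidean_space" and A B :: "real^2^2"
  assumes AB: "A ** B = mat 1" "B ** A = mat 1" and f: "integrable lebesgue (\<lambda>x. (norm (f x))\<^sup>2)"
  shows "sqrt \<bar>det A\<bar> * L2_norm UNIV (\<lambda>x. f (c + A *v x)) = L2_norm UNIV f"
proof -
  have "(sqrt \<bar>det A\<bar> * L2_norm UNIV (\<lambda>x. f (c + A *v x)))\<^sup>2 = (L2_norm UNIV f)\<^sup>2"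
    unfolding power_mult_distrib L2_norm_square lebesgue_on_UNIV_eq
    using lebesgue_affine(2)[OF AB f, of c] by simp
  then show ?thesis by (simp add: L2_norm_nonneg power2_eq_iff_nonneg)
qed

text \<open>
  The divergence is inverted for data on \<open>P\<close>, but the fields may use all of \<open>\<Omega>\<close>: the construction on a square
  needs room around the support of the data.
\<close>

definition solvable_on :: "(real^2) set \<Rightarrow> (real^2) set \<Rightarrow> bool" where
  "solvable_on \<Omega> P \<longleftrightarrow> P \<in> lmeasurable \<and> (\<exists>K\<ge>0. \<forall>q. square_integrable UNIV q \<longrightarrow> (\<forall>x. x \<notin> P \<longrightarrow> q x = 0) \<longrightarrow>
     integral\<^sup>L lebesgue q = 0 \<longrightarrow> div_approx \<Omega> (K * L2_norm UNIV q) q)"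

lemma square_integrable_supported:
  fixes h :: "real^2 \<Rightarrow> real"
  assumes P: "P \<in> lmeasurable" and h: "square_integrable UNIV h" "\<And>x. x \<notin> P \<Longrightarrow> h x = 0"
  shows "integrable lebesgue h" "\<bar>integral\<^sup>L lebesgue h\<bar> \<le> sqrt (measure lebesgue P) * L2_norm UNIV h"
proof -
  have su: "P \<in> sets lebesgue" using P by auto
  have e: "(\<lambda>x. if x \<in> P then h x else 0) = h" using h(2) by auto
  have s: "square_integrable P h" using square_integrable_restrict_UNIV[OF su, of h] h(1) e by simp
  show "integrable lebesgue h"
    using Lebesgue_Measure.integrable_restrict_UNIV[OF su, of h] square_integrable_imp_integrable[OF P s] e by simp
  show "\<bar>integral\<^sup>L lebesgue h\<bar> \<le> sqrt (measure lebesgue P) * L2_norm UNIV h"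
    using Lebesgue_Measure.integral_restrict_UNIV[OF su, of h] integral_le_L2_norm[OF P s]
      L2_norm_restrict_UNIV[OF su, of h] e by simp
qed

lemma affine_image_eq:
  assumes "A ** B = mat 1" "B ** A = mat (1::real)"
  shows "(\<lambda>x. c + A *v x) ` S = {y. B *v (y - c) \<in> S}"
proof -
  have "y \<in> (\<lambda>x. c + A *v x) ` S" if "B *v (y - c) \<in> S" for y
    using that by (intro image_eqI[of _ _ "B *v (y - c)"]) (auto simp: matrix_vector_mul_assoc assms)
  then show ?thesis by (auto simp: matrix_vector_mul_assoc assms)
qed

text \<open>
  With the Piola transform \<open>w = A v (A\<^sup>-\<^sup>1 (y - c))\<close> the gradient becomes \<open>A ** G ** A\<^sup>-\<^sup>1\<close>, and the trace is invariant
  under conjugation.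
\<close>

lemma parallelogram_solvable:
  fixes A B :: "real^2^2"
  assumes AB: "A ** B = mat 1" "B ** A = mat 1" and sub: "(\<lambda>x. c + A *v x) ` open_square \<subseteq> \<Omega>"
  shows "solvable_on \<Omega> ((\<lambda>x. c + A *v x) ` unit_square)"
  unfolding solvable_on_def
proof
  show lm: "(\<lambda>x. c + A *v x) ` unit_square \<in> lmeasurable"
  proof -
    have "compact ((\<lambda>x. c + A *v x) ` unit_square)" unfolding unit_square_cbox
      by (intro compact_continuous_image continuous_intros) auto
    then show ?thesis by (rule lmeasurable_compact)
  qed
  define D where "D = sqrt \<bar>det A\<bar>"
  have d: "det A \<noteq> 0" using det_mul[of A B] AB by (metis det_I mult_zero_left zero_neq_one)
  then have D: "D > 0" by (simp add: D_def)
  obtain L where L: "L > 0" "\<And>G. norm (A ** (G :: real^2^2) ** B) \<le> L * norm G"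
    using linear_bounded_pos[OF linear_conjugation[of A B]] by blast
  define K where "K = L * 10^7"
  show "\<exists>K\<ge>0. \<forall>q. square_integrable UNIV q \<longrightarrow> (\<forall>x. x \<notin> (\<lambda>x. c + A *v x) ` unit_square \<longrightarrow> q x = 0) \<longrightarrow>
     integral\<^sup>L lebesgue q = 0 \<longrightarrow> div_approx \<Omega> (K * L2_norm UNIV q) q"
  proof (intro exI[of _ K] conjI allI impI)
    show "0 \<le> K" using L by (simp add: K_def)
    fix q :: "real^2 \<Rightarrow> real"
    assume q: "square_integrable UNIV q" and q0: "\<forall>x. x \<notin> (\<lambda>x. c + A *v x) ` unit_square \<longrightarrow> q x = 0"
      and qint: "integral\<^sup>L lebesgue q = 0"
    define p where "p = (\<lambda>x. q (c + A *v x))"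
    have qi: "integrable lebesgue q" by (rule square_integrable_supported(1)[OF lm q]) (use q0 in auto)
    have q2: "integrable lebesgue (\<lambda>x. (norm (q x))\<^sup>2)" using square_integrable_integrable[OF q] by (simp add: lebesgue_on_UNIV_eq)
    have p: "square_integrable UNIV p"
      unfolding square_integrable_def lebesgue_on_UNIV_eq p_def
      using lebesgue_affine(1)[OF AB qi, of c] lebesgue_affine(1)[OF AB q2, of c] by auto
    have p0: "p x = 0" if "x \<notin> unit_square" for x
    proof -
      have "c + A *v x \<notin> (\<lambda>x. c + A *v x) ` unit_square"
        unfolding affine_image_eq[OF AB] using that by (simp add: matrix_vector_mul_assoc AB)
      then show ?thesis using q0 by (simp add: p_def)
    qed
    have pint: "integral\<^sup>L lebesgue p = 0"
      using lebesgue_affine(2)[OF AB qi, of c] qint d by (simp add: p_def)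
    have pn: "D * L2_norm UNIV p = L2_norm UNIV q"
      unfolding D_def p_def by (rule L2_norm_affine[OF AB q2])
    show "div_approx \<Omega> (K * L2_norm UNIV q) q"
      unfolding div_approx_def
    proof (intro allI impI)
      fix \<epsilon> :: real assume \<epsilon>: "\<epsilon> > 0"
      (* makes both D * \<delta> and L * D * \<delta> at most \<epsilon> *)
      define \<delta> where "\<delta> = \<epsilon> / (D * (1 + L))"
      have \<delta>: "\<delta> > 0" using \<epsilon> D L by (simp add: \<delta>_def)
      have "D * \<delta> = \<epsilon> / (1 + L)" "L * D * \<delta> = L * \<epsilon> / (1 + L)" using D by (simp_all add: \<delta>_def)
      then have \<delta>': "D * \<delta> \<le> \<epsilon>" "L * D * \<delta> \<le> \<epsilon>"
        using \<epsilon> L by (simp_all add: pos_divide_le_eq algebra_simps)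
      obtain v G where v: "field_on open_square v G" "L2_norm UNIV (\<lambda>x. trace (G x) - p x) \<le> \<delta>"
          "L2_norm UNIV G \<le> 10^7 * L2_norm UNIV p + \<delta>"
        using unit_square_solver[OF p p0 pint] \<delta> unfolding div_approx_def by meson
      define S where "S = (\<lambda>y. B *v (y - c))"
      have ST: "S (c + A *v x) = x" "c + A *v S y = y" for x y
        by (simp_all add: S_def matrix_vector_mul_assoc AB)
      have cS: "continuous_on UNIV S" unfolding S_def by (intro continuous_intros)
      define w where "w = (\<lambda>y. A *v v (S y))"
      define H where "H = (\<lambda>y. A ** G (S y) ** B)"
      have vp: "continuous_on UNIV v" "G \<in> borel_measurable borel" "bounded (range G)"
        "\<And>a b. ((\<lambda>t. G (a + t *\<^sub>R (b - a)) *v (b - a)) has_integral (v b - v a)) {0..1}"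
        "\<And>x. x \<notin> open_square \<Longrightarrow> v x = 0 \<and> G x = 0"
        using v(1) by (auto simp: field_on_def has_line_gradient_def)
      have bsq: "bounded open_square" unfolding open_square_box by auto
      have bdd: "bounded ((\<lambda>x. c + A *v x) ` open_square)"
        by (rule bounded_subset[of "(\<lambda>x. c + A *v x) ` cbox 0 (vec2 2 2)"])
          (auto simp: open_square_box box_subset_cbox[THEN subsetD] intro!: compact_imp_bounded compact_continuous_image continuous_intros image_mono)
      have f: "field_on ((\<lambda>x. c + A *v x) ` open_square) w H"
        unfolding field_on_def has_line_gradient_def
      proof (intro conjI allI impI)
        show "continuous_on UNIV w" unfolding w_def
          by (intro continuous_on_compose2[OF _ continuous_on_compose2[OF vp(1) cS]] continuous_intros) auto
        have "(\<lambda>G. A ** (G :: real^2^2) ** B) \<in> borel_measurable borel"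
          by (intro borel_measurable_continuous_onI linear_continuous_on linear_conv_bounded_linear[THEN iffD1] linear_conjugation)
        then show "H \<in> borel_measurable borel" unfolding H_def
          using measurable_compose[OF measurable_compose[OF borel_measurable_continuous_onI[OF cS] vp(2)]] by blast
        obtain M where "\<And>x. norm (G x) \<le> M" using vp(3) unfolding bounded_iff by auto
        then have "norm (H y) \<le> L * M" for y unfolding H_def using L by (meson mult_left_mono order_trans less_imp_le)
        then show "bounded (range H)" unfolding bounded_iff by auto
        fix a b
        have e: "S (a + t *\<^sub>R (b - a)) = S a + t *\<^sub>R (S b - S a)" for t
          by (simp add: S_def matrix_vector_mult_diff_distrib matrix_vector_right_distrib matrix_vector_mult_scaleR algebra_simps)
        have e2: "B *v (b - a) = S b - S a" by (simp add: S_def matrix_vector_mult_diff_distrib)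
        have "((\<lambda>t. A *v (G (S a + t *\<^sub>R (S b - S a)) *v (S b - S a))) has_integral A *v (v (S b) - v (S a))) {0..1}"
          using has_integral_linear[OF vp(4) matrix_vector_mul_bounded_linear[of A], unfolded o_def] .
        then show "((\<lambda>t. H (a + t *\<^sub>R (b - a)) *v (b - a)) has_integral (w b - w a)) {0..1}"
          unfolding H_def w_def e matrix_vector_mul_assoc[symmetric] e2
          by (simp only: matrix_vector_mult_diff_distrib)
      next
        fix y assume "y \<notin> (\<lambda>x. c + A *v x) ` open_square"
        then have "S y \<notin> open_square" unfolding affine_image_eq[OF AB] S_def by simp
        then show "w y = 0" "H y = 0" using vp(5) by (auto simp: w_def H_def matrix_vector_mult_0_right)
      qed
      note sG = field_on_si[OF bsq v(1)] and sH = field_on_si[OF bdd f]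
      have trH: "trace (H (c + A *v x)) = trace (G x)" for x
        unfolding H_def ST trace_mul_sym[of "A ** G x" B] by (simp add: matrix_mul_assoc AB)
      have i1: "integrable lebesgue (\<lambda>x. (norm (trace (H x) - q x))\<^sup>2)"
        using square_integrable_integrable[OF square_integrable_diff[OF sH(2) q]] by (simp add: lebesgue_on_UNIV_eq)
      have i2: "integrable lebesgue (\<lambda>x. (norm (H x))\<^sup>2)"
        using square_integrable_integrable[OF sH(1)] by (simp add: lebesgue_on_UNIV_eq)
      have "L2_norm UNIV (\<lambda>x. trace (H x) - q x) = D * L2_norm UNIV (\<lambda>x. trace (G x) - p x)"
        using L2_norm_affine[OF AB i1, of c] by (simp add: D_def trH p_def)
      also have "\<dots> \<le> D * \<delta>" using v(2) D by simp
      also have "\<dots> \<le> \<epsilon>" by (rule \<delta>')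
      finally have r1: "L2_norm UNIV (\<lambda>x. trace (H x) - q x) \<le> \<epsilon>" .
      have "L2_norm UNIV H = D * L2_norm UNIV (\<lambda>x. A ** G x ** B)"
        using L2_norm_affine[OF AB i2, of c] by (simp add: D_def H_def ST)
      also have "\<dots> \<le> D * L2_norm UNIV (\<lambda>x. L *\<^sub>R G x)"
        using D L by (intro mult_left_mono L2_norm_mono square_integrable_scaleR sG) auto
      also have "\<dots> = L * D * L2_norm UNIV G" using L by (simp add: L2_norm_scaleR)
      also have "\<dots> \<le> L * D * (10^7 * L2_norm UNIV p + \<delta>)" using v(3) L D by (intro mult_left_mono) auto
      also have "\<dots> = K * (D * L2_norm UNIV p) + L * D * \<delta>" by (simp add: K_def algebra_simps)
      also have "\<dots> \<le> K * L2_norm UNIV q + \<epsilon>" unfolding pn using \<delta>' by simp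
      finally show "\<exists>v G. field_on \<Omega> v G \<and> L2_norm UNIV (\<lambda>x. trace (G x) - q x) \<le> \<epsilon> \<and> L2_norm UNIV G \<le> K * L2_norm UNIV q + \<epsilon>"
        using r1 field_on_mono[OF f sub] by blast
    qed
  qed
qed

section \<open>Transport of mass and unions\<close>

definition uniform_density :: "(real^2) set \<Rightarrow> real^2 \<Rightarrow> real" where
  "uniform_density A x = indicat_real A x / measure lebesgue A"

lemma uniform_density:
  assumes A: "A \<in> lmeasurable" "measure lebesgue A > 0"
  shows "square_integrable UNIV (uniform_density A)" "integral\<^sup>L lebesgue (uniform_density A) = 1"
    "x \<notin> A \<Longrightarrow> uniform_density A x = 0"
proof -
  have e: "uniform_density A = (\<lambda>x. if x \<in> A then 1 / measure lebesgue A else 0)"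
    by (auto simp: uniform_density_def)
  have "square_integrable A (\<lambda>x. 1 / measure lebesgue A)" by (rule square_integrable_bounded[OF A(1)]) auto
  then show "square_integrable UNIV (uniform_density A)" unfolding e
    using square_integrable_restrict_UNIV[of A "\<lambda>x. 1 / measure lebesgue A"] A by auto
  show "integral\<^sup>L lebesgue (uniform_density A) = 1"
    unfolding e using A by (subst Lebesgue_Measure.integral_restrict_UNIV) (auto simp: measure_restrict_space)
  show "x \<notin> A \<Longrightarrow> uniform_density A x = 0" by (simp add: uniform_density_def)
qed

text \<open>
  Unit masses spread over small sets near \<open>x\<close> and near \<open>y\<close> differ by a divergence. The sets are arbitrary so that
  the relation is transitive; the constant may depend on them.
\<close>

definition mass_transport :: "(real^2) set \<Rightarrow> real^2 \<Rightarrow> real^2 \<Rightarrow> bool" where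
  "mass_transport \<Omega> x y \<longleftrightarrow> (\<exists>\<delta>>0. \<forall>A B. A \<in> lmeasurable \<longrightarrow> B \<in> lmeasurable \<longrightarrow>
     measure lebesgue A > 0 \<longrightarrow> measure lebesgue B > 0 \<longrightarrow> A \<subseteq> ball x \<delta> \<longrightarrow> B \<subseteq> ball y \<delta> \<longrightarrow>
     (\<exists>C\<ge>0. div_approx \<Omega> C (\<lambda>z. uniform_density A z - uniform_density B z)))"

lemma mass_transport_sym:
  assumes "mass_transport \<Omega> x y" shows "mass_transport \<Omega> y x"
proof -
  obtain \<delta> where \<delta>: "\<delta> > 0" and *: "\<And>A B. A \<in> lmeasurable \<Longrightarrow> B \<in> lmeasurable \<Longrightarrow>
     measure lebesgue A > 0 \<Longrightarrow> measure lebesgue B > 0 \<Longrightarrow> A \<subseteq> ball x \<delta> \<Longrightarrow> B \<subseteq> ball y \<delta> \<Longrightarrow>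
     (\<exists>C\<ge>0. div_approx \<Omega> C (\<lambda>z. uniform_density A z - uniform_density B z))"
    using assms unfolding mass_transport_def by blast
  show ?thesis unfolding mass_transport_def
  proof (rule exI[of _ \<delta>], intro conjI allI impI \<delta>)
    fix A B :: "(real^2) set"
    assume AB: "A \<in> lmeasurable" "B \<in> lmeasurable" "measure lebesgue A > 0" "measure lebesgue B > 0"
      "A \<subseteq> ball y \<delta>" "B \<subseteq> ball x \<delta>"
    then obtain C where "C \<ge> 0" "div_approx \<Omega> C (\<lambda>z. uniform_density B z - uniform_density A z)"
      using *[of B A] by blast
    then show "\<exists>C\<ge>0. div_approx \<Omega> C (\<lambda>z. uniform_density A z - uniform_density B z)"
      using div_approx_cmult[of \<Omega> C "\<lambda>z. uniform_density B z - uniform_density A z" "-1"] by auto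
  qed
qed

lemma mass_transport_trans:
  assumes \<Omega>: "bounded \<Omega>" and "mass_transport \<Omega> x y" "mass_transport \<Omega> y z" shows "mass_transport \<Omega> x z"
proof -
  obtain \<delta> where \<delta>: "\<delta> > 0" and 1: "\<And>A B. A \<in> lmeasurable \<Longrightarrow> B \<in> lmeasurable \<Longrightarrow>
     measure lebesgue A > 0 \<Longrightarrow> measure lebesgue B > 0 \<Longrightarrow> A \<subseteq> ball x \<delta> \<Longrightarrow> B \<subseteq> ball y \<delta> \<Longrightarrow>
     (\<exists>C\<ge>0. div_approx \<Omega> C (\<lambda>z. uniform_density A z - uniform_density B z))"
    using assms(2) unfolding mass_transport_def by blast
  obtain \<eta> where \<eta>: "\<eta> > 0" and 2: "\<And>A B. A \<in> lmeasurable \<Longrightarrow> B \<in> lmeasurable \<Longrightarrow>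
     measure lebesgue A > 0 \<Longrightarrow> measure lebesgue B > 0 \<Longrightarrow> A \<subseteq> ball y \<eta> \<Longrightarrow> B \<subseteq> ball z \<eta> \<Longrightarrow>
     (\<exists>C\<ge>0. div_approx \<Omega> C (\<lambda>z. uniform_density A z - uniform_density B z))"
    using assms(3) unfolding mass_transport_def by blast
  define M where "M = ball y (min \<delta> \<eta>)"
  have M: "M \<in> lmeasurable" "measure lebesgue M > 0"
    using \<delta> \<eta> by (auto simp: M_def measure_completion content_ball_pos)
  show ?thesis unfolding mass_transport_def
  proof (rule exI[of _ "min \<delta> \<eta>"], intro conjI allI impI)
    show "0 < min \<delta> \<eta>" using \<delta> \<eta> by simp
    fix A B :: "(real^2) set"
    assume AB: "A \<in> lmeasurable" "B \<in> lmeasurable" "measure lebesgue A > 0" "measure lebesgue B > 0"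
      "A \<subseteq> ball x (min \<delta> \<eta>)" "B \<subseteq> ball z (min \<delta> \<eta>)"
    have "A \<subseteq> ball x \<delta>" "M \<subseteq> ball y \<delta>" "M \<subseteq> ball y \<eta>" "B \<subseteq> ball z \<eta>" using AB(5,6) by (auto simp: M_def)
    then obtain C D where C: "C \<ge> 0" "div_approx \<Omega> C (\<lambda>z. uniform_density A z - uniform_density M z)"
      and D: "D \<ge> 0" "div_approx \<Omega> D (\<lambda>z. uniform_density M z - uniform_density B z)"
      using 1[OF AB(1) M(1) AB(3) M(2)] 2[OF M(1) AB(2) M(2) AB(4)] by blast
    have "div_approx \<Omega> (C + D) (\<lambda>z. (uniform_density A z - uniform_density M z) + (uniform_density M z - uniform_density B z))"
      by (intro div_approx_add[OF \<Omega> _ _ C(2) D(2)] square_integrable_diff uniform_density AB M)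
    then show "\<exists>C\<ge>0. div_approx \<Omega> C (\<lambda>z. uniform_density A z - uniform_density B z)"
      using C D by (auto intro: exI[of _ "C + D"])
  qed
qed

lemma solvable_mass_transport:
  assumes "solvable_on \<Omega> P" "A \<in> lmeasurable" "B \<in> lmeasurable" "measure lebesgue A > 0" "measure lebesgue B > 0"
    "A \<subseteq> P" "B \<subseteq> P"
  shows "\<exists>C\<ge>0. div_approx \<Omega> C (\<lambda>z. uniform_density A z - uniform_density B z)"
proof -
  obtain K where K: "K \<ge> 0" "\<And>q. square_integrable UNIV q \<Longrightarrow> (\<forall>x. x \<notin> P \<longrightarrow> q x = 0) \<Longrightarrow>
     integral\<^sup>L lebesgue q = 0 \<Longrightarrow> div_approx \<Omega> (K * L2_norm UNIV q) q"
    using assms(1) unfolding solvable_on_def by blast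
  define q where "q = (\<lambda>z. uniform_density A z - uniform_density B z)"
  note u = uniform_density[OF assms(2,4)] uniform_density[OF assms(3,5)]
  have "square_integrable UNIV q" unfolding q_def by (intro square_integrable_diff u)
  moreover have "q x = 0" if "x \<notin> P" for x
  proof -
    have "x \<notin> A" "x \<notin> B" using that assms(6,7) by auto
    then show ?thesis using u(3)[of x] u(6)[of x] by (simp add: q_def)
  qed
  then have "\<forall>x. x \<notin> P \<longrightarrow> q x = 0" by blast
  moreover have "integral\<^sup>L lebesgue q = 0"
    unfolding q_def using u(2,5) square_integrable_supported(1)[OF assms(2) u(1,3)] square_integrable_supported(1)[OF assms(3) u(4,6)] by simp
  ultimately have "div_approx \<Omega> (K * L2_norm UNIV q) q" by (rule K(2))
  then show ?thesis using K(1) L2_norm_nonneg[of UNIV q] unfolding q_def by (auto intro!: exI[of _ "K * _"])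
qed

lemma ball_solvable:
  assumes "open \<Omega>" "x \<in> \<Omega>"
  shows "\<exists>P. solvable_on \<Omega> P \<and> x \<in> interior P"
proof -
  obtain r where r: "r > 0" "ball x r \<subseteq> \<Omega>" using assms by (auto simp: open_contains_ball)
  (* a square of side s around x, and the double square, stay in the ball of radius r *)
  define s where "s = r / 4"
  have s: "s > 0" using r by (simp add: s_def)
  define A B :: "real^2^2" where "A = s *\<^sub>R mat 1" and "B = (1 / s) *\<^sub>R mat 1"
  have AB: "A ** B = mat 1" "B ** A = mat 1" using s
    by (simp_all add: A_def B_def matrix_matrix_mult_def mat_def vec_eq_iff sum_2 forall_2)
  define c where "c = x - s *\<^sub>R vec2 (1/2) (1/2)"
  have T: "c + A *v y = x + s *\<^sub>R (y - vec2 (1/2) (1/2))" for y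
    by (simp add: A_def c_def scaleR_matrix_vector_assoc[symmetric] algebra_simps)
  have "(\<lambda>y. c + A *v y) ` open_square \<subseteq> ball x r"
  proof clarify
    fix y assume y: "y \<in> open_square"
    define w where "w = y - vec2 (1/2) (1/2)"
    have "0 < y $ 1" "y $ 1 < 2" "0 < y $ 2" "y $ 2 < 2" using y by (auto simp: open_square_def)
    then have "\<bar>w $ 1\<bar> < 3/2" "\<bar>w $ 2\<bar> < 3/2" unfolding w_def vector_minus_component vec2_nth by linarith+
    then have "norm w < 4" using norm_le_l1_cart[of w] by (simp add: sum_2)
    then have "s * norm w < r" using s by (simp add: s_def)
    then show "c + A *v y \<in> ball x r" unfolding T w_def[symmetric] using s by (simp add: dist_norm)
  qed
  then have sub: "(\<lambda>y. c + A *v y) ` open_square \<subseteq> \<Omega>" using r by auto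
  let ?P = "(\<lambda>y. c + A *v y) ` unit_square"
  have "ball x (s / 4) \<subseteq> ?P"
  proof
    fix z assume "z \<in> ball x (s / 4)"
    then have z: "norm (z - x) < s / 4" by (simp add: dist_norm norm_minus_commute)
    have "\<bar>(z - x) $ i\<bar> < s / 4" for i using component_le_norm_cart[of "z - x" i] z by linarith
    then have "\<bar>(z - x) $ i\<bar> / s < 1/4" for i
      using s by (simp add: pos_divide_less_eq)
    then have e: "\<bar>(1 / s) * (z - x) $ i\<bar> < 1/4" for i
      using s by (simp add: abs_mult)
    have "vec2 (1/2) (1/2) + (1 / s) *\<^sub>R (z - x) \<in> unit_square"
      using e[of 1] e[of 2] unfolding unit_square_def mem_Collect_eq vector_add_component vector_scaleR_component vec2_nth real_scaleR_def
      by (intro conjI; linarith)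
    moreover have "c + A *v (vec2 (1/2) (1/2) + (1 / s) *\<^sub>R (z - x)) = z" unfolding T using s by simp
    ultimately show "z \<in> ?P" by (metis image_eqI)
  qed
  then have "x \<in> interior ?P" using s by (intro interiorI[of "ball x (s/4)"]) auto
  then show ?thesis using parallelogram_solvable[OF AB sub] by blast
qed

text \<open>
  The relation is an equivalence, and each class is open since a point lies inside a solvable square; so there is
  only one class in a connected set.
\<close>

lemma mass_transport_connected:
  assumes \<Omega>: "open \<Omega>" "connected \<Omega>" "bounded \<Omega>" and "x \<in> \<Omega>" "y \<in> \<Omega>"
  shows "mass_transport \<Omega> x y"
proof (rule connected_equivalence_relation[OF \<Omega>(2) assms(4,5)])
  show "mass_transport \<Omega> b a" if "mass_transport \<Omega> a b" for a b using mass_transport_sym[OF that] .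
  show "mass_transport \<Omega> a c" if "mass_transport \<Omega> a b" "mass_transport \<Omega> b c" for a b c
    using mass_transport_trans[OF \<Omega>(3) that] .
  fix a assume a: "a \<in> \<Omega>"
  obtain P where P: "solvable_on \<Omega> P" "a \<in> interior P" using ball_solvable[OF \<Omega>(1) a] by blast
  have "mass_transport \<Omega> a b" if b: "b \<in> interior P" for b
  proof -
    obtain d where d: "d > 0" "ball a d \<subseteq> interior P" using P(2) by (meson open_interior open_contains_ball)
    obtain e where e: "e > 0" "ball b e \<subseteq> interior P" using b by (meson open_interior open_contains_ball)
    show ?thesis unfolding mass_transport_def
    proof (rule exI[of _ "min d e"], intro conjI allI impI)
      show "0 < min d e" using d e by simp
      fix A B :: "(real^2) set"
      assume AB: "A \<in> lmeasurable" "B \<in> lmeasurable" "measure lebesgue A > 0" "measure lebesgue B > 0"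
      "A \<subseteq> ball a (min d e)" "B \<subseteq> ball b (min d e)"
      have "A \<subseteq> ball a d" "B \<subseteq> ball b e" using AB(5,6) by auto
      then have "A \<subseteq> P" "B \<subseteq> P" using d e interior_subset by blast+
      then show "\<exists>C\<ge>0. div_approx \<Omega> C (\<lambda>z. uniform_density A z - uniform_density B z)"
        by (rule solvable_mass_transport[OF P(1) AB(1-4)])
    qed
  qed
  then show "\<exists>T. openin (top_of_set \<Omega>) T \<and> a \<in> T \<and> (\<forall>x\<in>T. mass_transport \<Omega> a x)"
    using P(2) a by (intro exI[of _ "\<Omega> \<inter> interior P"]) (auto intro: openin_open_Int)
qed

text \<open>
  The datum is split into its parts on \<open>P\<close> and on the rest. Their mean values \<open>m\<close> and \<open>- m\<close> are compensated by
  multiples of uniform densities inside the two sets, and the difference of these densities is a divergence because mass can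
  be transported in \<open>\<Omega>\<close>. No overlap of the two sets is required.
\<close>

lemma solvable_on_Un:
  assumes \<Omega>: "open \<Omega>" "connected \<Omega>" "bounded \<Omega>"
    and P: "solvable_on \<Omega> P" "interior P \<inter> \<Omega> \<noteq> {}" and U: "solvable_on \<Omega> U" "interior U \<inter> \<Omega> \<noteq> {}"
  shows "solvable_on \<Omega> (P \<union> U)"
proof -
  obtain x y where x: "x \<in> interior P" "x \<in> \<Omega>" and y: "y \<in> interior U" "y \<in> \<Omega>" using P(2) U(2) by blast
  obtain \<delta> where \<delta>: "\<delta> > 0" and tr: "\<And>A B. A \<in> lmeasurable \<Longrightarrow> B \<in> lmeasurable \<Longrightarrow>
     measure lebesgue A > 0 \<Longrightarrow> measure lebesgue B > 0 \<Longrightarrow> A \<subseteq> ball x \<delta> \<Longrightarrow> B \<subseteq> ball y \<delta> \<Longrightarrow>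
     (\<exists>C\<ge>0. div_approx \<Omega> C (\<lambda>z. uniform_density A z - uniform_density B z))"
    using mass_transport_connected[OF \<Omega> x(2) y(2)] unfolding mass_transport_def by blast
  obtain d where d: "d > 0" "ball x d \<subseteq> interior P" using x(1) by (meson open_interior open_contains_ball)
  obtain e where e: "e > 0" "ball y e \<subseteq> interior U" using y(1) by (meson open_interior open_contains_ball)
  define A B where "A = ball x (min \<delta> d)" and "B = ball y (min \<delta> e)"
  have A: "A \<in> lmeasurable" "measure lebesgue A > 0" and B: "B \<in> lmeasurable" "measure lebesgue B > 0"
    using \<delta> d e by (auto simp: A_def B_def measure_completion content_ball_pos)
  have AP: "A \<subseteq> P" "B \<subseteq> U" using d e interior_subset by (fastforce simp: A_def B_def)+
  obtain C0 where C0: "C0 \<ge> 0" "div_approx \<Omega> C0 (\<lambda>z. uniform_density A z - uniform_density B z)"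
    using tr[OF A(1) B(1) A(2) B(2)] subset_ball[of "min \<delta> d" \<delta> x] subset_ball[of "min \<delta> e" \<delta> y]
    unfolding A_def B_def by auto
  define a where "a = uniform_density A"
  define b where "b = uniform_density B"
  note ua = uniform_density[OF A, folded a_def] and ub = uniform_density[OF B, folded b_def]
  obtain K where K: "K \<ge> 0" "\<And>q. square_integrable UNIV q \<Longrightarrow> (\<forall>x. x \<notin> P \<longrightarrow> q x = 0) \<Longrightarrow>
     integral\<^sup>L lebesgue q = 0 \<Longrightarrow> div_approx \<Omega> (K * L2_norm UNIV q) q" and Pm: "P \<in> lmeasurable"
    using P(1) unfolding solvable_on_def by blast
  obtain L where L: "L \<ge> 0" "\<And>q. square_integrable UNIV q \<Longrightarrow> (\<forall>x. x \<notin> U \<longrightarrow> q x = 0) \<Longrightarrow>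
     integral\<^sup>L lebesgue q = 0 \<Longrightarrow> div_approx \<Omega> (L * L2_norm UNIV q) q" and Um: "U \<in> lmeasurable"
    using U(1) unfolding solvable_on_def by blast
  define s where "s = sqrt (measure lebesgue P)"
  define Z where "Z = K * (1 + s * L2_norm UNIV a) + L * (1 + s * L2_norm UNIV b) + s * C0"
  have s: "s \<ge> 0" by (simp add: s_def)
  have "Z \<ge> 0" using K L C0 s by (simp add: Z_def L2_norm_nonneg)
  show ?thesis unfolding solvable_on_def
  proof (intro conjI exI[of _ Z] allI impI)
    show "P \<union> U \<in> lmeasurable" using Pm Um by (rule fmeasurable.Un)
    show "Z \<ge> 0" by fact
    fix q :: "real^2 \<Rightarrow> real" assume q: "square_integrable UNIV q" "\<forall>x. x \<notin> P \<union> U \<longrightarrow> q x = 0" "integral\<^sup>L lebesgue q = 0"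
    define q1 where "q1 = (\<lambda>x. if x \<in> P then q x else 0)"
    have Ps: "P \<in> sets lebesgue" using Pm by auto
    have q1: "square_integrable UNIV q1" unfolding q1_def
      using square_integrable_restrict_UNIV[OF Ps, of q] square_integrable_subset[OF q(1)] Ps by auto
    define q2 where "q2 = (\<lambda>x. q x - q1 x)"
    have q2: "square_integrable UNIV q2" unfolding q2_def by (intro square_integrable_diff q q1)
    have n1: "L2_norm UNIV q1 \<le> L2_norm UNIV q" by (rule L2_norm_mono[OF q(1)]) (simp add: q1_def)
    have n2: "L2_norm UNIV q2 \<le> L2_norm UNIV q" by (rule L2_norm_mono[OF q(1)]) (simp add: q1_def q2_def)
    have z1: "q1 x = 0" if "x \<notin> P" for x using that by (simp add: q1_def)
    have z2: "q2 x = 0" if "x \<notin> U" for x using that q(2) by (auto simp: q1_def q2_def)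
    define m where "m = integral\<^sup>L lebesgue q1"
    have m: "\<bar>m\<bar> \<le> s * L2_norm UNIV q"
      using square_integrable_supported(2)[OF Pm q1 z1] mult_left_mono[OF n1 s] by (simp add: m_def s_def)
    note i = square_integrable_supported(1)[OF Pm q1 z1] square_integrable_supported(1)[OF Um q2 z2]
    have qi: "integrable lebesgue q"
      by (rule square_integrable_supported(1)[of "P \<union> U"]) (use q Pm Um in \<open>auto intro: fmeasurable.Un\<close>)
    have m2: "integral\<^sup>L lebesgue q2 = - m"
      unfolding q2_def m_def using qi i(1) q(3) by simp
    have ai: "integrable lebesgue a" "integrable lebesgue b"
      using square_integrable_supported(1)[OF A(1) ua(1,3)] square_integrable_supported(1)[OF B(1) ub(1,3)] by auto
    have d1: "div_approx \<Omega> (K * L2_norm UNIV (\<lambda>x. q1 x - m * a x)) (\<lambda>x. q1 x - m * a x)"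
    proof (rule K(2))
      show "square_integrable UNIV (\<lambda>x. q1 x - m * a x)" by (intro square_integrable_diff square_integrable_mult q1 ua)
      show "\<forall>x. x \<notin> P \<longrightarrow> q1 x - m * a x = 0" using z1 ua(3) AP(1) by auto
      show "integral\<^sup>L lebesgue (\<lambda>x. q1 x - m * a x) = 0" using i(1) ai ua(2) by (simp add: m_def)
    qed
    have d2: "div_approx \<Omega> (L * L2_norm UNIV (\<lambda>x. q2 x + m * b x)) (\<lambda>x. q2 x + m * b x)"
    proof (rule L(2))
      show "square_integrable UNIV (\<lambda>x. q2 x + m * b x)" by (intro square_integrable_add square_integrable_mult q2 ub)
      show "\<forall>x. x \<notin> U \<longrightarrow> q2 x + m * b x = 0" using z2 ub(3) AP(2) by auto
      show "integral\<^sup>L lebesgue (\<lambda>x. q2 x + m * b x) = 0" using i(2) ai ub(2) m2 by simp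
    qed
    have d3: "div_approx \<Omega> (\<bar>m\<bar> * C0) (\<lambda>x. m * (a x - b x))"
      using div_approx_cmult[OF C0(2), of m] by (simp add: a_def b_def)
    have "div_approx \<Omega> (K * L2_norm UNIV (\<lambda>x. q1 x - m * a x) + L * L2_norm UNIV (\<lambda>x. q2 x + m * b x) + \<bar>m\<bar> * C0)
      (\<lambda>x. ((q1 x - m * a x) + (q2 x + m * b x)) + m * (a x - b x))"
      by (intro div_approx_add[OF \<Omega>(3)] d1 d2 d3 square_integrable_add square_integrable_diff square_integrable_mult q1 q2 ua ub)
    moreover have "(\<lambda>x. ((q1 x - m * a x) + (q2 x + m * b x)) + m * (a x - b x)) = q"
      by (auto simp: q2_def algebra_simps)
    moreover have "K * L2_norm UNIV (\<lambda>x. q1 x - m * a x) + L * L2_norm UNIV (\<lambda>x. q2 x + m * b x) + \<bar>m\<bar> * C0 \<le> Z * L2_norm UNIV q"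
    proof -
      have "L2_norm UNIV (\<lambda>x. q1 x - m * a x) \<le> L2_norm UNIV q1 + \<bar>m\<bar> * L2_norm UNIV a"
        using L2_norm_diff[OF q1 square_integrable_mult[OF ua(1)], of m] by (simp add: L2_norm_mult)
      also have "\<dots> \<le> L2_norm UNIV q + s * L2_norm UNIV q * L2_norm UNIV a"
        using n1 m by (intro add_mono mult_right_mono) (auto simp: L2_norm_nonneg)
      finally have e1: "K * L2_norm UNIV (\<lambda>x. q1 x - m * a x) \<le> K * (L2_norm UNIV q + s * L2_norm UNIV q * L2_norm UNIV a)"
        using K(1) by (rule mult_left_mono)
      have "L2_norm UNIV (\<lambda>x. q2 x + m * b x) \<le> L2_norm UNIV q2 + \<bar>m\<bar> * L2_norm UNIV b"
        using L2_norm_triangle[OF q2 square_integrable_mult[OF ub(1)], of m] by (simp add: L2_norm_mult)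
      also have "\<dots> \<le> L2_norm UNIV q + s * L2_norm UNIV q * L2_norm UNIV b"
        using n2 m by (intro add_mono mult_right_mono) (auto simp: L2_norm_nonneg)
      finally have e2: "L * L2_norm UNIV (\<lambda>x. q2 x + m * b x) \<le> L * (L2_norm UNIV q + s * L2_norm UNIV q * L2_norm UNIV b)"
        using L(1) by (rule mult_left_mono)
      have "\<bar>m\<bar> * C0 \<le> s * L2_norm UNIV q * C0" using m C0 by (intro mult_right_mono)
      then show ?thesis using e1 e2 by (simp add: Z_def algebra_simps)
    qed
    ultimately show "div_approx \<Omega> (Z * L2_norm UNIV q) q"
      using div_approx_mono[of \<Omega> _ q \<Omega>] by simp
  qed
qed

lemma solvable_on_Union:
  assumes \<Omega>: "open \<Omega>" "connected \<Omega>" "bounded \<Omega>"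
    and "finite \<P>" "\<P> \<noteq> {}" "\<And>P. P \<in> \<P> \<Longrightarrow> solvable_on \<Omega> P \<and> interior P \<inter> \<Omega> \<noteq> {}"
  shows "solvable_on \<Omega> (\<Union>\<P>) \<and> interior (\<Union>\<P>) \<inter> \<Omega> \<noteq> {}"
  using assms(4-6)
proof (induction \<P> rule: finite_ne_induct)
  case (insert P \<P>)
  then have IH: "solvable_on \<Omega> (\<Union>\<P>)" "interior (\<Union>\<P>) \<inter> \<Omega> \<noteq> {}" and P: "solvable_on \<Omega> P" "interior P \<inter> \<Omega> \<noteq> {}" by auto
  have "interior P \<subseteq> interior (P \<union> \<Union>\<P>)" by (rule interior_mono) auto
  then show ?case using solvable_on_Un[OF \<Omega> P IH] P(2) by auto
qed auto

section \<open>Covering a triangle by parallelograms\<close>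

lemma triangle_point:
  "p \<in> convex hull {a, b, c :: real^2} \<longleftrightarrow> (\<exists>s t. 0 \<le> s \<and> 0 \<le> t \<and> s + t \<le> 1 \<and> p = a + s *\<^sub>R (b - a) + t *\<^sub>R (c - a))"
  unfolding convex_hull_3_alt by auto

text \<open>
  The matrix has the columns \<open>u\<close> and \<open>v\<close>.
\<close>

lemma columns_inverse:
  fixes u v :: "real^2"
  assumes nc: "\<not> collinear {0, u, v}"
  shows "\<exists>B. transpose (vec2 u v) ** B = mat 1 \<and> B ** transpose (vec2 u v) = mat 1"
proof -
  define A :: "real^2^2" where "A = transpose (vec2 u v)"
  have Av: "A *v x = x $ 1 *\<^sub>R u + x $ 2 *\<^sub>R v" for x
    by (simp add: A_def mat2_vector transpose_def vec_eq_iff forall_2 algebra_simps)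
  have "x = y" if "A *v x = A *v y" for x y
  proof (rule ccontr)
    assume "x \<noteq> y"
    define w where "w = x - y"
    have w0: "w $ 1 *\<^sub>R u + w $ 2 *\<^sub>R v = 0"
      using that Av[of w] by (simp add: w_def matrix_vector_mult_diff_distrib)
    have "w \<noteq> 0" using \<open>x \<noteq> y\<close> by (simp add: w_def)
    then have "w $ 1 \<noteq> 0 \<or> w $ 2 \<noteq> 0" by (simp add: vec_eq_iff forall_2)
    then have "collinear {0, u, v}"
    proof
      assume w1: "w $ 1 \<noteq> 0"
      have "w $ 1 *\<^sub>R u = - (w $ 2 *\<^sub>R v)" using w0 by (simp add: eq_neg_iff_add_eq_0)
      then have "(1 / w $ 1) *\<^sub>R (w $ 1 *\<^sub>R u) = (1 / w $ 1) *\<^sub>R (- (w $ 2 *\<^sub>R v))" by simp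
      then have "u = (- w $ 2 / w $ 1) *\<^sub>R v" using w1 by simp
      then show ?thesis by (metis collinear_lemma insert_commute)
    next
      assume w1: "w $ 2 \<noteq> 0"
      have "w $ 2 *\<^sub>R v = - (w $ 1 *\<^sub>R u)" using w0 by (simp add: eq_neg_iff_add_eq_0 add.commute)
      then have "(1 / w $ 2) *\<^sub>R (w $ 2 *\<^sub>R v) = (1 / w $ 2) *\<^sub>R (- (w $ 1 *\<^sub>R u))" by simp
      then have "v = (- w $ 1 / w $ 2) *\<^sub>R u" using w1 by simp
      then show ?thesis by (metis collinear_lemma)
    qed
    then show False using nc by simp
  qed
  then obtain B where B: "B ** A = mat 1" using matrix_left_invertible_injective[of A] by (auto simp: inj_def)
  moreover from this have "A ** B = mat 1" using matrix_left_right_inverse by blast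
  ultimately show ?thesis unfolding A_def by blast
qed

text \<open>
  The triangle is cut by a lattice with spacing one twelfth of its sides. A cell with indices \<open>i + j \<le> 8\<close>, together
  with the larger cell that the fields need (twice the size), stays inside because \<open>i + j + 4 \<le> 12\<close>. Since cells reach
  only two thirds of the way to the opposite side, the triangle is treated from each of its corners.
\<close>

lemma corner_parallelograms_solvable:
  fixes a b c :: "real^2"
  assumes nc: "\<not> collinear {a, b, c}" and T: "interior (convex hull {a, b, c}) \<subseteq> \<Omega>"
  shows "\<exists>\<P>. finite \<P> \<and> (\<forall>P\<in>\<P>. solvable_on \<Omega> P \<and> interior P \<inter> \<Omega> \<noteq> {}) \<and>
    (\<forall>s t. 0 \<le> s \<longrightarrow> 0 \<le> t \<longrightarrow> s + t \<le> 2/3 \<longrightarrow> a + s *\<^sub>R (b - a) + t *\<^sub>R (c - a) \<in> \<Union>\<P>)"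
proof -
  define u v where "u = (1/12) *\<^sub>R (b - a)" and "v = (1/12) *\<^sub>R (c - a)"
  define A :: "real^2^2" where "A = transpose (vec2 u v)"
  have Av: "A *v x = x $ 1 *\<^sub>R u + x $ 2 *\<^sub>R v" for x
    by (simp add: A_def mat2_vector transpose_def vec_eq_iff forall_2 algebra_simps)
  have "A = (1/12) *\<^sub>R transpose (vec2 (b - a) (c - a))"
    by (simp add: A_def u_def v_def transpose_def vec_eq_iff forall_2)
  moreover have "\<not> collinear {0, b - a, c - a}"
    using nc collinear_3[of b a c] by (simp add: insert_commute)
  then obtain B0 where B0: "transpose (vec2 (b - a) (c - a)) ** B0 = mat 1" "B0 ** transpose (vec2 (b - a) (c - a)) = mat 1"
    using columns_inverse by blast
  define B where "B = 12 *\<^sub>R B0"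
  ultimately have AB: "A ** B = mat 1" and B: "B ** A = mat 1"
    using B0 by (simp_all add: B_def matrix_scalar_ac scalar_matrix_assoc[symmetric])
  have d2: "DIM(real^2) = 2" by simp
  define c0 where "c0 = (\<lambda>i j. a + real i *\<^sub>R u + real j *\<^sub>R v)"
  define cell where "cell = (\<lambda>i j S. (\<lambda>x. c0 i j + A *v x) ` S)"
  have cellT: "cell i j open_square \<subseteq> interior (convex hull {a, b, c})" if "i + j \<le> 8" for i j
  proof
    fix p assume "p \<in> cell i j open_square"
    then obtain x where x: "x \<in> open_square" "p = c0 i j + A *v x" by (auto simp: cell_def)
    define s t where "s = (real i + x $ 1) / 12" and "t = (real j + x $ 2) / 12"
    have "real i + real j \<le> 8" using that by linarith
    then have st: "0 < s" "0 < t" "s + t < 1" using x(1) by (auto simp: s_def t_def open_square_def field_simps)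
    have p: "p = (1 - s - t) *\<^sub>R a + s *\<^sub>R b + t *\<^sub>R c"
      unfolding x(2) c0_def Av u_def v_def s_def t_def
      by (simp add: vec_eq_iff field_simps)
    show "p \<in> interior (convex hull {a, b, c})"
      unfolding interior_convex_hull_3_minimal[OF nc d2]
      using st p by (intro CollectI exI[of _ "1 - s - t"] exI[of _ s] exI[of _ t]) auto
  qed
  define \<P> where "\<P> = (\<lambda>(i, j). cell i j unit_square) ` {(i, j). i + j \<le> (8::nat)}"
  have fin: "finite {(i, j). i + j \<le> (8::nat)}"
    by (rule finite_subset[of _ "{..8} \<times> {..8}"]) auto
  have good: "solvable_on \<Omega> (cell i j unit_square) \<and> interior (cell i j unit_square) \<inter> \<Omega> \<noteq> {}" if ij: "i + j \<le> 8" for i j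
  proof
    show "solvable_on \<Omega> (cell i j unit_square)"
      unfolding cell_def by (rule parallelogram_solvable[OF AB B]) (use cellT[OF ij] T in \<open>auto simp: cell_def\<close>)
    define O' :: "(real^2) set" where "O' = box 0 (vec2 1 1)"
    have eq: "cell i j S = {y. B *v (y - c0 i j) \<in> S}" for S
      unfolding cell_def by (rule affine_image_eq[OF AB B])
    have op: "open (cell i j O')" unfolding eq vimage_def[symmetric] O'_def
      by (intro open_vimage continuous_intros) auto
    have "cell i j O' \<subseteq> cell i j unit_square" "cell i j O' \<subseteq> cell i j open_square"
      unfolding eq O'_def unit_square_def open_square_def by (auto simp: mem_box_cart forall_2)
    moreover have "vec2 (1/2) (1/2) \<in> O'" by (simp add: O'_def mem_box_cart forall_2)
    then have "c0 i j + A *v vec2 (1/2) (1/2) \<in> cell i j O'" unfolding cell_def by blast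
    ultimately show "interior (cell i j unit_square) \<inter> \<Omega> \<noteq> {}"
      using interior_maximal[OF _ op] cellT[OF ij] T by blast
  qed
  have "a + s *\<^sub>R (b - a) + t *\<^sub>R (c - a) \<in> \<Union>\<P>" if st: "0 \<le> s" "0 \<le> t" "s + t \<le> 2/3" for s t
  proof -
    define i j where "i = nat \<lfloor>12 * s\<rfloor>" and "j = nat \<lfloor>12 * t\<rfloor>"
    have "real i = real_of_int \<lfloor>12 * s\<rfloor>" "real j = real_of_int \<lfloor>12 * t\<rfloor>" using st by (simp_all add: i_def j_def)
    then have i: "real i \<le> 12 * s" "12 * s \<le> real i + 1" and j: "real j \<le> 12 * t" "12 * t \<le> real j + 1"
      by linarith+
    have "real i + real j \<le> 8" using i j st by linarith
    then have ij: "i + j \<le> 8" by linarith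
    have "vec2 (12 * s - i) (12 * t - j) \<in> unit_square" using i j by (simp add: unit_square_def)
    moreover have "a + s *\<^sub>R (b - a) + t *\<^sub>R (c - a) = c0 i j + A *v vec2 (12 * s - i) (12 * t - j)"
      by (simp add: c0_def Av u_def v_def algebra_simps)
    ultimately have "a + s *\<^sub>R (b - a) + t *\<^sub>R (c - a) \<in> cell i j unit_square" unfolding cell_def by blast
    then show ?thesis using ij by (auto simp: \<P>_def)
  qed
  moreover have "finite \<P>" unfolding \<P>_def using fin by simp
  ultimately show ?thesis using good by (intro exI[of _ \<P>]) (auto simp: \<P>_def)
qed

text \<open>
  Of the three barycentric coordinates of a point, the largest is at least one third, so the corner it belongs to works.
\<close>

lemma triangle_cover:
  fixes a b c :: "real^2"
  assumes nc: "\<not> collinear {a, b, c}" and T: "interior (convex hull {a, b, c}) \<subseteq> \<Omega>"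
  shows "\<exists>\<P>. finite \<P> \<and> (\<forall>P\<in>\<P>. solvable_on \<Omega> P \<and> interior P \<inter> \<Omega> \<noteq> {}) \<and> convex hull {a, b, c} \<subseteq> \<Union>\<P>"
proof -
  have e: "{b, c, a} = {a, b, c}" "{c, a, b} = {a, b, c}" by auto
  have nc': "\<not> collinear {b, c, a}" "\<not> collinear {c, a, b}"
    and T': "interior (convex hull {b, c, a}) \<subseteq> \<Omega>" "interior (convex hull {c, a, b}) \<subseteq> \<Omega>"
    using nc T by (simp_all only: e not_False_eq_True)
  obtain P1 where P1: "finite P1" "\<forall>P\<in>P1. solvable_on \<Omega> P \<and> interior P \<inter> \<Omega> \<noteq> {}"
    "\<And>s t. 0 \<le> s \<Longrightarrow> 0 \<le> t \<Longrightarrow> s + t \<le> 2/3 \<Longrightarrow> a + s *\<^sub>R (b - a) + t *\<^sub>R (c - a) \<in> \<Union>P1"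
    using corner_parallelograms_solvable[OF nc T] by blast
  obtain P2 where P2: "finite P2" "\<forall>P\<in>P2. solvable_on \<Omega> P \<and> interior P \<inter> \<Omega> \<noteq> {}"
    "\<And>s t. 0 \<le> s \<Longrightarrow> 0 \<le> t \<Longrightarrow> s + t \<le> 2/3 \<Longrightarrow> b + s *\<^sub>R (c - b) + t *\<^sub>R (a - b) \<in> \<Union>P2"
    using corner_parallelograms_solvable[OF nc'(1) T'(1)] by blast
  obtain P3 where P3: "finite P3" "\<forall>P\<in>P3. solvable_on \<Omega> P \<and> interior P \<inter> \<Omega> \<noteq> {}"
    "\<And>s t. 0 \<le> s \<Longrightarrow> 0 \<le> t \<Longrightarrow> s + t \<le> 2/3 \<Longrightarrow> c + s *\<^sub>R (a - c) + t *\<^sub>R (b - c) \<in> \<Union>P3"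
    using corner_parallelograms_solvable[OF nc'(2) T'(2)] by blast
  have "convex hull {a, b, c} \<subseteq> \<Union>(P1 \<union> P2 \<union> P3)"
  proof
    fix p assume "p \<in> convex hull {a, b, c}"
    then obtain s t where st: "0 \<le> s" "0 \<le> t" "s + t \<le> 1" and p: "p = a + s *\<^sub>R (b - a) + t *\<^sub>R (c - a)"
      unfolding triangle_point by blast
    consider "s + t \<le> 2/3" | "t + (1 - s - t) \<le> 2/3" | "(1 - s - t) + s \<le> 2/3" using st by linarith
    then show "p \<in> \<Union>(P1 \<union> P2 \<union> P3)"
    proof cases
      case 1 then show ?thesis using P1(3)[OF st(1,2)] p by auto
    next
      case 2
      have "p = b + t *\<^sub>R (c - b) + (1 - s - t) *\<^sub>R (a - b)" unfolding p by (simp add: algebra_simps)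
      then show ?thesis using P2(3)[of t "1 - s - t"] 2 st by auto
    next
      case 3
      have "p = c + (1 - s - t) *\<^sub>R (a - c) + s *\<^sub>R (b - c)" unfolding p by (simp add: algebra_simps)
      then show ?thesis using P3(3)[of "1 - s - t" s] 3 st by auto
    qed
  qed
  then show ?thesis using P1 P2 P3 by (intro exI[of _ "P1 \<union> P2 \<union> P3"]) auto
qed

section \<open>Integration over a triangle\<close>

abbreviation U01 :: "real measure" where "U01 \<equiv> restrict_space lborel {0..1}"

lemma space_U01 [simp]: "space U01 = {0..1}" by (simp add: space_restrict_space)

lemma emeasure_U01: "emeasure U01 (space U01) = 1"
  by (simp add: emeasure_restrict_space)

lemma finite_measure_U01: "finite_measure U01"
  by (rule finite_measureI) (use emeasure_U01 in simp)

lemma measure_U01: "measure U01 (space U01) = 1"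
  using emeasure_U01 by (simp add: measure_def)

lemma pair_sigma_U01: "pair_sigma_finite U01 U01"
  using finite_measure_U01 by (simp add: pair_sigma_finite_def finite_measure.axioms(1))

lemma integrable_U01:
  fixes f :: "real \<Rightarrow> 'b::{banach, second_countable_topology}"
  assumes "f \<in> borel_measurable U01" "\<And>x. norm (f x) \<le> B"
  shows "integrable U01 f"
  by (rule finite_measure.integrable_const_bound[OF finite_measure_U01]) (use assms in auto)

lemma borel_imp_U01: "f \<in> borel_measurable borel \<Longrightarrow> f \<in> borel_measurable U01"
  by (intro measurable_restrict_space1) simp

lemma integral_U01_HK:
  fixes f :: "real \<Rightarrow> 'b::euclidean_space"
  assumes "f \<in> borel_measurable borel" "\<And>x. norm (f x) \<le> B"
  shows "f integrable_on {0..1}" "integral {0..1} f = integral\<^sup>L U01 f"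
proof -
  have i: "integrable U01 f" using assms by (intro integrable_U01 borel_imp_U01)
  then have s: "set_integrable lborel {0..1} f"
    unfolding set_integrable_def by (subst (asm) integrable_restrict_space) auto
  show "f integrable_on {0..1}" by (rule set_borel_integral_eq_integral(1)[OF s])
  have "integral {0..1} f = (LINT x : {0..1}|lborel. f x)" by (rule set_borel_integral_eq_integral(2)[OF s, symmetric])
  also have "\<dots> = integral\<^sup>L U01 f" unfolding set_lebesgue_integral_def by (subst integral_restrict_space) auto
  finally show "integral {0..1} f = integral\<^sup>L U01 f" .
qed

lemma integral_U01_mono:
  fixes f g :: "real \<Rightarrow> real"
  assumes "integrable U01 f" "integrable U01 g" "\<And>x. 0 \<le> x \<Longrightarrow> x \<le> 1 \<Longrightarrow> f x \<le> g x"
  shows "integral\<^sup>L U01 f \<le> integral\<^sup>L U01 g"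
  by (rule integral_mono_AE[OF assms(1,2)]) (use assms(3) in \<open>auto simp: AE_restrict_space_iff\<close>)

lemma integral_U01_square_le:
  fixes f :: "real \<Rightarrow> real"
  assumes "integrable U01 f" "integrable U01 (\<lambda>x. (f x)\<^sup>2)"
  shows "(integral\<^sup>L U01 f)\<^sup>2 \<le> integral\<^sup>L U01 (\<lambda>x. (f x)\<^sup>2)"
proof -
  define m where "m = integral\<^sup>L U01 f"
  have c: "integrable U01 (\<lambda>x. c)" for c :: real by (rule finite_measure.integrable_const[OF finite_measure_U01])
  have "0 \<le> integral\<^sup>L U01 (\<lambda>x. (f x - m)\<^sup>2)" by simp
  also have "(\<lambda>x. (f x - m)\<^sup>2) = (\<lambda>x. (f x)\<^sup>2 - 2 * m * f x + m\<^sup>2)"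
    by (auto simp: power2_eq_square algebra_simps)
  also have "integral\<^sup>L U01 \<dots> = integral\<^sup>L U01 (\<lambda>x. (f x)\<^sup>2) - 2 * m * m + m\<^sup>2"
    using assms c by (simp add: m_def measure_U01[simplified])
  finally show ?thesis by (simp add: m_def power2_eq_square)
qed

text \<open>
  Polar-like coordinates at the vertex \<open>a\<close>: \<open>r\<close> is the relative distance from \<open>a\<close> to the opposite side, \<open>s\<close>
  runs parallel to that side, and the area element is a constant multiple of \<open>r\<close>.
\<close>

definition fan_point :: "real^2 \<Rightarrow> real^2 \<Rightarrow> real^2 \<Rightarrow> real \<Rightarrow> real \<Rightarrow> real^2" where
  "fan_point a b c r s = a + r *\<^sub>R (b - a) + (r * s) *\<^sub>R (c - b)"

lemma borel_fan_point:
  assumes "h \<in> borel_measurable borel"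
  shows "(\<lambda>p. h (fan_point a b c (fst p) (snd p))) \<in> borel_measurable borel"
proof -
  have "(\<lambda>p. fan_point a b c (fst p) (snd p)) \<in> borel_measurable borel"
    unfolding fan_point_def by (intro borel_measurable_continuous_onI continuous_intros)
  then show ?thesis by (rule measurable_compose[OF _ assms])
qed

lemma borel_pair_U01:
  fixes f :: "real \<times> real \<Rightarrow> 'b::topological_space"
  assumes "f \<in> borel_measurable borel"
  shows "f \<in> borel_measurable (U01 \<Otimes>\<^sub>M U01)" "(\<lambda>s. f (r, s)) \<in> borel_measurable U01" "(\<lambda>r. f (r, s)) \<in> borel_measurable U01"
proof -
  have id: "(\<lambda>x. x) \<in> measurable U01 borel" by (intro borel_imp_U01) simp
  have "(\<lambda>p. (fst p, snd p)) \<in> measurable (U01 \<Otimes>\<^sub>M U01) (borel :: (real \<times> real) measure)"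
    by (intro borel_measurable_Pair measurable_compose[OF measurable_fst id] measurable_compose[OF measurable_snd id])
  from measurable_compose[OF this assms] show "f \<in> borel_measurable (U01 \<Otimes>\<^sub>M U01)" by simp
  have "(\<lambda>s. (r, s)) \<in> measurable U01 (borel :: (real \<times> real) measure)" "(\<lambda>r. (r, s)) \<in> measurable U01 (borel :: (real \<times> real) measure)"
    using id by (auto intro!: borel_measurable_Pair)
  from measurable_compose[OF this(1) assms] measurable_compose[OF this(2) assms]
  show "(\<lambda>s. f (r, s)) \<in> borel_measurable U01" "(\<lambda>r. f (r, s)) \<in> borel_measurable U01" by auto
qed

lemma integrable_pair_U01:
  fixes f :: "real \<times> real \<Rightarrow> real"
  assumes "f \<in> borel_measurable borel" "\<And>r s. 0 \<le> r \<Longrightarrow> r \<le> 1 \<Longrightarrow> 0 \<le> s \<Longrightarrow> s \<le> 1 \<Longrightarrow> \<bar>f (r, s)\<bar> \<le> B"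
  shows "integrable (U01 \<Otimes>\<^sub>M U01) f" "integrable U01 (\<lambda>r. LINT s|U01. f (r, s))"
    "0 \<le> r \<Longrightarrow> r \<le> 1 \<Longrightarrow> integrable U01 (\<lambda>s. f (r, s))" "0 \<le> s \<Longrightarrow> s \<le> 1 \<Longrightarrow> integrable U01 (\<lambda>r. f (r, s))"
    "(LINT r|U01. LINT s|U01. f (r, s)) = (LINT s|U01. LINT r|U01. f (r, s))"
    "integrable U01 (\<lambda>s. LINT r|U01. f (r, s))"
proof -
  interpret pair_sigma_finite U01 U01 by (rule pair_sigma_U01)
  have fm: "finite_measure (U01 \<Otimes>\<^sub>M U01)"
    by (rule finite_measure_pair_measure) (rule finite_measure_U01)+
  show i: "integrable (U01 \<Otimes>\<^sub>M U01) f"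
    by (rule finite_measure.integrable_const_bound[OF fm, of _ B])
      (use assms borel_pair_U01(1)[OF assms(1)] in \<open>auto simp: space_pair_measure intro!: AE_I2\<close>)
  show "integrable U01 (\<lambda>r. LINT s|U01. f (r, s))" using integrable_fst'[OF i] .
  show "0 \<le> r \<Longrightarrow> r \<le> 1 \<Longrightarrow> integrable U01 (\<lambda>s. f (r, s))"
    by (rule finite_measure.integrable_const_bound[OF finite_measure_U01, of _ B])
      (use assms borel_pair_U01(2)[OF assms(1)] in \<open>auto simp: AE_restrict_space_iff\<close>)
  show "0 \<le> s \<Longrightarrow> s \<le> 1 \<Longrightarrow> integrable U01 (\<lambda>r. f (r, s))"
    by (rule finite_measure.integrable_const_bound[OF finite_measure_U01, of _ B])
      (use assms borel_pair_U01(3)[OF assms(1)] in \<open>auto simp: AE_restrict_space_iff\<close>)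
  have i2: "integrable (U01 \<Otimes>\<^sub>M U01) (\<lambda>(r, s). f (r, s))" using i by simp
  show "(LINT r|U01. LINT s|U01. f (r, s)) = (LINT s|U01. LINT r|U01. f (r, s))"
    by (rule Fubini_integral[symmetric]) (use i2 in simp)
  show "integrable U01 (\<lambda>s. LINT r|U01. f (r, s))" by (rule integrable_snd) (use i2 in simp)
qed

text \<open>
  The substitution \<open>t = r * s\<close> on the slices of the triangle \<open>0 \<le> t \<le> r \<le> 1\<close>.
\<close>

lemma reference_triangle_integral:
  fixes k :: "real \<times> real \<Rightarrow> real"
  assumes k: "k \<in> borel_measurable borel" "\<And>p. \<bar>k p\<bar> \<le> B"
  shows "(LINT p|lborel. (if 0 \<le> snd p \<and> snd p \<le> fst p \<and> fst p \<le> 1 then k p else 0)) =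
    (LINT r|U01. LINT s|U01. r * k (r, r * s))"
proof -
  define f where "f = (\<lambda>p. if 0 \<le> snd p \<and> snd p \<le> fst p \<and> fst p \<le> (1::real) then k p else 0)"
  have cl: "{p. 0 \<le> snd p \<and> snd p \<le> fst p \<and> fst p \<le> (1::real)} \<in> sets borel"
  proof (rule borel_closed)
    show "closed {p. 0 \<le> snd p \<and> snd p \<le> fst p \<and> fst p \<le> (1::real)}"
      by (intro closed_Collect_conj closed_Collect_le continuous_intros)
  qed
  have "(\<lambda>p. if p \<in> {p. 0 \<le> snd p \<and> snd p \<le> fst p \<and> fst p \<le> (1::real)} then k p else 0) \<in> borel_measurable borel"
    by (rule measurable_If_set[OF k(1) measurable_const]) (use cl in simp_all)
  then have fb: "f \<in> borel_measurable borel" unfolding f_def mem_Collect_eq .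
  have fi: "integrable (lborel :: (real \<times> real) measure) f"
  proof (rule Bochner_Integration.integrable_bound)
    show "integrable lborel (\<lambda>p. indicat_real (cbox (0,0) (1,1)) p *\<^sub>R B)"
      by (rule borel_integrable_compact) (auto intro: compact_cbox)
    show "f \<in> borel_measurable lborel" using fb by simp
    have "norm (f p) \<le> norm (indicat_real (cbox (0,0) (1,1)) p *\<^sub>R B)" for p
    proof (cases "0 \<le> snd p \<and> snd p \<le> fst p \<and> fst p \<le> 1")
      case True
      then have "p \<in> cbox (0,0) (1,1)" by (cases p) (auto simp: mem_box Basis_prod_def)
      then show ?thesis using True k(2)[of p] by (simp add: f_def)
    next
      case False
      then have "f p = 0" unfolding f_def by (rule if_not_P)
      then show ?thesis by simp
    qed
    then show "AE p in lborel. norm (f p) \<le> norm (indicat_real (cbox (0,0) (1,1)) p *\<^sub>R B)" by simp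
  qed
  have fi': "integrable (lborel \<Otimes>\<^sub>M lborel) f" using fi by (simp add: lborel_prod)
  have "(LINT p|lborel. f p) = integral\<^sup>L (lborel \<Otimes>\<^sub>M lborel) f" by (simp add: lborel_prod)
  also have "\<dots> = (LINT r|lborel. LINT t|lborel. f (r, t))"
    by (rule lborel_pair.integral_fst'[OF fi', symmetric])
  also have "\<dots> = (LINT r|lborel. indicator {0..1} r *\<^sub>R (LINT s|U01. r * k (r, r * s)))"
  proof (rule integral_cong_AE)
    show "(\<lambda>r. LINT t|lborel. f (r, t)) \<in> borel_measurable lborel"
      using lborel_pair.integrable_fst'[OF fi'] by auto
    have km: "(\<lambda>p. fst p * k (fst p, fst p * snd p)) \<in> borel_measurable borel"
      by (intro borel_measurable_times measurable_compose[OF _ k(1)] borel_measurable_continuous_onI continuous_intros)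
    have "integrable U01 (\<lambda>r. LINT s|U01. fst (r, s) * k (fst (r, s), fst (r, s) * snd (r, s)))"
      by (rule integrable_pair_U01(2)[OF km, of B]) (use k(2) in \<open>auto simp: abs_mult intro!: order_trans[OF mult_left_le_one_le]\<close>)
    then have "integrable U01 (\<lambda>r. LINT s|U01. r * k (r, r * s))" by simp
    then have "integrable lborel (\<lambda>r. indicator {0..1} r *\<^sub>R (LINT s|U01. r * k (r, r * s)))"
      by (subst (asm) integrable_restrict_space) auto
    then show "(\<lambda>r. indicator {0..1} r *\<^sub>R (LINT s|U01. r * k (r, r * s))) \<in> borel_measurable lborel" by auto
    have "(LINT t|lborel. f (r, t)) = indicator {0..1} r *\<^sub>R (LINT s|U01. r * k (r, r * s))" if "r \<noteq> 0" for r
    proof (cases "0 < r \<and> r \<le> 1")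
      case True
      have "(LINT t|lborel. f (r, t)) = \<bar>r\<bar> *\<^sub>R (LINT s|lborel. f (r, 0 + r * s))"
        by (rule lborel_integral_real_affine[OF that])
      also have "(\<lambda>s. f (r, 0 + r * s)) = (\<lambda>s. indicator {0..1} s *\<^sub>R k (r, r * s))"
        using True by (auto simp: f_def indicator_def zero_le_mult_iff)
      also have "(LINT s|lborel. indicator {0..1} s *\<^sub>R k (r, r * s)) = (LINT s|U01. k (r, r * s))"
        by (rule integral_restrict_space[symmetric]) simp
      finally show ?thesis using True by simp
    next
      case False
      then have "r < 0 \<or> 1 < r" using that by auto
      then have "(\<lambda>t. f (r, t)) = (\<lambda>t. 0)" "indicator {0..1} r = (0::real)" by (auto simp: f_def)
      then show ?thesis by simp
    qed
    then show "AE r in lborel. (LINT t|lborel. f (r, t)) = indicator {0..1} r *\<^sub>R (LINT s|U01. r * k (r, r * s))"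
      using AE_lborel_singleton[of "0::real"] by (auto elim: eventually_mono)
  qed
  also have "\<dots> = (LINT r|U01. LINT s|U01. r * k (r, r * s))"
    by (rule integral_restrict_space[symmetric]) simp
  finally show ?thesis unfolding f_def .
qed

text \<open>
  The factor is the absolute value of the determinant of an affine map; its value is found afterwards by
  integrating the constant 1.
\<close>

lemma triangle_integral_up_to_factor:
  fixes h :: "real^2 \<Rightarrow> real"
  assumes nc: "\<not> collinear {a, b, c}"
  obtains d where "d > 0" "\<And>h B. h \<in> borel_measurable borel \<Longrightarrow> (\<And>x. \<bar>h x\<bar> \<le> B) \<Longrightarrow>
    integral\<^sup>L (lebesgue_on (convex hull {a, b, c})) h = d * (LINT r|U01. LINT s|U01. r * h (fan_point a b c r s))"
proof -
  define K where "K = convex hull {a, b, c}"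
  define u v where "u = b - a" and "v = c - b"
  have "\<not> collinear {0, u, v}"
  proof
    assume "collinear {0, u, v}"
    then consider "u = 0" | "v = 0" | k where "v = k *\<^sub>R u" unfolding collinear_lemma by blast
    then show False
    proof cases
      case 1 then show False using nc by (auto simp: u_def)
    next
      case 2 then show False using nc by (auto simp: v_def)
    next
      case (3 k)
      then have "c - b = (- k) *\<^sub>R (a - b)" by (simp add: u_def v_def algebra_simps)
      then have "collinear {0, a - b, c - b}" unfolding collinear_lemma by blast
      then show False using nc collinear_3[of a b c] by simp
    qed
  qed
  define A :: "real^2^2" where "A = transpose (vec2 u v)"
  obtain B where AB: "A ** B = mat 1" "B ** A = mat 1"
    using columns_inverse[OF \<open>\<not> collinear {0, u, v}\<close>] unfolding A_def by blast
  have Av: "A *v x = x $ 1 *\<^sub>R u + x $ 2 *\<^sub>R v" for x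
    by (simp add: A_def mat2_vector transpose_def vec_eq_iff forall_2 algebra_simps)
  have d: "det A \<noteq> 0" using det_mul[of A B] AB by (metis det_I mult_zero_left zero_neq_one)
  have K: "a + A *v x \<in> K \<longleftrightarrow> 0 \<le> x $ 2 \<and> x $ 2 \<le> x $ 1 \<and> x $ 1 \<le> 1" for x
  proof
    assume "a + A *v x \<in> K"
    then obtain s t where st: "0 \<le> s" "0 \<le> t" "s + t \<le> 1" "a + A *v x = a + s *\<^sub>R (b - a) + t *\<^sub>R (c - a)"
      unfolding K_def triangle_point by blast
    have "A *v x = A *v vec2 (s + t) t" using st(4) unfolding Av u_def v_def by (simp add: algebra_simps)
    then have "B *v (A *v x) = B *v (A *v vec2 (s + t) t)" by simp
    then have "x = vec2 (s + t) t" by (simp add: matrix_vector_mul_assoc AB)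
    then show "0 \<le> x $ 2 \<and> x $ 2 \<le> x $ 1 \<and> x $ 1 \<le> 1" using st by simp
  next
    assume x: "0 \<le> x $ 2 \<and> x $ 2 \<le> x $ 1 \<and> x $ 1 \<le> 1"
    show "a + A *v x \<in> K" unfolding K_def triangle_point
      using x by (intro exI[of _ "x $ 1 - x $ 2"] exI[of _ "x $ 2"]) (simp add: Av u_def v_def algebra_simps)
  qed
  have cK: "compact K" unfolding K_def by (intro finite_imp_compact_convex_hull) simp
  have Ks: "K \<in> sets borel" using cK by (simp add: borel_compact)
  have Kl: "K \<in> lmeasurable" using cK by (rule lmeasurable_compact)
  show ?thesis
  proof (rule that[of "\<bar>det A\<bar>"])
    show "\<bar>det A\<bar> > 0" using d by simp
    fix h :: "real^2 \<Rightarrow> real" and M assume h: "h \<in> borel_measurable borel" "\<And>x. \<bar>h x\<bar> \<le> M"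
    define g where "g = (\<lambda>x. if x \<in> K then h x else 0)"
    have gb: "g \<in> borel_measurable borel" unfolding g_def using Ks h by (intro measurable_If_set) auto
    have Ks': "K \<in> sets lebesgue" using Kl by auto
    have hK: "square_integrable K h"
      by (rule square_integrable_bounded[OF Kl, of _ M]) (use h in \<open>auto intro!: measurable_restrict_space1 measurable_completion\<close>)
    have gi: "integrable lebesgue g" unfolding g_def Lebesgue_Measure.integrable_restrict_UNIV[OF Ks']
      by (rule square_integrable_imp_integrable[OF Kl hK])
    have gT: "(\<lambda>x. g (a + A *v x)) \<in> borel_measurable borel"
      by (rule measurable_compose[OF _ gb]) (intro borel_measurable_continuous_onI continuous_intros)
    define k where "k = (\<lambda>p::real \<times> real. h (a + fst p *\<^sub>R u + snd p *\<^sub>R v))"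
    have kb: "k \<in> borel_measurable borel" unfolding k_def
      by (rule measurable_compose[OF _ h(1)]) (intro borel_measurable_continuous_onI continuous_intros)
    have "(\<lambda>p::real \<times> real. vec2 (fst p) (snd p)) \<in> borel_measurable borel"
      by (intro borel_measurable_continuous_onI continuous_intros)
    then have m: "(\<lambda>p. vec2 (fst p) (snd p)) \<in> measurable (lborel :: (real \<times> real) measure) borel" by simp
    have "integral\<^sup>L (lebesgue_on K) h = integral\<^sup>L lebesgue g"
      unfolding g_def by (rule Lebesgue_Measure.integral_restrict_UNIV[OF Ks', symmetric])
    also have "\<dots> = \<bar>det A\<bar> * integral\<^sup>L lebesgue (\<lambda>x. g (a + A *v x))" by (rule lebesgue_affine(2)[OF AB gi, symmetric])
    also have "integral\<^sup>L lebesgue (\<lambda>x. g (a + A *v x)) = integral\<^sup>L lborel (\<lambda>x. g (a + A *v x))"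
      by (rule integral_completion) (use gT in simp)
    also have "\<dots> = (LINT p|lborel. g (a + A *v vec2 (fst p) (snd p)))"
      unfolding lborel_vec2 by (rule integral_distr[OF m gT])
    also have "(\<lambda>p. g (a + A *v vec2 (fst p) (snd p))) = (\<lambda>p. if 0 \<le> snd p \<and> snd p \<le> fst p \<and> fst p \<le> 1 then k p else 0)"
      unfolding g_def K by (auto simp: k_def Av add.assoc)
    also have "(LINT p|lborel. (if 0 \<le> snd p \<and> snd p \<le> fst p \<and> fst p \<le> 1 then k p else 0)) = (LINT r|U01. LINT s|U01. r * k (r, r * s))"
      by (rule reference_triangle_integral[OF kb, of M]) (use h in \<open>auto simp: k_def\<close>)
    finally show "integral\<^sup>L (lebesgue_on (convex hull {a, b, c})) h = \<bar>det A\<bar> * (LINT r|U01. LINT s|U01. r * h (fan_point a b c r s))"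
      by (simp add: k_def fan_point_def u_def v_def K_def)
  qed
qed

lemma triangle_integral:
  fixes h :: "real^2 \<Rightarrow> real"
  assumes nc: "\<not> collinear {a, b, c}" and h: "h \<in> borel_measurable borel" "\<And>x. \<bar>h x\<bar> \<le> B"
  shows "integral\<^sup>L (lebesgue_on (convex hull {a, b, c})) h =
     2 * measure lebesgue (convex hull {a, b, c}) * (LINT r|U01. LINT s|U01. r * h (fan_point a b c r s))"
    "measure lebesgue (convex hull {a, b, c}) > 0"
proof -
  obtain d where d: "d > 0" and *: "\<And>h B. h \<in> borel_measurable borel \<Longrightarrow> (\<And>x. \<bar>h x\<bar> \<le> B) \<Longrightarrow>
    integral\<^sup>L (lebesgue_on (convex hull {a, b, c})) h = d * (LINT r|U01. LINT s|U01. r * h (fan_point a b c r s))"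
    using triangle_integral_up_to_factor[OF nc] by blast
  have Kl: "convex hull {a, b, c} \<in> lmeasurable"
    by (intro lmeasurable_compact finite_imp_compact_convex_hull) simp
  have r: "(LINT r|U01. r) = 1/2"
  proof -
    have "((\<lambda>x::real. x) has_integral (1\<^sup>2 / 2 - 0\<^sup>2 / 2)) {0..1}"
      by (rule fundamental_theorem_of_calculus)
        (auto simp: has_real_derivative_iff_has_vector_derivative[symmetric] intro!: derivative_eq_intros)
    then have "integral {0..1} (\<lambda>x::real. x) = 1/2" by (simp add: integral_unique)
    moreover have s: "set_integrable lborel {0..1} (\<lambda>x::real. x)"
      unfolding set_integrable_def by (rule borel_integrable_compact) (auto intro: continuous_intros)
    ultimately have "(LINT x : {0..1}|lborel. x) = (1/2 :: real)" using set_borel_integral_eq_integral(2)[OF s] by simp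
    then show ?thesis unfolding set_lebesgue_integral_def by (subst integral_restrict_space) auto
  qed
  have "measure lebesgue (convex hull {a, b, c}) = integral\<^sup>L (lebesgue_on (convex hull {a, b, c})) (\<lambda>_. 1::real)"
    using Kl by (simp add: measure_restrict_space)
  also have "\<dots> = d * (LINT r|U01. LINT s|U01. r * 1)" by (rule *[of _ 1]) auto
  also have "\<dots> = d / 2" using measure_U01 r by simp
  finally have m: "measure lebesgue (convex hull {a, b, c}) = d / 2" .
  then show "measure lebesgue (convex hull {a, b, c}) > 0" using d by simp
  show "integral\<^sup>L (lebesgue_on (convex hull {a, b, c})) h =
     2 * measure lebesgue (convex hull {a, b, c}) * (LINT r|U01. LINT s|U01. r * h (fan_point a b c r s))"
    using *[OF h] m by simp
qed

section \<open>Increments of fields\<close>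

lemma norm_matrix_vector_le: "norm (A *v x) \<le> norm A * norm x" for A :: "real^2^2"
proof (rule power2_le_imp_le)
  define p q r s y z where "p = A $ 1 $ 1" "q = A $ 1 $ 2" "r = A $ 2 $ 1" "s = A $ 2 $ 2" "y = x $ 1" "z = x $ 2"
  note d = this
  have "(norm A * norm x)\<^sup>2 - (norm (A *v x))\<^sup>2 = (p * z - q * y)\<^sup>2 + (r * z - s * y)\<^sup>2"
    unfolding power_mult_distrib norm_mat2 norm_vec2 mat2_vector vec2_nth d[symmetric]
    by (simp add: power2_eq_square algebra_simps)
  then show "(norm (A *v x))\<^sup>2 \<le> (norm A * norm x)\<^sup>2" by (smt (verit) zero_le_power2)
qed simp

lemma has_line_gradientD:
  assumes "has_line_gradient v G"
  shows "continuous_on UNIV v" "G \<in> borel_measurable borel" "\<exists>B. \<forall>x. norm (G x) \<le> B"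
    "((\<lambda>t. G (a + t *\<^sub>R (b - a)) *v (b - a)) has_integral (v b - v a)) {0..1}"
  using assms unfolding has_line_gradient_def bounded_iff by auto

lemma line_gradient_interval:
  assumes v: "has_line_gradient v G" and "s \<le> t"
  shows "((\<lambda>\<tau>. G (a + \<tau> *\<^sub>R d) *v d) has_integral (v (a + t *\<^sub>R d) - v (a + s *\<^sub>R d))) {s..t}"
proof (cases "s = t")
  case False
  define l where "l = t - s"
  have l: "l > 0" using False assms(2) by (simp add: l_def)
  have e: "(a + t *\<^sub>R d) - (a + s *\<^sub>R d) = l *\<^sub>R d" by (simp add: l_def algebra_simps)
  have "((\<lambda>\<tau>. G (a + s *\<^sub>R d + \<tau> *\<^sub>R l *\<^sub>R d) *v (l *\<^sub>R d)) has_integral (v (a + t *\<^sub>R d) - v (a + s *\<^sub>R d))) (cbox 0 1)"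
    using has_line_gradientD(4)[OF v, of "a + s *\<^sub>R d" "a + t *\<^sub>R d"] unfolding e by simp
  from has_integral_affinity[OF this, of "1 / l" "- (s / l)"]
  have "((\<lambda>x. G (a + s *\<^sub>R d + ((1 / l) *\<^sub>R x + - (s / l)) *\<^sub>R l *\<^sub>R d) *v (l *\<^sub>R d)) has_integral
      (1 / \<bar>1 / l\<bar> ^ DIM(real)) *\<^sub>R (v (a + t *\<^sub>R d) - v (a + s *\<^sub>R d)))
      ((\<lambda>x. (1 / (1 / l)) *\<^sub>R x + - ((1 / (1 / l)) *\<^sub>R (- (s / l)))) ` cbox 0 1)"
    using l by simp
  moreover have "(\<lambda>x. (1 / (1 / l)) *\<^sub>R x + - ((1 / (1 / l)) *\<^sub>R (- (s / l)))) ` cbox 0 1 = {s..t}"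
  proof -
    have "(\<lambda>x. (1 / (1 / l)) *\<^sub>R x + - ((1 / (1 / l)) *\<^sub>R (- (s / l)))) = (\<lambda>x. l * x + s)" using l by auto
    then show ?thesis using image_affinity_atLeastAtMost[of l s 0 1] l by (simp add: l_def)
  qed
  moreover have "((1 / l) *\<^sub>R x + - (s / l)) *\<^sub>R l *\<^sub>R d = (x - s) *\<^sub>R d" for x
  proof -
    have "((1 / l) *\<^sub>R x + - (s / l)) * l = x - s" using l by (simp add: field_simps)
    then show ?thesis by (simp only: scaleR_scaleR)
  qed
  ultimately have "((\<lambda>x. G (a + x *\<^sub>R d) *v (l *\<^sub>R d)) has_integral l *\<^sub>R (v (a + t *\<^sub>R d) - v (a + s *\<^sub>R d))) {s..t}"
    using l by (simp add: algebra_simps)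
  from has_integral_cmul[OF this, of "1 / l"] show ?thesis
    using l by (simp add: matrix_vector_mult_scaleR)
next
  case True
  then show ?thesis using has_integral_refl(2)[of "\<lambda>\<tau>. G (a + \<tau> *\<^sub>R d) *v d" t] by simp
qed

text \<open>
  The indicator makes the domain of integration independent of \<open>s\<close> and \<open>t\<close>, ready for Fubini.
\<close>

lemma line_gradient_bound:
  assumes v: "has_line_gradient v G" and st: "0 \<le> s" "s \<le> t" "t \<le> 1"
  shows "norm (v (a + t *\<^sub>R d) - v (a + s *\<^sub>R d)) \<le> norm d * (LINT \<tau>|U01. indicat_real {s..t} \<tau> * norm (G (a + \<tau> *\<^sub>R d)))"
proof -
  obtain B where B: "\<And>x. norm (G x) \<le> B" using has_line_gradientD(3)[OF v] by blast
  define g where "g = (\<lambda>\<tau>. norm (G (a + \<tau> *\<^sub>R d)))"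
  have gb: "g \<in> borel_measurable borel" unfolding g_def
    by (rule measurable_compose[OF measurable_compose[OF _ has_line_gradientD(2)[OF v]] borel_measurable_norm])
      (intro borel_measurable_continuous_onI continuous_intros)
  define h where "h = (\<lambda>\<tau>. indicat_real {s..t} \<tau> * g \<tau>)"
  have hb: "h \<in> borel_measurable borel" unfolding h_def using gb by (intro borel_measurable_times borel_measurable_indicator) auto
  have B0: "0 \<le> B" using order_trans[OF norm_ge_zero B] .
  have "norm (h \<tau>) \<le> B" for \<tau>
  proof (cases "\<tau> \<in> {s..t}")
    case True then show ?thesis using B by (simp add: h_def g_def)
  next
    case False then show ?thesis using B0 by (auto simp: h_def indicator_def)
  qed
  note hI = integral_U01_HK[OF hb this]
  have e: "integral {0..1} h = integral {s..t} g"
  proof -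
    have "integral {0..1} h = integral {0..1} (\<lambda>x. if x \<in> {s..t} then g x else 0)"
      by (rule integral_cong) (auto simp: h_def indicator_def)
    also have "\<dots> = integral ({s..t} \<inter> {0..1}) g" by (rule integral_restrict_Int)
    also have "{s..t} \<inter> {0..1} = {s..t}" using st by auto
    finally show ?thesis .
  qed
  have gi: "g integrable_on {s..t}"
  proof -
    have "(\<lambda>x. if x \<in> {s..t} then g x else 0) integrable_on {0..1}"
      by (rule integrable_eq[OF hI(1)]) (auto simp: h_def indicator_def)
    then have "g integrable_on {s..t} \<inter> {0..1}" unfolding integrable_restrict_Int .
    also have "{s..t} \<inter> {0..1} = {s..t}" using st by auto
    finally show ?thesis .
  qed
  note I = line_gradient_interval[OF v st(2), of a d]
  have "norm (v (a + t *\<^sub>R d) - v (a + s *\<^sub>R d)) = norm (integral {s..t} (\<lambda>\<tau>. G (a + \<tau> *\<^sub>R d) *v d))"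
    using integral_unique[OF I] by simp
  also have "\<dots> \<le> integral {s..t} (\<lambda>\<tau>. norm d * g \<tau>)"
  proof (rule integral_norm_bound_integral)
    show "(\<lambda>\<tau>. G (a + \<tau> *\<^sub>R d) *v d) integrable_on {s..t}" using I by blast
    show "(\<lambda>\<tau>. norm d * g \<tau>) integrable_on {s..t}" using gi by (rule integrable_on_mult_right)
    show "norm (G (a + x *\<^sub>R d) *v d) \<le> norm d * g x" for x
      using norm_matrix_vector_le[of "G (a + x *\<^sub>R d)" d] by (simp add: g_def mult.commute)
  qed
  also have "\<dots> = norm d * integral\<^sup>L U01 h" using e hI(2) by simp
  finally show ?thesis by (simp add: h_def g_def)
qed

section \<open>Edge means\<close>

definition edge_mean :: "(real^2 \<Rightarrow> real^2) \<Rightarrow> real^2 \<Rightarrow> real^2 \<Rightarrow> real^2" where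
  "edge_mean v b c = integral {0..1} (\<lambda>t. v (linepath b c t))"

lemma edge_mean_has_integral:
  assumes "continuous_on UNIV v"
  shows "((\<lambda>t. v (linepath b c t)) has_integral edge_mean v b c) {0..1}"
  unfolding edge_mean_def
  by (intro integrable_integral integrable_continuous_real continuous_on_compose2[OF assms continuous_on_linepath]) auto

lemma edge_mean_commute:
  assumes "continuous_on UNIV v"
  shows "edge_mean v b c = edge_mean v c b"
proof -
  have "((\<lambda>t. v (linepath b c t)) has_integral edge_mean v b c) (cbox 0 1)"
    using edge_mean_has_integral[OF assms] by simp
  from has_integral_affinity[OF this, of "-1" 1]
  have "((\<lambda>t. v (linepath b c (1 - t))) has_integral edge_mean v b c) ((\<lambda>t. 1 - t) ` {0..1})"
    by simp
  moreover have "(\<lambda>t::real. 1 - t) ` {0..1} = {0..1}"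
    using image_affinity_atLeastAtMost[of "-1" 1 0 "1::real"] by simp
  moreover have "linepath b c (1 - t) = linepath c b t" for t by (simp add: linepath_def algebra_simps)
  ultimately have "((\<lambda>t. v (linepath c b t)) has_integral edge_mean v b c) {0..1}" by simp
  then show ?thesis unfolding edge_mean_def[of v c b] by (simp add: integral_unique)
qed

lemma edge_mean_affine:
  "edge_mean (\<lambda>x. M *v (x - p) + q) b c = M *v (midpoint b c - p) + q"
proof -
  define F where "F = (\<lambda>t. (t - t\<^sup>2 / 2) *\<^sub>R (M *v (b - p) + q) + (t\<^sup>2 / 2) *\<^sub>R (M *v (c - p) + q))"
  have e: "M *v (linepath b c t - p) + q = (1 - t) *\<^sub>R (M *v (b - p) + q) + t *\<^sub>R (M *v (c - p) + q)" for t
    by (simp add: linepath_def matrix_vector_mult_diff_distrib matrix_vector_right_distrib matrix_vector_mult_scaleR algebra_simps)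
  have "((\<lambda>t. M *v (linepath b c t - p) + q) has_integral (F 1 - F 0)) {0..1}"
    unfolding e
  proof (rule fundamental_theorem_of_calculus)
    fix t :: real
    have d1: "((\<lambda>t. t - t\<^sup>2 / 2) has_real_derivative (1 - t)) (at t within {0..1})"
      and d2: "((\<lambda>t. t\<^sup>2 / 2) has_real_derivative t) (at t within {0..1})"
      by (auto intro!: derivative_eq_intros)
    show "(F has_vector_derivative (1 - t) *\<^sub>R (M *v (b - p) + q) + t *\<^sub>R (M *v (c - p) + q)) (at t within {0..1})"
      using has_vector_derivative_add[OF has_vector_derivative_scaleR[OF d1 has_vector_derivative_const[of "M *v (b - p) + q"]]
         has_vector_derivative_scaleR[OF d2 has_vector_derivative_const[of "M *v (c - p) + q"]]]
      by (simp add: F_def)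
  qed simp
  then have "edge_mean (\<lambda>x. M *v (x - p) + q) b c = F 1 - F 0" unfolding edge_mean_def by (rule integral_unique)
  also have "\<dots> = (1/2) *\<^sub>R (M *v (b - p) + q) + (1/2) *\<^sub>R (M *v (c - p) + q)" by (simp add: F_def)
  also have "\<dots> = M *v (midpoint b c - p) + q"
  proof -
    have m: "midpoint b c - p = (1/2) *\<^sub>R (b - p) + (1/2) *\<^sub>R (c - p)"
      by (simp add: midpoint_def vec_eq_iff field_simps)
    have "(1/2) *\<^sub>R (X + q) + (1/2) *\<^sub>R (Y + q) = ((1/2) *\<^sub>R X + (1/2) *\<^sub>R Y) + q" for X Y :: "real^2"
      by (simp add: vec_eq_iff field_simps)
    then show ?thesis unfolding m by (simp only: matrix_vector_right_distrib matrix_vector_mult_scaleR)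
  qed
  finally show ?thesis .
qed

lemma edge_mean_diff:
  assumes "continuous_on UNIV v" "continuous_on UNIV w"
  shows "edge_mean (\<lambda>x. v x - w x) b c = edge_mean v b c - edge_mean w b c"
  using has_integral_diff[OF edge_mean_has_integral[OF assms(1), of b c] edge_mean_has_integral[OF assms(2), of b c]]
  unfolding edge_mean_def[of "\<lambda>x. v x - w x"] by (rule integral_unique)

definition mean_gradient :: "(real^2) set \<Rightarrow> (real^2 \<Rightarrow> real^2^2) \<Rightarrow> real^2^2" where
  "mean_gradient K G = (1 / measure lebesgue K) *\<^sub>R integral\<^sup>L (lebesgue_on K) G"

lemma triangle_lmeasurable: "convex hull {a, b, c :: real^2} \<in> lmeasurable"
  by (intro lmeasurable_compact finite_imp_compact_convex_hull) simp

lemma line_gradient_si: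
  assumes "has_line_gradient v G" "K \<in> lmeasurable"
  shows "square_integrable K G"
proof -
  obtain B where B: "\<And>x. norm (G x) \<le> B" using has_line_gradientD(3)[OF assms(1)] by blast
  show ?thesis by (rule square_integrable_bounded[OF assms(2), of _ B])
    (use B has_line_gradientD(2)[OF assms(1)] in \<open>auto intro!: measurable_restrict_space1 measurable_completion\<close>)
qed

text \<open>
  In the coordinates at \<open>a\<close> the integral of \<open>G *v (c - b)\<close> is taken along the segments parallel to the side
  \<open>b c\<close>. The segment at \<open>r\<close> has direction \<open>r * (c - b)\<close>, so the factor \<open>r\<close> of the area element is just what
  turns the inner integral into the increment of \<open>v\<close>. The outer integral of these increments is the difference of the means
  over the two sides at \<open>a\<close>.
\<close>

lemma edge_mean_difference:
  assumes v: "has_line_gradient v G" and nc: "\<not> collinear {a, b, c}"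
  shows "edge_mean v a c - edge_mean v a b = (1/2) *\<^sub>R (mean_gradient (convex hull {a, b, c}) G *v (c - b))"
proof -
  define K where "K = convex hull {a, b, c}"
  obtain B where B: "\<And>x. norm (G x) \<le> B" using has_line_gradientD(3)[OF v] by blast
  have Gi: "integrable (lebesgue_on K) G"
    unfolding K_def by (rule square_integrable_imp_integrable[OF triangle_lmeasurable line_gradient_si[OF v triangle_lmeasurable]])
  have mK: "measure lebesgue K > 0" unfolding K_def by (rule triangle_integral(2)[OF nc, of "\<lambda>_. 0" 0]) auto
  have "(edge_mean v a c - edge_mean v a b) $ i = ((1/2) *\<^sub>R (mean_gradient K G *v (c - b))) $ i" for i
  proof -
    define h where "h = (\<lambda>x. (G x *v (c - b)) $ i)"
    have hcont: "continuous_on UNIV (\<lambda>A::real^2^2. (A *v (c - b)) $ i)"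
      unfolding matrix_vector_mult_def by (auto intro!: continuous_intros)
    have hb: "h \<in> borel_measurable borel"
      unfolding h_def using measurable_compose[OF has_line_gradientD(2)[OF v] borel_measurable_continuous_onI[OF hcont]] .
    have hB: "\<bar>h x\<bar> \<le> B * norm (c - b)" for x
      unfolding h_def using component_le_norm_cart[of "G x *v (c - b)" i] norm_matrix_vector_le[of "G x" "c - b"]
        mult_right_mono[OF B norm_ge_zero, of x "c - b"] by linarith
    have hr: "(LINT s|U01. r * h (fan_point a b c r s)) = v (a + r *\<^sub>R (c - a)) $ i - v (a + r *\<^sub>R (b - a)) $ i" for r
    proof -
      define p where "p = a + r *\<^sub>R (b - a)"
      have tr: "fan_point a b c r s = p + s *\<^sub>R (r *\<^sub>R (c - b))" for s by (simp add: fan_point_def p_def mult.commute)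
      have m: "(\<lambda>s. r * h (fan_point a b c r s)) \<in> borel_measurable borel" unfolding tr
        by (intro borel_measurable_times measurable_compose[OF _ hb] borel_measurable_continuous_onI continuous_intros)
      have b: "norm (r * h (fan_point a b c r s)) \<le> \<bar>r\<bar> * (B * norm (c - b))" for s
        using mult_left_mono[OF hB, of "\<bar>r\<bar>"] by (simp add: abs_mult)
      have e: "(p + r *\<^sub>R (c - b)) - p = r *\<^sub>R (c - b)" by simp
      have "((\<lambda>s. (G (p + s *\<^sub>R (r *\<^sub>R (c - b))) *v (r *\<^sub>R (c - b))) $ i) has_integral ((v (p + r *\<^sub>R (c - b)) - v p) $ i)) {0..1}"
        using has_integral_linear[OF has_line_gradientD(4)[OF v, of p "p + r *\<^sub>R (c - b)"] bounded_linear_vec_nth[of i]]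
        unfolding e o_def .
      then have "((\<lambda>s. r * h (fan_point a b c r s)) has_integral ((v (p + r *\<^sub>R (c - b)) - v p) $ i)) {0..1}"
        unfolding h_def tr by (simp add: matrix_vector_mult_scaleR)
      from integral_unique[OF this] have "(LINT s|U01. r * h (fan_point a b c r s)) = (v (p + r *\<^sub>R (c - b)) - v p) $ i"
        by (simp only: integral_U01_HK(2)[OF m b])
      then show ?thesis by (simp add: p_def algebra_simps)
    qed
    define D where "D = (\<lambda>r. v (a + r *\<^sub>R (c - a)) $ i - v (a + r *\<^sub>R (b - a)) $ i)"
    have cD: "continuous_on S D" for S unfolding D_def
      by (intro continuous_on_diff continuous_on_component continuous_on_compose2[OF has_line_gradientD(1)[OF v]] continuous_intros) auto
    have lp: "linepath a x r = a + r *\<^sub>R (x - a)" for x r by (simp add: linepath_def algebra_simps)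
    have "((\<lambda>r. D r) has_integral (edge_mean v a c $ i - edge_mean v a b $ i)) {0..1}"
      unfolding D_def lp[symmetric]
      using has_integral_linear[OF edge_mean_has_integral[OF has_line_gradientD(1)[OF v]] bounded_linear_vec_nth[of i], of a c]
        has_integral_linear[OF edge_mean_has_integral[OF has_line_gradientD(1)[OF v]] bounded_linear_vec_nth[of i], of a b]
      unfolding o_def by (rule has_integral_diff)
    then have "integral {0..1} D = edge_mean v a c $ i - edge_mean v a b $ i" by (rule integral_unique)
    moreover have "integral {0..1} D = integral\<^sup>L U01 D"
    proof -
      have s: "set_integrable lborel {0..1} D" unfolding set_integrable_def
        by (rule borel_integrable_compact) (auto intro: cD)
      show ?thesis using set_borel_integral_eq_integral(2)[OF s] unfolding set_lebesgue_integral_def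
        by (subst integral_restrict_space) auto
    qed
    ultimately have "edge_mean v a c $ i - edge_mean v a b $ i = (LINT r|U01. LINT s|U01. r * h (fan_point a b c r s))"
      unfolding hr D_def by simp
    also have "\<dots> = (1 / (2 * measure lebesgue K)) * integral\<^sup>L (lebesgue_on K) h"
      using triangle_integral(1)[OF nc hb hB] mK by (simp add: K_def)
    also have "integral\<^sup>L (lebesgue_on K) h = (integral\<^sup>L (lebesgue_on K) G *v (c - b)) $ i"
    proof -
      have "linear (\<lambda>A::real^2^2. (A *v (c - b)) $ i)"
        by (intro linearI) (simp_all add: matrix_vector_mult_def sum_2 algebra_simps)
      then have "bounded_linear (\<lambda>A::real^2^2. (A *v (c - b)) $ i)" by (simp add: linear_conv_bounded_linear)
      then show ?thesis unfolding h_def by (rule integral_bounded_linear[OF _ Gi])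
    qed
    finally show ?thesis by (simp add: mean_gradient_def scaleR_matrix_vector_assoc[symmetric])
  qed
  then show ?thesis unfolding K_def vec_eq_iff vector_minus_component by simp
qed

section \<open>A Poincare inequality\<close>

lemma fan_point_in_triangle:
  assumes "0 \<le> r" "r \<le> 1" "0 \<le> s" "s \<le> 1"
  shows "fan_point a b c r s \<in> convex hull {a, b, c}"
proof -
  have "r * s \<le> r" "0 \<le> r * s" using assms mult_left_le[of s r] by auto
  then show ?thesis unfolding triangle_point using assms
    by (intro exI[of _ "r - r * s"] exI[of _ "r * s"]) (auto simp: fan_point_def algebra_simps)
qed

text \<open>
  A point is joined to the points of the side \<open>b c\<close> by moving parallel to that side and then along a ray from \<open>a\<close>.
  Averaging over the points of the side removes the mean. The parallel move costs \<open>r * d\<close> times the mean of \<open>|H|\<close> on the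
  slice. The ray costs \<open>d\<close> times an integral over \<open>[r, 1]\<close>, which the weight \<open>r\<close> of the area element keeps bounded.
\<close>

lemma triangle_poincare:
  assumes f: "has_line_gradient f H" and nc: "\<not> collinear {a, b, c}" and mean: "edge_mean f b c = 0"
    and d: "norm (b - a) \<le> d" "norm (c - a) \<le> d" "norm (c - b) \<le> d"
  shows "L2_norm (convex hull {a, b, c}) f \<le> 2 * d * L2_norm (convex hull {a, b, c}) H"
proof -
  define K where "K = convex hull {a, b, c}"
  have d0: "0 \<le> d" using d(1) norm_ge_zero order_trans by blast
  obtain B where B: "\<And>x. norm (H x) \<le> B" using has_line_gradientD(3)[OF f] by blast
  have B0: "0 \<le> B" using B norm_ge_zero order_trans by blast
  have Kl: "K \<in> lmeasurable" unfolding K_def by (rule triangle_lmeasurable)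
  have cK: "compact K" unfolding K_def by (intro finite_imp_compact_convex_hull) simp
  have fc: "continuous_on UNIV f" by (rule has_line_gradientD(1)[OF f])
  have "bounded (f ` K)" by (intro compact_imp_bounded compact_continuous_image continuous_on_subset[OF fc] cK) auto
  then obtain M where M: "\<And>x. x \<in> K \<Longrightarrow> norm (f x) \<le> M" unfolding bounded_iff by auto
  define n where "n = (\<lambda>p. norm (H (fan_point a b c (fst p) (snd p))))"
  have nb: "n \<in> borel_measurable borel" unfolding n_def
    by (rule measurable_compose[OF borel_fan_point[OF has_line_gradientD(2)[OF f]] borel_measurable_norm])
  have nB: "0 \<le> n p" "\<bar>n p\<bar> \<le> B" "n p \<le> B" for p using B by (auto simp: n_def)
  define I where "I = (\<lambda>r. LINT \<sigma>|U01. n (r, \<sigma>))"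
  define J where "J = (\<lambda>r. LINT \<sigma>|U01. (n (r, \<sigma>))\<^sup>2)"
  have n2b: "(\<lambda>p. (n p)\<^sup>2) \<in> borel_measurable borel" using nb by measurable
  have n2B: "\<bar>(n p)\<^sup>2\<bar> \<le> B\<^sup>2" for p using power_mono[OF nB(3) nB(1), of p 2] by simp
  have in1: "integrable U01 (\<lambda>\<sigma>. n (r, \<sigma>))" for r
    by (rule integrable_U01[OF borel_pair_U01(2)[OF nb], of _ B]) (use nB in auto)
  have in2: "integrable U01 (\<lambda>\<sigma>. (n (r, \<sigma>))\<^sup>2)" for r
    by (rule integrable_U01[OF borel_pair_U01(2)[OF n2b], of _ "B\<^sup>2"]) (use n2B in auto)
  have iI: "integrable U01 I" unfolding I_def by (rule integrable_pair_U01(2)[OF nb, of B]) (use nB in auto)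
  have iJ: "integrable U01 J" unfolding J_def by (rule integrable_pair_U01(2)[OF n2b, of "B\<^sup>2"]) (use n2B in auto)
  have bint: "\<bar>LINT \<sigma>|U01. g \<sigma>\<bar> \<le> C" if "integrable U01 g" "\<And>x. \<bar>g x\<bar> \<le> C" for g :: "real \<Rightarrow> real" and C
  proof -
    have c: "integrable U01 (\<lambda>x. C)" by (rule finite_measure.integrable_const[OF finite_measure_U01])
    have "\<bar>LINT \<sigma>|U01. g \<sigma>\<bar> \<le> (LINT \<sigma>|U01. \<bar>g \<sigma>\<bar>)" using integral_norm_bound[of U01 g] by simp
    also have "\<dots> \<le> (LINT \<sigma>|U01. C)" by (rule integral_U01_mono) (use that c in auto)
    finally show ?thesis using measure_U01 by simp
  qed
  have IB: "0 \<le> I r" "\<bar>I r\<bar> \<le> B" for r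
  proof -
    show "0 \<le> I r" unfolding I_def by (rule Bochner_Integration.integral_nonneg) (rule nB(1))
    show "\<bar>I r\<bar> \<le> B" unfolding I_def by (rule bint[OF in1]) (rule nB(2))
  qed
  have JB: "0 \<le> J r" "\<bar>J r\<bar> \<le> B\<^sup>2" for r
  proof -
    show "0 \<le> J r" unfolding J_def by (rule Bochner_Integration.integral_nonneg) simp
    show "\<bar>J r\<bar> \<le> B\<^sup>2" unfolding J_def by (rule bint[OF in2]) (rule n2B)
  qed
  have IJ: "(I r)\<^sup>2 \<le> J r" for r unfolding I_def J_def by (rule integral_U01_square_le[OF in1 in2])
  have idm: "(\<lambda>x. x) \<in> borel_measurable U01" by (rule borel_imp_U01) simp
  have irJ: "integrable U01 (\<lambda>r. r * J r)"
    by (rule finite_measure.integrable_const_bound[OF finite_measure_U01, of _ "B\<^sup>2"])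
      (use JB idm borel_measurable_integrable[OF iJ] in \<open>auto simp: AE_restrict_space_iff abs_mult intro!: order_trans[OF mult_left_le_one_le] AE_I2\<close>)
  define T where "T = (LINT r|U01. r * J r)"
  define F where "F = (\<lambda>r s. f (fan_point a b c r s))"
  define N where "N = (\<lambda>r s. LINT \<rho>|U01. indicat_real {r..1} \<rho> * n (\<rho>, s))"
  have indm: "(\<lambda>\<rho>. indicat_real {r..1} \<rho>) \<in> borel_measurable borel" for r :: real
    by (rule borel_measurable_indicator) simp
  have ind01: "\<bar>indicat_real {r..1} \<rho> * z\<bar> \<le> \<bar>z\<bar>" for r \<rho> z :: real by (auto simp: indicator_def)
  have step1: "norm (F r s - F r s') \<le> r * d * I r" if r: "0 \<le> r" "r \<le> 1" and s: "0 \<le> s" "s \<le> 1" "0 \<le> s'" "s' \<le> 1" for r s s'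
  proof -
    have *: "norm (F r t - F r t') \<le> r * d * I r" if t: "0 \<le> t'" "t' \<le> t" "t \<le> 1" for t t'
    proof -
      define p where "p = a + r *\<^sub>R (b - a)"
      have tr: "fan_point a b c r s = p + s *\<^sub>R (r *\<^sub>R (c - b))" for s by (simp add: fan_point_def p_def mult.commute)
      have "norm (F r t - F r t') \<le> norm (r *\<^sub>R (c - b)) * (LINT \<tau>|U01. indicat_real {t'..t} \<tau> * norm (H (p + \<tau> *\<^sub>R (r *\<^sub>R (c - b)))))"
        unfolding F_def tr by (rule line_gradient_bound[OF f t])
      also have "\<dots> \<le> (r * d) * I r"
      proof (rule mult_mono)
        show "norm (r *\<^sub>R (c - b)) \<le> r * d" using r d(3) by (simp add: mult_left_mono)
        show "(LINT \<tau>|U01. indicat_real {t'..t} \<tau> * norm (H (p + \<tau> *\<^sub>R (r *\<^sub>R (c - b))))) \<le> I r"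
          unfolding I_def
        proof (rule integral_U01_mono[OF _ in1])
          have e: "norm (H (p + \<tau> *\<^sub>R (r *\<^sub>R (c - b)))) = n (r, \<tau>)" for \<tau> by (simp add: n_def tr)
          show "integrable U01 (\<lambda>\<tau>. indicat_real {t'..t} \<tau> * norm (H (p + \<tau> *\<^sub>R (r *\<^sub>R (c - b)))))"
            unfolding e
          proof (rule integrable_U01[of _ B])
            have "indicat_real {t'..t} \<in> borel_measurable U01"
              by (rule borel_imp_U01, rule borel_measurable_indicator) simp
            then show "(\<lambda>\<tau>. indicat_real {t'..t} \<tau> * n (r, \<tau>)) \<in> borel_measurable U01"
              using borel_pair_U01(2)[OF nb] by (rule borel_measurable_times)
            show "norm (indicat_real {t'..t} \<tau> * n (r, \<tau>)) \<le> B" for \<tau>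
              using nB B0 by (auto simp: indicator_def)
          qed
          show "indicat_real {t'..t} \<tau> * norm (H (p + \<tau> *\<^sub>R (r *\<^sub>R (c - b)))) \<le> n (r, \<tau>)" for \<tau>
            unfolding e using nB(1)[of "(r, \<tau>)"] by (auto simp: indicator_def)
        qed
      qed (use r d0 IB in auto)
      finally show ?thesis .
    qed
    show ?thesis
    proof (cases "s' \<le> s")
      case True then show ?thesis using *[of s' s] s by simp
    next
      case False then show ?thesis using *[of s s'] s by (simp add: norm_minus_commute)
    qed
  qed
  have step2: "norm (F 1 s - F r s) \<le> d * N r s" if r: "0 \<le> r" "r \<le> 1" and s: "0 \<le> s" "s \<le> 1" for r s
  proof -
    define e where "e = (b - a) + s *\<^sub>R (c - b)"
    have tr: "fan_point a b c \<rho> s = a + \<rho> *\<^sub>R e" for \<rho> by (simp add: fan_point_def e_def algebra_simps)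
    have "e = (1 - s) *\<^sub>R (b - a) + s *\<^sub>R (c - a)" by (simp add: e_def algebra_simps)
    then have "norm e \<le> (1 - s) * norm (b - a) + s * norm (c - a)"
      using norm_triangle_ineq[of "(1 - s) *\<^sub>R (b - a)" "s *\<^sub>R (c - a)"] s by simp
    also have "\<dots> \<le> (1 - s) * d + s * d" using s d by (intro add_mono mult_left_mono) auto
    finally have ed: "norm e \<le> d" by (simp add: algebra_simps)
    have "norm (F 1 s - F r s) \<le> norm e * N r s"
      using line_gradient_bound[OF f r(1,2) order_refl, of a e] unfolding F_def N_def n_def by (simp add: tr)
    also have "\<dots> \<le> d * N r s" using ed nB by (intro mult_right_mono) (auto simp: N_def)
    finally show ?thesis .
  qed
  define Q where "Q = (\<lambda>r. LINT \<rho>|U01. indicat_real {r..1} \<rho> * I \<rho>)"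
  have km: "(\<lambda>p. indicat_real {r..1} (fst p) * n p) \<in> borel_measurable borel" for r
    by (intro borel_measurable_times nb measurable_compose[OF _ indm] borel_measurable_continuous_onI continuous_intros)
  have NQ: "integrable U01 (N r)" "(LINT s|U01. N r s) = Q r" for r
  proof -
    have kB: "\<bar>indicat_real {r..1} (fst (x, y)) * n (x, y)\<bar> \<le> B" for x y
      using ind01[of r "fst (x, y)" "n (x, y)"] nB(2)[of "(x, y)"] by linarith
    note k = integrable_pair_U01[OF km[of r] kB]
    show "integrable U01 (N r)" using k(6) by (simp add: N_def)
    have "(LINT s|U01. N r s) = (LINT \<rho>|U01. LINT s|U01. indicat_real {r..1} \<rho> * n (\<rho>, s))"
      using k(5) by (simp add: N_def)
    then show "(LINT s|U01. N r s) = Q r" by (simp add: Q_def I_def)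
  qed
  have step3: "norm (F r s) \<le> d * (r * I r + Q r)" if r: "0 \<le> r" "r \<le> 1" and s: "0 \<le> s" "s \<le> 1" for r s
  proof -
    have F1: "F 1 s' = f (linepath b c s')" for s' by (simp add: F_def fan_point_def linepath_def algebra_simps)
    have cF: "continuous_on {0..1} (F 1)" unfolding F1 by (intro continuous_on_compose2[OF fc] continuous_intros) auto
    have s1: "set_integrable lborel {0..1} (F 1)" unfolding set_integrable_def by (rule borel_integrable_compact) (auto intro: cF)
    have iF: "integrable U01 (F 1)" using s1 unfolding set_integrable_def by (subst integrable_restrict_space) auto
    have zF: "integral\<^sup>L U01 (F 1) = 0"
    proof -
      have "integral\<^sup>L U01 (F 1) = (LINT x : {0..1}|lborel. F 1 x)"
        unfolding set_lebesgue_integral_def by (subst integral_restrict_space) auto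
      also have "\<dots> = integral {0..1} (F 1)" by (rule set_borel_integral_eq_integral(2)[OF s1])
      also have "\<dots> = edge_mean f b c" by (simp add: F1[abs_def] edge_mean_def)
      finally show ?thesis using mean by simp
    qed
    have c: "integrable U01 (\<lambda>x. C)" for C :: real by (rule finite_measure.integrable_const[OF finite_measure_U01])
    have c': "integrable U01 (\<lambda>x. C)" for C :: "real^2" by (rule finite_measure.integrable_const[OF finite_measure_U01])
    have "F r s = (LINT s'|U01. F r s - F 1 s')"
      unfolding Bochner_Integration.integral_diff[OF c' iF] zF using measure_U01 by simp
    then have "norm (F r s) = norm (LINT s'|U01. F r s - F 1 s')" by simp
    also have "\<dots> \<le> (LINT s'|U01. norm (F r s - F 1 s'))" by (rule integral_norm_bound)
    also have "\<dots> \<le> (LINT s'|U01. r * d * I r + d * N r s')"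
    proof (rule integral_U01_mono)
      show "integrable U01 (\<lambda>s'. norm (F r s - F 1 s'))" using iF c' by (intro integrable_norm Bochner_Integration.integrable_diff)
      show "integrable U01 (\<lambda>s'. r * d * I r + d * N r s')" using NQ(1) c by (intro Bochner_Integration.integrable_add integrable_mult_right)
      show "norm (F r s - F 1 s') \<le> r * d * I r + d * N r s'" if "0 \<le> s'" "s' \<le> 1" for s'
      proof -
        have "norm (F r s - F 1 s') \<le> norm (F r s - F r s') + norm (F r s' - F 1 s')"
          using norm_triangle_ineq[of "F r s - F r s'" "F r s' - F 1 s'"] by simp
        then show ?thesis using step1[OF r s that] step2[OF r that] by (simp add: norm_minus_commute)
      qed
    qed
    also have "\<dots> = d * (r * I r + Q r)" using NQ c measure_U01 by (simp add: algebra_simps)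
    finally show ?thesis .
  qed
  have step4: "r * (norm (F r s))\<^sup>2 \<le> 2 * d\<^sup>2 * (r * J r + T)" if r: "0 \<le> r" "r \<le> 1" and s: "0 \<le> s" "s \<le> 1" for r s
  proof -
    have iIm: "I \<in> borel_measurable U01" using iI by auto
    have iq: "integrable U01 (\<lambda>\<rho>. indicat_real {r..1} \<rho> * I \<rho>)"
    proof (rule integrable_U01[of _ B])
      show "(\<lambda>\<rho>. indicat_real {r..1} \<rho> * I \<rho>) \<in> borel_measurable U01" using iIm borel_imp_U01[OF indm] by (intro borel_measurable_times)
      show "norm (indicat_real {r..1} \<rho> * I \<rho>) \<le> B" for \<rho> using ind01[of r \<rho> "I \<rho>"] IB(2)[of \<rho>] by simp
    qed
    have iq2: "integrable U01 (\<lambda>\<rho>. (indicat_real {r..1} \<rho> * I \<rho>)\<^sup>2)"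
    proof (rule integrable_U01[of _ "B\<^sup>2"])
      show "(\<lambda>\<rho>. (indicat_real {r..1} \<rho> * I \<rho>)\<^sup>2) \<in> borel_measurable U01" using iq by auto
      show "norm ((indicat_real {r..1} \<rho> * I \<rho>)\<^sup>2) \<le> B\<^sup>2" for \<rho>
        using power_mono[of "\<bar>indicat_real {r..1} \<rho> * I \<rho>\<bar>" B 2] ind01[of r \<rho> "I \<rho>"] IB(2)[of \<rho>] by simp
    qed
    have "r * (Q r)\<^sup>2 \<le> r * (LINT \<rho>|U01. (indicat_real {r..1} \<rho> * I \<rho>)\<^sup>2)"
      unfolding Q_def by (intro mult_left_mono integral_U01_square_le iq iq2 r)
    also have "\<dots> = (LINT \<rho>|U01. r * (indicat_real {r..1} \<rho> * I \<rho>)\<^sup>2)" by simp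
    also have "\<dots> \<le> T" unfolding T_def
    proof (rule integral_U01_mono[OF integrable_mult_right[OF iq2] irJ])
      fix \<rho> :: real assume \<rho>: "0 \<le> \<rho>" "\<rho> \<le> 1"
      show "r * (indicat_real {r..1} \<rho> * I \<rho>)\<^sup>2 \<le> \<rho> * J \<rho>"
      proof (cases "r \<le> \<rho>")
        case True
        then show ?thesis using \<rho> IJ[of \<rho>] r JB(1)[of \<rho>] by (auto simp: indicator_def intro!: mult_mono)
      next
        case False then show ?thesis using \<rho> JB(1)[of \<rho>] by (simp add: indicator_def)
      qed
    qed
    finally have q: "r * (Q r)\<^sup>2 \<le> T" .
    have "r * (r * I r)\<^sup>2 = (r * r\<^sup>2) * (I r)\<^sup>2" by (simp add: power_mult_distrib)
    also have "\<dots> \<le> (r * 1) * J r" using r IJ by (intro mult_mono mult_left_mono power_le_one) auto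
    finally have p: "r * (r * I r)\<^sup>2 \<le> r * J r" by simp
    have "(norm (F r s))\<^sup>2 \<le> (d * (r * I r + Q r))\<^sup>2" using step3[OF r s] by (intro power_mono) auto
    also have "\<dots> \<le> d\<^sup>2 * (2 * (r * I r)\<^sup>2 + 2 * (Q r)\<^sup>2)"
      unfolding power_mult_distrib[of d]
    proof (intro mult_left_mono)
      show "(r * I r + Q r)\<^sup>2 \<le> 2 * (r * I r)\<^sup>2 + 2 * (Q r)\<^sup>2"
        using zero_le_power2[of "r * I r - Q r"] unfolding power2_diff power2_sum by simp
    qed simp
    finally have "r * (norm (F r s))\<^sup>2 \<le> r * (d\<^sup>2 * (2 * (r * I r)\<^sup>2 + 2 * (Q r)\<^sup>2))" using r by (intro mult_left_mono)
    also have "\<dots> = 2 * d\<^sup>2 * (r * (r * I r)\<^sup>2 + r * (Q r)\<^sup>2)" by (simp add: algebra_simps)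
    also have "\<dots> \<le> 2 * d\<^sup>2 * (r * J r + T)" using add_mono[OF p q] by (intro mult_left_mono) auto
    finally show ?thesis .
  qed
  define g where "g = (\<lambda>x. if x \<in> K then (norm (f x))\<^sup>2 else 0)"
  have gb: "g \<in> borel_measurable borel" unfolding g_def
  proof (rule measurable_If_set)
    show "(\<lambda>x. (norm (f x))\<^sup>2) \<in> borel_measurable borel" by (intro borel_measurable_continuous_onI continuous_intros fc)
  qed (use cK in \<open>auto simp: borel_compact\<close>)
  have gB: "\<bar>g x\<bar> \<le> M\<^sup>2" for x using power_mono[OF M, of x 2] by (auto simp: g_def)
  have c: "integrable U01 (\<lambda>x. C)" for C :: real by (rule finite_measure.integrable_const[OF finite_measure_U01])
  have gt: "g (fan_point a b c r s) = (norm (F r s))\<^sup>2" if "0 \<le> r" "r \<le> 1" "0 \<le> s" "s \<le> 1" for r s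
    using fan_point_in_triangle[OF that] by (simp add: g_def F_def K_def)
  have gm: "(\<lambda>p. fst p * g (fan_point a b c (fst p) (snd p))) \<in> borel_measurable borel"
    by (intro borel_measurable_times borel_fan_point gb borel_measurable_continuous_onI continuous_intros)
  have gB': "\<bar>fst (r, s) * g (fan_point a b c (fst (r, s)) (snd (r, s)))\<bar> \<le> M\<^sup>2" if "0 \<le> r" "r \<le> 1" "0 \<le> s" "s \<le> 1" for r s
    using gB[of "fan_point a b c r s"] that by (auto simp: abs_mult intro: order_trans[OF mult_left_le_one_le])
  note gi = integrable_pair_U01[OF gm gB', simplified]
  have "(LINT r|U01. LINT s|U01. r * g (fan_point a b c r s)) \<le> (LINT r|U01. 2 * d\<^sup>2 * (r * J r + T))"
  proof (rule integral_U01_mono)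
    show "integrable U01 (\<lambda>r. LINT s|U01. r * g (fan_point a b c r s))" using gi(2) by simp
    show "integrable U01 (\<lambda>r. 2 * d\<^sup>2 * (r * J r + T))" using irJ c by (intro integrable_mult_right Bochner_Integration.integrable_add)
    fix r :: real assume r: "0 \<le> r" "r \<le> 1"
    have "(LINT s|U01. r * g (fan_point a b c r s)) \<le> (LINT s|U01. 2 * d\<^sup>2 * (r * J r + T))"
    proof (rule integral_U01_mono)
      show "integrable U01 (\<lambda>s. r * g (fan_point a b c r s))" using gi(3)[OF r] by simp
      show "r * g (fan_point a b c r s) \<le> 2 * d\<^sup>2 * (r * J r + T)" if "0 \<le> s" "s \<le> 1" for s
        using step4[OF r that] gt[OF r that] by simp
    qed (rule c)
    then show "(LINT s|U01. r * g (fan_point a b c r s)) \<le> 2 * d\<^sup>2 * (r * J r + T)" using measure_U01 by simp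
  qed
  also have "\<dots> = 2 * d\<^sup>2 * ((LINT r|U01. r * J r) + T)" using irJ c measure_U01 by simp
  also have "\<dots> = 4 * d\<^sup>2 * T" by (simp add: T_def)
  finally have main: "(LINT r|U01. LINT s|U01. r * g (fan_point a b c r s)) \<le> 4 * d\<^sup>2 * T" .
  have f2: "(L2_norm K f)\<^sup>2 = 2 * measure lebesgue K * (LINT r|U01. LINT s|U01. r * g (fan_point a b c r s))"
  proof -
    have "(L2_norm K f)\<^sup>2 = integral\<^sup>L (lebesgue_on K) g"
      unfolding L2_norm_square using Kl
      by (intro Bochner_Integration.integral_cong refl) (auto simp: g_def space_restrict_space)
    then show ?thesis unfolding K_def using triangle_integral(1)[OF nc gb gB] by simp
  qed
  have "(\<lambda>x. (norm (H x))\<^sup>2) \<in> borel_measurable borel" using has_line_gradientD(2)[OF f] by measurable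
  moreover have "\<bar>(norm (H x))\<^sup>2\<bar> \<le> B\<^sup>2" for x using power_mono[OF B, of x 2] by simp
  ultimately have H2: "(L2_norm K H)\<^sup>2 = 2 * measure lebesgue K * T"
    unfolding L2_norm_square K_def using triangle_integral(1)[OF nc, of "\<lambda>x. (norm (H x))\<^sup>2" "B\<^sup>2"]
    by (simp add: T_def J_def n_def)
  have "(L2_norm K f)\<^sup>2 \<le> (2 * d * L2_norm K H)\<^sup>2"
    unfolding power_mult_distrib f2 H2 using mult_left_mono[OF main, of "2 * measure lebesgue K"] by (simp add: algebra_simps)
  then show ?thesis unfolding K_def by (rule power2_le_imp_le) (use d0 in \<open>auto simp: L2_norm_nonneg\<close>)
qed

section \<open>Triangles and their edges\<close>

definition triangle :: "(real^2) set \<Rightarrow> bool" where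
  "triangle K \<longleftrightarrow> (\<exists>a b c. K = convex hull {a, b, c} \<and> \<not> collinear {a, b, c})"

lemma triangle_props:
  assumes "triangle K"
  shows "compact K" "convex K" "K \<in> lmeasurable" "measure lebesgue K > 0" "interior K \<noteq> {}"
    "negligible (K - interior K)"
proof -
  obtain a b c where K: "K = convex hull {a, b, c}" and nc: "\<not> collinear {a, b, c}"
    using assms unfolding triangle_def by blast
  show cK: "compact K" unfolding K by (intro finite_imp_compact_convex_hull) simp
  show v: "convex K" unfolding K by (rule convex_convex_hull)
  show "K \<in> lmeasurable" using cK by (rule lmeasurable_compact)
  show m: "measure lebesgue K > 0" unfolding K by (rule triangle_integral(2)[OF nc, of "\<lambda>_. 0" 0]) auto
  have "K - interior K \<subseteq> frontier K" using closure_subset by (auto simp: frontier_def)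
  then show n: "negligible (K - interior K)" using negligible_convex_frontier[OF v] negligible_subset by blast
  show "interior K \<noteq> {}"
  proof
    assume "interior K = {}"
    then have "negligible K" using n by simp
    then show False using m by (simp add: negligible_iff_measure)
  qed
qed

lemma not_collinear_affine_independent:
  assumes "\<not> collinear {a, b, c :: real^2}"
  shows "\<not> affine_dependent {a, b, c}" "a \<noteq> b" "a \<noteq> c" "b \<noteq> c" "card {a, b, c} = 3"
  using assms collinear_3_eq_affine_dependent[of a b c] by auto

lemma two_simplex_triangle:
  assumes "2 simplex K" "K = element t" shows "triangle K"
proof -
  obtain z x y where t: "t = (z, x, y)" by (cases t)
  have K: "K = convex hull {z, x, y}" using assms t by simp
  have "aff_dim K = 2" using aff_dim_simplex[OF assms(1)] .
  then have "\<not> collinear {z, x, y}" by (simp add: K collinear_aff_dim aff_dim_convex_hull)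
  then show ?thesis using K unfolding triangle_def by blast
qed

text \<open>
  A one-dimensional face of a simplex is spanned by two of its vertices.
\<close>

lemma triangle_edge:
  assumes "triangle K" "E edge_of K"
  obtains a b c where "K = convex hull {a, b, c}" "\<not> collinear {a, b, c}" "E = closed_segment b c"
proof -
  obtain x y z where K: "K = convex hull {x, y, z}" and nc: "\<not> collinear {x, y, z}"
    using assms unfolding triangle_def by blast
  note ind = not_collinear_affine_independent[OF nc]
  have "E face_of K" "aff_dim E = 1" using assms(2) by (auto simp: edge_of_def)
  then obtain S where S: "S \<subseteq> {x, y, z}" "E = convex hull S"
    unfolding K using face_of_convex_hull_affine_independent[OF ind(1)] by auto
  have "\<not> affine_dependent S" using affine_independent_subset[OF ind(1) S(1)] .
  then have "aff_dim S = int (card S) - 1" using aff_dim_affine_independent[of S] by simp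
  then have cS: "card S = 2" using \<open>aff_dim E = 1\<close> S(2) by (simp add: aff_dim_convex_hull)
  have "finite S" using S(1) finite_subset by blast
  then have "card ({x, y, z} - S) = 1" using card_Diff_subset[OF _ S(1)] cS ind(5) by simp
  then obtain a where a: "{x, y, z} - S = {a}" by (auto simp: card_1_singleton_iff)
  obtain b c where bc: "S = {b, c}" using cS by (auto simp: card_2_iff)
  have e: "{a, b, c} = {x, y, z}" using a bc S(1) by blast
  show ?thesis
  proof (rule that[of a b c])
    show "K = convex hull {a, b, c}" unfolding K e ..
    show "\<not> collinear {a, b, c}" unfolding e by (rule nc)
    show "E = closed_segment b c" unfolding S(2) bc by (rule segment_convex_hull[symmetric])
  qed
qed

lemma triangle_vertices:
  assumes "convex hull {a, b, c} = convex hull {x, y, z}" "\<not> collinear {a, b, c}" "\<not> collinear {x, y, z :: real^2}"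
  shows "{a, b, c} = {x, y, z}"
proof (rule set_eqI)
  fix p
  have "p \<in> {a, b, c} \<longleftrightarrow> p extreme_point_of convex hull {a, b, c}"
    by (rule extreme_point_of_convex_hull_affine_independent[OF not_collinear_affine_independent(1)[OF assms(2)], symmetric])
  also have "\<dots> \<longleftrightarrow> p extreme_point_of convex hull {x, y, z}" unfolding assms(1) ..
  also have "\<dots> \<longleftrightarrow> p \<in> {x, y, z}"
    by (rule extreme_point_of_convex_hull_affine_independent[OF not_collinear_affine_independent(1)[OF assms(3)]])
  finally show "p \<in> {a, b, c} \<longleftrightarrow> p \<in> {x, y, z}" .
qed

text \<open>
  The orientation chosen in the definition of the edge integral may be either one; the mean over an edge does not
  depend on it.
\<close>

lemma edge_integral_segment:
  assumes "continuous_on UNIV f"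
  shows "edge_integral (closed_segment b c) f = dist b c *\<^sub>R edge_mean f b c"
proof -
  define p where "p = (SOME (x, y). closed_segment b c = closed_segment x y)"
  have "case p of (x, y) \<Rightarrow> closed_segment b c = closed_segment x y"
    unfolding p_def by (rule someI[of _ "(b, c)"]) simp
  then obtain x y where p: "p = (x, y)" and "closed_segment b c = closed_segment x y" by (cases p) auto
  then have "{b, c} = {x, y}" by (simp add: closed_segment_eq)
  then have "dist x y *\<^sub>R edge_mean f x y = dist b c *\<^sub>R edge_mean f b c"
    using edge_mean_commute[OF assms, of b c] by (auto simp: doubleton_eq_iff dist_commute)
  then show ?thesis unfolding edge_integral_def p_def[symmetric] p by (simp add: edge_mean_def)
qed

section \<open>Affine parts\<close>

lemma AE_lebesgue_on_triangle:
  assumes "triangle K" "\<And>x. x \<in> interior K \<Longrightarrow> P x"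
  shows "AE x in lebesgue_on K. P x"
proof -
  have K: "K \<in> sets lebesgue" using triangle_props(3)[OF assms(1)] by auto
  have "AE x in lebesgue. x \<notin> K - interior K"
    using triangle_props(6)[OF assms(1)] by (intro AE_not_in) (simp add: negligible_iff_null_sets)
  then have "AE x in lebesgue. x \<in> K \<longrightarrow> P x" by eventually_elim (use assms(2) in auto)
  then show ?thesis using K by (subst AE_restrict_space_iff) auto
qed

text \<open>
  The set where the affine map does not vanish is open in the interior, and it is a null set, so it is empty. An affine map
  that vanishes on a ball vanishes everywhere.
\<close>

lemma affine_zero_AE:
  assumes K: "triangle K" and L: "linear L" and z: "AE x in lebesgue_on K. L x + c = (0 :: real^2)"
  shows "L x + c = 0"
proof -
  have Ks: "K \<in> sets lebesgue" using triangle_props(3)[OF K] by auto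
  define U where "U = {x \<in> interior K. L x + c \<noteq> 0}"
  have cL: "continuous_on UNIV (\<lambda>x. L x + c)"
    by (intro continuous_on_add linear_continuous_on continuous_on_const) (use L in \<open>simp add: linear_conv_bounded_linear\<close>)
  have "open (interior K \<inter> (\<lambda>x. L x + c) -` (- {0}))"
    by (intro open_Int open_interior open_vimage) (use cL in auto)
  moreover have "interior K \<inter> (\<lambda>x. L x + c) -` (- {0}) = U" by (auto simp: U_def)
  ultimately have oU: "open U" by simp
  have "AE x in lebesgue. x \<in> K \<longrightarrow> L x + c = 0" using z Ks by (subst (asm) AE_restrict_space_iff) auto
  then obtain N where N: "{x. \<not> (x \<in> K \<longrightarrow> L x + c = 0)} \<subseteq> N" "N \<in> null_sets lebesgue"
    by (auto simp: eventually_ae_filter)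
  have "U \<subseteq> N" using N(1) interior_subset[of K] by (auto simp: U_def)
  then have "negligible U" using N(2) negligible_iff_null_sets negligible_subset by blast
  then have U0: "U = {}" using oU open_not_negligible by blast
  obtain y e where e: "e > 0" "ball y e \<subseteq> interior K"
    using triangle_props(5)[OF K] open_interior open_contains_ball by (metis ex_in_conv)
  have zero: "L w + c = 0" if "w \<in> ball y e" for w using U0 e that by (auto simp: U_def)
  have y0: "L y + c = 0" using zero[of y] e by simp
  define h where "h = x - y"
  (* s * h is shorter than e, so y + s * h stays in the ball *)
  define s where "s = e / (2 * (norm h + 1))"
  have s: "s > 0" unfolding s_def using e by (intro divide_pos_pos mult_pos_pos add_nonneg_pos) auto
  have np: "norm h + 1 > 0" by (simp add: add_nonneg_pos)
  have "s * norm h < s * (2 * (norm h + 1))" using s np by (intro mult_strict_left_mono) auto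
  also have "\<dots> = e"
  proof -
    have "2 * (norm h + 1) \<noteq> 0" using np by simp
    from iffD1[OF nonzero_eq_divide_eq[OF this] refl] show ?thesis by (simp only: s_def)
  qed
  finally have "s * norm h < e" .
  then have "y + s *\<^sub>R h \<in> ball y e" using s by (simp add: dist_norm)
  from zero[OF this] have "L y + s *\<^sub>R L h + c = 0" using L by (simp add: linear_add linear_scale)
  moreover have "s *\<^sub>R L h = (L y + s *\<^sub>R L h + c) - (L y + c)" by simp
  ultimately have "s *\<^sub>R L h = 0" using y0 by simp
  then have "L h = 0" using s by simp
  then show ?thesis using y0 L by (simp add: h_def linear_diff)
qed

lemma affine_part_eq:
  assumes K: "triangle K" and A: "is_affine_on K v A"
  shows "affine_part K v = A"
proof -
  have "is_affine_on K v (affine_part K v)" unfolding affine_part_def by (rule someI[of "is_affine_on K v", OF A])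
  then obtain L c where L: "linear L" "affine_part K v = (\<lambda>x. L x + c)" and 1: "AE x in lebesgue_on K. v x = affine_part K v x"
    unfolding is_affine_on_def by blast
  obtain L' c' where L': "linear L'" "A = (\<lambda>x. L' x + c')" and 2: "AE x in lebesgue_on K. v x = A x"
    using A unfolding is_affine_on_def by blast
  have "AE x in lebesgue_on K. (L x - L' x) + (c - c') = 0"
    using 1 2 by eventually_elim (simp add: L(2) L'(2) algebra_simps)
  then have "(L x - L' x) + (c - c') = 0" for x
    by (rule affine_zero_AE[OF K linear_compose_sub[OF L(1) L'(1)]])
  then show ?thesis unfolding L(2) L'(2) by (auto simp: fun_eq_iff algebra_simps)
qed

lemma affine_part_affine:
  assumes "\<exists>A. is_affine_on K v A"
  shows "is_affine_on K v (affine_part K v)"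
  using assms unfolding affine_part_def by (rule someI_ex)

section \<open>Interpolation on one triangle\<close>

text \<open>
  The affine map whose gradient is the mean of \<open>G\<close> and whose mean over one side is that of \<open>v\<close>. The representation by
  vertices is arbitrary; the means over the other two sides turn out to agree as well.
\<close>

definition cr_affine :: "(real^2) set \<Rightarrow> (real^2 \<Rightarrow> real^2) \<Rightarrow> (real^2 \<Rightarrow> real^2^2) \<Rightarrow> real^2 \<Rightarrow> real^2" where
  "cr_affine K v G x = (let (a, b, c) = (SOME (a, b, c). K = convex hull {a, b, c} \<and> \<not> collinear {a, b, c})
     in mean_gradient K G *v (x - midpoint b c) + edge_mean v b c)"

text \<open>
  Differences of edge means of an affine map are half its increment along the third side. By \<open>edge_mean_difference\<close> the
  same holds for \<open>v\<close> with the mean gradient, so agreement on one side spreads to all sides.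
\<close>

lemma cr_affine_edge_mean:
  assumes v: "has_line_gradient v G" and K: "K = convex hull {a, b, c}" and nc: "\<not> collinear {a, b, c}"
  shows "edge_mean (cr_affine K v G) b c = edge_mean v b c"
    "\<exists>q. cr_affine K v G = (\<lambda>x. mean_gradient K G *v x + q)"
proof -
  define p where "p = (SOME (a, b, c). K = convex hull {a, b, c} \<and> \<not> collinear {a, b, c})"
  have "case p of (a, b, c) \<Rightarrow> K = convex hull {a, b, c} \<and> \<not> collinear {a, b, c}"
    unfolding p_def by (rule someI[of _ "(a, b, c)"]) (use K nc in simp)
  then obtain x y z where p: "p = (x, y, z)" and K': "K = convex hull {x, y, z}" and nc': "\<not> collinear {x, y, z}"
    by (cases p) auto
  define M where "M = mean_gradient K G"
  have A: "cr_affine K v G = (\<lambda>w. M *v (w - midpoint y z) + edge_mean v y z)"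
    unfolding cr_affine_def p_def[symmetric] p M_def by simp
  then show "\<exists>q. cr_affine K v G = (\<lambda>x. mean_gradient K G *v x + q)"
    by (intro exI[of _ "edge_mean v y z - M *v midpoint y z"]) (auto simp: M_def matrix_vector_mult_diff_distrib)
  note cv = has_line_gradientD(1)[OF v]
  have E: "edge_mean (cr_affine K v G) r s = M *v (midpoint r s - midpoint y z) + edge_mean v y z" for r s
    unfolding A by (rule edge_mean_affine)
  have rot: "{y, x, z} = {x, y, z}" "{z, y, x} = {x, y, z}" "{y, z, x} = {x, y, z}" "{z, x, y} = {x, y, z}" by auto
  have yz: "edge_mean (cr_affine K v G) y z = edge_mean v y z" by (simp add: E)
  have yx: "edge_mean (cr_affine K v G) y x = edge_mean v y x"
  proof -
    have e: "edge_mean v y x - edge_mean v y z = (1/2) *\<^sub>R (M *v (x - z))"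
      using edge_mean_difference[OF v, of y z x] nc' unfolding rot K'[symmetric] M_def by simp
    have m: "midpoint y x - midpoint y z = (1/2) *\<^sub>R (x - z)" by (simp add: midpoint_def algebra_simps)
    show ?thesis unfolding E m matrix_vector_mult_scaleR e[symmetric] by simp
  qed
  have zx: "edge_mean (cr_affine K v G) z x = edge_mean v z x"
  proof -
    have e: "edge_mean v z x - edge_mean v z y = (1/2) *\<^sub>R (M *v (x - y))"
      using edge_mean_difference[OF v, of z y x] nc' unfolding rot K'[symmetric] M_def by simp
    have m: "midpoint z x - midpoint y z = (1/2) *\<^sub>R (x - y)" by (simp add: midpoint_def algebra_simps)
    have c: "edge_mean v z y = edge_mean v y z" by (rule edge_mean_commute[OF cv])
    show ?thesis unfolding E m matrix_vector_mult_scaleR e[symmetric] c by simp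
  qed
  have cA: "continuous_on UNIV (cr_affine K v G)" unfolding A by (intro continuous_intros)
  have com: "edge_mean (cr_affine K v G) s r = edge_mean v s r" if "edge_mean (cr_affine K v G) r s = edge_mean v r s" for r s
    using that edge_mean_commute[OF cA, of r s] edge_mean_commute[OF cv, of r s] by simp
  have "{a, b, c} = {x, y, z}" by (rule triangle_vertices[OF _ nc nc']) (use K K' in simp)
  then have "b \<in> {x, y, z}" "c \<in> {x, y, z}" by blast+
  moreover have "b \<noteq> c" using not_collinear_affine_independent(4)[OF nc] .
  ultimately show "edge_mean (cr_affine K v G) b c = edge_mean v b c"
    using yz yx zx com by auto
qed

lemma has_line_gradient_affine: "has_line_gradient (\<lambda>x. M *v x + q) (\<lambda>x. M)"
  unfolding has_line_gradient_def
proof (intro conjI allI)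
  show "continuous_on UNIV (\<lambda>x. M *v x + q)" by (intro continuous_intros)
  show "((\<lambda>t::real. M *v (b - a)) has_integral (M *v b + q - (M *v a + q))) {0..1}" for a b
    using has_integral_const_real[of "M *v (b - a)" 0 1] by (simp add: matrix_vector_mult_diff_distrib)
qed auto

lemma has_line_gradient_diff:
  assumes "has_line_gradient v G" "has_line_gradient w H"
  shows "has_line_gradient (\<lambda>x. v x - w x) (\<lambda>x. G x - H x)"
proof -
  have "field_on UNIV v G" "field_on UNIV w H" using assms by (auto simp: field_on_def)
  from field_on_add[OF this(1) field_on_scaleR[OF this(2), of "-1"]] show ?thesis by (simp add: field_on_def)
qed

lemma mean_gradient_norm:
  assumes "triangle K" "square_integrable K G"
  shows "L2_norm K (\<lambda>x. mean_gradient K G) \<le> L2_norm K G"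
proof -
  have Kl: "K \<in> lmeasurable" and m: "measure lebesgue K > 0" using triangle_props[OF assms(1)] by auto
  define M where "M = mean_gradient K G"
  have sM: "square_integrable K (\<lambda>x. M)" by (rule square_integrable_bounded[OF Kl, of _ "norm M"]) auto
  have Gi: "integrable (lebesgue_on K) G" by (rule square_integrable_imp_integrable[OF Kl assms(2)])
  have IG: "integral\<^sup>L (lebesgue_on K) G = measure lebesgue K *\<^sub>R M" using m by (simp add: M_def mean_gradient_def)
  have "L2_inner K (\<lambda>x. M) G = M \<bullet> integral\<^sup>L (lebesgue_on K) G"
    unfolding L2_inner_def using Gi by (cases "M = 0") (auto simp: integral_inner_right)
  also have "\<dots> = measure lebesgue K * (norm M)\<^sup>2" by (simp add: IG power2_norm_eq_inner)
  also have "\<dots> = (L2_norm K (\<lambda>x. M))\<^sup>2"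
    unfolding L2_norm_square using Kl by (simp add: measure_restrict_space)
  finally have "(L2_norm K (\<lambda>x. M))\<^sup>2 \<le> L2_norm K (\<lambda>x. M) * L2_norm K G"
    using L2_Cauchy_Schwarz[OF sM assms(2)] by simp
  then have "L2_norm K (\<lambda>x. M) = 0 \<or> L2_norm K (\<lambda>x. M) \<le> L2_norm K G"
    unfolding power2_eq_square using L2_norm_nonneg[of K "\<lambda>x. M"] by (auto simp: mult_le_cancel_left)
  then show ?thesis using L2_norm_nonneg[of K G] by (auto simp: M_def)
qed

text \<open>
  The error has mean zero over a side, and its gradient is at most twice as large as \<open>G\<close> in \<open>L\<^sup>2\<close>.
\<close>

lemma cr_affine_error_le:
  assumes v: "has_line_gradient v G" and K: "triangle K"
  shows "L2_norm K (\<lambda>x. v x - cr_affine K v G x) \<le> 4 * diameter K * L2_norm K G"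
proof -
  obtain a b c where Ke: "K = convex hull {a, b, c}" and nc: "\<not> collinear {a, b, c}"
    using K unfolding triangle_def by blast
  have Kl: "K \<in> lmeasurable" using triangle_props[OF K] by auto
  obtain q where q: "cr_affine K v G = (\<lambda>x. mean_gradient K G *v x + q)"
    using cr_affine_edge_mean(2)[OF v Ke nc] by blast
  have A: "has_line_gradient (cr_affine K v G) (\<lambda>x. mean_gradient K G)" unfolding q by (rule has_line_gradient_affine)
  note D = has_line_gradient_diff[OF v A]
  have m0: "edge_mean (\<lambda>x. v x - cr_affine K v G x) b c = 0"
    using edge_mean_diff[OF has_line_gradientD(1)[OF v] has_line_gradientD(1)[OF A], of b c] cr_affine_edge_mean(1)[OF v Ke nc] by simp
  have bK: "bounded K" using triangle_props(1)[OF K] compact_imp_bounded by blast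
  have "a \<in> K" "b \<in> K" "c \<in> K" unfolding Ke by (auto intro: hull_inc)
  then have d: "norm (b - a) \<le> diameter K" "norm (c - a) \<le> diameter K" "norm (c - b) \<le> diameter K"
    using diameter_bounded_bound[OF bK] by (auto simp: dist_norm)
  note sG = line_gradient_si[OF v Kl] and sM = line_gradient_si[OF A Kl]
  have "L2_norm K (\<lambda>x. v x - cr_affine K v G x) \<le> 2 * diameter K * L2_norm K (\<lambda>x. G x - mean_gradient K G)"
    using triangle_poincare[OF D nc m0 d] unfolding Ke .
  also have "\<dots> \<le> 2 * diameter K * (2 * L2_norm K G)"
  proof (rule mult_left_mono)
    show "L2_norm K (\<lambda>x. G x - mean_gradient K G) \<le> 2 * L2_norm K G"
      using L2_norm_diff[OF sG sM] mean_gradient_norm[OF K sG] by simp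
    show "0 \<le> 2 * diameter K" using diameter_ge_0[OF bK] by simp
  qed
  finally show ?thesis by simp
qed

section \<open>Meshes and piecewise functions\<close>

text \<open>
  What integration over the mesh needs. It also covers the mesh that refines a single triangle \<open>K\<close>, with \<open>\<Omega>\<close> the
  interior of \<open>K\<close>.
\<close>

definition triangle_mesh :: "(real^2) set \<Rightarrow> (real^2) set set \<Rightarrow> bool" where
  "triangle_mesh \<Omega> \<T> \<longleftrightarrow> open \<Omega> \<and> bounded \<Omega> \<and> negligible (closure \<Omega> - \<Omega>) \<and> finite \<T> \<and> (\<forall>K\<in>\<T>. triangle K) \<and>
     (\<forall>K\<in>\<T>. \<forall>K'\<in>\<T>. K \<noteq> K' \<longrightarrow> interior K \<inter> interior K' = {}) \<and>
     (\<forall>K\<in>\<T>. interior K \<subseteq> \<Omega>) \<and> \<Union>\<T> = closure \<Omega>"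

lemma triangle_meshD:
  assumes "triangle_mesh \<Omega> \<T>"
  shows "open \<Omega>" "bounded \<Omega>" "finite \<T>" "K \<in> \<T> \<Longrightarrow> triangle K" "K \<in> \<T> \<Longrightarrow> interior K \<subseteq> \<Omega>"
    "K \<in> \<T> \<Longrightarrow> K' \<in> \<T> \<Longrightarrow> x \<in> interior K \<Longrightarrow> x \<in> interior K' \<Longrightarrow> K = K'"
    "\<Union>\<T> = closure \<Omega>" "\<Omega> \<in> lmeasurable" "\<Omega> \<in> sets lebesgue" "K \<in> \<T> \<Longrightarrow> K \<in> lmeasurable" "K \<in> \<T> \<Longrightarrow> K \<in> sets lebesgue"
proof -
  note m = assms[unfolded triangle_mesh_def]
  show "open \<Omega>" "bounded \<Omega>" "finite \<T>" "\<Union>\<T> = closure \<Omega>" using m by simp_all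
  then show "\<Omega> \<in> lmeasurable" by (intro lmeasurable_open)
  then show "\<Omega> \<in> sets lebesgue" by auto
  show "triangle K" if "K \<in> \<T>" using m that by simp
  then show l: "K \<in> lmeasurable" if "K \<in> \<T>" using that triangle_props(3) by simp
  then show "K \<in> sets lebesgue" if "K \<in> \<T>" using that by auto
  show "interior K \<subseteq> \<Omega>" if "K \<in> \<T>" using m that by simp
  show "K = K'" if "K \<in> \<T>" "K' \<in> \<T>" "x \<in> interior K" "x \<in> interior K'"
  proof (rule ccontr)
    assume "K \<noteq> K'"
    then have "interior K \<inter> interior K' = {}" using m that(1,2) by simp
    then show False using that(3,4) by blast
  qed
qed

text \<open>
  The edges form a null set, so almost every point lies in the interior of every triangle that contains it.
\<close>

lemma mesh_skeleton:
  assumes T: "triangle_mesh \<Omega> \<T>"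
  shows "AE x in lebesgue. (x \<in> \<Omega> \<longleftrightarrow> (\<exists>K\<in>\<T>. x \<in> interior K)) \<and> (\<forall>K\<in>\<T>. x \<in> K \<longrightarrow> x \<in> interior K)"
proof -
  have "negligible ((closure \<Omega> - \<Omega>) \<union> (\<Union>K\<in>\<T>. K - interior K))"
    using T triangle_props(6) unfolding triangle_mesh_def by (intro negligible_Un negligible_Union) auto
  then have "AE x in lebesgue. x \<notin> (closure \<Omega> - \<Omega>) \<union> (\<Union>K\<in>\<T>. K - interior K)"
    by (intro AE_not_in) (simp add: negligible_iff_null_sets)
  then show ?thesis
  proof eventually_elim
    case (elim x)
    have i: "\<forall>K\<in>\<T>. x \<in> K \<longrightarrow> x \<in> interior K" using elim by auto
    moreover have "x \<in> \<Omega> \<longleftrightarrow> (\<exists>K\<in>\<T>. x \<in> interior K)"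
      using i triangle_meshD(5,7)[OF T] closure_subset[of \<Omega>] by blast
    ultimately show ?case by blast
  qed
qed

lemma measurable_on_element:
  fixes f :: "real^2 \<Rightarrow> 'b::euclidean_space"
  assumes K: "triangle K" and f: "f \<in> borel_measurable (lebesgue_on S)" "interior K \<subseteq> S" "S \<in> sets lebesgue"
  shows "f \<in> borel_measurable (lebesgue_on K)"
proof -
  have Ks: "K \<in> sets lebesgue" using triangle_props(3)[OF K] by auto
  have "(\<lambda>x. if x \<in> S then f x else 0) \<in> borel_measurable lebesgue"
    using f by (simp add: borel_measurable_if)
  then have "(\<lambda>x. if x \<in> interior K then (if x \<in> S then f x else 0) else 0) \<in> borel_measurable lebesgue"
    by (rule measurable_If_set) auto
  also have "(\<lambda>x. if x \<in> interior K then (if x \<in> S then f x else 0) else 0) = (\<lambda>x. if x \<in> interior K then f x else 0)"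
    by (intro ext) (use f(2) in \<open>auto dest: subsetD\<close>)
  finally have fi: "f \<in> borel_measurable (lebesgue_on (interior K))" by (simp add: borel_measurable_if)
  have e: "interior K = K - (K - interior K)" using interior_subset by auto
  have "K - interior K \<in> null_sets lebesgue" using triangle_props(6)[OF K] by (simp add: negligible_iff_null_sets)
  then have "K - interior K \<in> null_sets (lebesgue_on K)" using Ks by (subst null_sets_restrict_space) auto
  from borel_measurable_diff_null[OF this Ks, of f] show ?thesis using fi e by simp
qed

lemma square_integrable_on_triangle:
  assumes K: "triangle K" and f: "square_integrable S f" "interior K \<subseteq> S" "S \<in> sets lebesgue"
  shows "square_integrable K f"
proof -
  have Ks: "K \<in> sets lebesgue" using triangle_props(3)[OF K] by auto
  have fm: "f \<in> borel_measurable (lebesgue_on K)" by (rule measurable_on_element[OF K square_integrable_measurable[OF f(1)] f(2,3)])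
  have "square_integrable UNIV (\<lambda>x. if x \<in> S then f x else 0)" using f by (simp add: square_integrable_restrict_UNIV)
  then have "square_integrable K (\<lambda>x. if x \<in> S then f x else 0)" by (rule square_integrable_subset) (use Ks in auto)
  then show ?thesis
    by (rule square_integrable_cong_AE[OF _ fm]) (use f(2) in \<open>auto intro!: AE_lebesgue_on_triangle[OF K]\<close>)
qed

lemma integral_mesh:
  fixes F :: "real^2 \<Rightarrow> real"
  assumes T: "triangle_mesh \<Omega> \<T>" and F: "integrable (lebesgue_on \<Omega>) F"
  shows "integral\<^sup>L (lebesgue_on \<Omega>) F = (\<Sum>K\<in>\<T>. integral\<^sup>L (lebesgue_on K) F)"
proof -
  note D = triangle_meshD[OF T]
  have F0: "integrable lebesgue (\<lambda>x. if x \<in> \<Omega> then F x else 0)"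
    using F Lebesgue_Measure.integrable_restrict_UNIV[OF D(9)] by blast
  have Fm: "F \<in> borel_measurable (lebesgue_on K)" if "K \<in> \<T>" for K
    by (rule measurable_on_element[OF D(4)[OF that] borel_measurable_integrable[OF F] D(5)[OF that] D(9)])
  have Fm': "(\<lambda>x. if x \<in> K then F x else 0) \<in> borel_measurable lebesgue" if "K \<in> \<T>" for K
    using Fm[OF that] D(11)[OF that] by (simp add: borel_measurable_if)
  have Fi: "integrable lebesgue (\<lambda>x. if x \<in> K then F x else 0)" if "K \<in> \<T>" for K
  proof (rule Bochner_Integration.integrable_bound[OF F0 Fm'[OF that]])
    show "AE x in lebesgue. norm (if x \<in> K then F x else 0) \<le> norm (if x \<in> \<Omega> then F x else 0)"
      using mesh_skeleton[OF T] by eventually_elim (use that in auto)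
  qed
  have "integral\<^sup>L (lebesgue_on \<Omega>) F = integral\<^sup>L lebesgue (\<lambda>x. if x \<in> \<Omega> then F x else 0)"
    by (rule Lebesgue_Measure.integral_restrict_UNIV[OF D(9), symmetric])
  also have "\<dots> = integral\<^sup>L lebesgue (\<lambda>x. \<Sum>K\<in>\<T>. if x \<in> K then F x else 0)"
  proof (rule integral_cong_AE)
    show "(\<lambda>x. \<Sum>K\<in>\<T>. if x \<in> K then F x else 0) \<in> borel_measurable lebesgue" by (intro borel_measurable_sum Fm')
    show "AE x in lebesgue. (if x \<in> \<Omega> then F x else 0) = (\<Sum>K\<in>\<T>. if x \<in> K then F x else 0)"
      using mesh_skeleton[OF T]
    proof eventually_elim
      case (elim x)
      show ?case
      proof (cases "x \<in> \<Omega>")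
        case True
        then obtain K where K: "K \<in> \<T>" "x \<in> interior K" using elim by blast
        have "(\<Sum>K'\<in>\<T>. if x \<in> K' then F x else 0) = (\<Sum>K'\<in>\<T>. if K' = K then F x else 0)"
        proof (rule sum.cong)
          fix K' assume K': "K' \<in> \<T>"
          have "x \<in> K' \<longleftrightarrow> K' = K"
          proof
            assume "x \<in> K'"
            then have "x \<in> interior K'" using elim K' by simp
            then show "K' = K" by (rule D(6)[OF K' K(1) _ K(2)])
          next
            assume "K' = K" then show "x \<in> K'" using K(2) interior_subset by (simp only:) blast
          qed
          then show "(if x \<in> K' then F x else 0) = (if K' = K then F x else 0)" by simp
        qed simp
        then show ?thesis using True K D(3) by simp
      next
        case False
        then have "\<forall>K\<in>\<T>. x \<notin> K" using elim by blast
        then show ?thesis using False by simp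
      qed
    qed
  qed (use F0 in auto)
  also have "\<dots> = (\<Sum>K\<in>\<T>. integral\<^sup>L lebesgue (\<lambda>x. if x \<in> K then F x else 0))"
    by (rule Bochner_Integration.integral_sum) (rule Fi)
  also have "\<dots> = (\<Sum>K\<in>\<T>. integral\<^sup>L (lebesgue_on K) F)"
    by (intro sum.cong refl Lebesgue_Measure.integral_restrict_UNIV D(11))
  finally show ?thesis .
qed

lemma L2_inner_mesh:
  assumes T: "triangle_mesh \<Omega> \<T>" and f: "square_integrable \<Omega> f" "square_integrable \<Omega> g"
  shows "L2_inner \<Omega> f g = (\<Sum>K\<in>\<T>. L2_inner K f g)"
  unfolding L2_inner_def by (rule integral_mesh[OF T square_integrable_inner_integrable[OF f]])

lemma L2_norm_mesh:
  assumes T: "triangle_mesh \<Omega> \<T>" and f: "square_integrable \<Omega> f"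
  shows "(L2_norm \<Omega> f)\<^sup>2 = (\<Sum>K\<in>\<T>. (L2_norm K f)\<^sup>2)"
  using L2_inner_mesh[OF T f f] unfolding L2_norm_square L2_inner_def power2_norm_eq_inner .

text \<open>
  On the edges the value is 0, so the pieces need no tie-breaking.
\<close>

definition piecewise :: "(real^2) set set \<Rightarrow> ((real^2) set \<Rightarrow> real^2 \<Rightarrow> 'b::real_vector) \<Rightarrow> real^2 \<Rightarrow> 'b" where
  "piecewise \<T> F x = (\<Sum>K\<in>\<T>. indicat_real (interior K) x *\<^sub>R F K x)"

lemma piecewise_eq:
  assumes T: "triangle_mesh \<Omega> \<T>" and K: "K \<in> \<T>" "x \<in> interior K"
  shows "piecewise \<T> F x = F K x"
proof -
  note D = triangle_meshD[OF T]
  have "piecewise \<T> F x = (\<Sum>K'\<in>\<T>. if K' = K then F K x else 0)"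
    unfolding piecewise_def
  proof (rule sum.cong)
    fix K' assume K': "K' \<in> \<T>"
    show "indicat_real (interior K') x *\<^sub>R F K' x = (if K' = K then F K x else 0)"
    proof (cases "K' = K")
      case False
      then have "x \<notin> interior K'" using D(6)[OF K' K(1) _ K(2)] by blast
      then show ?thesis using False by simp
    qed (use K(2) in simp)
  qed simp
  then show ?thesis using K D(3) by simp
qed

lemma piecewise_AE:
  assumes T: "triangle_mesh \<Omega> \<T>" and K: "K \<in> \<T>"
  shows "AE x in lebesgue_on K. piecewise \<T> F x = F K x"
  by (rule AE_lebesgue_on_triangle[OF triangle_meshD(4)[OF T K]]) (rule piecewise_eq[OF T K])

lemma piecewise_si:
  fixes F :: "(real^2) set \<Rightarrow> real^2 \<Rightarrow> 'b::euclidean_space"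
  assumes T: "triangle_mesh \<Omega> \<T>" and c: "\<And>K. K \<in> \<T> \<Longrightarrow> continuous_on UNIV (F K)"
    and S: "S \<in> sets lebesgue"
  shows "square_integrable S (piecewise \<T> F)"
proof -
  note D = triangle_meshD[OF T]
  have m: "piecewise \<T> F \<in> borel_measurable borel"
    unfolding piecewise_def
    by (intro borel_measurable_sum borel_measurable_scaleR borel_measurable_indicator borel_measurable_continuous_onI c) auto
  have "square_integrable UNIV (\<lambda>x. \<Sum>K\<in>\<T>. (if x \<in> K then indicat_real (interior K) x *\<^sub>R F K x else 0))"
  proof (rule square_integrable_sum)
    fix K assume K: "K \<in> \<T>"
    have "bounded (F K ` K)"
      using triangle_props(1)[OF D(4)[OF K]] by (intro compact_imp_bounded compact_continuous_image continuous_on_subset[OF c[OF K]]) auto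
    then obtain M where M: "\<And>x. x \<in> K \<Longrightarrow> norm (F K x) \<le> M" unfolding bounded_iff by auto
    have "square_integrable K (\<lambda>x. indicat_real (interior K) x *\<^sub>R F K x)"
    proof (rule square_integrable_bounded[OF D(10)[OF K], of _ M])
      show "(\<lambda>x. indicat_real (interior K) x *\<^sub>R F K x) \<in> borel_measurable (lebesgue_on K)"
        by (intro measurable_restrict_space1 measurable_completion)
          (simp, intro borel_measurable_scaleR borel_measurable_indicator borel_measurable_continuous_onI c K, auto)
      have "norm (indicat_real (interior K) x *\<^sub>R F K x) \<le> M" if "x \<in> K" for x
        using M[OF that] norm_ge_zero[of "F K x"] by (auto simp: indicator_def simp del: norm_ge_zero)
      then show "AE x in lebesgue_on K. norm (indicat_real (interior K) x *\<^sub>R F K x) \<le> M"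
        using D(11)[OF K] by (auto simp: AE_restrict_space_iff)
    qed
    then show "square_integrable UNIV (\<lambda>x. if x \<in> K then indicat_real (interior K) x *\<^sub>R F K x else 0)"
      by (rule iffD2[OF square_integrable_restrict_UNIV[OF D(11)[OF K]]])
  qed
  moreover have "(\<lambda>x. \<Sum>K\<in>\<T>. (if x \<in> K then indicat_real (interior K) x *\<^sub>R F K x else 0)) = piecewise \<T> F"
    unfolding piecewise_def using interior_subset by (intro ext sum.cong refl) (auto simp: indicator_def)
  ultimately have "square_integrable UNIV (piecewise \<T> F)" by simp
  then show ?thesis by (rule square_integrable_subset) (use S in auto)
qed

section \<open>The Crouzeix-Raviart interpolant\<close>

definition cr_interpolant :: "(real^2) set set \<Rightarrow> (real^2 \<Rightarrow> real^2) \<Rightarrow> (real^2 \<Rightarrow> real^2^2) \<Rightarrow> real^2 \<Rightarrow> real^2" where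
  "cr_interpolant \<T> v G = piecewise \<T> (\<lambda>K. cr_affine K v G)"

lemma cr_affine_gradient:
  assumes "has_line_gradient v G" "triangle K"
  obtains q where "cr_affine K v G = (\<lambda>x. mean_gradient K G *v x + q)"
  using assms cr_affine_edge_mean(2) unfolding triangle_def by blast

lemma cr_affine_continuous:
  assumes "has_line_gradient v G" "triangle K"
  shows "continuous_on UNIV (cr_affine K v G)"
proof -
  obtain q where "cr_affine K v G = (\<lambda>x. mean_gradient K G *v x + q)" using cr_affine_gradient[OF assms] .
  then show ?thesis by (simp only:) (intro continuous_intros)
qed

lemma affine_part_interpolant:
  assumes T: "triangle_mesh \<Omega> \<T>" and v: "has_line_gradient v G" and K: "K \<in> \<T>"
  shows "is_affine_on K (cr_interpolant \<T> v G) (cr_affine K v G)"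
    "affine_part K (cr_interpolant \<T> v G) = cr_affine K v G"
proof -
  note tK = triangle_meshD(4)[OF T K]
  obtain q where q: "cr_affine K v G = (\<lambda>x. mean_gradient K G *v x + q)" using cr_affine_gradient[OF v tK] .
  show a: "is_affine_on K (cr_interpolant \<T> v G) (cr_affine K v G)"
    unfolding is_affine_on_def
  proof
    show "\<exists>L c. linear L \<and> cr_affine K v G = (\<lambda>x. L x + c)" using q matrix_vector_mul_linear by blast
    show "AE x in lebesgue_on K. cr_interpolant \<T> v G x = cr_affine K v G x"
      unfolding cr_interpolant_def by (rule piecewise_AE[OF T K])
  qed
  show "affine_part K (cr_interpolant \<T> v G) = cr_affine K v G" by (rule affine_part_eq[OF tK a])
qed

text \<open>
  Both triangles at an edge, and the boundary condition, see the mean of the same continuous field \<open>v\<close>, which vanishes on the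
  boundary.
\<close>

lemma interpolant_in_CR:
  assumes T: "triangle_mesh \<Omega> \<T>" and v: "field_on \<Omega> v G"
  shows "cr_interpolant \<T> v G \<in> CR_velocity \<Omega> \<T>"
proof -
  note D = triangle_meshD[OF T]
  have lg: "has_line_gradient v G" and v0: "\<And>x. x \<notin> \<Omega> \<Longrightarrow> v x = 0" using v by (auto simp: field_on_def)
  note cv = has_line_gradientD(1)[OF lg]
  have em: "\<exists>b c. E = closed_segment b c \<and> edge_mean (cr_affine K v G) b c = edge_mean v b c" if "K \<in> \<T>" "E edge_of K" for E K
    using triangle_edge[OF D(4)[OF that(1)] that(2)] cr_affine_edge_mean(1)[OF lg] by metis
  have em': "edge_mean (cr_affine K v G) b c = edge_mean v b c" if KE: "K \<in> \<T>" "closed_segment b c edge_of K" for K b c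
  proof -
    obtain x y where xy: "closed_segment b c = closed_segment x y" "edge_mean (cr_affine K v G) x y = edge_mean v x y"
      using em[OF KE] by blast
    then have "{b, c} = {x, y}" by (simp add: closed_segment_eq)
    then show ?thesis using xy(2) edge_mean_commute[OF cv, of x y]
        edge_mean_commute[OF cr_affine_continuous[OF lg D(4)[OF KE(1)]], of x y] by (auto simp: doubleton_eq_iff)
  qed
  show ?thesis
    unfolding CR_velocity_def
  proof (intro CollectI conjI ballI impI)
    show "square_integrable \<Omega> (cr_interpolant \<T> v G)"
      unfolding cr_interpolant_def by (rule piecewise_si[OF T cr_affine_continuous[OF lg D(4)] D(9)])
    show "\<exists>A. is_affine_on K (cr_interpolant \<T> v G) A" if "K \<in> \<T>" for K
      using affine_part_interpolant(1)[OF T lg that] by blast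
  next
    fix E K K' assume K: "K \<in> \<T>" "K' \<in> \<T>" and E: "K \<noteq> K' \<and> E edge_of K \<and> E edge_of K'"
    obtain b c where bc: "E = closed_segment b c" using em[OF K(1)] E by blast
    note cK = cr_affine_continuous[OF lg D(4)[OF K(1)]] and cK' = cr_affine_continuous[OF lg D(4)[OF K(2)]]
    have "edge_mean (\<lambda>x. cr_affine K v G x - cr_affine K' v G x) b c = 0"
      unfolding edge_mean_diff[OF cK cK'] using em'[OF K(1)] em'[OF K(2)] E bc by simp
    then show "edge_integral E (\<lambda>x. affine_part K (cr_interpolant \<T> v G) x - affine_part K' (cr_interpolant \<T> v G) x) = 0"
      unfolding affine_part_interpolant(2)[OF T lg K(1)] affine_part_interpolant(2)[OF T lg K(2)] bc
      by (simp add: edge_integral_segment[OF continuous_on_diff[OF cK cK']])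
  next
    fix E K assume E: "E \<in> boundary_edges \<Omega> \<T>" and K: "K \<in> \<T>" and EK: "E edge_of K"
    obtain b c where bc: "E = closed_segment b c" using em[OF K EK] by blast
    have "E \<subseteq> frontier \<Omega>" using E by (simp add: boundary_edges_def)
    then have vE: "v x = 0" if "x \<in> E" for x using that v0[of x] D(1) by (auto simp: frontier_def interior_open)
    then have "v (linepath b c t) = 0" if "t \<in> {0..1}" for t using vE[of "linepath b c t"] linepath_in_path[OF that, of b c] bc by simp
    then have "edge_mean v b c = integral {0..1} (\<lambda>t::real. 0)" unfolding edge_mean_def by (intro Henstock_Kurzweil_Integration.integral_cong) auto
    then have "edge_mean (cr_affine K v G) b c = 0" using em'[OF K] EK bc by simp
    then show "edge_integral E (affine_part K (cr_interpolant \<T> v G)) = 0"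
      unfolding affine_part_interpolant(2)[OF T lg K] bc
      by (simp add: edge_integral_segment[OF cr_affine_continuous[OF lg D(4)[OF K]]])
  qed
qed

lemma jacobian_affine: "jacobian (\<lambda>x. M *v x + q) (at y) = M" for M :: "real^2^2"
proof -
  have "((\<lambda>x. M *v x + q) has_derivative (*v) M) (at y)"
    by (auto intro!: derivative_eq_intros bounded_linear_imp_has_derivative)
  then have "frechet_derivative (\<lambda>x. M *v x + q) (at y) = (*v) M" by (rule frechet_derivative_at[symmetric])
  then show ?thesis by (simp add: jacobian_def)
qed

definition element_gradient :: "(real^2) set \<Rightarrow> (real^2 \<Rightarrow> real^2) \<Rightarrow> real^2^2" where
  "element_gradient K w = jacobian (affine_part K w) (at 0)"

lemma affine_part_gradient:
  assumes "\<exists>A. is_affine_on K w A"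
  obtains q where "affine_part K w = (\<lambda>x. element_gradient K w *v x + q)"
proof -
  obtain L c where L: "linear L" "affine_part K w = (\<lambda>x. L x + c)"
    using affine_part_affine[OF assms] unfolding is_affine_on_def by blast
  then have "affine_part K w = (\<lambda>x. matrix L *v x + c)" by (simp add: matrix_works)
  then show ?thesis using that[of c] jacobian_affine[of "matrix L" c 0] by (simp add: element_gradient_def)
qed

lemma broken_jacobian_piecewise:
  assumes T: "triangle_mesh \<Omega> \<T>" and w: "\<And>K. K \<in> \<T> \<Longrightarrow> \<exists>A. is_affine_on K w A"
  shows "broken_jacobian \<T> w = piecewise \<T> (\<lambda>K _. element_gradient K w)"
  unfolding broken_jacobian_def piecewise_def
proof (intro ext sum.cong refl)
  fix x K assume "K \<in> \<T>"
  then obtain q where "affine_part K w = (\<lambda>x. element_gradient K w *v x + q)" using affine_part_gradient[OF w] by blast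
  then have "jacobian (affine_part K w) (at x) = element_gradient K w" by (metis jacobian_affine)
  then show "indicat_real (interior K) x *\<^sub>R jacobian (affine_part K w) (at x) = indicat_real (interior K) x *\<^sub>R element_gradient K w" by simp
qed

lemma element_gradient_interpolant:
  assumes T: "triangle_mesh \<Omega> \<T>" and v: "has_line_gradient v G" and K: "K \<in> \<T>"
  shows "element_gradient K (cr_interpolant \<T> v G) = mean_gradient K G"
proof -
  obtain q where "cr_affine K v G = (\<lambda>x. mean_gradient K G *v x + q)"
    using cr_affine_gradient[OF v triangle_meshD(4)[OF T K]] .
  then show ?thesis unfolding element_gradient_def affine_part_interpolant(2)[OF T v K] by (simp only: jacobian_affine)
qed

lemma CR_affine: "w \<in> CR_velocity \<Omega> \<T> \<Longrightarrow> K \<in> \<T> \<Longrightarrow> \<exists>A. is_affine_on K w A"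
  and CR_si: "w \<in> CR_velocity \<Omega> \<T> \<Longrightarrow> square_integrable \<Omega> w"
  by (auto simp: CR_velocity_def)

lemma integral_mean_gradient:
  assumes "triangle K" "square_integrable K G"
  shows "L2_inner K (\<lambda>x. J) G = L2_inner K (\<lambda>x. J) (\<lambda>x. mean_gradient K G)"
proof -
  have Kl: "K \<in> lmeasurable" and m: "measure lebesgue K > 0" using triangle_props[OF assms(1)] by auto
  have Gi: "integrable (lebesgue_on K) G" by (rule square_integrable_imp_integrable[OF Kl assms(2)])
  have "L2_inner K (\<lambda>x. J) G = J \<bullet> integral\<^sup>L (lebesgue_on K) G"
    unfolding L2_inner_def using Gi by (cases "J = 0") auto
  then show ?thesis unfolding L2_inner_def using m Kl
    by (simp add: mean_gradient_def measure_restrict_space)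
qed

text \<open>
  On each triangle the gradient of the interpolant is the mean of \<open>G\<close>, and the gradient of \<open>w\<close> is constant, so the mean may
  be replaced by \<open>G\<close> itself.
\<close>

lemma discrete_a_interpolant:
  assumes T: "triangle_mesh \<Omega> \<T>" and v: "field_on \<Omega> v G" and w: "w \<in> CR_velocity \<Omega> \<T>"
  shows "discrete_a \<Omega> \<T> \<mu> w (cr_interpolant \<T> v G) = \<mu> * L2_inner \<Omega> (broken_jacobian \<T> w) G"
proof -
  note D = triangle_meshD[OF T]
  have lg: "has_line_gradient v G" using v by (simp add: field_on_def)
  note cr = interpolant_in_CR[OF T v]
  have bw: "broken_jacobian \<T> w = piecewise \<T> (\<lambda>K _. element_gradient K w)"
    by (rule broken_jacobian_piecewise[OF T CR_affine[OF w]])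
  have bi: "broken_jacobian \<T> (cr_interpolant \<T> v G) = piecewise \<T> (\<lambda>K _. element_gradient K (cr_interpolant \<T> v G))"
    by (rule broken_jacobian_piecewise[OF T CR_affine[OF cr]])
  have sc: "square_integrable S (piecewise \<T> (\<lambda>K _. J K :: real^2^2))" if "S \<in> sets lebesgue" for S J
    by (rule piecewise_si[OF T _ that]) simp
  have sG: "square_integrable \<Omega> G" by (rule line_gradient_si[OF lg D(8)])
  have "L2_inner \<Omega> (broken_jacobian \<T> w) (broken_jacobian \<T> (cr_interpolant \<T> v G)) =
     (\<Sum>K\<in>\<T>. L2_inner K (broken_jacobian \<T> w) (broken_jacobian \<T> (cr_interpolant \<T> v G)))"
    unfolding bw bi by (rule L2_inner_mesh[OF T sc[OF D(9)] sc[OF D(9)]])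
  also have "\<dots> = (\<Sum>K\<in>\<T>. L2_inner K (broken_jacobian \<T> w) G)"
  proof (rule sum.cong)
    fix K assume K: "K \<in> \<T>"
    have sK: "square_integrable K G" by (rule line_gradient_si[OF lg D(10)[OF K]])
    define J where "J = element_gradient K w"
    have c: "square_integrable K (\<lambda>x. M)" for M :: "real^2^2" by (rule square_integrable_bounded[OF D(10)[OF K], of _ "norm M"]) auto
    have "L2_inner K (broken_jacobian \<T> w) (broken_jacobian \<T> (cr_interpolant \<T> v G)) = L2_inner K (\<lambda>x. J) (\<lambda>x. mean_gradient K G)"
      unfolding L2_inner_def
    proof (rule integral_cong_AE)
      show "(\<lambda>x. broken_jacobian \<T> w x \<bullet> broken_jacobian \<T> (cr_interpolant \<T> v G) x) \<in> borel_measurable (lebesgue_on K)"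
        unfolding bw bi using sc[OF D(11)[OF K]] by (intro borel_measurable_inner square_integrable_measurable)
      show "AE x in lebesgue_on K. broken_jacobian \<T> w x \<bullet> broken_jacobian \<T> (cr_interpolant \<T> v G) x = J \<bullet> mean_gradient K G"
        unfolding bw bi using piecewise_AE[OF T K, of "\<lambda>K _. element_gradient K w"]
            piecewise_AE[OF T K, of "\<lambda>K _. element_gradient K (cr_interpolant \<T> v G)"]
        by eventually_elim (simp add: J_def element_gradient_interpolant[OF T lg K])
    qed simp
    also have "\<dots> = L2_inner K (\<lambda>x. J) G" by (rule integral_mean_gradient[OF D(4)[OF K] sK, symmetric])
    also have "\<dots> = L2_inner K (broken_jacobian \<T> w) G"
      unfolding L2_inner_def
    proof (rule integral_cong_AE)
      show "(\<lambda>x. J \<bullet> G x) \<in> borel_measurable (lebesgue_on K)"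
        using c sK by (intro borel_measurable_inner square_integrable_measurable)
      show "(\<lambda>x. broken_jacobian \<T> w x \<bullet> G x) \<in> borel_measurable (lebesgue_on K)"
        unfolding bw using sc[OF D(11)[OF K]] sK by (intro borel_measurable_inner square_integrable_measurable)
      show "AE x in lebesgue_on K. J \<bullet> G x = broken_jacobian \<T> w x \<bullet> G x"
        unfolding bw using piecewise_AE[OF T K, of "\<lambda>K _. element_gradient K w"] by eventually_elim (simp add: J_def)
    qed
    finally show "L2_inner K (broken_jacobian \<T> w) (broken_jacobian \<T> (cr_interpolant \<T> v G)) = L2_inner K (broken_jacobian \<T> w) G" .
  qed simp
  also have "\<dots> = L2_inner \<Omega> (broken_jacobian \<T> w) G"
    unfolding bw by (rule L2_inner_mesh[OF T sc[OF D(9)] sG, symmetric])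
  finally show ?thesis by (simp add: discrete_a_def)
qed

lemma square_integrable_trace:
  assumes "square_integrable S G" shows "square_integrable S (\<lambda>x. trace (G x :: real^2^2))"
proof -
  have "(\<lambda>x. trace (G x)) \<in> borel_measurable (lebesgue_on S)"
    using measurable_compose[OF square_integrable_measurable[OF assms] borel_measurable_continuous_onI[OF continuous_on_trace]] .
  then show ?thesis by (rule square_integrable_bound[OF square_integrable_scaleR[OF assms, of 2]]) (use abs_trace_le in auto)
qed

text \<open>
  As for the gradient: a piecewise constant pressure does not see the difference between \<open>trace G\<close> and its mean.
\<close>

lemma discrete_b_interpolant:
  assumes T: "triangle_mesh \<Omega> \<T>" and v: "field_on \<Omega> v G" and q: "q \<in> P0_pressure \<Omega> \<T>"
  shows "discrete_b \<Omega> \<T> (cr_interpolant \<T> v G) q = L2_inner \<Omega> (\<lambda>x. trace (G x)) q"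
proof -
  note D = triangle_meshD[OF T]
  have lg: "has_line_gradient v G" using v by (simp add: field_on_def)
  note cr = interpolant_in_CR[OF T v]
  have bi: "broken_jacobian \<T> (cr_interpolant \<T> v G) = piecewise \<T> (\<lambda>K _. element_gradient K (cr_interpolant \<T> v G))"
    by (rule broken_jacobian_piecewise[OF T CR_affine[OF cr]])
  have sq: "square_integrable \<Omega> q" using q by (simp add: P0_pressure_def L2_zero_mean_def)
  have sc: "square_integrable S (piecewise \<T> (\<lambda>K _. J K :: real^2^2))" if "S \<in> sets lebesgue" for S J
    by (rule piecewise_si[OF T _ that]) simp
  have sd: "square_integrable S (broken_div \<T> (cr_interpolant \<T> v G))" if "S \<in> sets lebesgue" for S
    using square_integrable_trace[OF sc[OF that]] unfolding broken_div_def[abs_def] bi .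
  have sG: "square_integrable \<Omega> (\<lambda>x. trace (G x))" by (rule square_integrable_trace[OF line_gradient_si[OF lg D(8)]])
  have "L2_inner \<Omega> (broken_div \<T> (cr_interpolant \<T> v G)) q = (\<Sum>K\<in>\<T>. L2_inner K (broken_div \<T> (cr_interpolant \<T> v G)) q)"
    by (rule L2_inner_mesh[OF T sd[OF D(9)] sq])
  also have "\<dots> = (\<Sum>K\<in>\<T>. L2_inner K (\<lambda>x. trace (G x)) q)"
  proof (rule sum.cong)
    fix K assume K: "K \<in> \<T>"
    obtain c where c: "AE x in lebesgue_on K. q x = c" using q K by (auto simp: P0_pressure_def)
    have sK: "square_integrable K G" by (rule line_gradient_si[OF lg D(10)[OF K]])
    have sqK: "square_integrable K q" by (rule square_integrable_on_triangle[OF D(4)[OF K] sq D(5)[OF K] D(9)])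
    define I :: "real^2^2" where "I = c *\<^sub>R mat 1"
    have tr: "I \<bullet> A = trace A * c" for A by (simp add: I_def inner_vec_def sum_2 mat_def trace_2 algebra_simps)
    have cs: "square_integrable K (\<lambda>x. M)" for M :: "real^2^2" by (rule square_integrable_bounded[OF D(10)[OF K], of _ "norm M"]) auto
    have "L2_inner K (broken_div \<T> (cr_interpolant \<T> v G)) q = L2_inner K (\<lambda>x. I) (\<lambda>x. mean_gradient K G)"
      unfolding L2_inner_def
    proof (rule integral_cong_AE)
      show "(\<lambda>x. broken_div \<T> (cr_interpolant \<T> v G) x \<bullet> q x) \<in> borel_measurable (lebesgue_on K)"
        using sd[OF D(11)[OF K]] sqK by (intro borel_measurable_inner square_integrable_measurable)
      show "AE x in lebesgue_on K. broken_div \<T> (cr_interpolant \<T> v G) x \<bullet> q x = I \<bullet> mean_gradient K G"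
        unfolding broken_div_def bi tr using c piecewise_AE[OF T K, of "\<lambda>K _. element_gradient K (cr_interpolant \<T> v G)"]
        by eventually_elim (simp add: element_gradient_interpolant[OF T lg K])
    qed simp
    also have "\<dots> = L2_inner K (\<lambda>x. I) G" by (rule integral_mean_gradient[OF D(4)[OF K] sK, symmetric])
    also have "\<dots> = L2_inner K (\<lambda>x. trace (G x)) q"
      unfolding L2_inner_def
    proof (rule integral_cong_AE)
      show "(\<lambda>x. I \<bullet> G x) \<in> borel_measurable (lebesgue_on K)"
        using cs sK by (intro borel_measurable_inner square_integrable_measurable)
      show "(\<lambda>x. trace (G x) \<bullet> q x) \<in> borel_measurable (lebesgue_on K)"
        using square_integrable_trace[OF sK] sqK by (intro borel_measurable_inner square_integrable_measurable)
      show "AE x in lebesgue_on K. I \<bullet> G x = trace (G x) \<bullet> q x"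
        unfolding tr using c by eventually_elim simp
    qed
    finally show "L2_inner K (broken_div \<T> (cr_interpolant \<T> v G)) q = L2_inner K (\<lambda>x. trace (G x)) q" .
  qed simp
  also have "\<dots> = L2_inner \<Omega> (\<lambda>x. trace (G x)) q" by (rule L2_inner_mesh[OF T sG sq, symmetric])
  finally show ?thesis by (simp add: discrete_b_def)
qed

section \<open>Newest vertex bisection\<close>

text \<open>
  Two members that meet in their interiors share a face of each that meets the interior, so the face is the whole
  triangle. The boundary of the domain is a finite union of segments, hence a null set.
\<close>

lemma conforming_triangle_mesh:
  assumes \<Omega>: "polygonal_domain \<Omega>" and M: "conforming_mesh \<Omega> M"
  shows "triangle_mesh \<Omega> (elements M)"
proof -
  have P: "open \<Omega>" "bounded \<Omega>" "interior (closure \<Omega>) = \<Omega>" using \<Omega> by (auto simp: polygonal_domain_def)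
  obtain S where S: "finite S" "frontier \<Omega> = (\<Union>(a, b)\<in>S. closed_segment a b)"
    using \<Omega> unfolding polygonal_domain_def by blast
  have t: "triangulation (elements M)" and s: "\<And>K. K \<in> elements M \<Longrightarrow> 2 simplex K" and U: "\<Union>(elements M) = closure \<Omega>"
    using M by (auto simp: conforming_mesh_def)
  have fan_point: "triangle K" if "K \<in> elements M" for K
    using two_simplex_triangle[OF s[OF that]] that unfolding elements_def by blast
  have neg: "negligible (closed_segment a b)" for a b :: "real^2"
    by (simp add: negligible_convex_interior interior_closed_segment_ge2)
  have "negligible (frontier \<Omega>)"
    unfolding S(2) by (rule negligible_Union) (use S(1) neg in auto)
  then have "negligible (closure \<Omega> - \<Omega>)" by (simp add: frontier_def interior_open[OF P(1)])
  moreover have "interior K \<inter> interior K' = {}" if K: "K \<in> elements M" "K' \<in> elements M" "K \<noteq> K'" for K K'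
  proof -
    have face: "(A \<inter> B) face_of A" if "A \<in> elements M" "B \<in> elements M" for A B
      using t that unfolding triangulation_def by blast
    have f: "(K \<inter> K') face_of K" "(K \<inter> K') face_of K'"
      using face[OF K(1,2)] face[OF K(2,1)] by (simp_all add: Int_commute)
    have "K \<inter> K' \<noteq> K \<or> K \<inter> K' \<noteq> K'" using K(3) by blast
    then show ?thesis
    proof
      assume "K \<inter> K' \<noteq> K"
      from face_of_disjoint_interior[OF f(1) this] show ?thesis using interior_subset[of K] interior_subset[of K'] by blast
    next
      assume "K \<inter> K' \<noteq> K'"
      from face_of_disjoint_interior[OF f(2) this] show ?thesis using interior_subset[of K] interior_subset[of K'] by blast
    qed
  qed
  moreover have "interior K \<subseteq> \<Omega>" if "K \<in> elements M" for K
    using interior_mono[of K "closure \<Omega>"] that U P(3) by blast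
  moreover have "finite (elements M)" using t by (simp add: triangulation_def)
  ultimately show ?thesis using P U fan_point by (simp add: triangle_mesh_def)
qed

text \<open>
  The squared lengths of the two sides at the newest vertex, a substitute for the squared diameter that bisection halves exactly.
\<close>

fun leg_square :: "labelled_triangle \<Rightarrow> real" where
  "leg_square (z, x, y) = (norm (x - z))\<^sup>2 + (norm (y - z))\<^sup>2"

lemma measure_element:
  "measure lebesgue (element (z, x, y)) = \<bar>(y $ 1 - z $ 1) * (x $ 2 - z $ 2) - (x $ 1 - z $ 1) * (y $ 2 - z $ 2)\<bar> / 2"
  using content_triangle[of z x y] by (simp add: measure_completion borel_closed compact_imp_closed finite_imp_compact_convex_hull)

text \<open>
  With \<open>m\<close> the midpoint of \<open>x\<close> and \<open>y\<close>, the parallelogram law gives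
  \<open>|x - z|\<^sup>2 + |y - z|\<^sup>2 = 2 * |m - z|\<^sup>2 + 2 * |x - m|\<^sup>2\<close>, and the two children have the same area.
\<close>

lemma children_properties:
  assumes "t' \<in> children t"
  shows "element t' \<subseteq> element t" "leg_square t' = leg_square t / 2"
    "measure lebesgue (element t') = measure lebesgue (element t) / 2"
proof -
  obtain z x y where t: "t = (z, x, y)" by (cases t)
  define m where "m = midpoint x y"
  have t': "t' = (m, z, x) \<or> t' = (m, z, y)" using assms by (simp add: t m_def)
  have sub: "{m, z, x, y} \<subseteq> convex hull {z, x, y}"
  proof -
    have "closed_segment x y \<subseteq> convex hull {z, x, y}" unfolding segment_convex_hull by (rule hull_mono) auto
    then have "m \<in> convex hull {z, x, y}" unfolding m_def using midpoint_in_closed_segment[of x y] by blast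
    then show ?thesis by (auto intro: hull_inc)
  qed
  then have "convex hull {m, z, x} \<subseteq> convex hull {z, x, y}" "convex hull {m, z, y} \<subseteq> convex hull {z, x, y}"
    by (intro hull_minimal; simp)+
  then show "element t' \<subseteq> element t" using t' by (auto simp: t)
  have m1: "m $ i = (x $ i + y $ i) / 2" for i by (simp add: m_def midpoint_def)
  show "leg_square t' = leg_square t / 2"
    using t' unfolding t by (elim disjE; simp only: leg_square.simps norm_vec2 vector_minus_component m1)
      (simp_all add: power2_eq_square field_simps)
  have "(x$1 - m$1) * (z$2 - m$2) - (z$1 - m$1) * (x$2 - m$2) = ((y$1 - z$1) * (x$2 - z$2) - (x$1 - z$1) * (y$2 - z$2)) / 2"
    "(y$1 - m$1) * (z$2 - m$2) - (z$1 - m$1) * (y$2 - m$2) = - ((y$1 - z$1) * (x$2 - z$2) - (x$1 - z$1) * (y$2 - z$2)) / 2"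
    by (simp_all add: m1 field_simps)
  note area = this
  show "measure lebesgue (element t') = measure lebesgue (element t) / 2"
    using t'
  proof
    assume "t' = (m, z, x)"
    then show ?thesis unfolding t by (simp only: measure_element area) simp
  next
    assume "t' = (m, z, y)"
    then show ?thesis unfolding t by (simp only: measure_element area) (simp add: abs_divide abs_minus_commute)
  qed
qed

text \<open>
  Both the area and the sum of squares are halved in each step, so their ratio is inherited by all descendants.
\<close>

lemma bisections_refine:
  assumes "bisect_one\<^sup>*\<^sup>* M M'" "t' \<in> M'"
  shows "\<exists>t\<in>M. element t' \<subseteq> element t \<and>
    leg_square t' * measure lebesgue (element t) = leg_square t * measure lebesgue (element t')"
  using assms
proof (induction arbitrary: t' rule: rtranclp_induct)
  case base
  then show ?case by auto
next
  case (step N N')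
  obtain s where s: "s \<in> N" "N' = (N - {s}) \<union> children s" using step.hyps(2) by (auto simp: bisect_one_def)
  show ?case
  proof (cases "t' \<in> N")
    case True
    then show ?thesis by (rule step.IH)
  next
    case False
    then have c: "t' \<in> children s" using s step.prems by blast
    obtain t where t: "t \<in> M" "element s \<subseteq> element t"
      "leg_square s * measure lebesgue (element t) = leg_square t * measure lebesgue (element s)"
      using step.IH[OF s(1)] by blast
    have "leg_square t' * measure lebesgue (element t) = leg_square t * measure lebesgue (element t')"
      using t(3) unfolding children_properties(2,3)[OF c] by simp
    then show ?thesis using children_properties(1)[OF c] t by blast
  qed
qed

lemma diameter_element:
  "diameter (element t) \<le> sqrt (2 * leg_square t)"
proof -
  obtain z x y where t: "t = (z, x, y)" by (cases t)
  have a: "(norm (x - z))\<^sup>2 \<le> 2 * leg_square t" "(norm (y - z))\<^sup>2 \<le> 2 * leg_square t"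
    by (simp_all add: t)
  have "norm (x - y) \<le> norm (x - z) + norm (y - z)" using norm_triangle_ineq4[of "x - z" "y - z"] by simp
  then have "(norm (x - y))\<^sup>2 \<le> (norm (x - z) + norm (y - z))\<^sup>2" by (intro power_mono) auto
  also have "\<dots> \<le> 2 * leg_square t"
    using zero_le_power2[of "norm (x - z) - norm (y - z)"] by (simp add: t power2_eq_square algebra_simps)
  finally have b: "(norm (x - y))\<^sup>2 \<le> 2 * leg_square t" .
  have vert: "norm (u - v) \<le> sqrt (2 * leg_square t)" if "u \<in> {z, x, y}" "v \<in> {z, x, y}" for u v
    using that a b by (intro real_le_rsqrt) (auto simp: norm_minus_commute t)
  show ?thesis
  proof (rule diameter_le)
    show "element t \<noteq> {} \<or> 0 \<le> sqrt (2 * leg_square t)" by (simp add: t)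
    fix p q assume "p \<in> element t" "q \<in> element t"
    then have "\<exists>u\<in>{z, x, y}. \<exists>v\<in>{z, x, y}. norm (p - q) \<le> norm (u - v)"
      by (intro simplex_extremal_le_exists) (simp_all add: t)
    then obtain u v where "u \<in> {z, x, y}" "v \<in> {z, x, y}" "norm (p - q) \<le> norm (u - v)" by blast
    then show "norm (p - q) \<le> sqrt (2 * leg_square t)" using vert[of u v] by linarith
  qed
qed

lemma leg_square_diameter: "leg_square t \<le> 2 * (diameter (element t))\<^sup>2"
proof -
  obtain z x y where t: "t = (z, x, y)" by (cases t)
  have b: "bounded (element t)" by (simp add: t finite_imp_bounded_convex_hull)
  have "norm (x - z) \<le> diameter (element t)" "norm (y - z) \<le> diameter (element t)"
    using diameter_bounded_bound[OF b] by (auto simp: t dist_norm hull_inc)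
  then have "(norm (x - z))\<^sup>2 \<le> (diameter (element t))\<^sup>2" "(norm (y - z))\<^sup>2 \<le> (diameter (element t))\<^sup>2"
    by (auto intro: power_mono)
  then show ?thesis by (simp add: t)
qed

text \<open>
  The diameter and the invariant of an element control each other up to a factor \<open>\<surd>2\<close> each way, so the constant at most
  doubles, on every level.
\<close>

lemma nvb_shape_regular:
  assumes \<Omega>: "polygonal_domain \<Omega>" and M: "nvb_sequence \<Omega> M" and \<sigma>: "shape_regular \<sigma> (elements (M 0))"
  shows "shape_regular (2 * \<bar>\<sigma>\<bar>) (elements (M k))"
proof -
  have ref: "bisect_one\<^sup>*\<^sup>* (M 0) (M k)"
    by (induction k) (use M in \<open>auto simp: nvb_sequence_def intro: rtranclp_trans\<close>)
  show ?thesis unfolding shape_regular_def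
  proof
    fix K assume "K \<in> elements (M k)"
    then obtain t' where t': "t' \<in> M k" "K = element t'" by (auto simp: elements_def)
    obtain t where t: "t \<in> M 0"
      "leg_square t' * measure lebesgue (element t) = leg_square t * measure lebesgue (element t')"
      using bisections_refine[OF ref t'(1)] by blast
    have m: "measure lebesgue (element t) > 0"
    proof -
      have "triangle_mesh \<Omega> (elements (M 0))" using M by (intro conforming_triangle_mesh \<Omega>) (simp add: nvb_sequence_def)
      then show ?thesis using t(1) triangle_meshD(4) triangle_props(4) unfolding elements_def by blast
    qed
    have "diameter (element t) \<le> \<sigma> * sqrt (measure lebesgue (element t))"
      using \<sigma> t(1) by (auto simp: shape_regular_def elements_def elem_size_def)
    moreover have "0 \<le> diameter (element t)"
      by (cases t) (simp add: diameter_ge_0 finite_imp_bounded_convex_hull)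
    ultimately have "(diameter (element t))\<^sup>2 \<le> (\<sigma> * sqrt (measure lebesgue (element t)))\<^sup>2" by (rule power_mono)
    also have "\<dots> = \<sigma>\<^sup>2 * measure lebesgue (element t)" using m by (simp add: power_mult_distrib)
    finally have "leg_square t \<le> 2 * \<sigma>\<^sup>2 * measure lebesgue (element t)" using leg_square_diameter[of t] by simp
    then have "leg_square t * measure lebesgue (element t') \<le> 2 * \<sigma>\<^sup>2 * measure lebesgue (element t) * measure lebesgue (element t')"
      by (intro mult_right_mono) auto
    then have "leg_square t' * measure lebesgue (element t) \<le> (2 * \<sigma>\<^sup>2 * measure lebesgue (element t')) * measure lebesgue (element t)"
      unfolding t(2) by (simp add: mult_ac)
    then have "leg_square t' \<le> 2 * \<sigma>\<^sup>2 * measure lebesgue (element t')" using m by (simp add: mult_le_cancel_right)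
    then have "sqrt (2 * leg_square t') \<le> sqrt ((2 * \<bar>\<sigma>\<bar>)\<^sup>2 * measure lebesgue (element t'))" by (simp add: power_mult_distrib)
    also have "\<dots> = 2 * \<bar>\<sigma>\<bar> * elem_size K" by (simp add: t'(2) elem_size_def real_sqrt_mult)
    finally show "diameter K \<le> 2 * \<bar>\<sigma>\<bar> * elem_size K" using diameter_element[of t'] t'(2) by simp
  qed
qed

section \<open>Interpolation on nested meshes\<close>

text \<open>
  The fine triangles inside \<open>K'\<close> cover \<open>K'\<close>: almost every point of its interior lies in the interior of a fine triangle,
  whose parent can only be \<open>K'\<close>; and the union of the fine triangles is closed.
\<close>

lemma submesh:
  assumes T: "triangle_mesh \<Omega> \<T>" and T': "triangle_mesh \<Omega> \<T>'" and nest: "\<And>K. K \<in> \<T> \<Longrightarrow> \<exists>K'\<in>\<T>'. K \<subseteq> K'"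
    and K': "K' \<in> \<T>'"
  shows "triangle_mesh (interior K') {K \<in> \<T>. K \<subseteq> K'}"
proof -
  note D = triangle_meshD[OF T] and D' = triangle_meshD[OF T']
  note p = triangle_props[OF D'(4)[OF K']]
  let ?S = "{K \<in> \<T>. K \<subseteq> K'}"
  have clK: "closure (interior K') = K'"
    using convex_closure_interior[OF p(2,5)] closure_closed[OF compact_imp_closed[OF p(1)]] by simp
  have cU: "closed (\<Union>?S)"
    using D(3,4) triangle_props(1) by (intro closed_Union) (auto intro: compact_imp_closed)
  have "AE x in lebesgue. x \<notin> interior K' - \<Union>?S"
    using mesh_skeleton[OF T]
  proof eventually_elim
    case (elim x)
    show ?case
    proof
      assume x: "x \<in> interior K' - \<Union>?S"
      then have "x \<in> \<Omega>" using D'(5)[OF K'] by blast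
      then obtain K where K: "K \<in> \<T>" "x \<in> interior K" using elim by blast
      obtain K'' where K'': "K'' \<in> \<T>'" "K \<subseteq> K''" using nest[OF K(1)] by blast
      have "x \<in> interior K''" using K(2) interior_mono[OF K''(2)] by blast
      then have "K'' = K'" using D'(6)[OF K''(1) K', of x] x by blast
      then have "x \<in> \<Union>?S" using K K''(2) interior_subset[of K] by blast
      then show False using x by blast
    qed
  qed
  then have "negligible (interior K' - \<Union>?S)"
    by (simp add: AE_iff_null_sets negligible_iff_null_sets borel_open open_Diff cU)
  then have "interior K' - \<Union>?S = {}" using open_not_negligible[OF open_Diff[OF open_interior cU]] by blast
  then have "closure (interior K') \<subseteq> \<Union>?S" by (intro closure_minimal cU) blast
  then have U: "\<Union>?S = closure (interior K')" unfolding clK by blast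
  show ?thesis
    unfolding triangle_mesh_def
  proof (intro conjI ballI impI)
    show "bounded (interior K')" using bounded_interior[OF compact_imp_bounded[OF p(1)]] .
    show "negligible (closure (interior K') - interior K')" unfolding clK by (rule p(6))
    show "interior K \<subseteq> interior K'" if "K \<in> ?S" for K using that interior_mono[of K K'] by simp
    show "interior K \<inter> interior L = {}" if "K \<in> ?S" "L \<in> ?S" "K \<noteq> L" for K L using that D(6)[of K L] by blast
  qed (use U D(3,4) in auto)
qed

lemma L2_norm_interior_triangle:
  assumes K: "triangle K" and f: "square_integrable K f"
  shows "L2_norm (interior K) f = L2_norm K f"
proof -
  note p = triangle_props[OF K]
  have "closure (interior K) = K"
    using convex_closure_interior[OF p(2,5)] closure_closed[OF compact_imp_closed[OF p(1)]] by simp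
  then have m: "triangle_mesh (interior K) {K}"
    using p(6) K bounded_interior[OF compact_imp_bounded[OF p(1)]] by (simp add: triangle_mesh_def)
  have "square_integrable (interior K) f" by (rule square_integrable_subset[OF f interior_subset]) (use p(3) in auto)
  from L2_norm_mesh[OF m this] show ?thesis by (simp add: L2_norm_nonneg)
qed

lemma square_integrable_continuous:
  fixes f :: "real^2 \<Rightarrow> 'b::euclidean_space"
  assumes A: "compact A" and f: "continuous_on UNIV f"
  shows "square_integrable A f"
proof -
  have "bounded (f ` A)" by (intro compact_imp_bounded compact_continuous_image continuous_on_subset[OF f] A) auto
  then obtain B where B: "\<And>x. x \<in> A \<Longrightarrow> norm (f x) \<le> B" unfolding bounded_iff by auto
  have Al: "A \<in> lmeasurable" by (rule lmeasurable_compact[OF A])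
  then have As: "A \<in> sets lebesgue" by auto
  show ?thesis
  proof (rule square_integrable_bounded[OF Al])
    show "f \<in> borel_measurable (lebesgue_on A)"
      using borel_measurable_continuous_onI[OF f] by (intro measurable_restrict_space1 measurable_completion) simp
    show "AE x in lebesgue_on A. norm (f x) \<le> B" using As B by (auto simp: AE_restrict_space_iff)
  qed
qed

text \<open>
  The local estimates on the fine triangles inside \<open>K'\<close> are squared and summed; the mesh \<open>\<T>\<close> may also be \<open>\<T>'\<close>
  itself.
\<close>

lemma interpolant_error_coarse:
  assumes T: "triangle_mesh \<Omega> \<T>" and T': "triangle_mesh \<Omega> \<T>'" and nest: "\<And>K. K \<in> \<T> \<Longrightarrow> \<exists>K'\<in>\<T>'. K \<subseteq> K'"
    and K': "K' \<in> \<T>'" and v: "has_line_gradient v G"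
  shows "L2_norm K' (\<lambda>x. v x - cr_interpolant \<T> v G x) \<le> 4 * diameter K' * L2_norm K' G"
proof -
  let ?S = "{K \<in> \<T>. K \<subseteq> K'}"
  let ?e = "\<lambda>x. v x - cr_interpolant \<T> v G x"
  note D = triangle_meshD[OF T] and D' = triangle_meshD[OF T']
  note S = submesh[OF T T' nest K']
  note p = triangle_props[OF D'(4)[OF K']]
  have d0: "0 \<le> diameter K'" by (rule diameter_ge_0[OF compact_imp_bounded[OF p(1)]])
  have siv: "square_integrable A v" if "compact A" for A by (rule square_integrable_continuous[OF that has_line_gradientD(1)[OF v]])
  have sii: "square_integrable A (cr_interpolant \<T> v G)" if "A \<in> sets lebesgue" for A
    unfolding cr_interpolant_def by (rule piecewise_si[OF T cr_affine_continuous[OF v D(4)] that])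
  have sie: "square_integrable A ?e" if "compact A" for A
    using siv[OF that] sii[of A] lmeasurable_compact[OF that] by (intro square_integrable_diff) auto
  have siG: "square_integrable A G" if "compact A" for A by (rule line_gradient_si[OF v lmeasurable_compact[OF that]])
  have int: "square_integrable (interior K') f" if "square_integrable K' f" for f :: "real^2 \<Rightarrow> 'c::euclidean_space"
    by (rule square_integrable_subset[OF that interior_subset]) (use p(3) in auto)
  have "(L2_norm K' ?e)\<^sup>2 = (\<Sum>K\<in>?S. (L2_norm K ?e)\<^sup>2)"
    using L2_norm_mesh[OF S int[OF sie[OF p(1)]]] unfolding L2_norm_interior_triangle[OF D'(4)[OF K'] sie[OF p(1)]] .
  also have "\<dots> \<le> (\<Sum>K\<in>?S. (4 * diameter K')\<^sup>2 * (L2_norm K G)\<^sup>2)"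
  proof (rule sum_mono)
    fix K assume K: "K \<in> ?S"
    then have KT: "K \<in> \<T>" and sub: "K \<subseteq> K'" by auto
    note q = triangle_props[OF D(4)[OF KT]]
    have c: "compact K" by (rule q(1))
    have "L2_norm K ?e = L2_norm K (\<lambda>x. v x - cr_affine K v G x)"
    proof (rule L2_norm_cong_AE)
      show "square_integrable K ?e" by (rule sie[OF c])
      show "AE x in lebesgue_on K. ?e x = v x - cr_affine K v G x"
        using piecewise_AE[OF T KT, of "\<lambda>K. cr_affine K v G"] by eventually_elim (simp add: cr_interpolant_def)
      show "square_integrable K (\<lambda>x. v x - cr_affine K v G x)"
        by (intro square_integrable_continuous c continuous_on_diff has_line_gradientD(1)[OF v] cr_affine_continuous[OF v D(4)[OF KT]])
    qed
    also have "\<dots> \<le> 4 * diameter K * L2_norm K G" by (rule cr_affine_error_le[OF v D(4)[OF KT]])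
    also have "\<dots> \<le> 4 * diameter K' * L2_norm K G"
      using diameter_subset[OF sub compact_imp_bounded[OF p(1)]] by (intro mult_right_mono L2_norm_nonneg) auto
    finally have "(L2_norm K ?e)\<^sup>2 \<le> (4 * diameter K' * L2_norm K G)\<^sup>2" by (rule power_mono) (rule L2_norm_nonneg)
    then show "(L2_norm K ?e)\<^sup>2 \<le> (4 * diameter K')\<^sup>2 * (L2_norm K G)\<^sup>2" by (simp add: power_mult_distrib)
  qed
  also have "\<dots> = (4 * diameter K' * L2_norm K' G)\<^sup>2"
    using L2_norm_mesh[OF S int[OF siG[OF p(1)]]]
    unfolding L2_norm_interior_triangle[OF D'(4)[OF K'] siG[OF p(1)]] power_mult_distrib[of "4 * diameter K'"]
    by (simp only: sum_distrib_left)
  finally show ?thesis by (rule power2_le_imp_le) (use d0 L2_norm_nonneg[of K' G] in simp)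
qed

text \<open>
  On a common triangle both interpolants coincide. On a refined triangle both are within \<open>4 * diameter K * \<parallel>G\<parallel>\<close> of \<open>v\<close>.
\<close>

lemma interpolant_change:
  assumes T: "triangle_mesh \<Omega> \<T>" and T': "triangle_mesh \<Omega> \<T>'" and nest: "\<And>K. K \<in> \<T> \<Longrightarrow> \<exists>K'\<in>\<T>'. K \<subseteq> K'"
    and v: "field_on \<Omega> v G" and g: "square_integrable \<Omega> g" and \<sigma>: "0 \<le> \<sigma>" "shape_regular \<sigma> \<T>'"
  shows "\<bar>L2_inner \<Omega> g (\<lambda>x. cr_interpolant \<T> v G x - cr_interpolant \<T>' v G x)\<bar>
    \<le> 8 * \<sigma> * sqrt (\<Sum>K\<in>\<T>' - \<T>. (elem_size K)\<^sup>2 * (L2_norm K g)\<^sup>2) * L2_norm \<Omega> G"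
proof -
  note D = triangle_meshD[OF T] and D' = triangle_meshD[OF T']
  have lg: "has_line_gradient v G" using v by (simp add: field_on_def)
  let ?d = "\<lambda>x. cr_interpolant \<T> v G x - cr_interpolant \<T>' v G x"
  let ?w = "\<lambda>K. elem_size K * L2_norm K g"
  have si: "square_integrable A (cr_interpolant \<T> v G)" "square_integrable A (cr_interpolant \<T>' v G)" if "A \<in> sets lebesgue" for A
    unfolding cr_interpolant_def using piecewise_si[OF T cr_affine_continuous[OF lg D(4)] that]
      piecewise_si[OF T' cr_affine_continuous[OF lg D'(4)] that] by auto
  have sd: "square_integrable A ?d" if "A \<in> sets lebesgue" for A using si[OF that] by (rule square_integrable_diff)
  have sG: "square_integrable \<Omega> G" by (rule line_gradient_si[OF lg D(8)])
  have old: "L2_inner K g ?d = 0" if K: "K \<in> \<T>'" "K \<in> \<T>" for K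
  proof -
    have "AE x in lebesgue_on K. g x \<bullet> ?d x = 0"
      using piecewise_AE[OF T K(2), of "\<lambda>K. cr_affine K v G"] piecewise_AE[OF T' K(1), of "\<lambda>K. cr_affine K v G"]
      by eventually_elim (simp add: cr_interpolant_def)
    then show ?thesis unfolding L2_inner_def by (rule integral_eq_zero_AE)
  qed
  have new: "\<bar>L2_inner K g ?d\<bar> \<le> 8 * \<sigma> * (?w K * L2_norm K G)" if K: "K \<in> \<T>'" for K
  proof -
    note p = triangle_props[OF D'(4)[OF K]]
    have sv: "square_integrable K v" by (rule square_integrable_continuous[OF p(1) has_line_gradientD(1)[OF lg]])
    have gK: "square_integrable K g" by (rule square_integrable_on_triangle[OF D'(4)[OF K] g D'(5)[OF K] D(9)])
    have "L2_norm K (\<lambda>x. v x - cr_interpolant \<T>' v G x) \<le> 4 * diameter K * L2_norm K G"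
      by (rule interpolant_error_coarse[OF T' T' _ K lg]) blast
    moreover have "L2_norm K (\<lambda>x. v x - cr_interpolant \<T> v G x) \<le> 4 * diameter K * L2_norm K G"
      by (rule interpolant_error_coarse[OF T T' nest K lg])
    moreover have "L2_norm K ?d \<le> L2_norm K (\<lambda>x. v x - cr_interpolant \<T>' v G x) + L2_norm K (\<lambda>x. v x - cr_interpolant \<T> v G x)"
      using L2_norm_diff[OF square_integrable_diff[OF sv si(2)] square_integrable_diff[OF sv si(1)], OF D'(11)[OF K] D'(11)[OF K]] by (simp add: algebra_simps)
    ultimately have "L2_norm K ?d \<le> 8 * diameter K * L2_norm K G" by simp
    also have "\<dots> \<le> 8 * (\<sigma> * elem_size K) * L2_norm K G"
      using \<sigma>(2) K by (intro mult_right_mono mult_left_mono L2_norm_nonneg) (auto simp: shape_regular_def)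
    finally have "L2_norm K g * L2_norm K ?d \<le> L2_norm K g * (8 * (\<sigma> * elem_size K) * L2_norm K G)"
      by (rule mult_left_mono) (rule L2_norm_nonneg)
    then show ?thesis using L2_Cauchy_Schwarz[OF gK sd[OF D'(11)[OF K]]] by (simp add: mult_ac)
  qed
  have "\<bar>L2_inner \<Omega> g ?d\<bar> = \<bar>\<Sum>K\<in>\<T>'. L2_inner K g ?d\<bar>"
    unfolding L2_inner_mesh[OF T' g sd[OF D(9)]] ..
  also have "(\<Sum>K\<in>\<T>'. L2_inner K g ?d) = (\<Sum>K\<in>\<T>' - \<T>. L2_inner K g ?d)"
    by (rule sum.mono_neutral_right) (use D'(3) old in auto)
  also have "\<bar>\<dots>\<bar> \<le> (\<Sum>K\<in>\<T>' - \<T>. 8 * \<sigma> * (?w K * L2_norm K G))"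
    by (rule order_trans[OF sum_abs]) (intro sum_mono new, simp)
  also have "\<dots> = 8 * \<sigma> * (\<Sum>K\<in>\<T>' - \<T>. ?w K * L2_norm K G)" by (rule sum_distrib_left[symmetric])
  also have "\<dots> \<le> 8 * \<sigma> * (sqrt (\<Sum>K\<in>\<T>' - \<T>. (?w K)\<^sup>2) * L2_norm \<Omega> G)"
  proof (rule mult_left_mono)
    have "(\<Sum>K\<in>\<T>' - \<T>. ?w K * L2_norm K G)\<^sup>2 \<le> (\<Sum>K\<in>\<T>' - \<T>. (?w K)\<^sup>2) * (\<Sum>K\<in>\<T>' - \<T>. (L2_norm K G)\<^sup>2)"
      by (rule Cauchy_Schwarz_ineq_sum)
    also have "\<dots> \<le> (\<Sum>K\<in>\<T>' - \<T>. (?w K)\<^sup>2) * (\<Sum>K\<in>\<T>'. (L2_norm K G)\<^sup>2)"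
      using D'(3) by (intro mult_left_mono sum_mono2 sum_nonneg) auto
    also have "\<dots> = (sqrt (\<Sum>K\<in>\<T>' - \<T>. (?w K)\<^sup>2) * L2_norm \<Omega> G)\<^sup>2"
      unfolding L2_norm_mesh[OF T' sG, symmetric] by (simp add: power_mult_distrib sum_nonneg)
    finally show "(\<Sum>K\<in>\<T>' - \<T>. ?w K * L2_norm K G) \<le> sqrt (\<Sum>K\<in>\<T>' - \<T>. (?w K)\<^sup>2) * L2_norm \<Omega> G"
      by (rule power2_le_imp_le) (simp add: sum_nonneg L2_norm_nonneg)
  qed (use \<sigma> in simp)
  finally show ?thesis by (simp add: power_mult_distrib mult_ac)
qed

lemma AE_lebesgue_on_subset:
  assumes "AE x in lebesgue_on B. P x" "A \<subseteq> B" "A \<in> sets lebesgue" "B \<in> sets lebesgue"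
  shows "AE x in lebesgue_on A. P x"
proof -
  have "AE x in lebesgue. x \<in> B \<longrightarrow> P x" using assms by (subst (asm) AE_restrict_space_iff) auto
  then have "AE x in lebesgue. x \<in> A \<longrightarrow> P x" by eventually_elim (use assms(2) in auto)
  then show ?thesis using assms(3) by (subst AE_restrict_space_iff) auto
qed

text \<open>
  A coarse function is affine on each fine triangle with the gradient of the triangle that contains it, so the broken
  gradient with respect to the fine mesh applies to it as well.
\<close>

lemma broken_jacobian_nested:
  assumes T: "triangle_mesh \<Omega> \<T>" and T': "triangle_mesh \<Omega> \<T>'" and nest: "\<forall>K\<in>\<T>. \<exists>K'\<in>\<T>'. K \<subseteq> K'"
    and w: "w \<in> CR_velocity \<Omega> \<T>" and w': "w' \<in> CR_velocity \<Omega> \<T>'"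
  shows "AE x in lebesgue_on \<Omega>. broken_jacobian \<T> (\<lambda>x. w x - w' x) x = broken_jacobian \<T> w x - broken_jacobian \<T>' w' x"
    "square_integrable \<Omega> (broken_jacobian \<T> (\<lambda>x. w x - w' x))"
    "square_integrable \<Omega> (broken_jacobian \<T> w)" "square_integrable \<Omega> (broken_jacobian \<T>' w')"
proof -
  note D = triangle_meshD[OF T] and D' = triangle_meshD[OF T']
  have diff: "\<exists>A. is_affine_on K (\<lambda>x. w x - w' x) A \<and> A = (\<lambda>x. affine_part K w x - affine_part K' w' x)"
    if K: "K \<in> \<T>" "K' \<in> \<T>'" "K \<subseteq> K'" for K K'
  proof -
    have a: "is_affine_on K w (affine_part K w)" "is_affine_on K' w' (affine_part K' w')"
      by (rule affine_part_affine[OF CR_affine[OF w K(1)]], rule affine_part_affine[OF CR_affine[OF w' K(2)]])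
    obtain L c where L: "linear L" "affine_part K w = (\<lambda>x. L x + c)" using a(1) unfolding is_affine_on_def by blast
    obtain L' c' where L': "linear L'" "affine_part K' w' = (\<lambda>x. L' x + c')" using a(2) unfolding is_affine_on_def by blast
    have e: "AE x in lebesgue_on K. w x = affine_part K w x" using a(1) by (simp add: is_affine_on_def)
    have e': "AE x in lebesgue_on K. w' x = affine_part K' w' x"
      by (rule AE_lebesgue_on_subset[OF _ K(3) D(11)[OF K(1)] D'(11)[OF K(2)]]) (use a(2) in \<open>simp add: is_affine_on_def\<close>)
    have "is_affine_on K (\<lambda>x. w x - w' x) (\<lambda>x. affine_part K w x - affine_part K' w' x)"
      unfolding is_affine_on_def
    proof
      show "\<exists>L c. linear L \<and> (\<lambda>x. affine_part K w x - affine_part K' w' x) = (\<lambda>x. L x + c)"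
        unfolding L(2) L'(2) using linear_compose_sub[OF L(1) L'(1)]
        by (intro exI[of _ "\<lambda>x. L x - L' x"] exI[of _ "c - c'"]) auto
      show "AE x in lebesgue_on K. w x - w' x = affine_part K w x - affine_part K' w' x"
        using e e' by eventually_elim simp
    qed
    then show ?thesis by blast
  qed
  have grad: "element_gradient K (\<lambda>x. w x - w' x) = element_gradient K w - element_gradient K' w'"
    if K: "K \<in> \<T>" "K' \<in> \<T>'" "K \<subseteq> K'" for K K'
  proof -
    obtain q where q: "affine_part K w = (\<lambda>x. element_gradient K w *v x + q)" using affine_part_gradient[OF CR_affine[OF w K(1)]] .
    obtain q' where q': "affine_part K' w' = (\<lambda>x. element_gradient K' w' *v x + q')" using affine_part_gradient[OF CR_affine[OF w' K(2)]] .
    have "affine_part K (\<lambda>x. w x - w' x) = (\<lambda>x. affine_part K w x - affine_part K' w' x)"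
      using diff[OF K] affine_part_eq[OF D(4)[OF K(1)]] by blast
    also have "\<dots> = (\<lambda>x. (element_gradient K w - element_gradient K' w') *v x + (q - q'))"
      unfolding q q' by (auto simp: matrix_vector_mult_diff_rdistrib)
    finally show ?thesis by (simp only: element_gradient_def[of K "\<lambda>x. w x - w' x"] jacobian_affine)
  qed
  have J: "broken_jacobian \<T> w = piecewise \<T> (\<lambda>K _. element_gradient K w)"
    by (rule broken_jacobian_piecewise[OF T CR_affine[OF w]])
  have J': "broken_jacobian \<T>' w' = piecewise \<T>' (\<lambda>K _. element_gradient K w')"
    by (rule broken_jacobian_piecewise[OF T' CR_affine[OF w']])
  have Jd: "broken_jacobian \<T> (\<lambda>x. w x - w' x) = piecewise \<T> (\<lambda>K _. element_gradient K (\<lambda>x. w x - w' x))"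
    by (rule broken_jacobian_piecewise[OF T]) (use nest diff in blast)
  show "square_integrable \<Omega> (broken_jacobian \<T> (\<lambda>x. w x - w' x))" "square_integrable \<Omega> (broken_jacobian \<T> w)"
    unfolding Jd J by (rule piecewise_si[OF T _ D(9)], simp)+
  show "square_integrable \<Omega> (broken_jacobian \<T>' w')" unfolding J' by (rule piecewise_si[OF T' _ D(9)], simp)
  have "AE x in lebesgue. x \<in> \<Omega> \<longrightarrow> broken_jacobian \<T> (\<lambda>x. w x - w' x) x = broken_jacobian \<T> w x - broken_jacobian \<T>' w' x"
    using mesh_skeleton[OF T]
  proof eventually_elim
    case (elim x)
    show ?case
    proof
      assume "x \<in> \<Omega>"
      then obtain K where K: "K \<in> \<T>" "x \<in> interior K" using elim by blast
      obtain K' where K': "K' \<in> \<T>'" "K \<subseteq> K'" using bspec[OF nest K(1)] by blast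
      have x: "x \<in> interior K'" using K(2) interior_mono[OF K'(2)] by blast
      show "broken_jacobian \<T> (\<lambda>x. w x - w' x) x = broken_jacobian \<T> w x - broken_jacobian \<T>' w' x"
        unfolding J J' Jd piecewise_eq[OF T K] piecewise_eq[OF T' K'(1) x] by (rule grad[OF K(1) K'])
    qed
  qed
  then show "AE x in lebesgue_on \<Omega>. broken_jacobian \<T> (\<lambda>x. w x - w' x) x = broken_jacobian \<T> w x - broken_jacobian \<T>' w' x"
    using D(9) by (subst AE_restrict_space_iff) auto
qed

section \<open>The discrete momentum equations\<close>

lemma zero_P0_pressure: "(\<lambda>x. 0) \<in> P0_pressure \<Omega> \<T>"
  by (auto simp: P0_pressure_def L2_zero_mean_def square_integrable_zero)

text \<open>
  The test functions are the interpolant and the pressure 0.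
\<close>

lemma discrete_momentum:
  assumes T: "triangle_mesh \<Omega> \<T>" and v: "field_on \<Omega> v G" and s: "discrete_solution \<Omega> \<T> \<mu> g uh ph"
  shows "\<mu> * L2_inner \<Omega> (broken_jacobian \<T> uh) G + L2_inner \<Omega> (\<lambda>x. trace (G x)) ph = L2_inner \<Omega> g (cr_interpolant \<T> v G)"
proof -
  have u: "uh \<in> CR_velocity \<Omega> \<T>" and p: "ph \<in> P0_pressure \<Omega> \<T>" using s by (auto simp: discrete_solution_def)
  have "discrete_a \<Omega> \<T> \<mu> uh (cr_interpolant \<T> v G) + discrete_b \<Omega> \<T> (cr_interpolant \<T> v G) ph + discrete_b \<Omega> \<T> uh (\<lambda>x. 0)
    = L2_inner \<Omega> g (cr_interpolant \<T> v G)"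
    using s interpolant_in_CR[OF T v] zero_P0_pressure unfolding discrete_solution_def by blast
  moreover have "discrete_b \<Omega> \<T> uh (\<lambda>x. 0) = 0" by (simp add: discrete_b_def L2_inner_def)
  ultimately show ?thesis unfolding discrete_a_interpolant[OF T v u] discrete_b_interpolant[OF T v p] by simp
qed

text \<open>
  The difference of the two discrete momentum equations, each tested with the interpolant of the same field \<open>v\<close> on its own
  mesh, reads \<open>(div v, pk - pk') = (g, \<Pi>v - \<Pi>'v) - \<mu> * (\<nabla>(uk - uk'), \<nabla>v)\<close>.
\<close>

lemma pressure_difference_bound:
  assumes T: "triangle_mesh \<Omega> \<T>" and T': "triangle_mesh \<Omega> \<T>'" and nest: "\<And>K. K \<in> \<T> \<Longrightarrow> \<exists>K'\<in>\<T>'. K \<subseteq> K'"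
    and v: "field_on \<Omega> v G" and g: "square_integrable \<Omega> g" and \<sigma>: "0 \<le> \<sigma>" "shape_regular \<sigma> \<T>'" and \<mu>: "\<mu> > 0"
    and s: "discrete_solution \<Omega> \<T> \<mu> g uk pk" and s': "discrete_solution \<Omega> \<T>' \<mu> g uk' pk'"
  shows "\<bar>L2_inner \<Omega> (\<lambda>x. trace (G x)) (\<lambda>x. pk x - pk' x)\<bar>
    \<le> (8 * \<sigma> + \<mu>) * (sqrt (\<Sum>K\<in>\<T>' - \<T>. (elem_size K)\<^sup>2 * (L2_norm K g)\<^sup>2)
        + L2_norm \<Omega> (broken_jacobian \<T> (\<lambda>x. uk x - uk' x))) * L2_norm \<Omega> G"
proof -
  note D = triangle_meshD[OF T]
  have lg: "has_line_gradient v G" using v by (simp add: field_on_def)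
  have sG: "square_integrable \<Omega> G" by (rule line_gradient_si[OF lg D(8)])
  note sT = square_integrable_trace[OF sG]
  have u: "uk \<in> CR_velocity \<Omega> \<T>" "uk' \<in> CR_velocity \<Omega> \<T>'" and "pk \<in> P0_pressure \<Omega> \<T>" "pk' \<in> P0_pressure \<Omega> \<T>'"
    using s s' by (auto simp: discrete_solution_def)
  then have sp: "square_integrable \<Omega> pk" "square_integrable \<Omega> pk'" by (auto simp: P0_pressure_def L2_zero_mean_def)
  have nested: "\<forall>K\<in>\<T>. \<exists>K'\<in>\<T>'. K \<subseteq> K'" using nest by blast
  note N = broken_jacobian_nested[OF T T' nested u]
  let ?J = "broken_jacobian \<T> (\<lambda>x. uk x - uk' x)"
  let ?R = "sqrt (\<Sum>K\<in>\<T>' - \<T>. (elem_size K)\<^sup>2 * (L2_norm K g)\<^sup>2)"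
  have J: "L2_inner \<Omega> ?J G = L2_inner \<Omega> (broken_jacobian \<T> uk) G - L2_inner \<Omega> (broken_jacobian \<T>' uk') G"
  proof -
    have "L2_inner \<Omega> ?J G = L2_inner \<Omega> (\<lambda>x. broken_jacobian \<T> uk x - broken_jacobian \<T>' uk' x) G"
      unfolding L2_inner_def
    proof (rule integral_cong_AE)
      show "AE x in lebesgue_on \<Omega>. ?J x \<bullet> G x = (broken_jacobian \<T> uk x - broken_jacobian \<T>' uk' x) \<bullet> G x"
        using N(1) by eventually_elim simp
    qed (intro borel_measurable_inner square_integrable_measurable N(2) sG square_integrable_diff N(3,4))+
    then show ?thesis by (simp add: L2_inner_diff[OF N(3,4) sG])
  qed
  have "L2_inner \<Omega> (\<lambda>x. trace (G x)) (\<lambda>x. pk x - pk' x) =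
    L2_inner \<Omega> (\<lambda>x. trace (G x)) pk - L2_inner \<Omega> (\<lambda>x. trace (G x)) pk'"
    by (rule L2_inner_diff_right[OF sp sT])
  also have "\<dots> = (L2_inner \<Omega> g (cr_interpolant \<T> v G) - L2_inner \<Omega> g (cr_interpolant \<T>' v G)) - \<mu> * L2_inner \<Omega> ?J G"
    using discrete_momentum[OF T v s] discrete_momentum[OF T' v s'] unfolding J by (simp add: algebra_simps)
  also have "L2_inner \<Omega> g (cr_interpolant \<T> v G) - L2_inner \<Omega> g (cr_interpolant \<T>' v G) =
    L2_inner \<Omega> g (\<lambda>x. cr_interpolant \<T> v G x - cr_interpolant \<T>' v G x)"
    by (rule L2_inner_diff_right[OF CR_si[OF interpolant_in_CR[OF T v]] CR_si[OF interpolant_in_CR[OF T' v]] g, symmetric])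
  finally have e: "L2_inner \<Omega> (\<lambda>x. trace (G x)) (\<lambda>x. pk x - pk' x) =
    L2_inner \<Omega> g (\<lambda>x. cr_interpolant \<T> v G x - cr_interpolant \<T>' v G x) - \<mu> * L2_inner \<Omega> ?J G" .
  have b: "\<bar>\<mu> * L2_inner \<Omega> ?J G\<bar> \<le> \<mu> * (L2_norm \<Omega> ?J * L2_norm \<Omega> G)"
    using L2_Cauchy_Schwarz[OF N(2) sG] \<mu> by (simp add: abs_mult)
  have "\<bar>L2_inner \<Omega> (\<lambda>x. trace (G x)) (\<lambda>x. pk x - pk' x)\<bar> \<le> 8 * \<sigma> * ?R * L2_norm \<Omega> G + \<mu> * (L2_norm \<Omega> ?J * L2_norm \<Omega> G)"
    unfolding e using interpolant_change[OF T T' nest v g \<sigma>] b by linarith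
  also have "\<dots> = (8 * \<sigma> * ?R + \<mu> * L2_norm \<Omega> ?J) * L2_norm \<Omega> G" by (simp add: algebra_simps)
  also have "\<dots> \<le> ((8 * \<sigma> + \<mu>) * (?R + L2_norm \<Omega> ?J)) * L2_norm \<Omega> G"
  proof (rule mult_right_mono)
    have "0 \<le> ?R" by (simp add: sum_nonneg)
    then have "0 \<le> \<mu> * ?R" "0 \<le> 8 * \<sigma> * L2_norm \<Omega> ?J" using \<mu> \<sigma>(1) L2_norm_nonneg[of \<Omega> ?J] by simp_all
    then show "8 * \<sigma> * ?R + \<mu> * L2_norm \<Omega> ?J \<le> (8 * \<sigma> + \<mu>) * (?R + L2_norm \<Omega> ?J)" by (simp add: algebra_simps)
  qed (rule L2_norm_nonneg)
  finally show ?thesis .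
qed

section \<open>Quasi-orthogonality of the pressure\<close>

text \<open>
  Any mesh of the domain provides a finite cover by solvable pieces; the resulting constant depends on \<open>\<Omega>\<close> only.
\<close>

lemma mesh_domain_solvable:
  assumes \<Omega>: "polygonal_domain \<Omega>" and T: "triangle_mesh \<Omega> \<T>"
  obtains K where "0 \<le> K" "\<And>q. square_integrable UNIV q \<Longrightarrow> (\<And>x. x \<notin> \<Omega> \<Longrightarrow> q x = 0) \<Longrightarrow>
     integral\<^sup>L lebesgue q = 0 \<Longrightarrow> div_approx \<Omega> (K * L2_norm UNIV q) q"
proof -
  note D = triangle_meshD[OF T]
  have P: "open \<Omega>" "connected \<Omega>" "bounded \<Omega>" "\<Omega> \<noteq> {}" using \<Omega> by (auto simp: polygonal_domain_def)
  have "\<exists>\<P>. finite \<P> \<and> (\<forall>P\<in>\<P>. solvable_on \<Omega> P \<and> interior P \<inter> \<Omega> \<noteq> {}) \<and> K \<subseteq> \<Union>\<P>" if K: "K \<in> \<T>" for K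
  proof -
    obtain a b c where "K = convex hull {a, b, c}" "\<not> collinear {a, b, c}" using D(4)[OF K] unfolding triangle_def by blast
    then show ?thesis using triangle_cover[of a b c \<Omega>] D(5)[OF K] by simp
  qed
  then obtain F where F: "\<And>K. K \<in> \<T> \<Longrightarrow> finite (F K) \<and> (\<forall>P\<in>F K. solvable_on \<Omega> P \<and> interior P \<inter> \<Omega> \<noteq> {}) \<and> K \<subseteq> \<Union>(F K)"
    by metis
  let ?P = "\<Union>(F ` \<T>)"
  have sub: "\<Omega> \<subseteq> \<Union>?P"
  proof
    fix x assume "x \<in> \<Omega>"
    then obtain K where "K \<in> \<T>" "x \<in> K" using D(7) closure_subset[of \<Omega>] by blast
    then show "x \<in> \<Union>?P" using F[of K] by blast
  qed
  then have "?P \<noteq> {}" using P(4) by blast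
  have "solvable_on \<Omega> (\<Union>?P)"
  proof (rule conjunct1[OF solvable_on_Union[OF P(1-3)]])
    show "finite ?P" using D(3) F by blast
    show "?P \<noteq> {}" by fact
    show "solvable_on \<Omega> Q \<and> interior Q \<inter> \<Omega> \<noteq> {}" if "Q \<in> ?P" for Q using that F by blast
  qed
  then obtain K where "0 \<le> K" and K: "\<And>q. square_integrable UNIV q \<Longrightarrow> (\<forall>x. x \<notin> \<Union>?P \<longrightarrow> q x = 0) \<Longrightarrow>
     integral\<^sup>L lebesgue q = 0 \<Longrightarrow> div_approx \<Omega> (K * L2_norm UNIV q) q" unfolding solvable_on_def by blast
  show ?thesis
  proof (rule that[OF \<open>0 \<le> K\<close>])
    fix q :: "real^2 \<Rightarrow> real" assume q: "square_integrable UNIV q" "\<And>x. x \<notin> \<Omega> \<Longrightarrow> q x = 0" "integral\<^sup>L lebesgue q = 0"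
    show "div_approx \<Omega> (K * L2_norm UNIV q) q" by (rule K[OF q(1) _ q(3)]) (use q(2) sub in blast)
  qed
qed

text \<open>
  A bound for the divergences of fields in terms of their gradients extends to all mean-zero functions, since these are
  approximated by such divergences with control of the gradient.
\<close>

lemma pairing_bound:
  assumes \<Omega>: "open \<Omega>" "bounded \<Omega>" and r: "r \<in> L2_zero_mean \<Omega>" and q: "square_integrable \<Omega> q" and "0 \<le> B" "0 \<le> K"
    and K: "\<And>q. square_integrable UNIV q \<Longrightarrow> (\<And>x. x \<notin> \<Omega> \<Longrightarrow> q x = 0) \<Longrightarrow>
     integral\<^sup>L lebesgue q = 0 \<Longrightarrow> div_approx \<Omega> (K * L2_norm UNIV q) q"
    and B: "\<And>v G. field_on \<Omega> v G \<Longrightarrow> \<bar>L2_inner \<Omega> (\<lambda>x. trace (G x)) q\<bar> \<le> B * L2_norm \<Omega> G"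
  shows "\<bar>L2_inner \<Omega> r q\<bar> \<le> B * K * L2_norm \<Omega> r"
proof -
  have \<Omega>l: "\<Omega> \<in> sets lebesgue" "\<Omega> \<in> lmeasurable" using \<Omega> lmeasurable_open[OF \<Omega>(2,1)] by auto
  define r0 where "r0 x = (if x \<in> \<Omega> then r x else 0)" for x
  have sr: "square_integrable \<Omega> r" and ir: "integral\<^sup>L (lebesgue_on \<Omega>) r = 0" using r by (auto simp: L2_zero_mean_def)
  have r0: "square_integrable UNIV r0" unfolding r0_def by (rule iffD2[OF square_integrable_restrict_UNIV[OF \<Omega>l(1)] sr])
  have "integral\<^sup>L lebesgue r0 = 0" unfolding r0_def using Lebesgue_Measure.integral_restrict_UNIV[OF \<Omega>l(1), of r] ir by simp
  then have da: "div_approx \<Omega> (K * L2_norm UNIV r0) r0" by (intro K r0) (auto simp: r0_def)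
  have nr: "L2_norm UNIV r0 = L2_norm \<Omega> r" unfolding r0_def by (rule L2_norm_restrict_UNIV[OF \<Omega>l(1)])
  have step: "\<bar>L2_inner \<Omega> r q\<bar> \<le> B * K * L2_norm \<Omega> r + \<epsilon> * (B + L2_norm \<Omega> q)" if \<epsilon>: "\<epsilon> > 0" for \<epsilon>
  proof -
    obtain v G where v: "field_on \<Omega> v G" and e: "L2_norm UNIV (\<lambda>x. trace (G x) - r0 x) \<le> \<epsilon>" and n: "L2_norm UNIV G \<le> K * L2_norm UNIV r0 + \<epsilon>"
      using da \<epsilon> unfolding div_approx_def by blast
    have lg: "has_line_gradient v G" using v by (simp add: field_on_def)
    have sT: "square_integrable \<Omega> (\<lambda>x. trace (G x))" by (rule square_integrable_trace[OF line_gradient_si[OF lg \<Omega>l(2)]])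
    have "(\<lambda>x. trace (G x) - r0 x) = (\<lambda>x. if x \<in> \<Omega> then trace (G x) - r x else 0)"
      using v by (intro ext) (auto simp: field_on_def r0_def trace_2)
    then have e': "L2_norm \<Omega> (\<lambda>x. trace (G x) - r x) \<le> \<epsilon>" using e L2_norm_restrict_UNIV[OF \<Omega>l(1), of "\<lambda>x. trace (G x) - r x"] by simp
    have "G = (\<lambda>x. if x \<in> \<Omega> then G x else 0)" using v by (auto simp: field_on_def)
    then have n': "L2_norm \<Omega> G \<le> K * L2_norm \<Omega> r + \<epsilon>" using n nr L2_norm_restrict_UNIV[OF \<Omega>l(1), of G] by simp
    have "L2_inner \<Omega> r q = L2_inner \<Omega> (\<lambda>x. trace (G x)) q - L2_inner \<Omega> (\<lambda>x. trace (G x) - r x) q"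
      by (simp add: L2_inner_diff[OF sT sr q])
    moreover have "\<bar>L2_inner \<Omega> (\<lambda>x. trace (G x) - r x) q\<bar> \<le> \<epsilon> * L2_norm \<Omega> q"
      using L2_Cauchy_Schwarz[OF square_integrable_diff[OF sT sr] q] mult_right_mono[OF e' L2_norm_nonneg[of \<Omega> q]] by linarith
    moreover have "\<bar>L2_inner \<Omega> (\<lambda>x. trace (G x)) q\<bar> \<le> B * (K * L2_norm \<Omega> r + \<epsilon>)"
      using B[OF v] mult_left_mono[OF n' \<open>0 \<le> B\<close>] by linarith
    ultimately have "\<bar>L2_inner \<Omega> r q\<bar> \<le> B * (K * L2_norm \<Omega> r + \<epsilon>) + \<epsilon> * L2_norm \<Omega> q" by linarith
    then show ?thesis by (simp add: algebra_simps)
  qed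
  define m where "m = B + L2_norm \<Omega> q + 1"
  have m: "m > 0" using \<open>0 \<le> B\<close> L2_norm_nonneg[of \<Omega> q] by (simp add: m_def)
  show ?thesis
  proof (rule field_le_epsilon)
    fix e :: real assume e: "e > 0"
    have "e / m * (B + L2_norm \<Omega> q) \<le> e / m * m" using e m by (intro mult_left_mono) (auto simp: m_def)
    then show "\<bar>L2_inner \<Omega> r q\<bar> \<le> B * K * L2_norm \<Omega> r + e" using step[of "e / m"] e m by simp
  qed
qed

theorem lemma3p5:
  fixes \<Omega> :: "(real^2) set" and \<mu> \<sigma> :: real
  assumes "polygonal_domain \<Omega>" and "\<mu> > 0"
  shows "\<exists>C>0. \<forall>(M :: nat \<Rightarrow> labelled_triangle set) (k :: nat) g u p uk pk uk' pk'.
    nvb_sequence \<Omega> M \<longrightarrow> shape_regular \<sigma> (elements (M 0)) \<longrightarrow> k \<ge> 1 \<longrightarrow>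
    square_integrable \<Omega> g \<longrightarrow>
    stokes_solution \<Omega> \<mu> g u p \<longrightarrow>
    discrete_solution \<Omega> (elements (M k)) \<mu> g uk pk \<longrightarrow>
    discrete_solution \<Omega> (elements (M (k - 1))) \<mu> g uk' pk' \<longrightarrow>
    \<bar>L2_inner \<Omega> (\<lambda>x. p x - pk x) (\<lambda>x. pk x - pk' x)\<bar>
      \<le> C * (sqrt (\<Sum>K\<in>elements (M (k - 1)) - elements (M k). (elem_size K)\<^sup>2 * (L2_norm K g)\<^sup>2)
              + L2_norm \<Omega> (broken_jacobian (elements (M k)) (\<lambda>x. uk x - uk' x)))
          * L2_norm \<Omega> (\<lambda>x. p x - pk x)"
proof (cases "\<exists>M. nvb_sequence \<Omega> M")
  case False
  then show ?thesis by (intro exI[of _ 1]) simp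
next
  case True
  then obtain M0 where "nvb_sequence \<Omega> M0" by blast
  then have "triangle_mesh \<Omega> (elements (M0 0))" using conforming_triangle_mesh[OF assms(1)] by (simp add: nvb_sequence_def)
  then obtain K where K0: "0 \<le> K" and K: "\<And>q. square_integrable UNIV q \<Longrightarrow> (\<And>x. x \<notin> \<Omega> \<Longrightarrow> q x = 0) \<Longrightarrow>
     integral\<^sup>L lebesgue q = 0 \<Longrightarrow> div_approx \<Omega> (K * L2_norm UNIV q) q"
    using mesh_domain_solvable[OF assms(1)] by blast
  have P: "open \<Omega>" "bounded \<Omega>" using assms(1) by (auto simp: polygonal_domain_def)
  (* refinement doubles the shape regularity constant *)
  define A where "A = 8 * (2 * \<bar>\<sigma>\<bar>) + \<mu>"
  have A: "A > 0" using assms(2) by (simp add: A_def)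
  show ?thesis
  (* the summand 1 keeps the constant positive when K = 0 *)
  proof (intro exI[of _ "A * K + 1"] conjI allI impI)
    show "0 < A * K + 1" using A K0 by (simp add: add_nonneg_pos)
  next
    fix M k g u p uk pk uk' pk'
    assume M: "nvb_sequence \<Omega> M" and sh: "shape_regular \<sigma> (elements (M 0))" and k: "1 \<le> (k::nat)" and g: "square_integrable \<Omega> g"
      and st: "stokes_solution \<Omega> \<mu> g u p" and s: "discrete_solution \<Omega> (elements (M k)) \<mu> g uk pk"
      and s': "discrete_solution \<Omega> (elements (M (k - 1))) \<mu> g uk' pk'"
    have T: "triangle_mesh \<Omega> (elements (M j))" for j
      using M conforming_triangle_mesh[OF assms(1)] by (simp add: nvb_sequence_def)
    have nest: "\<exists>K'\<in>elements (M (k - 1)). L \<subseteq> K'" if L: "L \<in> elements (M k)" for L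
    proof -
      have "bisect_one\<^sup>*\<^sup>* (M (k - 1)) (M (Suc (k - 1)))" using M by (simp only: nvb_sequence_def)
      moreover have "Suc (k - 1) = k" using k by simp
      ultimately have ref: "bisect_one\<^sup>*\<^sup>* (M (k - 1)) (M k)" by (simp only:)
      obtain t' where t': "t' \<in> M k" "L = element t'" using L unfolding elements_def by blast
      obtain t where "t \<in> M (k - 1)" "element t' \<subseteq> element t" using bisections_refine[OF ref t'(1)] by blast
      then show ?thesis using t'(2) by (auto simp: elements_def)
    qed
    have p: "p \<in> L2_zero_mean \<Omega>" "pk \<in> L2_zero_mean \<Omega>" "pk' \<in> L2_zero_mean \<Omega>"
      using st s s' by (auto simp: stokes_solution_def discrete_solution_def P0_pressure_def)
    have \<Omega>l: "\<Omega> \<in> lmeasurable" by (rule lmeasurable_open[OF P(2,1)])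
    have r: "(\<lambda>x. p x - pk x) \<in> L2_zero_mean \<Omega>"
      using p(1,2) square_integrable_diff[of \<Omega> p pk] square_integrable_imp_integrable[OF \<Omega>l, of p] square_integrable_imp_integrable[OF \<Omega>l, of pk]
      by (auto simp: L2_zero_mean_def)
    have q: "square_integrable \<Omega> (\<lambda>x. pk x - pk' x)" using p by (intro square_integrable_diff) (auto simp: L2_zero_mean_def)
    define R where "R = sqrt (\<Sum>K\<in>elements (M (k - 1)) - elements (M k). (elem_size K)\<^sup>2 * (L2_norm K g)\<^sup>2)
              + L2_norm \<Omega> (broken_jacobian (elements (M k)) (\<lambda>x. uk x - uk' x))"
    have R: "R \<ge> 0" by (simp add: R_def sum_nonneg L2_norm_nonneg)
    have "\<bar>L2_inner \<Omega> (\<lambda>x. p x - pk x) (\<lambda>x. pk x - pk' x)\<bar> \<le> A * R * K * L2_norm \<Omega> (\<lambda>x. p x - pk x)"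
    proof (rule pairing_bound[OF P r q _ K0 K])
      show "0 \<le> A * R" using A R by simp
      show "\<bar>L2_inner \<Omega> (\<lambda>x. trace (G x)) (\<lambda>x. pk x - pk' x)\<bar> \<le> A * R * L2_norm \<Omega> G" if "field_on \<Omega> v G" for v G
        unfolding A_def R_def
        by (rule pressure_difference_bound[OF T T nest that g _ nvb_shape_regular[OF assms(1) M sh] assms(2) s s']) auto
    qed
    also have "\<dots> \<le> (A * K + 1) * R * L2_norm \<Omega> (\<lambda>x. p x - pk x)"
      using R by (intro mult_right_mono L2_norm_nonneg) (simp add: algebra_simps)
    finally show "\<bar>L2_inner \<Omega> (\<lambda>x. p x - pk x) (\<lambda>x. pk x - pk' x)\<bar>
      \<le> (A * K + 1) * (sqrt (\<Sum>K\<in>elements (M (k - 1)) - elements (M k). (elem_size K)\<^sup>2 * (L2_norm K g)\<^sup>2)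
              + L2_norm \<Omega> (broken_jacobian (elements (M k)) (\<lambda>x. uk x - uk' x)))
          * L2_norm \<Omega> (\<lambda>x. p x - pk x)" unfolding R_def .
  qed
qed

end
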